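(* Let $M_1,M_2$ be finite monoids and, for $i=1,2$, $N_i\subseteq M_i$ a submonoid with the same identity, such that: (1) $\mathbb{C}[M_1]$ and $\mathbb{C}[M_2]$ are semi-simple; (2) for each $i$, $N_i$ and $M_i$ are centric submonoids of $M_i$; (3) for each $i$, $N_i$ is a group; (4) there is a monoid isomorphism $\iota:\frac{M_1}{N_1}\simeq\frac{M_2}{N_2}$. Let $\Gamma=\{(m_1,m_2)\in M_1\times M_2:\iota([m_1])=[m_2]\}$, and let $(\rho,W)$ be a finite-dimensional complex representation of $\Gamma$ all of whose irreducible components have the same apex $(f,f)$, $f\in E$. Then $\mathrm{Res}^{\Gamma}_{N_1\times N_2}\rho$ is a theta representation of $N_1\times N_2$ if and only if $\pi=\mathrm{Ind}_{\Gamma}^{M_1\times M_2}\rho$ is a theta representation of $M_1\times M_2$ with respect to $\mathrm{Irr}^{E}(M_1\times M_2)$.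
   Context: **Centric submonoids and quotients.** A submonoid $N$ of $M$ with the same identity is centric if $mN=Nm$ for all $m\in M$ (so $M$ centric in itself means $mM=Mm$ for all $m$). Then $\frac MN$ is the monoid of classes $[x]$, $x\in M$, where $[x]=[y]$ iff $Nx=Ny$, and $[x][y]=[xy]$. **Idempotents.** $E(M)$ is the set of idempotents of $M$. Under the hypotheses $M_1,M_2$ are inverse monoids and $e\mapsto[e]$ is a bijection $E(M_i)\to E(\frac{M_i}{N_i})$; together with $\iota$ this gives a bijection $E(M_1)\leftrightarrow E(M_2)$, by which both sets are identified with a single set $E$; for $f\in E$, $(f,f)$ denotes the corresponding idempotent of $M_1\times M_2$, which lies in $\Gamma$. **Apex.** An irreducible complex representation $V$ of a finite monoid $M$ has apex $e\in E(M)$ if $\{m\in M: mV=0\}=\{m\in M: e\notin MmM\}$. $\mathrm{Irr}^E(M_1\times M_2)$ is the set of (classes of) irreducible complex representations of $M_1\times M_2$ having an apex of the form $(f,f)$ with $f\in E$. **Induction.** $\mathrm{Ind}_\Gamma^{M_1\times M_2}\rho$ is the space of functions $\varphi:M_1\times M_2\to W$ with $\varphi(\gamma x)=\rho(\gamma)\varphi(x)$ for $\gamma\in\Gamma$, with action $(m\varphi)(x)=\varphi(xm)$. **Theta representations.** In this semisimple setting, a finite-dimensional representation $\Pi$ of $A_1\times A_2$ is a theta representation if $\dim\mathrm{Hom}_{A_1\times A_2}(\Pi,\pi_1\otimes\pi_2)\le1$ for all irreducible $\pi_1,\pi_2$, and for each irreducible $\pi_1$ there is at most one irreducible $\pi_2$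 with $\mathrm{Hom}(\Pi,\pi_1\otimes\pi_2)\neq0$, and symmetrically for each $\pi_2$ at most one such $\pi_1$. "With respect to $\mathrm{Irr}^E(M_1\times M_2)$" means that these conditions are required only for those $\pi_1\otimes\pi_2$ belonging to $\mathrm{Irr}^E(M_1\times M_2)$. *)

theory Defs
  imports Complex_Main "HOL-Library.Function_Algebras" "HOL-Algebra.AbelCoset"
begin

section \<open>Centric submonoids and quotients\<close>

definition centric :: "'a set \<Rightarrow> ('a, 'm) monoid_scheme \<Rightarrow> bool" where
  "centric N M \<longleftrightarrow>
     submonoid N M \<and> (\<forall>m\<in>carrier M. m <#\<^bsub>M\<^esub> N = N #>\<^bsub>M\<^esub> m)"

definition quot_class :: "('a, 'm) monoid_scheme \<Rightarrow> 'a set \<Rightarrow> 'a \<Rightarrow> 'a set" where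
  "quot_class M N x = {y \<in> carrier M. N #>\<^bsub>M\<^esub> y = N #>\<^bsub>M\<^esub> x}"

text \<open>For centric \<open>N\<close> all the sets in the union below coincide, see \<open>quot_monoid_mult\<close>.\<close>

definition quot_monoid :: "('a, 'm) monoid_scheme \<Rightarrow> 'a set \<Rightarrow> 'a set monoid" where
  "quot_monoid M N =
     \<lparr>carrier = quot_class M N ` carrier M,
      mult = (\<lambda>A B. \<Union>x\<in>A. \<Union>y\<in>B. quot_class M N (x \<otimes>\<^bsub>M\<^esub> y)),
      one = quot_class M N \<one>\<^bsub>M\<^esub>\<rparr>"

lemma quot_class_mult_cong:
  assumes "monoid M" "centric N M"
    and "x \<in> carrier M" "y \<in> carrier M" "x' \<in> quot_class M N x" "y' \<in> quot_class M N y"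
  shows "quot_class M N (x' \<otimes>\<^bsub>M\<^esub> y') = quot_class M N (x \<otimes>\<^bsub>M\<^esub> y)"
proof -
  interpret monoid M by fact
  have N: "N \<subseteq> carrier M" using assms(2) by (auto simp: centric_def submonoid.subset)
  have c: "m <#\<^bsub>M\<^esub> N = N #>\<^bsub>M\<^esub> m" if "m \<in> carrier M" for m
    using assms(2) that by (auto simp: centric_def)
  have x': "x' \<in> carrier M" "N #>\<^bsub>M\<^esub> x' = N #>\<^bsub>M\<^esub> x"
    and y': "y' \<in> carrier M" "N #>\<^bsub>M\<^esub> y' = N #>\<^bsub>M\<^esub> y"
    using assms by (auto simp: quot_class_def)
  have r: "N #>\<^bsub>M\<^esub> a = (\<lambda>n. n \<otimes>\<^bsub>M\<^esub> a) ` N"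
    and l: "a <#\<^bsub>M\<^esub> N = (\<lambda>n. a \<otimes>\<^bsub>M\<^esub> n) ` N" for a
    by (auto simp: r_coset_def l_coset_def)
  note im = image_image
  have rc: "N #>\<^bsub>M\<^esub> (a \<otimes>\<^bsub>M\<^esub> b) = (\<lambda>n. n \<otimes>\<^bsub>M\<^esub> b) ` (N #>\<^bsub>M\<^esub> a)"
    if "a \<in> carrier M" "b \<in> carrier M" for a b
    using that N unfolding r im by (intro image_cong) (auto simp: m_assoc)
  have lc: "(\<lambda>n. n \<otimes>\<^bsub>M\<^esub> b) ` (a <#\<^bsub>M\<^esub> N) = (\<lambda>n. a \<otimes>\<^bsub>M\<^esub> n) ` (N #>\<^bsub>M\<^esub> b)"
    if "a \<in> carrier M" "b \<in> carrier M" for a b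
    using that N unfolding r l im by (intro image_cong) (auto simp: m_assoc)
  have "N #>\<^bsub>M\<^esub> (x' \<otimes>\<^bsub>M\<^esub> y') = N #>\<^bsub>M\<^esub> (x \<otimes>\<^bsub>M\<^esub> y')"
    using rc x' y' assms(3) by simp
  also have "\<dots> = N #>\<^bsub>M\<^esub> (x \<otimes>\<^bsub>M\<^esub> y)"
    using y' assms(4) by (simp add: rc[OF assms(3)] lc[OF assms(3)] c[OF assms(3), symmetric])
  finally show ?thesis by (simp add: quot_class_def)
qed

lemma quot_monoid_mult:
  assumes "monoid M" "centric N M" "x \<in> carrier M" "y \<in> carrier M"
  shows "quot_class M N x \<otimes>\<^bsub>quot_monoid M N\<^esub> quot_class M N y = quot_class M N (x \<otimes>\<^bsub>M\<^esub> y)"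
proof -
  have "x \<in> quot_class M N x" "y \<in> quot_class M N y"
    using assms by (auto simp: quot_class_def)
  moreover have "\<forall>a\<in>quot_class M N x. \<forall>b\<in>quot_class M N y.
      quot_class M N (a \<otimes>\<^bsub>M\<^esub> b) = quot_class M N (x \<otimes>\<^bsub>M\<^esub> y)"
    using quot_class_mult_cong[OF assms] by blast
  ultimately show ?thesis
    unfolding quot_monoid_def monoid.simps by blast
qed

definition fibre_prod ::
  "('a, 'm) monoid_scheme \<Rightarrow> 'a set \<Rightarrow> ('b, 'k) monoid_scheme \<Rightarrow> 'b set \<Rightarrow> ('a set \<Rightarrow> 'b set)
     \<Rightarrow> ('a \<times> 'b) set" where
  "fibre_prod M1 N1 M2 N2 \<iota> =
     {(m1, m2) \<in> carrier M1 \<times> carrier M2. \<iota> (quot_class M1 N1 m1) = quot_class M2 N2 m2}"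

definition idempotents :: "('a, 'm) monoid_scheme \<Rightarrow> 'a set" where
  "idempotents M = {e \<in> carrier M. e \<otimes>\<^bsub>M\<^esub> e = e}"

text \<open>The graph of the correspondence between \<open>E(M1)\<close> and \<open>E(M2)\<close> induced by \<open>\<iota>\<close>. Where this
  correspondence is a bijection and is used to identify both sets with one set \<open>E\<close>, the elements
  of \<open>matched_idempotents\<close> are the pairs \<open>(f, f)\<close> with \<open>f \<in> E\<close>.\<close>

definition matched_idempotents ::
  "('a, 'm) monoid_scheme \<Rightarrow> 'a set \<Rightarrow> ('b, 'k) monoid_scheme \<Rightarrow> 'b set \<Rightarrow> ('a set \<Rightarrow> 'b set)
     \<Rightarrow> ('a \<times> 'b) set" where
  "matched_idempotents M1 N1 M2 N2 \<iota> =
     {(e1, e2) \<in> idempotents M1 \<times> idempotents M2.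
        \<iota> (quot_class M1 N1 e1) = quot_class M2 N2 e2}"


section \<open>Semisimple monoid algebras\<close>

text \<open>Elements of \<open>\<complex>[M]\<close> are coefficient functions vanishing outside \<open>carrier M\<close>; the definition is
  meant for finite \<open>M\<close>.\<close>

definition monoid_algebra :: "('a, 'm) monoid_scheme \<Rightarrow> ('a \<Rightarrow> complex) ring" where
  "monoid_algebra M =
     \<lparr>carrier = {x. \<forall>a. a \<notin> carrier M \<longrightarrow> x a = 0},
      mult = (\<lambda>x y c. \<Sum>(a, b) | a \<in> carrier M \<and> b \<in> carrier M \<and> a \<otimes>\<^bsub>M\<^esub> b = c. x a * y b),
      one = (\<lambda>a. if a = \<one>\<^bsub>M\<^esub> then 1 else 0),
      zero = (\<lambda>a. 0),
      add = (\<lambda>x y a. x a + y a)\<rparr>"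

lemma monoid_algebra_mult:
  assumes "finite (carrier M)"
  shows "(x \<otimes>\<^bsub>monoid_algebra M\<^esub> y) c =
    (\<Sum>a\<in>carrier M. \<Sum>b\<in>carrier M. if a \<otimes>\<^bsub>M\<^esub> b = c then x a * y b else 0)"
proof -
  have "(\<Sum>a\<in>carrier M. \<Sum>b\<in>carrier M. if a \<otimes>\<^bsub>M\<^esub> b = c then x a * y b else 0) =
      (\<Sum>(a, b)\<in>carrier M \<times> carrier M. if a \<otimes>\<^bsub>M\<^esub> b = c then x a * y b else 0)"
    by (rule sum.cartesian_product)
  also have "\<dots> = (\<Sum>(a, b) | a \<in> carrier M \<and> b \<in> carrier M \<and> a \<otimes>\<^bsub>M\<^esub> b = c. x a * y b)"
    using assms by (intro sum.mono_neutral_cong_right) (auto split: if_splits)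
  finally show ?thesis by (simp add: monoid_algebra_def)
qed

lemma ring_monoid_algebra:
  assumes "monoid M" "finite (carrier M)"
  shows "ring (monoid_algebra M)"
proof -
  interpret M: monoid M by fact
  let ?R = "monoid_algebra M" and ?C = "carrier M"
  note mult = monoid_algebra_mult[OF assms(2)]
  have C: "carrier ?R = {x. \<forall>a. a \<notin> ?C \<longrightarrow> x a = 0}"
    and add: "x \<oplus>\<^bsub>?R\<^esub> y = (\<lambda>a. x a + y a)" and zero: "\<zero>\<^bsub>?R\<^esub> = (\<lambda>a. 0)"
    and one: "\<one>\<^bsub>?R\<^esub> = (\<lambda>a. if a = \<one>\<^bsub>M\<^esub> then 1 else 0)" for x y
    by (simp_all add: monoid_algebra_def)
  have assoc: "((x \<otimes>\<^bsub>?R\<^esub> y) \<otimes>\<^bsub>?R\<^esub> z) d = (x \<otimes>\<^bsub>?R\<^esub> (y \<otimes>\<^bsub>?R\<^esub> z)) d" for x y z d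
  proof -
    have "((x \<otimes>\<^bsub>?R\<^esub> y) \<otimes>\<^bsub>?R\<^esub> z) d =
        (\<Sum>p\<in>?C. \<Sum>c\<in>?C. \<Sum>a\<in>?C. \<Sum>b\<in>?C.
           if p = a \<otimes>\<^bsub>M\<^esub> b then (if p \<otimes>\<^bsub>M\<^esub> c = d then x a * y b * z c else 0) else 0)"
      unfolding mult
      by (intro sum.cong refl) (auto simp: sum_distrib_right intro!: sum.cong sum.neutral)
    also have "\<dots> = (\<Sum>c\<in>?C. \<Sum>a\<in>?C. \<Sum>b\<in>?C. \<Sum>p\<in>?C.
           if p = a \<otimes>\<^bsub>M\<^esub> b then (if p \<otimes>\<^bsub>M\<^esub> c = d then x a * y b * z c else 0) else 0)"
      by (subst sum.swap, rule sum.cong[OF refl], subst sum.swap, rule sum.cong[OF refl],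
          rule sum.swap)
    also have "\<dots> = (\<Sum>c\<in>?C. \<Sum>a\<in>?C. \<Sum>b\<in>?C.
           if a \<otimes>\<^bsub>M\<^esub> b \<otimes>\<^bsub>M\<^esub> c = d then x a * y b * z c else 0)"
      using assms(2) by (intro sum.cong refl) (simp add: sum.delta)
    also have "\<dots> = (\<Sum>a\<in>?C. \<Sum>b\<in>?C. \<Sum>c\<in>?C.
           if a \<otimes>\<^bsub>M\<^esub> b \<otimes>\<^bsub>M\<^esub> c = d then x a * y b * z c else 0)"
      by (subst sum.swap, rule sum.cong[OF refl], rule sum.swap)
    also have "\<dots> = (\<Sum>a\<in>?C. \<Sum>b\<in>?C. \<Sum>c\<in>?C. \<Sum>q\<in>?C.
           if q = b \<otimes>\<^bsub>M\<^esub> c then (if a \<otimes>\<^bsub>M\<^esub> q = d then x a * (y b * z c) else 0) else 0)"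
      using assms(2) by (intro sum.cong refl) (simp add: sum.delta M.m_assoc mult.assoc)
    also have "\<dots> = (\<Sum>a\<in>?C. \<Sum>q\<in>?C. \<Sum>b\<in>?C. \<Sum>c\<in>?C.
           if q = b \<otimes>\<^bsub>M\<^esub> c then (if a \<otimes>\<^bsub>M\<^esub> q = d then x a * (y b * z c) else 0) else 0)"
      by (rule sum.cong[OF refl], rule trans[OF _ sum.swap], rule sum.cong[OF refl], rule sum.swap)
    also have "\<dots> = (x \<otimes>\<^bsub>?R\<^esub> (y \<otimes>\<^bsub>?R\<^esub> z)) d"
      unfolding mult
      by (intro sum.cong refl) (auto simp: sum_distrib_left intro!: sum.cong sum.neutral)
    finally show ?thesis .
  qed
  show ?thesis
  proof (rule ringI)
    show "abelian_group ?R"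
    proof (rule abelian_groupI)
      show "\<exists>y\<in>carrier ?R. y \<oplus>\<^bsub>?R\<^esub> x = \<zero>\<^bsub>?R\<^esub>" if "x \<in> carrier ?R" for x
        using that by (intro bexI[of _ "\<lambda>a. - x a"]) (auto simp: C add zero)
    qed (auto simp: C add zero algebra_simps)
    show "monoid ?R"
    proof (rule monoidI)
      show "x \<otimes>\<^bsub>?R\<^esub> y \<in> carrier ?R" for x y
        unfolding C mem_Collect_eq mult by (auto intro!: sum.neutral)
      show "\<one>\<^bsub>?R\<^esub> \<otimes>\<^bsub>?R\<^esub> x = x" if "x \<in> carrier ?R" for x
      proof
        fix c
        have "(\<one>\<^bsub>?R\<^esub> \<otimes>\<^bsub>?R\<^esub> x) c = (\<Sum>a\<in>?C. if a = \<one>\<^bsub>M\<^esub> then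
            (\<Sum>b\<in>?C. if b = c then x b else 0) else 0)"
          unfolding mult one by (intro sum.cong refl) (auto intro!: sum.cong sum.neutral)
        then show "(\<one>\<^bsub>?R\<^esub> \<otimes>\<^bsub>?R\<^esub> x) c = x c"
          using that assms(2) by (auto simp: C)
      qed
      show "x \<otimes>\<^bsub>?R\<^esub> \<one>\<^bsub>?R\<^esub> = x" if "x \<in> carrier ?R" for x
      proof
        fix c
        have "(x \<otimes>\<^bsub>?R\<^esub> \<one>\<^bsub>?R\<^esub>) c = (\<Sum>a\<in>?C. \<Sum>b\<in>?C.
            if b = \<one>\<^bsub>M\<^esub> then (if a = c then x a else 0) else 0)"
          unfolding mult one by (intro sum.cong refl) auto
        then show "(x \<otimes>\<^bsub>?R\<^esub> \<one>\<^bsub>?R\<^esub>) c = x c"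
          using that assms(2) by (auto simp: C)
      qed
    qed (auto simp: C one assoc)
    show "(x \<oplus>\<^bsub>?R\<^esub> y) \<otimes>\<^bsub>?R\<^esub> z = x \<otimes>\<^bsub>?R\<^esub> z \<oplus>\<^bsub>?R\<^esub> y \<otimes>\<^bsub>?R\<^esub> z" for x y z
      unfolding add mult fun_eq_iff sum.distrib[symmetric]
      by (intro allI sum.cong refl) (auto simp: algebra_simps)
    show "z \<otimes>\<^bsub>?R\<^esub> (x \<oplus>\<^bsub>?R\<^esub> y) = z \<otimes>\<^bsub>?R\<^esub> x \<oplus>\<^bsub>?R\<^esub> z \<otimes>\<^bsub>?R\<^esub> y" for x y z
      unfolding add mult fun_eq_iff sum.distrib[symmetric]
      by (intro allI sum.cong refl) (auto simp: algebra_simps)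
  qed
qed

definition left_ideal :: "'r set \<Rightarrow> ('r, 'm) ring_scheme \<Rightarrow> bool" where
  "left_ideal I R \<longleftrightarrow>
     additive_subgroup I R \<and> (\<forall>r\<in>carrier R. \<forall>x\<in>I. r \<otimes>\<^bsub>R\<^esub> x \<in> I)"

text \<open>\<open>R\<close> is semisimple as a left module over itself: every submodule is a direct summand.\<close>

definition semisimple_ring :: "('r, 'm) ring_scheme \<Rightarrow> bool" where
  "semisimple_ring R \<longleftrightarrow> ring R \<and>
     (\<forall>I. left_ideal I R \<longrightarrow>
        (\<exists>J. left_ideal J R \<and> I \<inter> J = {\<zero>\<^bsub>R\<^esub>} \<and> I <+>\<^bsub>R\<^esub> J = carrier R))"


section \<open>Complex representations of monoids\<close>

text \<open>The representation space is a subspace \<open>V\<close> of a complex vector space given by a type with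
  scalar multiplication \<open>s\<close>. Only the restrictions of the operators \<open>\<rho> a\<close> to \<open>V\<close> matter, so
  restricting to a subrepresentation or to a submonoid leaves \<open>\<rho>\<close> unchanged.\<close>

locale monoid_rep = A: monoid A + VS: vector_space s
  for A :: "('a, 'm) monoid_scheme"
    and s :: "complex \<Rightarrow> 'v::ab_group_add \<Rightarrow> 'v"
    and V :: "'v set"
    and \<rho> :: "'a \<Rightarrow> 'v \<Rightarrow> 'v" +
  assumes subspace: "VS.subspace V"
    and maps: "a \<in> carrier A \<Longrightarrow> v \<in> V \<Longrightarrow> \<rho> a v \<in> V"
    and map_add: "a \<in> carrier A \<Longrightarrow> v \<in> V \<Longrightarrow> w \<in> V \<Longrightarrow> \<rho> a (v + w) = \<rho> a v + \<rho> a w"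
    and map_scale: "a \<in> carrier A \<Longrightarrow> v \<in> V \<Longrightarrow> \<rho> a (s c v) = s c (\<rho> a v)"
    and map_one: "v \<in> V \<Longrightarrow> \<rho> \<one>\<^bsub>A\<^esub> v = v"
    and map_mult: "a \<in> carrier A \<Longrightarrow> b \<in> carrier A \<Longrightarrow> v \<in> V \<Longrightarrow> \<rho> (a \<otimes>\<^bsub>A\<^esub> b) v = \<rho> a (\<rho> b v)"

definition finite_dim :: "(complex \<Rightarrow> 'v::ab_group_add \<Rightarrow> 'v) \<Rightarrow> 'v set \<Rightarrow> bool" where
  "finite_dim s V \<longleftrightarrow> (\<exists>B. finite B \<and> V \<subseteq> module.span s B)"

definition irreducible_rep ::
  "('a, 'm) monoid_scheme \<Rightarrow> (complex \<Rightarrow> 'v::ab_group_add \<Rightarrow> 'v) \<Rightarrow> 'v set \<Rightarrow> ('a \<Rightarrow> 'v \<Rightarrow> 'v) \<Rightarrow> bool"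
  where
  "irreducible_rep A s V \<rho> \<longleftrightarrow> monoid_rep A s V \<rho> \<and> V \<noteq> {0} \<and>
     (\<forall>U. U \<subseteq> V \<and> monoid_rep A s U \<rho> \<longrightarrow> U = {0} \<or> U = V)"

definition is_apex ::
  "('a, 'm) monoid_scheme \<Rightarrow> 'v::zero set \<Rightarrow> ('a \<Rightarrow> 'v \<Rightarrow> 'v) \<Rightarrow> 'a \<Rightarrow> bool" where
  "is_apex A V \<rho> e \<longleftrightarrow> e \<in> idempotents A \<and>
     {m \<in> carrier A. \<forall>v\<in>V. \<rho> m v = 0} =
     {m \<in> carrier A. e \<notin> {x \<otimes>\<^bsub>A\<^esub> m \<otimes>\<^bsub>A\<^esub> y | x y. x \<in> carrier A \<and> y \<in> carrier A}}"

text \<open>Intertwiners \<open>V \<rightarrow> V'\<close>, extended by zero outside \<open>V\<close> so that they form a subspace of the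
  function type that is isomorphic to \<open>Hom(V, V')\<close>.\<close>

definition rep_hom ::
  "('a, 'm) monoid_scheme
     \<Rightarrow> (complex \<Rightarrow> 'v::ab_group_add \<Rightarrow> 'v) \<Rightarrow> 'v set \<Rightarrow> ('a \<Rightarrow> 'v \<Rightarrow> 'v)
     \<Rightarrow> (complex \<Rightarrow> 'u::ab_group_add \<Rightarrow> 'u) \<Rightarrow> 'u set \<Rightarrow> ('a \<Rightarrow> 'u \<Rightarrow> 'u) \<Rightarrow> ('v \<Rightarrow> 'u) set" where
  "rep_hom A s V \<rho> s' V' \<rho>' =
     {T. (\<forall>v\<in>V. T v \<in> V') \<and>
         (\<forall>v\<in>V. \<forall>w\<in>V. T (v + w) = T v + T w) \<and>
         (\<forall>c. \<forall>v\<in>V. T (s c v) = s' c (T v)) \<and>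
         (\<forall>a\<in>carrier A. \<forall>v\<in>V. T (\<rho> a v) = \<rho>' a (T v)) \<and>
         (\<forall>v. v \<notin> V \<longrightarrow> T v = 0)}"

definition rep_isomorphic ::
  "('a, 'm) monoid_scheme
     \<Rightarrow> (complex \<Rightarrow> 'v::ab_group_add \<Rightarrow> 'v) \<Rightarrow> 'v set \<Rightarrow> ('a \<Rightarrow> 'v \<Rightarrow> 'v)
     \<Rightarrow> (complex \<Rightarrow> 'u::ab_group_add \<Rightarrow> 'u) \<Rightarrow> 'u set \<Rightarrow> ('a \<Rightarrow> 'u \<Rightarrow> 'u) \<Rightarrow> bool" where
  "rep_isomorphic A s V \<rho> s' V' \<rho>' \<longleftrightarrow> (\<exists>T\<in>rep_hom A s V \<rho> s' V' \<rho>'. bij_betw T V V')"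

definition fun_scale :: "(complex \<Rightarrow> 'v \<Rightarrow> 'v) \<Rightarrow> complex \<Rightarrow> ('x \<Rightarrow> 'v) \<Rightarrow> 'x \<Rightarrow> 'v" where
  "fun_scale s c \<phi> = (\<lambda>x. s c (\<phi> x))"

lemma vector_space_fun_scale:
  assumes "vector_space s"
  shows "vector_space (fun_scale s :: complex \<Rightarrow> ('x \<Rightarrow> 'v::ab_group_add) \<Rightarrow> 'x \<Rightarrow> 'v)"
proof -
  interpret vector_space s by fact
  show ?thesis
    by unfold_locales (auto simp: fun_scale_def fun_eq_iff algebra_simps)
qed


section \<open>Tensor products of coordinate representations\<close>

text \<open>\<open>coord_space {..<n}\<close> is a copy of \<open>\<complex>\<^sup>n\<close> inside a type that does not depend on \<open>n\<close>, so that
  quantifying over \<open>n\<close> and over the representations on this space covers every finite-dimensional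
  representation up to isomorphism. The tensor product of \<open>\<complex>\<^sup>n\<close> and \<open>\<complex>\<^sup>m\<close> is then
  \<open>coord_space ({..<n} \<times> {..<m})\<close>.\<close>

definition coord_space :: "'i set \<Rightarrow> ('i \<Rightarrow> complex) set" where
  "coord_space I = {v. \<forall>i. i \<notin> I \<longrightarrow> v i = 0}"

abbreviation coord_scale :: "complex \<Rightarrow> ('i \<Rightarrow> complex) \<Rightarrow> 'i \<Rightarrow> complex" where
  "coord_scale \<equiv> fun_scale (*)"

definition unit_vec :: "'i \<Rightarrow> 'i \<Rightarrow> complex" where
  "unit_vec k = (\<lambda>i. if i = k then 1 else 0)"

definition tensor_vec :: "('i \<Rightarrow> complex) \<Rightarrow> ('j \<Rightarrow> complex) \<Rightarrow> 'i \<times> 'j \<Rightarrow> complex" where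
  "tensor_vec v w = (\<lambda>(i, j). v i * w j)"

text \<open>\<open>\<pi>1 a1 \<otimes> \<pi>2 a2\<close> is the linear extension of
  \<open>unit_vec k \<otimes> unit_vec l \<mapsto> \<pi>1 a1 (unit_vec k) \<otimes> \<pi>2 a2 (unit_vec l)\<close>.\<close>

definition tensor_rep ::
  "nat \<Rightarrow> ('a \<Rightarrow> (nat \<Rightarrow> complex) \<Rightarrow> nat \<Rightarrow> complex)
     \<Rightarrow> nat \<Rightarrow> ('b \<Rightarrow> (nat \<Rightarrow> complex) \<Rightarrow> nat \<Rightarrow> complex)
     \<Rightarrow> 'a \<times> 'b \<Rightarrow> (nat \<times> nat \<Rightarrow> complex) \<Rightarrow> nat \<times> nat \<Rightarrow> complex" where
  "tensor_rep n \<pi>1 m \<pi>2 = (\<lambda>(a1, a2) t.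
     \<Sum>(k, l)\<in>{..<n} \<times> {..<m}.
       coord_scale (t (k, l)) (tensor_vec (\<pi>1 a1 (unit_vec k)) (\<pi>2 a2 (unit_vec l))))"

lemma coord_rep_expand:
  fixes v :: "nat \<Rightarrow> complex"
  assumes "monoid_rep A coord_scale (coord_space {..<r}) \<pi>" "a \<in> carrier A"
    and "v \<in> coord_space {..<r}"
  shows "\<pi> a v i = (\<Sum>k<r. v k * \<pi> a (unit_vec k) i)"
proof -
  interpret R: monoid_rep A coord_scale "coord_space {..<r}" \<pi> by fact
  have z: "\<pi> a 0 = 0" using R.map_add[OF assms(2), of 0 0] R.VS.subspace_0[OF R.subspace] by simp
  have u: "unit_vec k \<in> coord_space {..<r}" if "k < r" for k
    using that by (auto simp: unit_vec_def coord_space_def)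
  have *: "\<pi> a (\<Sum>k\<in>X. coord_scale (v k) (unit_vec k)) i = (\<Sum>k\<in>X. v k * \<pi> a (unit_vec k) i)"
    if "finite X" "X \<subseteq> {..<r}" for X
    using that
  proof (induction X)
    case (insert k X)
    have "(\<Sum>k\<in>X. coord_scale (v k) (unit_vec k)) \<in> coord_space {..<r}"
      using insert u by (intro R.VS.subspace_sum[OF R.subspace] R.VS.subspace_scale[OF R.subspace]) auto
    moreover have "coord_scale (v k) (unit_vec k) \<in> coord_space {..<r}"
      using insert u by (intro R.VS.subspace_scale[OF R.subspace]) auto
    ultimately show ?case
      using insert u
      by (simp add: R.map_add[OF assms(2)] R.map_scale[OF assms(2)] del: plus_fun_apply)
        (simp add: fun_scale_def)
  qed (simp add: z)
  have "(\<Sum>k\<in>X. F k) x = (\<Sum>k\<in>X. F k x)" for X and F :: "nat \<Rightarrow> nat \<Rightarrow> complex" and x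
    by (induction X rule: infinite_finite_induct) auto
  then have "(\<Sum>k<r. coord_scale (v k) (unit_vec k)) = v"
    using assms(3) by (auto simp: fun_eq_iff fun_scale_def unit_vec_def coord_space_def if_distrib cong: if_cong)
  with *[of "{..<r}"] show ?thesis by simp
qed

lemma monoid_rep_tensor:
  assumes "monoid_rep A1 coord_scale (coord_space {..<n}) \<pi>1"
    and "monoid_rep A2 coord_scale (coord_space {..<m}) \<pi>2"
  shows "monoid_rep (A1 \<times>\<times> A2) coord_scale (coord_space ({..<n} \<times> {..<m})) (tensor_rep n \<pi>1 m \<pi>2)"
proof -
  interpret R1: monoid_rep A1 coord_scale "coord_space {..<n}" \<pi>1 by fact
  interpret R2: monoid_rep A2 coord_scale "coord_space {..<m}" \<pi>2 by fact
  interpret V: vector_space "coord_scale :: complex \<Rightarrow> (nat \<times> nat \<Rightarrow> complex) \<Rightarrow> nat \<times> nat \<Rightarrow> complex"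
    by (rule vector_space_fun_scale) (unfold_locales, auto simp: algebra_simps)
  let ?I = "{..<n} \<times> {..<m}"
  have val: "tensor_rep n \<pi>1 m \<pi>2 (a1, a2) t (i, j) =
      (\<Sum>k<n. \<Sum>l<m. t (k, l) * (\<pi>1 a1 (unit_vec k) i * \<pi>2 a2 (unit_vec l) j))" for a1 a2 t i j
  proof -
    have "(\<Sum>p\<in>X. F p) x = (\<Sum>p\<in>X. F p x)" for X and F :: "nat \<times> nat \<Rightarrow> nat \<times> nat \<Rightarrow> complex" and x
      by (induction X rule: infinite_finite_induct) auto
    then show ?thesis
      by (simp add: tensor_rep_def fun_scale_def tensor_vec_def case_prod_unfold sum.cartesian_product)
  qed
  have u1: "unit_vec k \<in> coord_space {..<r}" if "k < r" for k r :: nat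
    using that by (auto simp: unit_vec_def coord_space_def)
  show ?thesis
  proof (intro monoid_rep.intro monoid_rep_axioms.intro)
    show "monoid (A1 \<times>\<times> A2)" by (intro DirProd_monoid R1.A.monoid_axioms R2.A.monoid_axioms)
    show "vector_space (coord_scale :: complex \<Rightarrow> (nat \<times> nat \<Rightarrow> complex) \<Rightarrow> nat \<times> nat \<Rightarrow> complex)"
      by (rule V.vector_space_axioms)
    show "V.subspace (coord_space ?I)"
      by (rule V.subspaceI) (auto simp: coord_space_def fun_scale_def)
  next
    fix a t assume "a \<in> carrier (A1 \<times>\<times> A2)" "t \<in> coord_space ?I"
    then show "tensor_rep n \<pi>1 m \<pi>2 a t \<in> coord_space ?I"
      using R1.maps[OF _ u1] R2.maps[OF _ u1]
      by (cases a) (auto simp: coord_space_def val intro!: sum.neutral)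
  next
    fix a t t' assume "a \<in> carrier (A1 \<times>\<times> A2)" "t \<in> coord_space ?I" "t' \<in> coord_space ?I"
    show "tensor_rep n \<pi>1 m \<pi>2 a (t + t') = tensor_rep n \<pi>1 m \<pi>2 a t + tensor_rep n \<pi>1 m \<pi>2 a t'"
      by (cases a) (auto simp: fun_eq_iff val algebra_simps sum.distrib)
  next
    fix a t c assume "a \<in> carrier (A1 \<times>\<times> A2)" "t \<in> coord_space ?I"
    show "tensor_rep n \<pi>1 m \<pi>2 a (coord_scale c t) = coord_scale c (tensor_rep n \<pi>1 m \<pi>2 a t)"
      by (cases a) (auto simp: fun_eq_iff val fun_scale_def sum_distrib_left mult.assoc)
  next
    fix t assume t: "t \<in> coord_space ?I"
    have "tensor_rep n \<pi>1 m \<pi>2 (\<one>\<^bsub>A1\<^esub>, \<one>\<^bsub>A2\<^esub>) t (i, j) = t (i, j)" for i j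
    proof -
      have "tensor_rep n \<pi>1 m \<pi>2 (\<one>\<^bsub>A1\<^esub>, \<one>\<^bsub>A2\<^esub>) t (i, j) =
          (\<Sum>k<n. if i = k then (\<Sum>l<m. if j = l then t (k, l) else 0) else 0)"
        unfolding val by (intro sum.cong refl)
          (auto simp: R1.map_one[OF u1] R2.map_one[OF u1] intro!: sum.cong sum.neutral,
            auto simp: unit_vec_def if_distrib[of "(*) _"] cong: if_cong)
      then show ?thesis using t by (auto simp: coord_space_def)
    qed
    then show "tensor_rep n \<pi>1 m \<pi>2 \<one>\<^bsub>A1 \<times>\<times> A2\<^esub> t = t" by (auto simp: fun_eq_iff)
  next
    fix a b t assume ab: "a \<in> carrier (A1 \<times>\<times> A2)" "b \<in> carrier (A1 \<times>\<times> A2)"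
      and t: "t \<in> coord_space ?I"
    obtain a1 a2 b1 b2 where e: "a = (a1, a2)" "b = (b1, b2)" by (cases a, cases b) auto
    have c: "a1 \<in> carrier A1" "a2 \<in> carrier A2" "b1 \<in> carrier A1" "b2 \<in> carrier A2"
      using ab e by auto
    let ?f = "\<lambda>k p i. \<pi>1 b1 (unit_vec k) p * \<pi>1 a1 (unit_vec p) i"
    let ?g = "\<lambda>l q j. \<pi>2 b2 (unit_vec l) q * \<pi>2 a2 (unit_vec q) j"
    have "tensor_rep n \<pi>1 m \<pi>2 (a1 \<otimes>\<^bsub>A1\<^esub> b1, a2 \<otimes>\<^bsub>A2\<^esub> b2) t (i, j) =
        tensor_rep n \<pi>1 m \<pi>2 (a1, a2) (tensor_rep n \<pi>1 m \<pi>2 (b1, b2) t) (i, j)" for i j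
    proof -
      have "tensor_rep n \<pi>1 m \<pi>2 (a1 \<otimes>\<^bsub>A1\<^esub> b1, a2 \<otimes>\<^bsub>A2\<^esub> b2) t (i, j) =
          (\<Sum>k<n. \<Sum>l<m. t (k, l) * ((\<Sum>p<n. ?f k p i) * (\<Sum>q<m. ?g l q j)))"
        unfolding val using c
        by (intro sum.cong refl)
          (simp add: R1.map_mult[OF _ _ u1] R2.map_mult[OF _ _ u1]
            coord_rep_expand[OF assms(1) _ R1.maps[OF _ u1], of a1] coord_rep_expand[OF assms(2) _ R2.maps[OF _ u1], of a2])
      also have "\<dots> = (\<Sum>k<n. \<Sum>l<m. \<Sum>p<n. \<Sum>q<m. t (k, l) * (?f k p i * ?g l q j))"
        by (simp only: sum_product) (simp only: sum_distrib_left)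
      also have "\<dots> = (\<Sum>(k, l)\<in>?I. \<Sum>(p, q)\<in>?I. t (k, l) * (?f k p i * ?g l q j))"
        by (simp only: sum.cartesian_product[symmetric])
      also have "\<dots> = (\<Sum>(p, q)\<in>?I. \<Sum>(k, l)\<in>?I. t (k, l) * (?f k p i * ?g l q j))"
        unfolding case_prod_unfold by (rule sum.swap)
      also have "\<dots> = (\<Sum>p<n. \<Sum>q<m. \<Sum>k<n. \<Sum>l<m. t (k, l) * (?f k p i * ?g l q j))"
        by (simp only: sum.cartesian_product[symmetric])
      also have "\<dots> = tensor_rep n \<pi>1 m \<pi>2 (a1, a2) (tensor_rep n \<pi>1 m \<pi>2 (b1, b2) t) (i, j)"
        unfolding val sum_distrib_right by (intro sum.cong refl) (simp add: ac_simps)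
      finally show ?thesis .
    qed
    then show "tensor_rep n \<pi>1 m \<pi>2 (a \<otimes>\<^bsub>A1 \<times>\<times> A2\<^esub> b) t =
        tensor_rep n \<pi>1 m \<pi>2 a (tensor_rep n \<pi>1 m \<pi>2 b t)"
      by (auto simp: e fun_eq_iff)
  qed
qed

abbreviation irrep :: "('a, 'm) monoid_scheme \<Rightarrow> nat \<Rightarrow> ('a \<Rightarrow> (nat \<Rightarrow> complex) \<Rightarrow> nat \<Rightarrow> complex) \<Rightarrow> bool"
  where
  "irrep A n \<pi> \<equiv> irreducible_rep A coord_scale (coord_space {..<n}) \<pi>"

abbreviation irrep_isomorphic ::
  "('a, 'm) monoid_scheme \<Rightarrow> nat \<Rightarrow> ('a \<Rightarrow> (nat \<Rightarrow> complex) \<Rightarrow> nat \<Rightarrow> complex)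
     \<Rightarrow> nat \<Rightarrow> ('a \<Rightarrow> (nat \<Rightarrow> complex) \<Rightarrow> nat \<Rightarrow> complex) \<Rightarrow> bool" where
  "irrep_isomorphic A n \<pi> n' \<pi>' \<equiv>
     rep_isomorphic A coord_scale (coord_space {..<n}) \<pi> coord_scale (coord_space {..<n'}) \<pi>'"


section \<open>Theta representations\<close>

type_synonym 'c coord_rep2 =
  "(nat \<times> nat \<Rightarrow> complex) set \<times> ('c \<Rightarrow> (nat \<times> nat \<Rightarrow> complex) \<Rightarrow> nat \<times> nat \<Rightarrow> complex)"

text \<open>\<open>Hom(\<tau>, \<pi>1 \<otimes> \<pi>2)\<close> for representations of \<open>A1 \<times> A2\<close>.\<close>

definition theta_hom ::
  "('a, 'm) monoid_scheme \<Rightarrow> ('b, 'k) monoid_scheme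
     \<Rightarrow> (complex \<Rightarrow> 'v::ab_group_add \<Rightarrow> 'v) \<Rightarrow> 'v set \<Rightarrow> ('a \<times> 'b \<Rightarrow> 'v \<Rightarrow> 'v)
     \<Rightarrow> nat \<Rightarrow> ('a \<Rightarrow> (nat \<Rightarrow> complex) \<Rightarrow> nat \<Rightarrow> complex)
     \<Rightarrow> nat \<Rightarrow> ('b \<Rightarrow> (nat \<Rightarrow> complex) \<Rightarrow> nat \<Rightarrow> complex)
     \<Rightarrow> ('v \<Rightarrow> nat \<times> nat \<Rightarrow> complex) set" where
  "theta_hom A1 A2 s V \<tau> n \<pi>1 m \<pi>2 =
     rep_hom (A1 \<times>\<times> A2) s V \<tau> coord_scale (coord_space ({..<n} \<times> {..<m})) (tensor_rep n \<pi>1 m \<pi>2)"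

text \<open>Theta representations of \<open>A1 \<times> A2\<close> with respect to a class \<open>S\<close> of representations of
  \<open>A1 \<times> A2\<close>; \<open>corr\<close> is the correspondence between irreducible representations that \<open>\<tau>\<close> defines
  inside \<open>S\<close>.\<close>

definition theta_rep_wrt ::
  "('a, 'm) monoid_scheme \<Rightarrow> ('b, 'k) monoid_scheme \<Rightarrow> ('a \<times> 'b) coord_rep2 set
     \<Rightarrow> (complex \<Rightarrow> 'v::ab_group_add \<Rightarrow> 'v) \<Rightarrow> 'v set \<Rightarrow> ('a \<times> 'b \<Rightarrow> 'v \<Rightarrow> 'v) \<Rightarrow> bool" where
  "theta_rep_wrt A1 A2 S s V \<tau> \<longleftrightarrow>
     monoid_rep (A1 \<times>\<times> A2) s V \<tau> \<and> finite_dim s V \<and>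
     (let inS = (\<lambda>n \<pi>1 m \<pi>2. irrep A1 n \<pi>1 \<and> irrep A2 m \<pi>2 \<and>
                   (coord_space ({..<n} \<times> {..<m}), tensor_rep n \<pi>1 m \<pi>2) \<in> S);
          corr = (\<lambda>n \<pi>1 m \<pi>2. inS n \<pi>1 m \<pi>2 \<and> theta_hom A1 A2 s V \<tau> n \<pi>1 m \<pi>2 \<noteq> {0})
      in (\<forall>n \<pi>1 m \<pi>2. inS n \<pi>1 m \<pi>2 \<longrightarrow>
            vector_space.dim (fun_scale coord_scale) (theta_hom A1 A2 s V \<tau> n \<pi>1 m \<pi>2) \<le> 1) \<and>
         (\<forall>n \<pi>1 m \<pi>2 m' \<pi>2'. corr n \<pi>1 m \<pi>2 \<and> corr n \<pi>1 m' \<pi>2' \<longrightarrow>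
            irrep_isomorphic A2 m \<pi>2 m' \<pi>2') \<and>
         (\<forall>n \<pi>1 n' \<pi>1' m \<pi>2. corr n \<pi>1 m \<pi>2 \<and> corr n' \<pi>1' m \<pi>2 \<longrightarrow>
            irrep_isomorphic A1 n \<pi>1 n' \<pi>1'))"

definition theta_rep ::
  "('a, 'm) monoid_scheme \<Rightarrow> ('b, 'k) monoid_scheme
     \<Rightarrow> (complex \<Rightarrow> 'v::ab_group_add \<Rightarrow> 'v) \<Rightarrow> 'v set \<Rightarrow> ('a \<times> 'b \<Rightarrow> 'v \<Rightarrow> 'v) \<Rightarrow> bool" where
  "theta_rep A1 A2 s V \<tau> \<longleftrightarrow> theta_rep_wrt A1 A2 UNIV s V \<tau>"

definition Irr_E ::
  "('a, 'm) monoid_scheme \<Rightarrow> 'a set \<Rightarrow> ('b, 'k) monoid_scheme \<Rightarrow> 'b set \<Rightarrow> ('a set \<Rightarrow> 'b set)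
     \<Rightarrow> ('a \<times> 'b) coord_rep2 set" where
  "Irr_E M1 N1 M2 N2 \<iota> =
     {(V, \<sigma>). irreducible_rep (M1 \<times>\<times> M2) coord_scale V \<sigma> \<and>
        (\<exists>e\<in>matched_idempotents M1 N1 M2 N2 \<iota>. is_apex (M1 \<times>\<times> M2) V \<sigma> e)}"


section \<open>Induction\<close>

text \<open>Functions on the monoid \<open>A\<close> are represented by functions vanishing outside \<open>carrier A\<close>.\<close>

definition ind_space ::
  "('c, 'm) monoid_scheme \<Rightarrow> 'c set \<Rightarrow> 'w::zero set \<Rightarrow> ('c \<Rightarrow> 'w \<Rightarrow> 'w) \<Rightarrow> ('c \<Rightarrow> 'w) set" where
  "ind_space A G W \<rho> =
     {\<phi>. (\<forall>x\<in>carrier A. \<phi> x \<in> W) \<and> (\<forall>x. x \<notin> carrier A \<longrightarrow> \<phi> x = 0) \<and>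
         (\<forall>\<gamma>\<in>G. \<forall>x\<in>carrier A. \<phi> (\<gamma> \<otimes>\<^bsub>A\<^esub> x) = \<rho> \<gamma> (\<phi> x))}"

definition ind_action :: "('c, 'm) monoid_scheme \<Rightarrow> 'c \<Rightarrow> ('c \<Rightarrow> 'w::zero) \<Rightarrow> 'c \<Rightarrow> 'w" where
  "ind_action A m \<phi> = (\<lambda>x. if x \<in> carrier A then \<phi> (x \<otimes>\<^bsub>A\<^esub> m) else 0)"

lemma monoid_rep_ind:
  assumes "monoid A" "G \<subseteq> carrier A" "monoid_rep (A\<lparr>carrier := G\<rparr>) s W \<rho>"
  shows "monoid_rep A (fun_scale s) (ind_space A G W \<rho>) (ind_action A)"
proof -
  interpret A: monoid A by fact
  interpret R: monoid_rep "A\<lparr>carrier := G\<rparr>" s W \<rho> by fact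
  interpret F: vector_space "fun_scale s :: complex \<Rightarrow> ('a \<Rightarrow> 'c) \<Rightarrow> 'a \<Rightarrow> 'c"
    by (rule vector_space_fun_scale) (rule R.VS.vector_space_axioms)
  have G: "\<gamma> \<in> carrier A" if "\<gamma> \<in> G" for \<gamma> using assms(2) that by auto
  have 0: "\<rho> \<gamma> 0 = 0" if "\<gamma> \<in> G" for \<gamma>
    using R.map_add[of \<gamma> 0 0] R.VS.subspace_0[OF R.subspace] that by simp
  note W = R.VS.subspace_0[OF R.subspace] R.VS.subspace_add[OF R.subspace]
    R.VS.subspace_scale[OF R.subspace]
  have sub: "F.subspace (ind_space A G W \<rho>)"
  proof (rule F.subspaceI)
    show "0 \<in> ind_space A G W \<rho>"
      using W(1) 0 by (simp add: ind_space_def)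
    show "\<phi> + \<psi> \<in> ind_space A G W \<rho>"
      if "\<phi> \<in> ind_space A G W \<rho>" "\<psi> \<in> ind_space A G W \<rho>" for \<phi> \<psi>
      using that W(2) R.map_add by (simp add: ind_space_def)
    show "fun_scale s c \<phi> \<in> ind_space A G W \<rho>" if "\<phi> \<in> ind_space A G W \<rho>" for c \<phi>
      using that W(3) R.map_scale by (simp add: ind_space_def fun_scale_def)
  qed
  show ?thesis
  proof (intro monoid_rep.intro monoid_rep_axioms.intro)
    show "monoid A" by fact
    show "vector_space (fun_scale s :: complex \<Rightarrow> ('a \<Rightarrow> 'c) \<Rightarrow> 'a \<Rightarrow> 'c)"
      by (rule F.vector_space_axioms)
    show "F.subspace (ind_space A G W \<rho>)" by (rule sub)
  next
    fix a \<phi> assume "a \<in> carrier A" "\<phi> \<in> ind_space A G W \<rho>"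
    then show "ind_action A a \<phi> \<in> ind_space A G W \<rho>"
      using G by (simp add: ind_space_def ind_action_def A.m_assoc)
  next
    fix \<phi> assume "\<phi> \<in> ind_space A G W \<rho>"
    then show "ind_action A \<one>\<^bsub>A\<^esub> \<phi> = \<phi>"
      by (simp add: ind_space_def ind_action_def fun_eq_iff)
  qed (auto simp: ind_action_def fun_scale_def fun_eq_iff A.m_assoc)
qed

end

theory Submission
  imports Defs "Jordan_Normal_Form.Spectral_Radius"
begin

text \<open>Under the hypotheses the idempotents of \<open>M1\<close> and \<open>M2\<close> are central and every element is a unit of
  \<open>e M e\<close> for some idempotent \<open>e\<close>. Hence \<open>\<rho>\<close> is the identity on \<open>f = (f1, f2)\<close>, vanishes on all \<open>\<gamma>\<close> for
  which \<open>\<gamma> f\<close> is not a unit of \<open>f \<Gamma> f\<close>, and the part of the induced representation seen by \<open>Irr\<^sup>E\<close> is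
  the representation \<open>J\<close> induced from the fibre product \<open>K = \<Gamma> \<inter> (H1 \<times> H2)\<close> to \<open>H1 \<times> H2\<close>, where \<open>Hi\<close> is the
  group of units of \<open>fi Mi fi\<close>. So it suffices to treat groups.

  For finite groups, a representation \<open>V\<close> of \<open>A1 \<times> A2\<close> is a theta representation iff every
  \<open>A1\<close>-endomorphism of \<open>V\<close> commutes with every \<open>A2\<close>-endomorphism of \<open>V\<close>. This condition passes between
  \<open>W\<close>, as a representation of \<open>N1 \<times> N2\<close>, and \<open>J\<close>. An \<open>N1\<close>-endomorphism \<open>X\<close> of \<open>W\<close> lifts to the
  \<open>H1\<close>-endomorphism \<open>T \<phi> x = \<rho> \<kappa> X \<rho> (inv \<kappa>) (\<phi> x)\<close> of \<open>J\<close>, where \<open>\<kappa> \<in> K\<close> has the same second component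
  as \<open>x\<close>, and \<open>T \<phi> 1 = X (\<phi> 1)\<close>. Conversely, for endomorphisms \<open>T\<close>, \<open>U\<close> of \<open>J\<close> over \<open>H1\<close> and \<open>H2\<close>, both \<open>T U\<close>
  and \<open>U T\<close> send the function \<open>emb w\<close>, supported on \<open>K\<close> with value \<open>w\<close> at 1, to a function whose value
  at 1 is proportional to the sum over \<open>(y, z) \<in> K\<close> of \<open>\<rho> (inv (y, z)) (T\<^sub>z (U\<^sub>y w))\<close>, where
  \<open>T\<^sub>z w = T (emb w) (1, z)\<close> and \<open>U\<^sub>y w = U (emb w) (y, 1)\<close> are endomorphisms of \<open>W\<close> over \<open>N1\<close> and \<open>N2\<close>.\<close>

text \<open>For a finite group, the commutant of the \<open>A1\<close>-endomorphisms of
  \<open>V\<close> is the image of the group algebra of \<open>A1\<close>. The commutation condition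
  therefore says that the images of the two group algebras are each other's commutants. It is
  symmetric in the two factors and mentions no decomposition into irreducibles, which is why it can
  be carried through the induction without knowing the irreducibles of \<open>N1 \<times> N2\<close>
  or \<open>H1 \<times> H2\<close>.

  The induced representation can have constituents with unmatched apex. For
  \<open>M1 = M2 = {0, 1}\<close> with trivial \<open>N1\<close>, \<open>N2\<close> and
  \<open>f = (1, 1)\<close>, the apexes \<open>(0, 1)\<close> and \<open>(1, 0)\<close> occur
  besides \<open>f\<close>. Testing against \<open>Irr\<^sup>E\<close> separates \<open>f\<close>
  from these, because a matched idempotent lies in \<open>\<Gamma>\<close> and is central: it acts
  on an induced function through \<open>\<rho>\<close>, hence as 0 or as the identity.\<close>

hide_const (open) Matrix.unit_vec
hide_fact (open) Matrix.unit_vec_def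

section \<open>Coordinate spaces\<close>

lemma sum_apply: "(\<Sum>k\<in>X. F k) x = (\<Sum>k\<in>X. F k x)"
  for F :: "'i \<Rightarrow> 'x \<Rightarrow> 'c::comm_monoid_add"
  by (induction X rule: infinite_finite_induct) auto

lemma vector_space_coord: "vector_space (coord_scale :: complex \<Rightarrow> ('i \<Rightarrow> complex) \<Rightarrow> 'i \<Rightarrow> complex)"
  by (rule vector_space_fun_scale) (unfold_locales, auto simp: algebra_simps)

interpretation coord: vector_space "coord_scale :: complex \<Rightarrow> ('i \<Rightarrow> complex) \<Rightarrow> 'i \<Rightarrow> complex"
  by (rule vector_space_coord)

lemma subspace_coord_space: "coord.subspace (coord_space I)"
  by (rule coord.subspaceI) (auto simp: coord_space_def fun_scale_def)

lemma unit_vec_in_coord_space [simp]: "unit_vec k \<in> coord_space I \<longleftrightarrow> k \<in> I"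
  by (auto simp: unit_vec_def coord_space_def)

lemma coord_space_expand:
  assumes "finite I" "v \<in> coord_space I"
  shows "v = (\<Sum>k\<in>I. coord_scale (v k) (unit_vec k))"
proof
  fix x
  have "(\<Sum>k\<in>I. coord_scale (v k) (unit_vec k)) x = (\<Sum>k\<in>I. if x = k then v k else 0)"
    unfolding sum_apply by (rule sum.cong) (auto simp: fun_scale_def unit_vec_def)
  then show "v x = (\<Sum>k\<in>I. coord_scale (v k) (unit_vec k)) x"
    using assms by (auto simp: coord_space_def)
qed

lemma coord_space_nontrivial: "coord_space {..<n} \<noteq> {0} \<longleftrightarrow> 0 < (n::nat)"
proof
  assume "0 < n"
  then have "unit_vec 0 \<in> coord_space {..<n}" by simp
  moreover have "unit_vec (0::nat) \<noteq> 0" by (auto simp: unit_vec_def fun_eq_iff)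
  ultimately show "coord_space {..<n} \<noteq> {0}" by blast
next
  assume "coord_space {..<n} \<noteq> {0}"
  then show "0 < n" by (rule contrapos_np) (auto simp: coord_space_def)
qed

section \<open>Subspaces of finite dimension\<close>

lemma finite_dim_subset: "finite_dim s V \<Longrightarrow> U \<subseteq> V \<Longrightarrow> finite_dim s U"
  by (auto simp: finite_dim_def)

context
  fixes s :: "complex \<Rightarrow> 'v::ab_group_add \<Rightarrow> 'v"
  assumes vs: "vector_space s"
begin

interpretation vector_space s by (rule vs)

lemma finite_dim_basis:
  assumes "finite_dim s V"
  obtains B where "B \<subseteq> V" "independent B" "V \<subseteq> span B" "finite B" "card B = dim V"
proof -
  obtain C where C: "finite C" "V \<subseteq> span C" using assms by (auto simp: finite_dim_def)
  obtain B where B: "B \<subseteq> V" "independent B" "V \<subseteq> span B" "card B = dim V"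
    by (rule basis_exists)
  then have "finite B" using independent_span_bound[of C B] C by blast
  with B that show ?thesis by blast
qed

lemma finite_dim_subspace_less:
  assumes "finite_dim s V" "subspace U" "U \<subseteq> V" "U \<noteq> V"
  shows "dim U < dim V"
proof -
  obtain B where B: "B \<subseteq> U" "independent B" "U \<subseteq> span B" "finite B" "card B = dim U"
    by (rule finite_dim_basis[OF finite_dim_subset[OF assms(1,3)]])
  obtain C where C: "C \<subseteq> V" "independent C" "V \<subseteq> span C" "finite C" "card C = dim V"
    by (rule finite_dim_basis[OF assms(1)])
  obtain v where v: "v \<in> V" "v \<notin> U" using assms by blast
  have "span B \<subseteq> U" using B(1) assms(2) by (rule span_minimal)
  then have "v \<notin> span B" using v by blast
  then have "independent (insert v B)" by (rule independent_insertI) fact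
  moreover have "insert v B \<subseteq> span C" using v B C assms by blast
  ultimately have "card (insert v B) \<le> card C" using independent_span_bound[OF C(4)] by blast
  moreover have "v \<notin> B" using v B by blast
  ultimately show ?thesis using B C by simp
qed

text \<open>The theta conditions bound a dimension. In terms of pairs of vectors the bound can be
  tested on single intertwiners and moved along bijections that respect scalars.\<close>

lemma dim_le_1_iff_proportional:
  assumes "finite_dim s X"
  shows "dim X \<le> 1 \<longleftrightarrow> (\<forall>S\<in>X. \<forall>T\<in>X. T \<noteq> 0 \<longrightarrow> (\<exists>c. S = s c T))"
proof
  assume d: "dim X \<le> 1"
  show "\<forall>S\<in>X. \<forall>T\<in>X. T \<noteq> 0 \<longrightarrow> (\<exists>c. S = s c T)"
  proof (intro ballI impI, rule ccontr)
    fix S T assume ST: "S \<in> X" "T \<in> X" "T \<noteq> 0" and "\<nexists>c. S = s c T"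
    then have "S \<notin> span {T}" by (auto simp: span_singleton)
    then have i: "independent {S, T}" using ST by (intro independent_insertI) (auto simp: independent_empty)
    obtain C where C: "C \<subseteq> X" "independent C" "X \<subseteq> span C" "finite C" "card C = dim X"
      by (rule finite_dim_basis[OF assms])
    have "card {S, T} \<le> card C"
      using independent_span_bound[OF C(4) i] C(3) ST by blast
    moreover have "S \<noteq> T" using \<open>S \<notin> span {T}\<close> by (auto intro: span_base)
    ultimately show False using d C by simp
  qed
next
  assume p: "\<forall>S\<in>X. \<forall>T\<in>X. T \<noteq> 0 \<longrightarrow> (\<exists>c. S = s c T)"
  show "dim X \<le> 1"
  proof (cases "\<exists>T\<in>X. T \<noteq> 0")
    case True
    then obtain T where T: "T \<in> X" "T \<noteq> 0" by blast
    have "X \<subseteq> span {T}"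
    proof
      fix S assume "S \<in> X"
      then obtain c where "S = s c T" using p T by blast
      then show "S \<in> span {T}" by (simp add: span_scale span_base)
    qed
    then show ?thesis using dim_le_card[of X "{T}"] by simp
  next
    case False
    then have "X \<subseteq> span {}" by (auto simp: span_empty)
    then show ?thesis using dim_le_card[of X "{}"] by simp
  qed
qed

end

text \<open>The functions \<open>?e (x, b)\<close>, concentrated at one point with a basis vector of
  \<open>W\<close> as value, span a space containing \<open>X\<close>. They may lie outside
  \<open>X\<close>, which \<open>finite_dim\<close> permits.\<close>

lemma finite_dim_fun_space:
  fixes s :: "complex \<Rightarrow> 'w::ab_group_add \<Rightarrow> 'w"
  assumes "vector_space s" "finite D" "finite_dim s W" "module.subspace s W"
    and "\<And>\<phi> x. \<phi> \<in> X \<Longrightarrow> x \<in> D \<Longrightarrow> \<phi> x \<in> W" "\<And>\<phi> x. \<phi> \<in> X \<Longrightarrow> x \<notin> D \<Longrightarrow> \<phi> x = 0"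
  shows "finite_dim (fun_scale s) X"
proof -
  interpret vector_space s by fact
  interpret F: vector_space "fun_scale s :: complex \<Rightarrow> ('x \<Rightarrow> 'w) \<Rightarrow> 'x \<Rightarrow> 'w"
    by (rule vector_space_fun_scale) fact
  obtain B where B: "B \<subseteq> W" "independent B" "W \<subseteq> span B" "finite B"
    by (rule finite_dim_basis[OF assms(1,3)])
  let ?e = "\<lambda>(x, b) y. if y = x then b else 0"
  show ?thesis unfolding finite_dim_def
  proof (intro exI conjI subsetI)
    show "finite (?e ` (D \<times> B))" using assms(2) B by simp
    fix \<phi> assume \<phi>: "\<phi> \<in> X"
    let ?r = "\<lambda>x b. representation B (\<phi> x) b"
    have "\<phi> = (\<Sum>x\<in>D. \<Sum>b\<in>B. fun_scale s (?r x b) (?e (x, b)))"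
    proof
      fix y
      have "(\<Sum>x\<in>D. \<Sum>b\<in>B. fun_scale s (?r x b) (?e (x, b))) y =
          (\<Sum>x\<in>D. if y = x then (\<Sum>b\<in>B. s (?r x b) b) else 0)"
        unfolding sum_apply by (rule sum.cong) (auto simp: fun_scale_def)
      also have "\<dots> = \<phi> y"
        using assms(2,5,6) \<phi> B by (auto simp: sum_representation_eq subset_iff)
      finally show "\<phi> y = (\<Sum>x\<in>D. \<Sum>b\<in>B. fun_scale s (?r x b) (?e (x, b))) y" by simp
    qed
    also have "\<dots> \<in> F.span (?e ` (D \<times> B))"
      by (intro F.span_sum F.span_scale F.span_base) auto
    finally show "\<phi> \<in> F.span (?e ` (D \<times> B))" .
  qed
qed

section \<open>Intertwiners\<close>

text \<open>\<open>rep_hom\<close> prescribes the value 0 outside \<open>V\<close> so that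
  intertwiners form a vector space. Without this normalisation they can be composed and restricted
  as they stand; \<open>zero_ext\<close> returns to the normal form.\<close>

definition intertwiner ::
  "('a, 'm) monoid_scheme
     \<Rightarrow> (complex \<Rightarrow> 'v::ab_group_add \<Rightarrow> 'v) \<Rightarrow> 'v set \<Rightarrow> ('a \<Rightarrow> 'v \<Rightarrow> 'v)
     \<Rightarrow> (complex \<Rightarrow> 'u::ab_group_add \<Rightarrow> 'u) \<Rightarrow> 'u set \<Rightarrow> ('a \<Rightarrow> 'u \<Rightarrow> 'u) \<Rightarrow> ('v \<Rightarrow> 'u) \<Rightarrow> bool"
  where
  "intertwiner A s V \<rho> s' V' \<rho>' T \<longleftrightarrow>
     (\<forall>v\<in>V. T v \<in> V') \<and>
     (\<forall>v\<in>V. \<forall>w\<in>V. T (v + w) = T v + T w) \<and>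
     (\<forall>c. \<forall>v\<in>V. T (s c v) = s' c (T v)) \<and>
     (\<forall>a\<in>carrier A. \<forall>v\<in>V. T (\<rho> a v) = \<rho>' a (T v))"

lemma rep_hom_iff:
  "T \<in> rep_hom A s V \<rho> s' V' \<rho>' \<longleftrightarrow>
     intertwiner A s V \<rho> s' V' \<rho>' T \<and> (\<forall>v. v \<notin> V \<longrightarrow> T v = 0)"
  by (auto simp: rep_hom_def intertwiner_def)

lemma intertwiner_in: "intertwiner A s V \<rho> s' V' \<rho>' T \<Longrightarrow> v \<in> V \<Longrightarrow> T v \<in> V'"
  and intertwiner_add:
    "intertwiner A s V \<rho> s' V' \<rho>' T \<Longrightarrow> v \<in> V \<Longrightarrow> w \<in> V \<Longrightarrow> T (v + w) = T v + T w"
  and intertwiner_scale: "intertwiner A s V \<rho> s' V' \<rho>' T \<Longrightarrow> v \<in> V \<Longrightarrow> T (s c v) = s' c (T v)"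
  and intertwiner_commutes: "intertwiner A s V \<rho> s' V' \<rho>' T \<Longrightarrow> a \<in> carrier A \<Longrightarrow> v \<in> V \<Longrightarrow>
    T (\<rho> a v) = \<rho>' a (T v)"
  by (auto simp: intertwiner_def)

lemma intertwinerI:
  assumes "\<And>v. v \<in> V \<Longrightarrow> T v \<in> V'"
    and "\<And>v w. v \<in> V \<Longrightarrow> w \<in> V \<Longrightarrow> T (v + w) = T v + T w"
    and "\<And>c v. v \<in> V \<Longrightarrow> T (s c v) = s' c (T v)"
    and "\<And>a v. a \<in> carrier A \<Longrightarrow> v \<in> V \<Longrightarrow> T (\<rho> a v) = \<rho>' a (T v)"
  shows "intertwiner A s V \<rho> s' V' \<rho>' T"
  using assms by (auto simp: intertwiner_def)

lemma intertwiner_compose: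
  assumes "intertwiner A s V \<rho> s' V' \<rho>' T" "intertwiner A s' V' \<rho>' s'' V'' \<rho>'' S"
  shows "intertwiner A s V \<rho> s'' V'' \<rho>'' (\<lambda>v. S (T v))"
  using assms by (auto simp: intertwiner_def)

lemma intertwiner_zero:
  assumes "intertwiner A s V \<rho> s' V' \<rho>' T" "0 \<in> V"
  shows "T 0 = 0"
  using intertwiner_add[OF assms(1), of 0 0] assms(2) by simp

lemma intertwiner_restrict_monoid:
  assumes "intertwiner A s V \<rho> s' V' \<rho>' T" "carrier B \<subseteq> carrier A"
  shows "intertwiner B s V \<rho> s' V' \<rho>' T"
  using assms by (auto simp: intertwiner_def)

lemma intertwiner_subspace:
  assumes "intertwiner A s V \<rho> s' V' \<rho>' T" "U \<subseteq> V"
  shows "intertwiner A s U \<rho> s' V' \<rho>' T"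
  using assms unfolding intertwiner_def subset_iff by blast

definition zero_ext :: "'v set \<Rightarrow> ('v \<Rightarrow> 'u::zero) \<Rightarrow> 'v \<Rightarrow> 'u" where
  "zero_ext V T = (\<lambda>v. if v \<in> V then T v else 0)"

context monoid_rep begin

lemma zero_in: "0 \<in> V" and add_in: "v \<in> V \<Longrightarrow> w \<in> V \<Longrightarrow> v + w \<in> V"
  and diff_in: "v \<in> V \<Longrightarrow> w \<in> V \<Longrightarrow> v - w \<in> V"
  and scale_in: "v \<in> V \<Longrightarrow> s c v \<in> V"
  and sum_in: "(\<And>i. i \<in> I \<Longrightarrow> g i \<in> V) \<Longrightarrow> sum g I \<in> V"
  using VS.subspace_0[OF subspace] VS.subspace_add[OF subspace] VS.subspace_diff[OF subspace]
    VS.subspace_scale[OF subspace] VS.subspace_sum[OF subspace, of I g] by simp_all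

lemma map_zero: "a \<in> carrier A \<Longrightarrow> \<rho> a 0 = 0"
  using map_add[of a 0 0] zero_in by simp

lemma map_diff: "a \<in> carrier A \<Longrightarrow> v \<in> V \<Longrightarrow> w \<in> V \<Longrightarrow> \<rho> a (v - w) = \<rho> a v - \<rho> a w"
  using map_add[of a "v - w" w] diff_in by (simp add: algebra_simps)

lemma map_sum:
  assumes "a \<in> carrier A" "\<And>i. i \<in> I \<Longrightarrow> g i \<in> V"
  shows "\<rho> a (sum g I) = (\<Sum>i\<in>I. \<rho> a (g i))"
  using assms(2)
  by (induction I rule: infinite_finite_induct)
    (auto simp: map_zero[OF assms(1)] map_add[OF assms(1)] sum_in)

lemma sub_rep:
  assumes "VS.subspace U" "U \<subseteq> V" "\<And>a v. a \<in> carrier A \<Longrightarrow> v \<in> U \<Longrightarrow> \<rho> a v \<in> U"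
  shows "monoid_rep A s U \<rho>"
  using assms by unfold_locales (auto simp: map_add map_scale map_one map_mult subset_iff)

lemma zero_ext_rep_hom:
  assumes "intertwiner A s V \<rho> s' V' \<rho>' T"
  shows "zero_ext V T \<in> rep_hom A s V \<rho> s' V' \<rho>'"
  using assms add_in scale_in maps unfolding rep_hom_def intertwiner_def zero_ext_def by auto

lemma intertwiner_diff:
  assumes "intertwiner A s V \<rho> s' V' \<rho>' T" "v \<in> V" "w \<in> V"
  shows "T (v - w) = T v - T w"
  using intertwiner_add[OF assms(1), of "v - w" w] assms diff_in by (simp add: algebra_simps)

lemma intertwiner_sum:
  assumes "intertwiner A s V \<rho> s' V' \<rho>' T" "\<And>i. i \<in> I \<Longrightarrow> g i \<in> V"
  shows "T (sum g I) = (\<Sum>i\<in>I. T (g i))"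
  using assms(2)
  by (induction I rule: infinite_finite_induct)
    (auto simp: intertwiner_zero[OF assms(1) zero_in] intertwiner_add[OF assms(1)] sum_in)

lemma subspace_kernel:
  assumes "intertwiner A s V \<rho> s' V' \<rho>' T" "vector_space s'"
  shows "VS.subspace {v \<in> V. T v = 0}"
proof -
  interpret V': vector_space s' by fact
  show ?thesis
    by (rule VS.subspaceI)
      (auto simp: zero_in add_in scale_in intertwiner_zero[OF assms(1)] intertwiner_add[OF assms(1)]
        intertwiner_scale[OF assms(1)])
qed

lemma kernel_rep:
  assumes "intertwiner A s V \<rho> s' V' \<rho>' T" "monoid_rep A s' V' \<rho>'"
  shows "monoid_rep A s {v \<in> V. T v = 0} \<rho>"
proof -
  interpret V': monoid_rep A s' V' \<rho>' by fact
  show ?thesis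
    by (rule sub_rep)
      (auto simp: subspace_kernel[OF assms(1) V'.VS.vector_space_axioms] maps
        intertwiner_commutes[OF assms(1)] V'.map_zero)
qed

lemma image_rep:
  assumes "intertwiner A s V \<rho> s' V' \<rho>' T" "monoid_rep A s' V' \<rho>'"
  shows "monoid_rep A s' (T ` V) \<rho>'"
proof -
  interpret V': monoid_rep A s' V' \<rho>' by fact
  note T = intertwiner_in[OF assms(1)] intertwiner_add[OF assms(1)] intertwiner_scale[OF assms(1)]
    intertwiner_commutes[OF assms(1)] intertwiner_zero[OF assms(1) zero_in]
  show ?thesis
  proof (rule V'.sub_rep)
    show "V'.VS.subspace (T ` V)"
    proof (rule V'.VS.subspaceI)
      show "0 \<in> T ` V" using T(5) zero_in by force
    next
      fix x y c assume "x \<in> T ` V" "y \<in> T ` V"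
      then obtain v w where vw: "v \<in> V" "w \<in> V" "x = T v" "y = T w" by blast
      show "x + y \<in> T ` V" using vw T(2)[of v w] add_in by (intro image_eqI[of _ _ "v + w"]) auto
      show "s' c x \<in> T ` V" using vw T(3)[of v c] scale_in by (intro image_eqI[of _ _ "s c v"]) auto
    qed
    show "T ` V \<subseteq> V'" using T(1) by blast
    fix a x assume a: "a \<in> carrier A" "x \<in> T ` V"
    then obtain v where v: "v \<in> V" "x = T v" by blast
    then show "\<rho>' a x \<in> T ` V" using T(4) a maps by (intro image_eqI[of _ _ "\<rho> a v"]) auto
  qed
qed

text \<open>A nonzero subrepresentation of least dimension works: a proper nonzero one inside it
  would have smaller dimension.\<close>

lemma exists_irreducible_subrep:
  assumes "finite_dim s V" "V \<noteq> {0}"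
  obtains U where "U \<subseteq> V" "irreducible_rep A s U \<rho>"
proof -
  define P where "P = (\<lambda>U. U \<subseteq> V \<and> monoid_rep A s U \<rho> \<and> U \<noteq> {0})"
  have "P V" using assms monoid_rep_axioms by (simp add: P_def)
  then obtain U where U: "P U" and least: "\<And>U'. P U' \<Longrightarrow> VS.dim U \<le> VS.dim U'"
    using ex_has_least_nat[of P V VS.dim] by blast
  interpret U: monoid_rep A s U \<rho> using U by (simp add: P_def)
  have "U' = {0} \<or> U' = U" if "U' \<subseteq> U" "monoid_rep A s U' \<rho>" for U'
  proof (rule ccontr)
    assume a: "\<not> (U' = {0} \<or> U' = U)"
    interpret U': monoid_rep A s U' \<rho> by fact
    have "VS.dim U' < VS.dim U"
      using a that U'.subspace U finite_dim_subset[OF assms(1)]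
      by (intro finite_dim_subspace_less[OF VS.vector_space_axioms]) (auto simp: P_def)
    moreover have "P U'" using that a U by (auto simp: P_def)
    ultimately show False using least by force
  qed
  with U that show ?thesis by (auto simp: P_def irreducible_rep_def)
qed

end

section \<open>Schur's lemma\<close>

lemma irreducible_rep_rep: "irreducible_rep A s V \<rho> \<Longrightarrow> monoid_rep A s V \<rho>"
  by (simp add: irreducible_rep_def)

lemma irreducible_subrep_cases:
  "irreducible_rep A s V \<rho> \<Longrightarrow> monoid_rep A s U \<rho> \<Longrightarrow> U \<subseteq> V \<Longrightarrow> U = {0} \<or> U = V"
  by (simp add: irreducible_rep_def)

lemma irreducible_subrep_eq:
  "irreducible_rep A s V \<rho> \<Longrightarrow> monoid_rep A s U \<rho> \<Longrightarrow> U \<subseteq> V \<Longrightarrow> u \<in> U \<Longrightarrow> u \<noteq> 0 \<Longrightarrow> U = V"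
  by (auto simp: irreducible_rep_def)

lemma intertwiner_onto_irreducible:
  assumes "monoid_rep A s V \<rho>" "irreducible_rep A s' V' \<rho>'" "intertwiner A s V \<rho> s' V' \<rho>' T"
    and "v \<in> V" "T v \<noteq> 0"
  shows "T ` V = V'"
proof -
  interpret monoid_rep A s V \<rho> by fact
  show ?thesis
    using irreducible_subrep_eq[OF assms(2) image_rep[OF assms(3) irreducible_rep_rep[OF assms(2)]]]
      assms intertwiner_in[OF assms(3)] by blast
qed

lemma intertwiner_from_irreducible:
  assumes "irreducible_rep A s V \<rho>" "monoid_rep A s' V' \<rho>'" "intertwiner A s V \<rho> s' V' \<rho>' T"
    and "v \<in> V" "T v \<noteq> 0"
  shows "inj_on T V"
proof -
  interpret monoid_rep A s V \<rho> by (rule irreducible_rep_rep) fact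
  have "{v \<in> V. T v = 0} \<noteq> V" using assms(4,5) by blast
  then have ker: "{v \<in> V. T v = 0} = {0}"
    using irreducible_subrep_cases[OF assms(1) kernel_rep[OF assms(3,2)]] by blast
  show ?thesis
  proof (rule inj_onI)
    fix x y assume "x \<in> V" "y \<in> V" "T x = T y"
    then have "x - y \<in> {v \<in> V. T v = 0}" by (simp add: diff_in intertwiner_diff[OF assms(3)])
    then show "x = y" using ker by simp
  qed
qed

lemma Schur_bij:
  assumes "irreducible_rep A s V \<rho>" "irreducible_rep A s' V' \<rho>'" "intertwiner A s V \<rho> s' V' \<rho>' T"
    and "v \<in> V" "T v \<noteq> 0"
  shows "bij_betw T V V'"
  using intertwiner_from_irreducible[OF assms(1) irreducible_rep_rep[OF assms(2)] assms(3-5)]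
    intertwiner_onto_irreducible[OF irreducible_rep_rep[OF assms(1)] assms(2-5)]
  by (simp add: bij_betw_def)

lemma rep_isomorphicI:
  assumes "irreducible_rep A s V \<rho>" "irreducible_rep A s' V' \<rho>'" "intertwiner A s V \<rho> s' V' \<rho>' T"
    and "v \<in> V" "T v \<noteq> 0"
  shows "rep_isomorphic A s V \<rho> s' V' \<rho>'"
proof -
  have "bij_betw (zero_ext V T) V V'"
    using Schur_bij[OF assms] by (simp add: zero_ext_def cong: bij_betw_cong)
  then show ?thesis
    using monoid_rep.zero_ext_rep_hom[OF irreducible_rep_rep[OF assms(1)] assms(3)]
    by (auto simp: rep_isomorphic_def)
qed

text \<open>An eigenvector of \<open>T\<close> is taken from the matrix of \<open>T\<close> in the standard basis.\<close>

lemma Schur_scalar: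
  assumes irr: "irrep A n \<pi>"
    and T: "intertwiner A coord_scale (coord_space {..<n}) \<pi> coord_scale (coord_space {..<n}) \<pi> T"
  obtains c where "\<And>v. v \<in> coord_space {..<n} \<Longrightarrow> T v = coord_scale c v"
proof -
  interpret monoid_rep A coord_scale "coord_space {..<n}" \<pi> by (rule irreducible_rep_rep) fact
  let ?V = "coord_space {..<n}"
  have n: "0 < n" using irr coord_space_nontrivial by (auto simp: irreducible_rep_def)
  define M where "M = mat n n (\<lambda>(i, j). T (unit_vec j) i)"
  have M: "M \<in> carrier_mat n n" by (simp add: M_def)
  obtain c where "eigenvalue M c" using spectrum_non_empty[OF M n] by (auto simp: spectrum_def)
  then obtain w where w: "w \<in> carrier_vec n" "w \<noteq> 0\<^sub>v n" "M *\<^sub>v w = c \<cdot>\<^sub>v w"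
    using M by (auto simp: eigenvalue_def eigenvector_def)
  define v where "v = (\<lambda>i. if i < n then w $ i else 0)"
  have v: "v \<in> ?V" by (simp add: v_def coord_space_def)
  obtain i where "i < n" "w $ i \<noteq> 0" using w(1,2) by (auto simp: vec_eq_iff)
  then have v0: "v \<noteq> 0" by (auto simp: v_def fun_eq_iff)
  have Tv: "T v = coord_scale c v"
  proof
    fix i
    show "T v i = coord_scale c v i"
    proof (cases "i < n")
      case True
      have "T v = T (\<Sum>k<n. coord_scale (v k) (unit_vec k))" using coord_space_expand[OF _ v] by simp
      also have "\<dots> = (\<Sum>k<n. coord_scale (v k) (T (unit_vec k)))"
        by (subst intertwiner_sum[OF T])
          (auto simp: intertwiner_scale[OF T] scale_in)
      finally have "T v i = (\<Sum>k<n. T (unit_vec k) i * w $ k)"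
        by (simp add: sum_apply fun_scale_def v_def mult.commute)
      also have "\<dots> = (M *\<^sub>v w) $ i"
        using True w(1) by (simp add: M_def scalar_prod_def atLeast0LessThan)
      finally show ?thesis using True w by (simp add: v_def fun_scale_def)
    next
      case False
      then show ?thesis using intertwiner_in[OF T v] by (simp add: coord_space_def fun_scale_def v_def)
    qed
  qed
  \<comment> \<open>The eigenvector \<open>v\<close> lies in the kernel of \<open>T - c\<close>.
    This kernel is a nonzero subrepresentation, hence everything.\<close>
  let ?S = "\<lambda>v. T v - coord_scale c v"
  have S: "intertwiner A coord_scale ?V \<pi> coord_scale ?V \<pi> ?S"
    by (rule intertwinerI)
      (auto simp: diff_in scale_in intertwiner_in[OF T] intertwiner_add[OF T]
        intertwiner_scale[OF T] intertwiner_commutes[OF T] map_diff map_scale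
        coord.scale_right_distrib coord.scale_right_diff_distrib mult.commute)
  have "{v \<in> ?V. ?S v = 0} = ?V"
    using irreducible_subrep_eq[OF irr kernel_rep[OF S monoid_rep_axioms] _ _ v0] v Tv by auto
  then show ?thesis using that by auto
qed

section \<open>Finite groups\<close>

lemma (in group) sum_translate_left:
  "x \<in> carrier G \<Longrightarrow> (\<Sum>g\<in>carrier G. f (x \<otimes> g)) = (\<Sum>g\<in>carrier G. f g)"
  by (rule sum.reindex_bij_witness[of _ "\<lambda>g. inv x \<otimes> g" "\<lambda>g. x \<otimes> g"])
    (auto simp: m_assoc[symmetric])

lemma (in group) sum_translate_right:
  "x \<in> carrier G \<Longrightarrow> (\<Sum>g\<in>carrier G. f (g \<otimes> x)) = (\<Sum>g\<in>carrier G. f g)"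
  by (rule sum.reindex_bij_witness[of _ "\<lambda>g. g \<otimes> inv x" "\<lambda>g. g \<otimes> x"])
    (auto simp: m_assoc)

lemma (in group) monoid_rep_inv:
  assumes "monoid_rep G s V \<rho>" "g \<in> carrier G" "v \<in> V"
  shows "\<rho> (inv g) (\<rho> g v) = v" "\<rho> g (\<rho> (inv g) v) = v"
proof -
  interpret monoid_rep G s V \<rho> by fact
  show "\<rho> (inv g) (\<rho> g v) = v" "\<rho> g (\<rho> (inv g) v) = v"
    using assms by (simp_all add: map_mult[symmetric] map_one)
qed

text \<open>Averaging a linear projection \<open>q\<close> onto \<open>U\<close> over the group
  makes it equivariant. The average still maps into \<open>U\<close> and fixes it pointwise, because
  \<open>U\<close> is invariant. The projection rather than a complement of \<open>U\<close> is
  recorded, since later arguments compose with it.\<close>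

lemma Maschke:
  assumes "group G" "finite (carrier G)" "monoid_rep G s V \<rho>" "monoid_rep G s U \<rho>" "U \<subseteq> V"
  obtains p where "intertwiner G s V \<rho> s V \<rho> p" "\<And>v. v \<in> V \<Longrightarrow> p v \<in> U" "\<And>u. u \<in> U \<Longrightarrow> p u = u"
proof -
  interpret group G by fact
  interpret V: monoid_rep G s V \<rho> by fact
  interpret U: monoid_rep G s U \<rho> by fact
  interpret P: vector_space_pair s s ..
  \<comment> \<open>A linear left inverse on \<open>U\<close> of the identity map, with range in
    \<open>U\<close>, is a linear projection onto \<open>U\<close>.\<close>
  have "Vector_Spaces.linear s s (\<lambda>v. v)"
    unfolding Vector_Spaces.linear_iff using V.VS.vector_space_axioms by simp
  then obtain q where q: "range q \<subseteq> U" "Vector_Spaces.linear s s q" "\<And>v. v \<in> U \<Longrightarrow> q v = v"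
    using P.linear_exists_left_inverse_on[of "\<lambda>v. v" U] U.subspace by auto
  have qa: "q (x + y) = q x + q y" and qs: "q (s c x) = s c (q x)" and qU: "q x \<in> U" for x y c
    using q(1,2) by (auto simp: Vector_Spaces.linear_iff)
  let ?N = "of_nat (card (carrier G)) :: complex"
  have N: "?N \<noteq> 0" using assms(2) by (auto simp: card_eq_0_iff)
  define p where "p v = s (1 / ?N) (\<Sum>g\<in>carrier G. \<rho> g (q (\<rho> (inv\<^bsub>G\<^esub> g) v)))" for v
  show ?thesis
  proof
    show pU: "p v \<in> U" if "v \<in> V" for v
      using that by (auto simp: p_def intro!: U.scale_in U.sum_in U.maps qU)
    show "p u = u" if "u \<in> U" for u
    proof -
      have "\<rho> g (q (\<rho> (inv\<^bsub>G\<^esub> g) u)) = u" if "g \<in> carrier G" for g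
        using that \<open>u \<in> U\<close> by (simp add: q(3) U.maps monoid_rep_inv[OF assms(4)])
      then show ?thesis using N by (simp add: p_def V.VS.sum_constant_scale)
    qed
    show "intertwiner G s V \<rho> s V \<rho> p"
    proof (rule intertwinerI)
      fix v assume v: "v \<in> V"
      show "p v \<in> V" using pU[OF v] assms(5) by blast
      show "p (s c v) = s c (p v)" for c
        using v by (simp add: p_def V.map_scale qs U.map_scale qU V.VS.scale_sum_right mult.commute)
      show "p (v + w) = p v + p w" if "w \<in> V" for w
        using v that by (simp add: p_def V.map_add qa U.map_add qU sum.distrib V.VS.scale_right_distrib)
      fix h assume h: "h \<in> carrier G"
      have "(\<Sum>g\<in>carrier G. \<rho> g (q (\<rho> (inv\<^bsub>G\<^esub> g) (\<rho> h v)))) =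
          (\<Sum>g\<in>carrier G. \<rho> (h \<otimes>\<^bsub>G\<^esub> g) (q (\<rho> (inv\<^bsub>G\<^esub> (h \<otimes>\<^bsub>G\<^esub> g)) (\<rho> h v))))"
        by (rule sum_translate_left[OF h, symmetric])
      also have "\<dots> = (\<Sum>g\<in>carrier G. \<rho> h (\<rho> g (q (\<rho> (inv\<^bsub>G\<^esub> g) v))))"
        using h v by (intro sum.cong refl)
          (simp add: U.map_mult qU inv_mult_group V.map_mult V.maps monoid_rep_inv[OF assms(3)])
      finally show "p (\<rho> h v) = \<rho> h (p v)"
        using h by (simp add: p_def U.map_scale U.map_sum U.sum_in U.maps qU)
    qed
  qed
qed

lemma coord_scale_apply: "coord_scale c v i = c * v i"
  by (simp add: fun_scale_def)

text \<open>A subrepresentation \<open>U\<close> of \<open>V'\<close> pulls back to the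
  subrepresentation \<open>?K\<close> of \<open>V\<close>, which is \<open>{0}\<close> or
  \<open>V\<close>; surjectivity of \<open>T\<close> recovers \<open>U\<close> from it.\<close>

lemma irreducible_transport:
  assumes "irreducible_rep A s V \<rho>" "monoid_rep A s' V' \<rho>'" "intertwiner A s V \<rho> s' V' \<rho>' T"
    and "bij_betw T V V'"
  shows "irreducible_rep A s' V' \<rho>'"
proof -
  interpret monoid_rep A s V \<rho> by (rule irreducible_rep_rep) fact
  interpret V': monoid_rep A s' V' \<rho>' by fact
  note T = intertwiner_in[OF assms(3)] intertwiner_add[OF assms(3)] intertwiner_scale[OF assms(3)]
    intertwiner_commutes[OF assms(3)] intertwiner_zero[OF assms(3) zero_in]
  have onto: "T ` V = V'" and inj: "inj_on T V" using assms(4) by (auto simp: bij_betw_def)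
  have "U = {0} \<or> U = V'" if U: "U \<subseteq> V'" "monoid_rep A s' U \<rho>'" for U
  proof -
    interpret U: monoid_rep A s' U \<rho>' by fact
    let ?K = "{v \<in> V. T v \<in> U}"
    have "monoid_rep A s ?K \<rho>"
    proof (rule sub_rep)
      show "VS.subspace ?K"
        by (rule VS.subspaceI) (auto simp: zero_in add_in scale_in T U.zero_in U.add_in U.scale_in)
    qed (auto simp: maps T U.maps)
    then have "?K = {0} \<or> ?K = V" by (rule irreducible_subrep_cases[OF assms(1)]) auto
    moreover have "T ` ?K = U" using U(1) onto by auto
    ultimately show ?thesis using T(5) onto by auto
  qed
  moreover have "V' \<noteq> {0}"
  proof
    assume "V' = {0}"
    have "v = 0" if "v \<in> V" for v
    proof (rule inj_onD[OF inj])
      show "T v = T 0" using T(1)[OF that] T(5) \<open>V' = {0}\<close> by simp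
    qed (use that zero_in in auto)
    then show False using assms(1) zero_in by (auto simp: irreducible_rep_def)
  qed
  ultimately show ?thesis using assms(2) by (simp add: irreducible_rep_def)
qed

text \<open>Theta representations are tested only against irreducibles on the spaces
  \<open>coord_space {..<n}\<close>. A choice of basis moves any finite-dimensional irreducible
  there, with \<open>c\<close> the coordinate map and \<open>d\<close> its inverse.\<close>

lemma irreducible_coordinates:
  assumes "irreducible_rep A s V \<rho>" "finite_dim s V"
  obtains n \<pi> c where "irrep A n \<pi>"
    "intertwiner A s V \<rho> coord_scale (coord_space {..<n}) \<pi> c" "bij_betw c V (coord_space {..<n})"
proof -
  interpret monoid_rep A s V \<rho> by (rule irreducible_rep_rep) fact
  obtain B where B: "B \<subseteq> V" "VS.independent B" "V \<subseteq> VS.span B" "finite B" "card B = VS.dim V"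
    by (rule finite_dim_basis[OF VS.vector_space_axioms assms(2)])
  define n where "n = card B"
  obtain b where "bij_betw b {0..<n} B" using ex_bij_betw_nat_finite[OF B(4)] n_def by blast
  then have b: "bij_betw b {..<n} B" by (simp add: atLeast0LessThan)
  then have bB: "i < n \<Longrightarrow> b i \<in> B" for i by (auto simp: bij_betw_def)
  let ?r = "VS.representation B" and ?C = "coord_space {..<n}"
  define c where "c u = (\<lambda>i. if i < n then ?r u (b i) else 0)" for u
  define d where "d t = (\<Sum>i<n. s (t i) (b i))" for t :: "nat \<Rightarrow> complex"
  have cC: "c u \<in> ?C" for u by (simp add: c_def coord_space_def)
  have dV: "d t \<in> V" for t
    unfolding d_def using bB B(1) by (intro sum_in scale_in) auto
  have dc: "d (c u) = u" if "u \<in> V" for u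
  proof -
    have "d (c u) = (\<Sum>i<n. s (?r u (b i)) (b i))" by (simp add: d_def c_def)
    also have "\<dots> = (\<Sum>x\<in>B. s (?r u x) x)" by (rule sum.reindex_bij_betw[OF b])
    also have "\<dots> = u" using B that by (intro VS.sum_representation_eq) auto
    finally show ?thesis .
  qed
  have cadd: "c (u + v) = c u + c v" if "u \<in> V" "v \<in> V" for u v
    using B(2,3) that by (auto simp: c_def fun_eq_iff VS.representation_add subset_iff)
  have cscale: "c (s x u) = coord_scale x (c u)" if "u \<in> V" for u x
    using B(2,3) that by (auto simp: c_def fun_eq_iff VS.representation_scale subset_iff fun_scale_def)
  have cd: "c (d t) = t" if "t \<in> ?C" for t
  proof
    fix i
    have "?r (d t) (b i) = t i" if i: "i < n"
    proof -
      have "?r (d t) (b i) = (\<Sum>j<n. t j * ?r (b j) (b i))"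
        unfolding d_def using B bB
        by (subst VS.representation_sum) (auto simp: VS.representation_scale VS.span_base VS.span_scale)
      also have "\<dots> = (\<Sum>j<n. if j = i then t j else 0)"
        using B(2) bB i b
        by (intro sum.cong refl) (auto simp: VS.representation_basis bij_betw_def inj_on_def)
      finally show ?thesis using i by simp
    qed
    then show "c (d t) i = t i" using that by (auto simp: c_def coord_space_def)
  qed
  have dadd: "d (x + y) = d x + d y" for x y
    by (simp add: d_def VS.scale_left_distrib sum.distrib)
  have dscale: "d (coord_scale z x) = s z (d x)" for z x
    by (simp add: d_def fun_scale_def VS.scale_sum_right)
  define \<pi> where "\<pi> a t = c (\<rho> a (d t))" for a t
  have rep: "monoid_rep A coord_scale ?C \<pi>"
    by (unfold_locales)
      (auto simp: subspace_coord_space \<pi>_def cC dadd dscale map_add map_scale cadd cscale dV maps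
        map_one map_mult cd dc)
  have c: "intertwiner A s V \<rho> coord_scale ?C \<pi> c"
    by (rule intertwinerI) (auto simp: cC cadd cscale \<pi>_def dc)
  have bij: "bij_betw c V ?C"
    by (rule bij_betw_byWitness[of _ d]) (auto simp: dc cd cC dV)
  show ?thesis by (rule that[OF irreducible_transport[OF assms(1) rep c bij] c bij])
qed

text \<open>Irreducible quotients of \<open>V\<close> detect every nonzero subrepresentation
  \<open>K\<close>: an irreducible \<open>U\<close> inside \<open>K\<close> is a quotient of all of
  \<open>V\<close> by the projection from \<open>Maschke\<close>, which does not kill
  \<open>U\<close>.\<close>

lemma exists_irrep_quotient:
  assumes "group G" "finite (carrier G)" "monoid_rep G s V \<rho>" "finite_dim s V"
    and "monoid_rep G s K \<rho>" "K \<subseteq> V" "K \<noteq> {0}"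
  obtains n \<pi> T v where "irrep G n \<pi>" "intertwiner G s V \<rho> coord_scale (coord_space {..<n}) \<pi> T"
    "v \<in> K" "T v \<noteq> 0"
proof -
  interpret K: monoid_rep G s K \<rho> by fact
  obtain U where U: "U \<subseteq> K" "irreducible_rep G s U \<rho>"
    using K.exists_irreducible_subrep[OF finite_dim_subset[OF assms(4,6)] assms(7)] by blast
  interpret U: monoid_rep G s U \<rho> by (rule irreducible_rep_rep) fact
  have "U \<subseteq> V" using U assms by blast
  then obtain p where p: "intertwiner G s V \<rho> s V \<rho> p" "\<And>v. v \<in> V \<Longrightarrow> p v \<in> U" "\<And>u. u \<in> U \<Longrightarrow> p u = u"
    using Maschke[OF assms(1-3) U.monoid_rep_axioms] by blast
  have "finite_dim s U" using finite_dim_subset[OF assms(4)] \<open>U \<subseteq> V\<close> .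
  then obtain n \<pi> c where c: "irrep G n \<pi>"
    "intertwiner G s U \<rho> coord_scale (coord_space {..<n}) \<pi> c" "bij_betw c U (coord_space {..<n})"
    using irreducible_coordinates[OF U(2)] by blast
  obtain u where u: "u \<in> U" "u \<noteq> 0" using U(2) U.zero_in by (auto simp: irreducible_rep_def)
  have "c u \<noteq> c 0" using c(3) u U.zero_in by (metis bij_betw_inv_into_left)
  then have "c (p u) \<noteq> 0" using intertwiner_zero[OF c(2) U.zero_in] p(3) u by simp
  moreover have "intertwiner G s V \<rho> coord_scale (coord_space {..<n}) \<pi> (\<lambda>v. c (p v))"
    by (rule intertwinerI)
      (auto simp: p(2) intertwiner_in[OF c(2)] intertwiner_add[OF c(2)] intertwiner_scale[OF c(2)]
        intertwiner_commutes[OF c(2)] intertwiner_add[OF p(1)] intertwiner_scale[OF p(1)]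
        intertwiner_commutes[OF p(1)])
  ultimately show ?thesis using that c(1) u(1) U(1) by blast
qed

text \<open>For a matrix unit \<open>E\<close> the sum \<open>\<Sum>\<^sub>a \<pi> a E \<pi> (inv a)\<close> is an intertwiner, hence a scalar, which is
  determined by its trace.\<close>

lemma (in group) Schur_orthogonality:
  assumes fin: "finite (carrier G)" and irr: "irrep G n \<pi>" and jk: "j < n" "k < n"
    and t: "t \<in> coord_space {..<n}"
  shows "(\<Sum>a\<in>carrier G. \<pi> (inv a) (unit_vec j) k * \<pi> a t p) =
    of_nat (card (carrier G)) / of_nat n * t k * unit_vec j p"
proof -
  let ?V = "coord_space {..<n}" and ?N = "of_nat (card (carrier G)) :: complex"
  interpret monoid_rep G coord_scale ?V \<pi> by (rule irreducible_rep_rep) fact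
  have expand: "\<pi> a v i = (\<Sum>k<n. v k * \<pi> a (unit_vec k) i)" if "a \<in> carrier G" "v \<in> ?V" for a v i
    using coord_rep_expand[OF monoid_rep_axioms that] .
  \<comment> \<open>\<open>Z q\<close> is the sum for the matrix unit that sends
    \<open>unit_vec k\<close> to \<open>unit_vec q\<close> and the other unit vectors to 0.\<close>
  define Z where "Z q v = (\<Sum>a\<in>carrier G. coord_scale (\<pi> (inv a) v k) (\<pi> a (unit_vec q)))" for q v
  have Z_int: "intertwiner G coord_scale ?V \<pi> coord_scale ?V \<pi> (Z q)" if q: "q < n" for q
  proof (rule intertwinerI)
    fix g v assume g: "g \<in> carrier G" and v: "v \<in> ?V"
    have "Z q (\<pi> g v) =
        (\<Sum>a\<in>carrier G. coord_scale (\<pi> (inv (g \<otimes> a)) (\<pi> g v) k) (\<pi> (g \<otimes> a) (unit_vec q)))"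
      unfolding Z_def by (rule sum_translate_left[OF g, symmetric])
    also have "\<dots> = (\<Sum>a\<in>carrier G. \<pi> g (coord_scale (\<pi> (inv a) v k) (\<pi> a (unit_vec q))))"
      using g v q by (intro sum.cong refl)
        (simp add: inv_mult_group map_mult maps map_scale monoid_rep_inv[OF monoid_rep_axioms])
    finally show "Z q (\<pi> g v) = \<pi> g (Z q v)"
      using g q by (simp add: Z_def map_sum scale_in maps)
  next
    fix v assume v: "v \<in> ?V"
    show "Z q v \<in> ?V" unfolding Z_def using q by (intro sum_in scale_in maps) auto
    show "Z q (v + w) = Z q v + Z q w" if "w \<in> ?V" for w
      using v that by (simp add: Z_def map_add coord.scale_left_distrib sum.distrib)
    show "Z q (coord_scale c v) = coord_scale c (Z q v)" for c
      using v by (simp add: Z_def map_scale coord.scale_sum_right coord_scale_apply)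
  qed
  have Z: "Z q v = coord_scale (if q = k then ?N / of_nat n else 0) v" if q: "q < n" and v: "v \<in> ?V" for q v
  proof -
    obtain c where c: "\<And>v. v \<in> ?V \<Longrightarrow> Z q v = coord_scale c v"
      using Schur_scalar[OF irr Z_int[OF q]] by blast
    \<comment> \<open>If \<open>Z q\<close> is the scalar \<open>c\<close>, its trace is
      \<open>n c\<close>. Each summand is conjugate to the matrix unit, whose trace is 1 for
      \<open>q = k\<close> and 0 otherwise.\<close>
    have "Z q (unit_vec r) r = c" if "r < n" for r
      using c[of "unit_vec r"] that by (simp add: coord_scale_apply) (simp add: unit_vec_def)
    then have "of_nat n * c = (\<Sum>r<n. Z q (unit_vec r) r)" by simp
    also have "\<dots> = (\<Sum>a\<in>carrier G. \<Sum>r<n. \<pi> a (unit_vec q) r * \<pi> (inv a) (unit_vec r) k)"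
      unfolding Z_def sum_apply by (subst sum.swap) (simp add: fun_scale_def mult.commute)
    also have "\<dots> = (\<Sum>a\<in>carrier G. \<pi> (inv a) (\<pi> a (unit_vec q)) k)"
      using q by (intro sum.cong refl expand[symmetric]) (auto simp: maps)
    also have "\<dots> = (\<Sum>a\<in>carrier G. unit_vec q k)"
      using q by (intro sum.cong refl) (simp add: monoid_rep_inv[OF monoid_rep_axioms])
    finally have "of_nat n * c = (if q = k then ?N else 0)" by (simp add: unit_vec_def)
    then show ?thesis using c[OF v] q by (auto simp: field_simps)
  qed
  have "(\<Sum>a\<in>carrier G. \<pi> (inv a) (unit_vec j) k * \<pi> a t p) =
      (\<Sum>a\<in>carrier G. \<Sum>q<n. t q * (\<pi> (inv a) (unit_vec j) k * \<pi> a (unit_vec q) p))"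
    by (intro sum.cong refl) (simp add: expand[OF _ t] sum_distrib_left ac_simps)
  also have "\<dots> = (\<Sum>q<n. t q * Z q (unit_vec j) p)"
    by (subst sum.swap) (simp add: Z_def sum_apply fun_scale_def sum_distrib_left)
  also have "\<dots> = (\<Sum>q<n. if q = k then t k * (?N / of_nat n) * unit_vec j p else 0)"
    using jk by (intro sum.cong refl) (auto simp: Z fun_scale_def)
  finally show ?thesis using jk by simp
qed

section \<open>Tensor products\<close>

lemma tensor_rep_apply:
  "tensor_rep n \<pi>1 m \<pi>2 (a1, a2) t (i, j) =
    (\<Sum>k<n. \<Sum>l<m. t (k, l) * (\<pi>1 a1 (unit_vec k) i * \<pi>2 a2 (unit_vec l) j))"
  by (simp add: tensor_rep_def sum_apply fun_scale_def tensor_vec_def case_prod_unfold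
      sum.cartesian_product)

lemma slice_fst_in: "t \<in> coord_space (I \<times> J) \<Longrightarrow> (\<lambda>i. t (i, j)) \<in> coord_space I"
  and slice_snd_in: "t \<in> coord_space (I \<times> J) \<Longrightarrow> (\<lambda>j. t (i, j)) \<in> coord_space J"
  by (auto simp: coord_space_def)

lemma tensor_rep_fst:
  assumes "monoid_rep A1 coord_scale (coord_space {..<n}) \<pi>1"
    and "monoid_rep A2 coord_scale (coord_space {..<m}) \<pi>2"
    and "a \<in> carrier A1" "t \<in> coord_space ({..<n} \<times> {..<m})"
  shows "tensor_rep n \<pi>1 m \<pi>2 (a, \<one>\<^bsub>A2\<^esub>) t (i, j) = \<pi>1 a (\<lambda>k. t (k, j)) i"
proof -
  interpret R2: monoid_rep A2 coord_scale "coord_space {..<m}" \<pi>2 by fact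
  have "tensor_rep n \<pi>1 m \<pi>2 (a, \<one>\<^bsub>A2\<^esub>) t (i, j) =
      (\<Sum>k<n. \<Sum>l<m. if l = j then t (k, l) * \<pi>1 a (unit_vec k) i else 0)"
    unfolding tensor_rep_apply by (intro sum.cong refl) (auto simp: R2.map_one, auto simp: unit_vec_def)
  also have "\<dots> = (\<Sum>k<n. t (k, j) * \<pi>1 a (unit_vec k) i)"
    using assms(4) by (intro sum.cong refl) (auto simp: coord_space_def)
  also have "\<dots> = \<pi>1 a (\<lambda>k. t (k, j)) i"
    using coord_rep_expand[OF assms(1,3) slice_fst_in[OF assms(4)]] by simp
  finally show ?thesis .
qed

lemma tensor_rep_snd:
  assumes "monoid_rep A1 coord_scale (coord_space {..<n}) \<pi>1"
    and "monoid_rep A2 coord_scale (coord_space {..<m}) \<pi>2"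
    and "b \<in> carrier A2" "t \<in> coord_space ({..<n} \<times> {..<m})"
  shows "tensor_rep n \<pi>1 m \<pi>2 (\<one>\<^bsub>A1\<^esub>, b) t (i, j) = \<pi>2 b (\<lambda>l. t (i, l)) j"
proof -
  interpret R1: monoid_rep A1 coord_scale "coord_space {..<n}" \<pi>1 by fact
  have "tensor_rep n \<pi>1 m \<pi>2 (\<one>\<^bsub>A1\<^esub>, b) t (i, j) =
      (\<Sum>k<n. if k = i then \<Sum>l<m. t (i, l) * \<pi>2 b (unit_vec l) j else 0)"
    unfolding tensor_rep_apply
    by (intro sum.cong refl) (auto simp: R1.map_one, auto simp: unit_vec_def)
  also have "\<dots> = (\<Sum>l<m. t (i, l) * \<pi>2 b (unit_vec l) j)"
    using assms(4) by (auto simp: coord_space_def)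
  also have "\<dots> = \<pi>2 b (\<lambda>l. t (i, l)) j"
    using coord_rep_expand[OF assms(2,3) slice_snd_in[OF assms(4)]] by simp
  finally show ?thesis .
qed

text \<open>Let \<open>t\<close> be a nonzero vector of a subrepresentation, with
  \<open>t (k, l) \<noteq> 0\<close>. Schur orthogonality in the first factor turns \<open>t\<close>
  into a multiple of \<open>unit_vec i\<close> \<otimes> (row \<open>k\<close> of \<open>t\<close>).
  In the second factor it turns this into a nonzero multiple of \<open>unit_vec (i, j)\<close>. As
  \<open>i\<close> and \<open>j\<close> are arbitrary, the subrepresentation is everything.\<close>

lemma irreducible_tensor:
  assumes "group A1" "group A2" "finite (carrier A1)" "finite (carrier A2)"
    and irr: "irrep A1 n \<pi>1" "irrep A2 m \<pi>2"
  shows "irreducible_rep (A1 \<times>\<times> A2) coord_scale (coord_space ({..<n} \<times> {..<m})) (tensor_rep n \<pi>1 m \<pi>2)"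
proof -
  interpret A1: group A1 by fact
  interpret A2: group A2 by fact
  note reps = irr[THEN irreducible_rep_rep]
  let ?I = "{..<n} \<times> {..<m}" and ?\<tau> = "tensor_rep n \<pi>1 m \<pi>2"
  let ?V = "coord_space ?I"
  interpret monoid_rep "A1 \<times>\<times> A2" coord_scale ?V ?\<tau> by (rule monoid_rep_tensor) (rule reps)+
  have nm: "0 < n" "0 < m" using irr coord_space_nontrivial by (auto simp: irreducible_rep_def)
  have "unit_vec (0, 0) \<in> ?V" using nm by simp
  moreover have "unit_vec (0::nat, 0::nat) \<noteq> 0" by (auto simp: unit_vec_def fun_eq_iff)
  ultimately have "?V \<noteq> {0}" by blast
  moreover have "U = {0} \<or> U = ?V" if U: "U \<subseteq> ?V" "monoid_rep (A1 \<times>\<times> A2) coord_scale U ?\<tau>" for U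
  proof (cases "U = {0}")
    case False
    interpret U: monoid_rep "A1 \<times>\<times> A2" coord_scale U ?\<tau> by fact
    obtain t where t: "t \<in> U" "t \<noteq> 0" using False U.zero_in by blast
    then obtain k l where kl: "t (k, l) \<noteq> 0" by (auto simp: fun_eq_iff)
    have tV: "t \<in> ?V" using t U by blast
    then have kl': "k < n" "l < m" using kl by (auto simp: coord_space_def)
    let ?N1 = "of_nat (card (carrier A1)) :: complex" and ?N2 = "of_nat (card (carrier A2)) :: complex"
    have N: "?N1 \<noteq> 0" "?N2 \<noteq> 0" using assms(3,4) by (auto simp: card_eq_0_iff)
    have unit: "unit_vec (i, j) \<in> U" if ij: "i < n" "j < m" for i j
    proof -
      define t1 where "t1 = (\<Sum>a\<in>carrier A1. coord_scale (\<pi>1 (inv\<^bsub>A1\<^esub> a) (unit_vec i) k) (?\<tau> (a, \<one>\<^bsub>A2\<^esub>) t))"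
      have t1U: "t1 \<in> U" unfolding t1_def using t by (intro U.sum_in U.scale_in U.maps) auto
      have t1: "t1 (p, q) = ?N1 / of_nat n * t (k, q) * unit_vec i p" for p q
        unfolding t1_def sum_apply
        using A1.Schur_orthogonality[OF assms(3) irr(1) ij(1) kl'(1) slice_fst_in[OF tV], of q p]
        by (simp add: fun_scale_def tensor_rep_fst[OF reps _ tV])
      define t2 where "t2 = (\<Sum>b\<in>carrier A2. coord_scale (\<pi>2 (inv\<^bsub>A2\<^esub> b) (unit_vec j) l) (?\<tau> (\<one>\<^bsub>A1\<^esub>, b) t1))"
      have t2U: "t2 \<in> U" unfolding t2_def using t1U by (intro U.sum_in U.scale_in U.maps) auto
      have t1V: "t1 \<in> ?V" using t1U U by blast
      have t2: "t2 (p, q) = ?N2 / of_nat m * t1 (p, l) * unit_vec j q" for p q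
        unfolding t2_def sum_apply
        using A2.Schur_orthogonality[OF assms(4) irr(2) ij(2) kl'(2) slice_snd_in[OF t1V], of p q]
        by (simp add: fun_scale_def tensor_rep_snd[OF reps _ t1V])
      let ?c = "?N1 / of_nat n * (?N2 / of_nat m) * t (k, l)"
      have "t2 = coord_scale ?c (unit_vec (i, j))"
        by (auto simp: fun_eq_iff t1 t2 fun_scale_def unit_vec_def ac_simps)
      then have "unit_vec (i, j) = coord_scale (1 / ?c) t2"
        using N kl nm by (simp add: coord.scale_scale)
      then show ?thesis using U.scale_in[OF t2U] by metis
    qed
    have "v \<in> U" if v: "v \<in> ?V" for v
    proof -
      have "v = (\<Sum>x\<in>?I. coord_scale (v x) (unit_vec x))" using coord_space_expand[OF _ v] by simp
      also have "\<dots> \<in> U" using unit by (intro U.sum_in U.scale_in) auto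
      finally show ?thesis .
    qed
    then show ?thesis using U by blast
  qed simp
  ultimately show ?thesis using monoid_rep_axioms by (simp add: irreducible_rep_def)
qed

section \<open>Theta representations of finite groups\<close>

text \<open>An intertwiner is determined by the coordinates of its values on a basis of
  \<open>V\<close>. The spanning maps \<open>?e\<close> are linear on \<open>V\<close> but in
  general not equivariant. Finiteness is what makes \<open>dim_le_1_iff_proportional\<close>
  applicable to Hom spaces.\<close>

lemma finite_dim_rep_hom:
  fixes s :: "complex \<Rightarrow> 'v::ab_group_add \<Rightarrow> 'v" and I :: "'i set"
  assumes "monoid_rep A s V \<rho>" "finite_dim s V" "finite I"
  shows "finite_dim (fun_scale coord_scale) (rep_hom A s V \<rho> coord_scale (coord_space I) \<rho>')"
proof -
  interpret monoid_rep A s V \<rho> by fact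
  interpret F: vector_space "fun_scale coord_scale :: complex \<Rightarrow> ('v \<Rightarrow> 'i \<Rightarrow> complex) \<Rightarrow> 'v \<Rightarrow> 'i \<Rightarrow> complex"
    by (rule vector_space_fun_scale) (rule vector_space_coord)
  obtain B where B: "B \<subseteq> V" "VS.independent B" "V \<subseteq> VS.span B" "finite B"
    by (rule finite_dim_basis[OF VS.vector_space_axioms assms(2)])
  let ?r = "VS.representation B"
  let ?e = "\<lambda>(b, i) v. if v \<in> V then coord_scale (?r v b) (unit_vec i) else 0"
  show ?thesis unfolding finite_dim_def
  proof (intro exI conjI subsetI)
    show "finite (?e ` (B \<times> I))" using assms(3) B by simp
    fix T assume "T \<in> rep_hom A s V \<rho> coord_scale (coord_space I) \<rho>'"
    then have T: "intertwiner A s V \<rho> coord_scale (coord_space I) \<rho>' T" "\<And>v. v \<notin> V \<Longrightarrow> T v = 0"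
      by (auto simp: rep_hom_iff)
    have "T = (\<Sum>b\<in>B. \<Sum>i\<in>I. fun_scale coord_scale (T b i) (?e (b, i)))"
    proof
      fix v
      show "T v = (\<Sum>b\<in>B. \<Sum>i\<in>I. fun_scale coord_scale (T b i) (?e (b, i))) v"
      proof (cases "v \<in> V")
        case True
        have "T v = T (\<Sum>b\<in>B. s (?r v b) b)"
          using B True by (simp add: VS.sum_representation_eq subset_iff)
        also have "\<dots> = (\<Sum>b\<in>B. coord_scale (?r v b) (T b))"
          using B(1) by (subst intertwiner_sum[OF T(1)])
            (auto simp: scale_in intertwiner_scale[OF T(1)] subset_iff intro!: sum.cong)
        also have "\<dots> = (\<Sum>b\<in>B. \<Sum>i\<in>I. coord_scale (T b i) (coord_scale (?r v b) (unit_vec i)))"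
        proof (intro sum.cong refl)
          fix b assume "b \<in> B"
          then have "T b = (\<Sum>i\<in>I. coord_scale (T b i) (unit_vec i))"
            using intertwiner_in[OF T(1)] B(1) by (intro coord_space_expand assms) auto
          then have "coord_scale (?r v b) (T b) = coord_scale (?r v b) (\<Sum>i\<in>I. coord_scale (T b i) (unit_vec i))"
            by simp
          also have "\<dots> = (\<Sum>i\<in>I. coord_scale (T b i) (coord_scale (?r v b) (unit_vec i)))"
            by (simp add: coord.scale_sum_right mult.commute)
          finally show "coord_scale (?r v b) (T b) = (\<Sum>i\<in>I. coord_scale (T b i) (coord_scale (?r v b) (unit_vec i)))" .
        qed
        finally show ?thesis using True by (simp add: sum_apply fun_scale_def[of coord_scale])
      qed (simp add: T(2) sum_apply fun_scale_def[of coord_scale])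
    qed
    also have "\<dots> \<in> F.span (?e ` (B \<times> I))"
      by (intro F.span_sum F.span_scale F.span_base) auto
    finally show "T \<in> F.span (?e ` (B \<times> I))" .
  qed
qed

text \<open>One half of the theta condition, seen from the first factor: uniqueness of \<pi>2 for
  given \<pi>1, and multiplicity one. It speaks of nonzero homomorphisms in place of nontrivial Hom
  spaces and dimensions. The other half is the same condition with the factors exchanged.\<close>

definition theta_fst ::
  "('a, 'm) monoid_scheme \<Rightarrow> ('b, 'k) monoid_scheme
     \<Rightarrow> (complex \<Rightarrow> 'v::ab_group_add \<Rightarrow> 'v) \<Rightarrow> 'v set \<Rightarrow> ('a \<times> 'b \<Rightarrow> 'v \<Rightarrow> 'v) \<Rightarrow> bool" where
  "theta_fst A1 A2 s V \<tau> \<longleftrightarrow>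
     (\<forall>n \<pi>1 m \<pi>2 m' \<pi>2'. \<forall>T\<in>theta_hom A1 A2 s V \<tau> n \<pi>1 m \<pi>2. \<forall>T'\<in>theta_hom A1 A2 s V \<tau> n \<pi>1 m' \<pi>2'.
        irrep A1 n \<pi>1 \<and> irrep A2 m \<pi>2 \<and> irrep A2 m' \<pi>2' \<and> T \<noteq> 0 \<and> T' \<noteq> 0 \<longrightarrow>
          irrep_isomorphic A2 m \<pi>2 m' \<pi>2') \<and>
     (\<forall>n \<pi>1 m \<pi>2. \<forall>T\<in>theta_hom A1 A2 s V \<tau> n \<pi>1 m \<pi>2. \<forall>T'\<in>theta_hom A1 A2 s V \<tau> n \<pi>1 m \<pi>2.
        irrep A1 n \<pi>1 \<and> irrep A2 m \<pi>2 \<and> T' \<noteq> 0 \<longrightarrow> (\<exists>c. T = fun_scale coord_scale c T'))"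

definition mutually_commuting ::
  "('a, 'm) monoid_scheme \<Rightarrow> ('b, 'k) monoid_scheme
     \<Rightarrow> (complex \<Rightarrow> 'v::ab_group_add \<Rightarrow> 'v) \<Rightarrow> 'v set \<Rightarrow> ('a \<times> 'b \<Rightarrow> 'v \<Rightarrow> 'v) \<Rightarrow> bool" where
  "mutually_commuting A1 A2 s V \<tau> \<longleftrightarrow>
     (\<forall>X Y. intertwiner A1 s V (\<lambda>a. \<tau> (a, \<one>\<^bsub>A2\<^esub>)) s V (\<lambda>a. \<tau> (a, \<one>\<^bsub>A2\<^esub>)) X \<longrightarrow>
        intertwiner A2 s V (\<lambda>b. \<tau> (\<one>\<^bsub>A1\<^esub>, b)) s V (\<lambda>b. \<tau> (\<one>\<^bsub>A1\<^esub>, b)) Y \<longrightarrow>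
        (\<forall>v\<in>V. X (Y v) = Y (X v)))"

lemma zero_in_rep_hom:
  assumes "monoid_rep A s' V' \<rho>'"
  shows "0 \<in> rep_hom A s V \<rho> s' V' \<rho>'"
proof -
  interpret monoid_rep A s' V' \<rho>' by fact
  show ?thesis using zero_in map_zero by (simp add: rep_hom_def)
qed

lemma rep_hom_nonzero_iff: "T \<in> rep_hom A s V \<rho> s' V' \<rho>' \<Longrightarrow> T \<noteq> 0 \<longleftrightarrow> (\<exists>v\<in>V. T v \<noteq> 0)"
  by (auto simp: rep_hom_def fun_eq_iff)

locale group_pair_rep = A1: group A1 + A2: group A2 + monoid_rep "A1 \<times>\<times> A2" s V \<tau>
  for A1 :: "('a, 'm) monoid_scheme" and A2 :: "('b, 'k) monoid_scheme"
    and s :: "complex \<Rightarrow> 'v::ab_group_add \<Rightarrow> 'v" and V :: "'v set" and \<tau> :: "'a \<times> 'b \<Rightarrow> 'v \<Rightarrow> 'v" +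
  assumes finite1: "finite (carrier A1)" and finite2: "finite (carrier A2)" and fin_dim: "finite_dim s V"
begin

abbreviation "\<rho>1 \<equiv> \<lambda>a. \<tau> (a, \<one>\<^bsub>A2\<^esub>)"
abbreviation "\<rho>2 \<equiv> \<lambda>b. \<tau> (\<one>\<^bsub>A1\<^esub>, b)"
abbreviation "tensor_hom n \<pi>1 m \<pi>2 \<equiv>
  intertwiner (A1 \<times>\<times> A2) s V \<tau> coord_scale (coord_space ({..<n} \<times> {..<m})) (tensor_rep n \<pi>1 m \<pi>2)"

lemma split1: "a \<in> carrier A1 \<Longrightarrow> b \<in> carrier A2 \<Longrightarrow> v \<in> V \<Longrightarrow> \<tau> (a, b) v = \<rho>1 a (\<rho>2 b v)"
  and split2: "a \<in> carrier A1 \<Longrightarrow> b \<in> carrier A2 \<Longrightarrow> v \<in> V \<Longrightarrow> \<tau> (a, b) v = \<rho>2 b (\<rho>1 a v)"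
  using map_mult[of "(a, \<one>\<^bsub>A2\<^esub>)" "(\<one>\<^bsub>A1\<^esub>, b)" v] map_mult[of "(\<one>\<^bsub>A1\<^esub>, b)" "(a, \<one>\<^bsub>A2\<^esub>)" v]
  by simp_all

lemma rep1: "monoid_rep A1 s V \<rho>1"
proof (intro monoid_rep.intro monoid_rep_axioms.intro)
  show "\<rho>1 (a \<otimes>\<^bsub>A1\<^esub> b) v = \<rho>1 a (\<rho>1 b v)" if "a \<in> carrier A1" "b \<in> carrier A1" "v \<in> V" for a b v
    using that map_mult[of "(a, \<one>\<^bsub>A2\<^esub>)" "(b, \<one>\<^bsub>A2\<^esub>)" v] by simp
  show "\<rho>1 \<one>\<^bsub>A1\<^esub> v = v" if "v \<in> V" for v
    using map_one[OF that] by simp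
qed (simp_all add: subspace maps map_add map_scale VS.vector_space_axioms A1.is_monoid)

lemma rep2: "monoid_rep A2 s V \<rho>2"
proof (intro monoid_rep.intro monoid_rep_axioms.intro)
  show "\<rho>2 (a \<otimes>\<^bsub>A2\<^esub> b) v = \<rho>2 a (\<rho>2 b v)" if "a \<in> carrier A2" "b \<in> carrier A2" "v \<in> V" for a b v
    using that map_mult[of "(\<one>\<^bsub>A1\<^esub>, a)" "(\<one>\<^bsub>A1\<^esub>, b)" v] by simp
  show "\<rho>2 \<one>\<^bsub>A2\<^esub> v = v" if "v \<in> V" for v
    using map_one[OF that] by simp
qed (simp_all add: subspace maps map_add map_scale VS.vector_space_axioms A2.is_monoid)

lemma finite_prod: "finite (carrier (A1 \<times>\<times> A2))"
  using finite1 finite2 by (simp add: DirProd_def)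

lemma group_prod: "group (A1 \<times>\<times> A2)"
  by (rule DirProd_group) (rule A1.group_axioms A2.group_axioms)+

lemma tensor_hom_fst:
  assumes "irrep A1 n \<pi>1" "irrep A2 m \<pi>2" "tensor_hom n \<pi>1 m \<pi>2 T" "a \<in> carrier A1" "v \<in> V"
  shows "T (\<rho>1 a v) (i, j) = \<pi>1 a (\<lambda>k. T v (k, j)) i"
  using assms tensor_rep_fst[OF assms(1,2)[THEN irreducible_rep_rep] assms(4)]
  by (simp add: intertwiner_commutes[OF assms(3)] intertwiner_in[OF assms(3)])

lemma tensor_hom_snd:
  assumes "irrep A1 n \<pi>1" "irrep A2 m \<pi>2" "tensor_hom n \<pi>1 m \<pi>2 T" "b \<in> carrier A2" "v \<in> V"
  shows "T (\<rho>2 b v) (i, j) = \<pi>2 b (\<lambda>l. T v (i, l)) j"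
  using assms tensor_rep_snd[OF assms(1,2)[THEN irreducible_rep_rep] assms(4)]
  by (simp add: intertwiner_commutes[OF assms(3)] intertwiner_in[OF assms(3)])

text \<open>Equivariance under each factor suffices, since \<open>(a, b) = (a, 1)(1, b)\<close>. On
  a tensor product each factor acts slice by slice, so the conditions involve only the action of a
  single group.\<close>

lemma tensor_homI:
  assumes irr: "irrep A1 n \<pi>1" "irrep A2 m \<pi>2"
    and "\<And>v. v \<in> V \<Longrightarrow> T v \<in> coord_space ({..<n} \<times> {..<m})"
    and "\<And>v w. v \<in> V \<Longrightarrow> w \<in> V \<Longrightarrow> T (v + w) = T v + T w"
    and "\<And>c v. v \<in> V \<Longrightarrow> T (s c v) = coord_scale c (T v)"
    and fst: "\<And>a v i j. a \<in> carrier A1 \<Longrightarrow> v \<in> V \<Longrightarrow> T (\<rho>1 a v) (i, j) = \<pi>1 a (\<lambda>k. T v (k, j)) i"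
    and snd: "\<And>b v i j. b \<in> carrier A2 \<Longrightarrow> v \<in> V \<Longrightarrow> T (\<rho>2 b v) (i, j) = \<pi>2 b (\<lambda>l. T v (i, l)) j"
  shows "tensor_hom n \<pi>1 m \<pi>2 T"
proof (rule intertwinerI)
  note reps = irr[THEN irreducible_rep_rep]
  interpret tens: monoid_rep "A1 \<times>\<times> A2" coord_scale "coord_space ({..<n} \<times> {..<m})" "tensor_rep n \<pi>1 m \<pi>2"
    by (rule monoid_rep_tensor) (rule reps)+
  fix x v assume x: "x \<in> carrier (A1 \<times>\<times> A2)" and v: "v \<in> V"
  then obtain a b where ab: "x = (a, b)" "a \<in> carrier A1" "b \<in> carrier A2" by (cases x) auto
  have "T (\<tau> x v) = T (\<rho>1 a (\<rho>2 b v))" by (simp only: ab(1) split1[OF ab(2,3) v])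
  also have "\<dots> = tensor_rep n \<pi>1 m \<pi>2 (a, \<one>\<^bsub>A2\<^esub>) (T (\<rho>2 b v))"
    using ab v by (auto simp: fun_eq_iff fst tensor_rep_fst[OF reps] assms(3) maps)
  also have "T (\<rho>2 b v) = tensor_rep n \<pi>1 m \<pi>2 (\<one>\<^bsub>A1\<^esub>, b) (T v)"
    using ab v by (auto simp: fun_eq_iff snd tensor_rep_snd[OF reps] assms(3))
  also have "tensor_rep n \<pi>1 m \<pi>2 (a, \<one>\<^bsub>A2\<^esub>) \<dots> = tensor_rep n \<pi>1 m \<pi>2 x (T v)"
    using tens.map_mult[of "(a, \<one>\<^bsub>A2\<^esub>)" "(\<one>\<^bsub>A1\<^esub>, b)" "T v"] ab v assms(3) by simp
  finally show "T (\<tau> x v) = tensor_rep n \<pi>1 m \<pi>2 x (T v)" .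
qed (use assms in auto)

lemma tensor_hom_onto:
  assumes "irrep A1 n \<pi>1" "irrep A2 m \<pi>2" "tensor_hom n \<pi>1 m \<pi>2 T" "v \<in> V" "T v \<noteq> 0"
  shows "T ` V = coord_space ({..<n} \<times> {..<m})"
  using intertwiner_onto_irreducible[OF monoid_rep_axioms _ assms(3-5)]
    irreducible_tensor[OF A1.group_axioms A2.group_axioms finite1 finite2 assms(1,2)] by blast

text \<open>By Schur orthogonality \<open>S (e k v) = c (S v) k unit_vec 0\<close> with \<open>c \<noteq> 0\<close>, so \<open>e k\<close> does not annihilate
  \<open>K\<close> for a suitable \<open>k\<close>. Moreover \<open>e k (\<rho>1 g v) = \<Sum>\<^sub>p \<pi>1 g (unit_vec p) k e p v\<close>, so the vectors
  \<open>e k v\<close> transform like the coordinates in \<open>\<pi>1\<close>.\<close>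

lemma exists_tensor_hom:
  assumes K: "monoid_rep (A1 \<times>\<times> A2) s K \<tau>" "K \<subseteq> V" and irr: "irrep A1 n \<pi>1"
    and S: "intertwiner A1 s V \<rho>1 coord_scale (coord_space {..<n}) \<pi>1 S" and v: "v \<in> K" "S v \<noteq> 0"
  obtains m \<pi>2 T w where "irrep A2 m \<pi>2" "tensor_hom n \<pi>1 m \<pi>2 T" "w \<in> K" "T w \<noteq> 0"
proof -
  interpret K: group_pair_rep A1 A2 s K \<tau>
    using K finite_dim_subset[OF fin_dim] finite1 finite2
    by (intro group_pair_rep.intro group_pair_rep_axioms.intro) (auto intro: A1.group_axioms A2.group_axioms)
  interpret V1: monoid_rep A1 s V \<rho>1 by (rule rep1)
  interpret P: monoid_rep A1 coord_scale "coord_space {..<n}" \<pi>1 by (rule irreducible_rep_rep) fact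
  have n: "0 < n" using irr coord_space_nontrivial by (auto simp: irreducible_rep_def)
  have SvC: "S v \<in> coord_space {..<n}" using intertwiner_in[OF S] v K by blast
  obtain k where k: "S v k \<noteq> 0" using v(2) by (auto simp: fun_eq_iff)
  then have kn: "k < n" using SvC by (auto simp: coord_space_def)
  define e where "e p w = (\<Sum>a\<in>carrier A1. s (\<pi>1 (inv\<^bsub>A1\<^esub> a) (unit_vec 0) p) (\<rho>1 a w))" for p w
  have eV: "e p w \<in> V" if "w \<in> V" for p w
    unfolding e_def using that by (intro sum_in scale_in V1.maps)
  have e_lin: "e p (x + y) = e p x + e p y" "e p (s c x) = s c (e p x)" if "x \<in> V" "y \<in> V" for p c x y
    using that by (simp_all add: e_def V1.map_add V1.map_scale VS.scale_right_distrib sum.distrib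
      VS.scale_sum_right mult.commute)
  have e2: "e p (\<rho>2 b w) = \<rho>2 b (e p w)" if "w \<in> V" "b \<in> carrier A2" for p b w
    using that by (simp add: e_def map_sum map_scale scale_in V1.maps split1[symmetric] split2[symmetric])
  have e1: "e p (\<rho>1 g w) = (\<Sum>q<n. s (\<pi>1 g (unit_vec q) p) (e q w))"
    if w: "w \<in> V" and g: "g \<in> carrier A1" for p g w
  proof -
    have "e p (\<rho>1 g w) = (\<Sum>a\<in>carrier A1. s (\<pi>1 (inv\<^bsub>A1\<^esub> (a \<otimes>\<^bsub>A1\<^esub> inv\<^bsub>A1\<^esub> g)) (unit_vec 0) p)
        (\<rho>1 (a \<otimes>\<^bsub>A1\<^esub> inv\<^bsub>A1\<^esub> g) (\<rho>1 g w)))"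
      unfolding e_def by (rule A1.sum_translate_right[symmetric]) (use g in simp)
    also have "\<dots> = (\<Sum>a\<in>carrier A1. s (\<pi>1 g (\<pi>1 (inv\<^bsub>A1\<^esub> a) (unit_vec 0)) p) (\<rho>1 a w))"
      using g w n by (intro sum.cong refl)
        (simp add: A1.inv_mult_group P.map_mult V1.map_mult V1.maps A1.monoid_rep_inv[OF rep1])
    also have "\<dots> = (\<Sum>a\<in>carrier A1. \<Sum>q<n. s (\<pi>1 g (unit_vec q) p)
        (s (\<pi>1 (inv\<^bsub>A1\<^esub> a) (unit_vec 0) q) (\<rho>1 a w)))"
      using g n by (intro sum.cong refl)
        (subst coord_rep_expand[OF P.monoid_rep_axioms g],
          auto simp: P.maps VS.scale_sum_left mult.commute)
    also have "\<dots> = (\<Sum>q<n. s (\<pi>1 g (unit_vec q) p) (e q w))"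
      by (subst sum.swap) (simp add: e_def VS.scale_sum_right)
    finally show ?thesis .
  qed
  have Se: "S (e k v) \<noteq> 0"
  proof -
    have vV: "v \<in> V" using v K by blast
    have "S (e k v) 0 = (\<Sum>a\<in>carrier A1. \<pi>1 (inv\<^bsub>A1\<^esub> a) (unit_vec 0) k * \<pi>1 a (S v) 0)"
      unfolding e_def using vV
      by (subst V1.intertwiner_sum[OF S])
        (auto simp: scale_in V1.maps intertwiner_scale[OF S] intertwiner_commutes[OF S] sum_apply coord_scale_apply)
    also have "\<dots> = of_nat (card (carrier A1)) / of_nat n * S v k * unit_vec 0 (0::nat)"
      by (rule A1.Schur_orthogonality[OF finite1 irr n kn SvC])
    finally have "S (e k v) 0 \<noteq> 0"
      using k n finite1 by (auto simp: unit_vec_def card_eq_0_iff)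
    then show ?thesis by auto
  qed
  interpret V2: monoid_rep A2 s V \<rho>2 by (rule rep2)
  have ek: "intertwiner A2 s V \<rho>2 s V \<rho>2 (e k)"
    by (rule intertwinerI) (auto simp: eV e_lin e2)
  have "monoid_rep A2 s K \<rho>2"
    by (rule V2.sub_rep) (use K.subspace K(2) K.maps in auto)
  then have L: "monoid_rep A2 s (e k ` K) \<rho>2"
    using monoid_rep.image_rep[OF _ intertwiner_subspace[OF ek K(2)] V2.monoid_rep_axioms] by blast
  have LV: "e k ` K \<subseteq> V" using eV K(2) by blast
  have L0: "e k ` K \<noteq> {0}"
  proof
    assume "e k ` K = {0}"
    then have "e k v = 0" using v by blast
    then show False using Se intertwiner_zero[OF S zero_in] by simp
  qed
  obtain m \<pi>2 R u where R: "irrep A2 m \<pi>2" "intertwiner A2 s V \<rho>2 coord_scale (coord_space {..<m}) \<pi>2 R"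
    "u \<in> e k ` K" "R u \<noteq> 0"
    using exists_irrep_quotient[OF A2.group_axioms finite2 V2.monoid_rep_axioms fin_dim L LV L0] .
  obtain w where w: "w \<in> K" "u = e k w" using R(3) by blast
  obtain l where l: "R u l \<noteq> 0" using R(4) by (auto simp: fun_eq_iff)
  \<comment> \<open>Row \<open>p\<close> of \<open>T x\<close> is the image of \<open>e p x\<close>
    under an irreducible \<open>A2\<close>-quotient \<open>R\<close> that does not vanish on the
    image of \<open>K\<close> under \<open>e k\<close>. Equivariance under \<open>A2\<close> holds
    row by row, as \<open>e p\<close> commutes with \<rho>2; equivariance under \<open>A1\<close> is
    the transformation rule \<open>e1\<close>.\<close>
  define T where "T x = (\<lambda>(p, l). if p < n then R (e p x) l else 0)" for x
  have RC: "R (e p x) \<in> coord_space {..<m}" if "x \<in> V" for p x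
    using intertwiner_in[OF R(2)] eV that by blast
  have zero: "\<pi>2 b (\<lambda>q. 0) j = 0" if "b \<in> carrier A2" for b j
    using monoid_rep.map_zero[OF irreducible_rep_rep[OF R(1)] that] by (simp add: zero_fun_def)
  have T_hom: "tensor_hom n \<pi>1 m \<pi>2 T"
  proof (rule tensor_homI[OF irr R(1)])
    fix x assume x: "x \<in> V"
    show "T x \<in> coord_space ({..<n} \<times> {..<m})"
      using RC[OF x] by (auto simp: T_def coord_space_def)
    show "T (x + y) = T x + T y" if "y \<in> V" for y
      using x that by (auto simp: T_def fun_eq_iff e_lin eV intertwiner_add[OF R(2)])
    show "T (s c x) = coord_scale c (T x)" for c
      using x by (auto simp: T_def fun_eq_iff e_lin eV intertwiner_scale[OF R(2)] coord_scale_apply)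
    show "T (\<rho>2 b x) (i, j) = \<pi>2 b (\<lambda>l. T x (i, l)) j" if "b \<in> carrier A2" for b i j
      using x that A1.one_closed by (auto simp: T_def e2 eV intertwiner_commutes[OF R(2)] zero)
    show "T (\<rho>1 a x) (i, j) = \<pi>1 a (\<lambda>k. T x (k, j)) i" if a: "a \<in> carrier A1" for a i j
    proof -
      let ?t = "\<lambda>k. T x (k, j)"
      have t: "?t \<in> coord_space {..<n}" by (auto simp: T_def coord_space_def)
      show ?thesis
      proof (cases "i < n")
        case True
        have "T (\<rho>1 a x) (i, j) = R (\<Sum>q<n. s (\<pi>1 a (unit_vec q) i) (e q x)) j"
          using True by (simp add: T_def e1[OF x a])
        also have "\<dots> = (\<Sum>q<n. \<pi>1 a (unit_vec q) i * R (e q x) j)"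
          using x by (subst V2.intertwiner_sum[OF R(2)])
            (auto simp: scale_in eV intertwiner_scale[OF R(2)] sum_apply coord_scale_apply)
        also have "\<dots> = (\<Sum>q<n. ?t q * \<pi>1 a (unit_vec q) i)"
          by (intro sum.cong refl) (simp add: T_def)
        also have "\<dots> = \<pi>1 a ?t i"
          by (rule coord_rep_expand[OF P.monoid_rep_axioms a t, symmetric])
        finally show ?thesis .
      next
        case False
        then show ?thesis using P.maps[OF a t] by (simp add: T_def coord_space_def)
      qed
    qed
  qed
  have "T w (k, l) \<noteq> 0" using l w kn by (simp add: T_def)
  then have "T w \<noteq> 0" by auto
  then show ?thesis using that R(1) T_hom w(1) by blast
qed

text \<open>\<open>T\<close> is onto \<pi>1 \<otimes> \<pi>2 and \<open>S\<close> vanishes on its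
  kernel, so \<open>S\<close> descends to an \<open>A1\<close>-map from \<pi>1 \<otimes> \<pi>2 to
  \<pi>1. As an \<open>A1\<close>-representation the source is a sum of copies \<pi>1 \<otimes>
  \<open>unit_vec q\<close>, on each of which Schur's lemma gives a scalar
  \<open>z q\<close>.\<close>

lemma hom_factors_through_tensor_hom:
  assumes irr: "irrep A1 n \<pi>1" "irrep A2 m \<pi>2" and T: "tensor_hom n \<pi>1 m \<pi>2 T" "v0 \<in> V" "T v0 \<noteq> 0"
    and S: "intertwiner A1 s V \<rho>1 coord_scale (coord_space {..<n}) \<pi>1 S"
    and ker: "\<And>v. v \<in> V \<Longrightarrow> T v = 0 \<Longrightarrow> S v = 0"
  obtains z where "\<And>v i. v \<in> V \<Longrightarrow> S v i = (\<Sum>q<m. z q * T v (i, q))"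
proof -
  let ?I = "{..<n} \<times> {..<m}"
  interpret V1: monoid_rep A1 s V \<rho>1 by (rule rep1)
  interpret P: monoid_rep A1 coord_scale "coord_space {..<n}" \<pi>1 by (rule irreducible_rep_rep) fact
  have onto: "T ` V = coord_space ?I" by (rule tensor_hom_onto[OF irr T])
  \<comment> \<open>\<open>g\<close> is an arbitrary section of \<open>T\<close>, in general not
    linear. By \<open>wd\<close> the value \<open>S (g t)\<close> does not depend on the choice, and
    is therefore linear and equivariant in \<open>t\<close>.\<close>
  define g where "g t = (SOME v. v \<in> V \<and> T v = t)" for t
  have g: "g t \<in> V" "T (g t) = t" if "t \<in> coord_space ?I" for t
  proof -
    have "\<exists>v. v \<in> V \<and> T v = t" using that onto by (metis imageE)
    then show "g t \<in> V" "T (g t) = t" unfolding g_def by (metis (mono_tags, lifting) someI_ex)+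
  qed
  have wd: "S v = S w" if "v \<in> V" "w \<in> V" "T v = T w" for v w
    using ker[of "v - w"] that diff_in by (simp add: intertwiner_diff[OF T(1)] V1.intertwiner_diff[OF S])
  have tv: "tensor_vec x (unit_vec q) \<in> coord_space ?I" if "x \<in> coord_space {..<n}" "q < m" for x q
    using that by (auto simp: tensor_vec_def coord_space_def unit_vec_def)
  have "\<exists>c. \<forall>x\<in>coord_space {..<n}. S (g (tensor_vec x (unit_vec q))) = coord_scale c x" if q: "q < m" for q
  proof -
    let ?F = "\<lambda>x. S (g (tensor_vec x (unit_vec q)))"
    have "intertwiner A1 coord_scale (coord_space {..<n}) \<pi>1 coord_scale (coord_space {..<n}) \<pi>1 ?F"
    proof (rule intertwinerI)
      fix x assume x: "x \<in> coord_space {..<n}"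
      note gx = g[OF tv[OF x q]]
      show "?F x \<in> coord_space {..<n}" using intertwiner_in[OF S] gx(1) .
      show "?F (x + y) = ?F x + ?F y" if y: "y \<in> coord_space {..<n}" for y
      proof -
        note gy = g[OF tv[OF y q]] and gxy = g[OF tv[OF P.add_in[OF x y] q]]
        have "tensor_vec (x + y) (unit_vec q) = tensor_vec x (unit_vec q) + tensor_vec y (unit_vec q)"
          by (auto simp: tensor_vec_def fun_eq_iff algebra_simps)
        then have "?F (x + y) = S (g (tensor_vec x (unit_vec q)) + g (tensor_vec y (unit_vec q)))"
          using gx gy gxy by (intro wd) (simp_all add: add_in intertwiner_add[OF T(1)])
        then show ?thesis using gx gy by (simp add: intertwiner_add[OF S])
      qed
      show "?F (coord_scale c x) = coord_scale c (?F x)" for c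
      proof -
        note gc = g[OF tv[OF P.scale_in[OF x] q]]
        have "tensor_vec (coord_scale c x) (unit_vec q) = coord_scale c (tensor_vec x (unit_vec q))"
          by (auto simp: tensor_vec_def fun_eq_iff coord_scale_apply)
        then have "?F (coord_scale c x) = S (s c (g (tensor_vec x (unit_vec q))))"
          using gx gc[of c] by (intro wd) (simp_all add: scale_in intertwiner_scale[OF T(1)])
        then show ?thesis using gx by (simp add: intertwiner_scale[OF S])
      qed
      show "?F (\<pi>1 a x) = \<pi>1 a (?F x)" if a: "a \<in> carrier A1" for a
      proof -
        note ga = g[OF tv[OF P.maps[OF a x] q]]
        have "T (\<rho>1 a (g (tensor_vec x (unit_vec q)))) (i, j) = tensor_vec (\<pi>1 a x) (unit_vec q) (i, j)" for i j
        proof -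
          have "(\<lambda>k. T (g (tensor_vec x (unit_vec q))) (k, j)) = coord_scale (unit_vec q j) x"
            unfolding gx(2) by (simp add: tensor_vec_def fun_eq_iff coord_scale_apply mult.commute)
          then show ?thesis
            by (simp add: tensor_hom_fst[OF irr T(1) a gx(1)] P.map_scale[OF a x] coord_scale_apply)
              (simp add: tensor_vec_def)
        qed
        then have "T (\<rho>1 a (g (tensor_vec x (unit_vec q)))) = tensor_vec (\<pi>1 a x) (unit_vec q)"
          by (auto simp: fun_eq_iff)
        then have "?F (\<pi>1 a x) = S (\<rho>1 a (g (tensor_vec x (unit_vec q))))"
          using gx ga a by (intro wd) (simp_all add: V1.maps)
        then show ?thesis using gx a by (simp add: intertwiner_commutes[OF S])
      qed
    qed
    then obtain c where "\<And>x. x \<in> coord_space {..<n} \<Longrightarrow> ?F x = coord_scale c x"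
      using Schur_scalar[OF irr(1)] by blast
    then show ?thesis by blast
  qed
  then obtain z where z: "\<And>q x. q < m \<Longrightarrow> x \<in> coord_space {..<n} \<Longrightarrow>
      S (g (tensor_vec x (unit_vec q))) = coord_scale (z q) x" by metis
  have "S v i = (\<Sum>q<m. z q * T v (i, q))" if v: "v \<in> V" for v i
  proof -
    let ?x = "\<lambda>q i. T v (i, q)"
    have TV: "T v \<in> coord_space ?I" using intertwiner_in[OF T(1) v] .
    have x: "?x q \<in> coord_space {..<n}" for q using slice_fst_in[OF TV] .
    let ?w = "\<Sum>q<m. g (tensor_vec (?x q) (unit_vec q))"
    have w: "?w \<in> V" using g(1)[OF tv[OF x]] by (intro sum_in) auto
    have "T ?w = (\<Sum>q<m. tensor_vec (?x q) (unit_vec q))"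
      using g[OF tv[OF x]] by (subst intertwiner_sum[OF T(1)]) auto
    also have "\<dots> = T v"
    proof
      fix p :: "nat \<times> nat"
      obtain i j where p: "p = (i, j)" by (cases p)
      have "(\<Sum>q<m. tensor_vec (?x q) (unit_vec q)) p = (\<Sum>q<m. if q = j then T v (i, q) else 0)"
        unfolding sum_apply p by (intro sum.cong refl) (auto simp: tensor_vec_def unit_vec_def)
      also have "\<dots> = T v p" using TV by (auto simp: p coord_space_def)
      finally show "(\<Sum>q<m. tensor_vec (?x q) (unit_vec q)) p = T v p" .
    qed
    finally have "S v = S ?w" using v w by (intro wd) auto
    also have "\<dots> = (\<Sum>q<m. coord_scale (z q) (?x q))"
      using g(1)[OF tv[OF x]] z[OF _ x] by (subst V1.intertwiner_sum[OF S]) auto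
    finally show ?thesis by (simp add: sum_apply coord_scale_apply)
  qed
  with that show ?thesis by blast
qed

section \<open>Consequences of the theta condition for one factor\<close>

lemma theta_hom_iff:
  "T \<in> theta_hom A1 A2 s V \<tau> n \<pi>1 m \<pi>2 \<longleftrightarrow> tensor_hom n \<pi>1 m \<pi>2 T \<and> (\<forall>v. v \<notin> V \<longrightarrow> T v = 0)"
  by (simp add: theta_hom_def rep_hom_iff)

lemma zero_ext_theta_hom: "tensor_hom n \<pi>1 m \<pi>2 T \<Longrightarrow> zero_ext V T \<in> theta_hom A1 A2 s V \<tau> n \<pi>1 m \<pi>2"
  by (simp add: theta_hom_def zero_ext_rep_hom)

lemma theta_fst_isomorphic:
  assumes "theta_fst A1 A2 s V \<tau>" "irrep A1 n \<pi>1" "irrep A2 m \<pi>2" "irrep A2 m' \<pi>2'"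
    and "tensor_hom n \<pi>1 m \<pi>2 T" "v \<in> V" "T v \<noteq> 0" "tensor_hom n \<pi>1 m' \<pi>2' T'" "v' \<in> V" "T' v' \<noteq> 0"
  shows "irrep_isomorphic A2 m \<pi>2 m' \<pi>2'"
proof -
  have "zero_ext V T \<noteq> 0" "zero_ext V T' \<noteq> 0"
    using assms by (auto simp: zero_ext_def fun_eq_iff)
  then show ?thesis
    using assms(1-4) zero_ext_theta_hom[OF assms(5)] zero_ext_theta_hom[OF assms(8)]
    unfolding theta_fst_def by blast
qed

lemma theta_fst_proportional:
  assumes "theta_fst A1 A2 s V \<tau>" "irrep A1 n \<pi>1" "irrep A2 m \<pi>2"
    and "tensor_hom n \<pi>1 m \<pi>2 T" "tensor_hom n \<pi>1 m \<pi>2 T'" "v' \<in> V" "T' v' \<noteq> 0"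
  obtains c where "\<And>v. v \<in> V \<Longrightarrow> T v = coord_scale c (T' v)"
proof -
  have "zero_ext V T' \<noteq> 0" using assms by (auto simp: zero_ext_def fun_eq_iff)
  then obtain c where c: "zero_ext V T = fun_scale coord_scale c (zero_ext V T')"
    using assms(1-3) zero_ext_theta_hom[OF assms(4)] zero_ext_theta_hom[OF assms(5)]
    unfolding theta_fst_def by blast
  have "T v = coord_scale c (T' v)" if "v \<in> V" for v
    using fun_cong[OF c, of v] that by (simp add: zero_ext_def fun_scale_def[of coord_scale])
  with that show ?thesis by blast
qed

text \<open>If \<open>S\<close> were nonzero on the kernel of \<open>T\<close>, then
  \<open>exists_tensor_hom\<close> would give a map \<open>T'\<close> to some \<pi>1 \<otimes>
  \<pi>2' that is nonzero on this kernel. The theta condition identifies \<pi>2' with \<pi>2, and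
  after this identification \<open>T'\<close> is proportional to \<open>T\<close>. So it vanishes on
  the kernel of \<open>T\<close> after all.\<close>

lemma theta_fst_kernel:
  assumes theta: "theta_fst A1 A2 s V \<tau>" and irr: "irrep A1 n \<pi>1" "irrep A2 m \<pi>2"
    and T: "tensor_hom n \<pi>1 m \<pi>2 T" "v0 \<in> V" "T v0 \<noteq> 0"
    and S: "intertwiner A1 s V \<rho>1 coord_scale (coord_space {..<n}) \<pi>1 S"
    and v: "v \<in> V" "T v = 0"
  shows "S v = 0"
proof (rule ccontr)
  assume "S v \<noteq> 0"
  let ?K = "{v \<in> V. T v = 0}"
  have "monoid_rep (A1 \<times>\<times> A2) s ?K \<tau>"
    by (rule kernel_rep[OF T(1) monoid_rep_tensor]) (rule irr[THEN irreducible_rep_rep])+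
  moreover have "?K \<subseteq> V" "v \<in> ?K" using v by auto
  ultimately obtain m' \<pi>2' T' w where T': "irrep A2 m' \<pi>2'" "tensor_hom n \<pi>1 m' \<pi>2' T'" "w \<in> ?K" "T' w \<noteq> 0"
    using exists_tensor_hom[OF _ _ irr(1) S _ \<open>S v \<noteq> 0\<close>] by blast
  have w: "w \<in> V" "T w = 0" using T'(3) by auto
  have "irrep_isomorphic A2 m' \<pi>2' m \<pi>2"
    by (rule theta_fst_isomorphic[OF theta irr(1) T'(1) irr(2) T'(2) w(1) T'(4) T])
  then obtain U where U: "intertwiner A2 coord_scale (coord_space {..<m'}) \<pi>2' coord_scale (coord_space {..<m}) \<pi>2 U"
    "bij_betw U (coord_space {..<m'}) (coord_space {..<m})"
    by (auto simp: rep_isomorphic_def rep_hom_iff)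
  interpret Q: monoid_rep A2 coord_scale "coord_space {..<m'}" \<pi>2' by (rule irreducible_rep_rep) (rule T')
  interpret P1: monoid_rep A1 coord_scale "coord_space {..<n}" \<pi>1 by (rule irreducible_rep_rep) (rule irr)
  interpret P2: monoid_rep A2 coord_scale "coord_space {..<m}" \<pi>2 by (rule irreducible_rep_rep) (rule irr)
  have U0: "U 0 = 0" by (rule intertwiner_zero[OF U(1) Q.zero_in])
  have T'C: "T' x \<in> coord_space ({..<n} \<times> {..<m'})" if "x \<in> V" for x
    using intertwiner_in[OF T'(2) that] .
  note sl = slice_snd_in[OF T'C]
  \<comment> \<open>\<open>R\<close> is \<open>T'\<close> followed by id \<otimes> \<open>U\<close>,
    a map to \<pi>1 \<otimes> \<pi>2 that can be compared with \<open>T\<close>.\<close>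
  define R where "R x = (\<lambda>(i, j). U (\<lambda>l. T' x (i, l)) j)" for x
  have R_slice: "(\<lambda>j. R x (i, j)) = U (\<lambda>l. T' x (i, l))" for x i by (simp add: R_def)
  have Ulin: "U (\<lambda>l. \<Sum>k\<in>I. c k * t k l) j = (\<Sum>k\<in>I. c k * U (t k) j)"
    if "\<And>k. k \<in> I \<Longrightarrow> t k \<in> coord_space {..<m'}" for c t j and I :: "nat set"
  proof -
    have "U (\<lambda>l. \<Sum>k\<in>I. c k * t k l) = U (\<Sum>k\<in>I. coord_scale (c k) (t k))"
      by (rule arg_cong[where f = U]) (simp add: fun_eq_iff sum_apply coord_scale_apply)
    also have "\<dots> = (\<Sum>k\<in>I. coord_scale (c k) (U (t k)))"
      using that by (subst Q.intertwiner_sum[OF U(1)]) (auto simp: Q.scale_in intertwiner_scale[OF U(1)])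
    finally show ?thesis by (simp add: sum_apply coord_scale_apply)
  qed
  have "tensor_hom n \<pi>1 m \<pi>2 R"
  proof (rule tensor_homI[OF irr])
    fix x assume x: "x \<in> V"
    have z: "(\<lambda>l. T' x (i, l)) = 0" if "\<not> i < n" for i
      using T'C[OF x] that by (auto simp: coord_space_def fun_eq_iff)
    show "R x \<in> coord_space ({..<n} \<times> {..<m})"
      using intertwiner_in[OF U(1) sl[OF x]] z U0 by (auto simp: R_def coord_space_def)
    show "R (x + y) = R x + R y" if "y \<in> V" for y
      using intertwiner_add[OF U(1) sl[OF x] sl[OF that]] x that
      by (auto simp: R_def fun_eq_iff intertwiner_add[OF T'(2)] plus_fun_def)
    show "R (s c x) = coord_scale c (R x)" for c
      using intertwiner_scale[OF U(1) sl[OF x], of c] x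
      by (auto simp: R_def fun_eq_iff intertwiner_scale[OF T'(2)] fun_scale_def)
    show "R (\<rho>2 b x) (i, j) = \<pi>2 b (\<lambda>l. R x (i, l)) j" if b: "b \<in> carrier A2" for b i j
    proof -
      have "(\<lambda>l. T' (\<rho>2 b x) (i, l)) = \<pi>2' b (\<lambda>l. T' x (i, l))"
        by (simp add: tensor_hom_snd[OF irr(1) T'(1,2) b x])
      then show ?thesis
        unfolding R_slice by (simp add: R_def intertwiner_commutes[OF U(1) b sl[OF x]])
    qed
    show "R (\<rho>1 a x) (i, j) = \<pi>1 a (\<lambda>k. R x (k, j)) i" if a: "a \<in> carrier A1" for a i j
    proof -
      have "R (\<rho>1 a x) (i, j) = U (\<lambda>l. \<Sum>k<n. \<pi>1 a (unit_vec k) i * T' x (k, l)) j"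
        using coord_rep_expand[OF P1.monoid_rep_axioms a slice_fst_in[OF T'C[OF x]]]
        by (simp add: R_def tensor_hom_fst[OF irr(1) T'(1,2) a x] mult.commute)
      also have "\<dots> = (\<Sum>k<n. R x (k, j) * \<pi>1 a (unit_vec k) i)"
        by (subst Ulin) (auto simp: sl[OF x] R_def mult.commute)
      also have "\<dots> = \<pi>1 a (\<lambda>k. R x (k, j)) i"
        using z U0 by (intro coord_rep_expand[OF P1.monoid_rep_axioms a, symmetric])
          (auto simp: coord_space_def R_def)
      finally show ?thesis .
    qed
  qed
  then obtain c where "\<And>x. x \<in> V \<Longrightarrow> R x = coord_scale c (T x)"
    using theta_fst_proportional[OF theta irr _ T] by blast
  then have "R w = 0" using w by (simp add: fun_eq_iff coord_scale_apply)
  obtain i l where il: "T' w (i, l) \<noteq> 0" using T'(4) by (auto simp: fun_eq_iff)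
  have "U (\<lambda>l. T' w (i, l)) = U 0"
    unfolding R_slice[symmetric] U0 using \<open>R w = 0\<close> by (simp add: fun_eq_iff)
  then have "(\<lambda>l. T' w (i, l)) = 0"
    using U(2) sl[OF w(1)] Q.zero_in by (auto simp: bij_betw_def dest: inj_onD)
  then show False using il by (simp add: fun_eq_iff)
qed

text \<open>Each column of \<open>T\<close> after \<open>X\<close> is an \<open>A1\<close>-map to
  \<pi>1 that vanishes on the kernel of \<open>T\<close>, so it factors through \<open>T\<close>.
  Thus on the quotient \<pi>1 \<otimes> \<pi>2 the endomorphism \<open>X\<close> acts on the second
  tensor factor only, by the matrix \<open>z\<close>.\<close>

lemma theta_fst_factor:
  assumes theta: "theta_fst A1 A2 s V \<tau>" and irr: "irrep A1 n \<pi>1" "irrep A2 m \<pi>2"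
    and T: "tensor_hom n \<pi>1 m \<pi>2 T"
    and X: "intertwiner A1 s V \<rho>1 s V \<rho>1 X"
  obtains z where "\<And>v i l. v \<in> V \<Longrightarrow> T (X v) (i, l) = (\<Sum>q<m. z l q * T v (i, q))"
proof (cases "\<exists>v\<in>V. T v \<noteq> 0")
  case True
  then obtain v0 where v0: "v0 \<in> V" "T v0 \<noteq> 0" by blast
  interpret V1: monoid_rep A1 s V \<rho>1 by (rule rep1)
  have "\<exists>z. \<forall>v\<in>V. \<forall>i. T (X v) (i, l) = (\<Sum>q<m. z q * T v (i, q))" for l
  proof -
    let ?S = "\<lambda>v i. T (X v) (i, l)"
    have S: "intertwiner A1 s V \<rho>1 coord_scale (coord_space {..<n}) \<pi>1 ?S"
      using intertwiner_in[OF X] slice_fst_in[OF intertwiner_in[OF T]]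
      by (intro intertwinerI)
        (auto simp: fun_eq_iff intertwiner_add[OF X] intertwiner_add[OF T] intertwiner_scale[OF X]
          intertwiner_scale[OF T] coord_scale_apply intertwiner_commutes[OF X] tensor_hom_fst[OF irr T])
    obtain z where "\<And>v i. v \<in> V \<Longrightarrow> ?S v i = (\<Sum>q<m. z q * T v (i, q))"
      using hom_factors_through_tensor_hom[OF irr T v0 S theta_fst_kernel[OF theta irr T v0 S]] by blast
    then show ?thesis by blast
  qed
  then show ?thesis using that by metis
next
  case False
  then show ?thesis using that[of "\<lambda>_ _. 0"] intertwiner_in[OF X] by auto
qed

section \<open>Exchanging the two factors\<close>

abbreviation "\<tau>' \<equiv> \<lambda>x. \<tau> (snd x, fst x)"

lemma swapped: "group_pair_rep A2 A1 s V \<tau>'"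
proof (intro group_pair_rep.intro group_pair_rep_axioms.intro monoid_rep.intro monoid_rep_axioms.intro)
  show "monoid (A2 \<times>\<times> A1)" by (intro DirProd_monoid A1.is_monoid A2.is_monoid)
  fix x y v assume "x \<in> carrier (A2 \<times>\<times> A1)" "y \<in> carrier (A2 \<times>\<times> A1)" "v \<in> V"
  then show "\<tau>' (x \<otimes>\<^bsub>A2 \<times>\<times> A1\<^esub> y) v = \<tau>' x (\<tau>' y v)"
    using map_mult[of "(snd x, fst x)" "(snd y, fst y)" v] by (cases x; cases y) auto
next
  show "\<tau>' \<one>\<^bsub>A2 \<times>\<times> A1\<^esub> v = v" if "v \<in> V" for v using map_one[OF that] by simp
qed (auto simp: A1.group_axioms A2.group_axioms VS.vector_space_axioms subspace maps map_add map_scale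
    finite1 finite2 fin_dim)

lemma tensor_hom_swap:
  assumes irr: "irrep A1 n \<pi>1" "irrep A2 m \<pi>2" and T: "tensor_hom n \<pi>1 m \<pi>2 T"
  shows "intertwiner (A2 \<times>\<times> A1) s V \<tau>' coord_scale (coord_space ({..<m} \<times> {..<n}))
    (tensor_rep m \<pi>2 n \<pi>1) (\<lambda>v x. T v (snd x, fst x))"
proof -
  interpret sw: group_pair_rep A2 A1 s V \<tau>' by (rule swapped)
  show ?thesis
  proof (rule sw.tensor_homI[OF irr(2,1)])
    show "(\<lambda>x. T v (snd x, fst x)) \<in> coord_space ({..<m} \<times> {..<n})" if "v \<in> V" for v
      using intertwiner_in[OF T that] by (auto simp: coord_space_def)
  qed (auto simp: fun_eq_iff intertwiner_add[OF T] intertwiner_scale[OF T] coord_scale_apply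
      tensor_hom_fst[OF irr T] tensor_hom_snd[OF irr T])
qed

lemma theta_hom_swap:
  assumes "irrep A1 n \<pi>1" "irrep A2 m \<pi>2" "T \<in> theta_hom A1 A2 s V \<tau> n \<pi>1 m \<pi>2"
  shows "(\<lambda>v x. T v (snd x, fst x)) \<in> theta_hom A2 A1 s V \<tau>' m \<pi>2 n \<pi>1"
  using tensor_hom_swap[OF assms(1,2)] assms(3)
  by (auto simp: theta_hom_iff group_pair_rep.theta_hom_iff[OF swapped] fun_eq_iff)

lemma theta_hom_nontrivial:
  assumes "irrep A1 n \<pi>1" "irrep A2 m \<pi>2"
  shows "theta_hom A1 A2 s V \<tau> n \<pi>1 m \<pi>2 \<noteq> {0} \<longleftrightarrow> (\<exists>T\<in>theta_hom A1 A2 s V \<tau> n \<pi>1 m \<pi>2. T \<noteq> 0)"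
proof -
  have "0 \<in> theta_hom A1 A2 s V \<tau> n \<pi>1 m \<pi>2"
    unfolding theta_hom_def
    by (rule zero_in_rep_hom[OF monoid_rep_tensor]) (rule assms[THEN irreducible_rep_rep])+
  then show ?thesis by blast
qed

lemma theta_hom_dim:
  assumes "irrep A1 n \<pi>1" "irrep A2 m \<pi>2"
  shows "vector_space.dim (fun_scale coord_scale) (theta_hom A1 A2 s V \<tau> n \<pi>1 m \<pi>2) \<le> 1 \<longleftrightarrow>
    (\<forall>T\<in>theta_hom A1 A2 s V \<tau> n \<pi>1 m \<pi>2. \<forall>T'\<in>theta_hom A1 A2 s V \<tau> n \<pi>1 m \<pi>2.
      T' \<noteq> 0 \<longrightarrow> (\<exists>c. T = fun_scale coord_scale c T'))"
  by (rule dim_le_1_iff_proportional[OF vector_space_fun_scale[OF vector_space_coord]])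
    (simp add: theta_hom_def finite_dim_rep_hom[OF monoid_rep_axioms fin_dim])

lemma theta_fstI:
  assumes "\<And>n \<pi>1 m \<pi>2 m' \<pi>2' T T'. irrep A1 n \<pi>1 \<Longrightarrow> irrep A2 m \<pi>2 \<Longrightarrow> irrep A2 m' \<pi>2' \<Longrightarrow>
      T \<in> theta_hom A1 A2 s V \<tau> n \<pi>1 m \<pi>2 \<Longrightarrow> T' \<in> theta_hom A1 A2 s V \<tau> n \<pi>1 m' \<pi>2' \<Longrightarrow>
      T \<noteq> 0 \<Longrightarrow> T' \<noteq> 0 \<Longrightarrow> irrep_isomorphic A2 m \<pi>2 m' \<pi>2'"
    and "\<And>n \<pi>1 m \<pi>2 T T'. irrep A1 n \<pi>1 \<Longrightarrow> irrep A2 m \<pi>2 \<Longrightarrow>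
      T \<in> theta_hom A1 A2 s V \<tau> n \<pi>1 m \<pi>2 \<Longrightarrow> T' \<in> theta_hom A1 A2 s V \<tau> n \<pi>1 m \<pi>2 \<Longrightarrow>
      T' \<noteq> 0 \<Longrightarrow> \<exists>c. T = fun_scale coord_scale c T'"
  shows "theta_fst A1 A2 s V \<tau>"
  unfolding theta_fst_def
  by (intro conjI allI ballI impI) (elim conjE, rule assms, assumption+)+

lemma theta_fstD:
  assumes "theta_fst A1 A2 s V \<tau>" "irrep A1 n \<pi>1" "irrep A2 m \<pi>2"
    and "T \<in> theta_hom A1 A2 s V \<tau> n \<pi>1 m \<pi>2"
  shows "irrep A2 m' \<pi>2' \<Longrightarrow> T' \<in> theta_hom A1 A2 s V \<tau> n \<pi>1 m' \<pi>2' \<Longrightarrow> T \<noteq> 0 \<Longrightarrow> T' \<noteq> 0 \<Longrightarrow>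
      irrep_isomorphic A2 m \<pi>2 m' \<pi>2'"
    and "T'' \<in> theta_hom A1 A2 s V \<tau> n \<pi>1 m \<pi>2 \<Longrightarrow> T'' \<noteq> 0 \<Longrightarrow> \<exists>c. T = fun_scale coord_scale c T''"
  using conjunct1[OF assms(1)[unfolded theta_fst_def], rule_format, of T n \<pi>1 m \<pi>2 T' m' \<pi>2']
    conjunct2[OF assms(1)[unfolded theta_fst_def], rule_format, of T n \<pi>1 m \<pi>2 T''] assms(2-4)
  by simp_all

text \<open>The coordinate swap \<open>sw1\<close> identifies the Hom spaces of \<open>V\<close>
  with those for the exchanged factors. The third theta condition is thereby the second one after
  the exchange, and the dimension bound occurs in both halves.\<close>

lemma theta_rep_iff_theta_fst:
  "theta_rep A1 A2 s V \<tau> \<longleftrightarrow> theta_fst A1 A2 s V \<tau> \<and> theta_fst A2 A1 s V \<tau>'"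
proof -
  interpret sw: group_pair_rep A2 A1 s V \<tau>' by (rule swapped)
  let ?H = "theta_hom A1 A2 s V \<tau>" and ?H' = "theta_hom A2 A1 s V \<tau>'"
  let ?dim = "\<lambda>n \<pi>1 m \<pi>2. vector_space.dim (fun_scale coord_scale) (?H n \<pi>1 m \<pi>2) \<le> 1"
  define sw1 :: "('v \<Rightarrow> nat \<times> nat \<Rightarrow> complex) \<Rightarrow> 'v \<Rightarrow> nat \<times> nat \<Rightarrow> complex"
    where "sw1 T = (\<lambda>v x. T v (snd x, fst x))" for T
  have sw1: "sw1 (sw1 T) = T" "sw1 T \<noteq> 0 \<longleftrightarrow> T \<noteq> 0"
    "sw1 (fun_scale coord_scale c T) = fun_scale coord_scale c (sw1 T)" for T c
    by (auto simp: sw1_def fun_eq_iff fun_scale_def)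
  have hom1: "sw1 T \<in> ?H' m \<pi>2 n \<pi>1" if "irrep A1 n \<pi>1" "irrep A2 m \<pi>2" "T \<in> ?H n \<pi>1 m \<pi>2" for n \<pi>1 m \<pi>2 T
    using theta_hom_swap[OF that] by (simp add: sw1_def)
  have hom2: "sw1 T \<in> ?H n \<pi>1 m \<pi>2" if "irrep A1 n \<pi>1" "irrep A2 m \<pi>2" "T \<in> ?H' m \<pi>2 n \<pi>1" for n \<pi>1 m \<pi>2 T
    using sw.theta_hom_swap[OF that(2,1,3)] by (simp add: sw1_def)
  have unfolded: "theta_rep A1 A2 s V \<tau> \<longleftrightarrow>
     (\<forall>n \<pi>1 m \<pi>2. irrep A1 n \<pi>1 \<longrightarrow> irrep A2 m \<pi>2 \<longrightarrow> ?dim n \<pi>1 m \<pi>2) \<and>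
     (\<forall>n \<pi>1 m \<pi>2 m' \<pi>2'. irrep A1 n \<pi>1 \<longrightarrow> irrep A2 m \<pi>2 \<longrightarrow> irrep A2 m' \<pi>2' \<longrightarrow>
        ?H n \<pi>1 m \<pi>2 \<noteq> {0} \<longrightarrow> ?H n \<pi>1 m' \<pi>2' \<noteq> {0} \<longrightarrow> irrep_isomorphic A2 m \<pi>2 m' \<pi>2') \<and>
     (\<forall>n \<pi>1 n' \<pi>1' m \<pi>2. irrep A1 n \<pi>1 \<longrightarrow> irrep A1 n' \<pi>1' \<longrightarrow> irrep A2 m \<pi>2 \<longrightarrow>
        ?H n \<pi>1 m \<pi>2 \<noteq> {0} \<longrightarrow> ?H n' \<pi>1' m \<pi>2 \<noteq> {0} \<longrightarrow> irrep_isomorphic A1 n \<pi>1 n' \<pi>1')"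
    unfolding theta_rep_def theta_rep_wrt_def Let_def
    using monoid_rep_axioms fin_dim by (simp only: UNIV_I simp_thms) blast
  show ?thesis
  proof
    assume L: "theta_rep A1 A2 s V \<tau>"
    note L = L[unfolded unfolded]
    note dim = conjunct1[OF L, rule_format] and fst = conjunct1[OF conjunct2[OF L], rule_format]
      and snd = conjunct2[OF conjunct2[OF L], rule_format]
    have nz: "?H n \<pi>1 m \<pi>2 \<noteq> {0}" if "T \<in> ?H n \<pi>1 m \<pi>2" "T \<noteq> 0" for n \<pi>1 m \<pi>2 T using that by auto
    have "theta_fst A1 A2 s V \<tau>"
    proof (rule theta_fstI)
      fix n \<pi>1 m \<pi>2 m' \<pi>2' T T'
      assume irr: "irrep A1 n \<pi>1" "irrep A2 m \<pi>2" "irrep A2 m' \<pi>2'"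
        and T: "T \<in> ?H n \<pi>1 m \<pi>2" "T' \<in> ?H n \<pi>1 m' \<pi>2'" "T \<noteq> 0" "T' \<noteq> 0"
      show "irrep_isomorphic A2 m \<pi>2 m' \<pi>2'" by (rule fst[OF irr nz[OF T(1,3)] nz[OF T(2,4)]])
    next
      fix n \<pi>1 m \<pi>2 T T'
      assume irr: "irrep A1 n \<pi>1" "irrep A2 m \<pi>2"
        and T: "T \<in> ?H n \<pi>1 m \<pi>2" "T' \<in> ?H n \<pi>1 m \<pi>2" "T' \<noteq> 0"
      show "\<exists>c. T = fun_scale coord_scale c T'"
        using dim[OF irr] T unfolding theta_hom_dim[OF irr] by blast
    qed
    moreover have "theta_fst A2 A1 s V \<tau>'"
    proof (rule sw.theta_fstI)
      fix m \<pi>2 n \<pi>1 n' \<pi>1' T T'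
      assume irr: "irrep A2 m \<pi>2" "irrep A1 n \<pi>1" "irrep A1 n' \<pi>1'"
        and T: "T \<in> ?H' m \<pi>2 n \<pi>1" "T' \<in> ?H' m \<pi>2 n' \<pi>1'" "T \<noteq> 0" "T' \<noteq> 0"
      show "irrep_isomorphic A1 n \<pi>1 n' \<pi>1'"
        by (rule snd[OF irr(2,3,1) nz[OF hom2[OF irr(2,1) T(1)]] nz[OF hom2[OF irr(3,1) T(2)]]])
          (simp_all only: sw1(2) T(3,4) not_False_eq_True)
    next
      fix m \<pi>2 n \<pi>1 T T'
      assume irr: "irrep A2 m \<pi>2" "irrep A1 n \<pi>1"
        and T: "T \<in> ?H' m \<pi>2 n \<pi>1" "T' \<in> ?H' m \<pi>2 n \<pi>1" "T' \<noteq> 0"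
      have "sw1 T' \<noteq> 0" by (simp only: sw1(2) T(3) not_False_eq_True)
      then obtain c where "sw1 T = fun_scale coord_scale c (sw1 T')"
        using dim[OF irr(2,1)] hom2[OF irr(2,1) T(1)] hom2[OF irr(2,1) T(2)]
        unfolding theta_hom_dim[OF irr(2,1)] by blast
      then show "\<exists>c. T = fun_scale coord_scale c T'" by (metis sw1(1,3))
    qed
    ultimately show "theta_fst A1 A2 s V \<tau> \<and> theta_fst A2 A1 s V \<tau>'" ..
  next
    assume R: "theta_fst A1 A2 s V \<tau> \<and> theta_fst A2 A1 s V \<tau>'"
    show "theta_rep A1 A2 s V \<tau>"
      unfolding unfolded
    proof (intro conjI allI impI)
      fix n \<pi>1 m \<pi>2 assume irr: "irrep A1 n \<pi>1" "irrep A2 m \<pi>2"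
      show "?dim n \<pi>1 m \<pi>2"
        unfolding theta_hom_dim[OF irr] using theta_fstD(2)[OF conjunct1[OF R] irr] by blast
    next
      fix n \<pi>1 m \<pi>2 m' \<pi>2'
      assume irr: "irrep A1 n \<pi>1" "irrep A2 m \<pi>2" "irrep A2 m' \<pi>2'"
        and ne: "?H n \<pi>1 m \<pi>2 \<noteq> {0}" "?H n \<pi>1 m' \<pi>2' \<noteq> {0}"
      obtain T T' where T: "T \<in> ?H n \<pi>1 m \<pi>2" "T \<noteq> 0" "T' \<in> ?H n \<pi>1 m' \<pi>2'" "T' \<noteq> 0"
        using ne unfolding theta_hom_nontrivial[OF irr(1,2)] theta_hom_nontrivial[OF irr(1,3)] by blast
      show "irrep_isomorphic A2 m \<pi>2 m' \<pi>2'"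
        by (rule theta_fstD(1)[OF conjunct1[OF R] irr(1,2) T(1) irr(3) T(3,2,4)])
    next
      fix n \<pi>1 n' \<pi>1' m \<pi>2
      assume irr: "irrep A1 n \<pi>1" "irrep A1 n' \<pi>1'" "irrep A2 m \<pi>2"
        and ne: "?H n \<pi>1 m \<pi>2 \<noteq> {0}" "?H n' \<pi>1' m \<pi>2 \<noteq> {0}"
      obtain T T' where T: "T \<in> ?H n \<pi>1 m \<pi>2" "T \<noteq> 0" "T' \<in> ?H n' \<pi>1' m \<pi>2" "T' \<noteq> 0"
        using ne unfolding theta_hom_nontrivial[OF irr(1,3)] theta_hom_nontrivial[OF irr(2,3)] by blast
      show "irrep_isomorphic A1 n \<pi>1 n' \<pi>1'"
        by (rule sw.theta_fstD(1)[OF conjunct2[OF R] irr(3,1) hom1[OF irr(1,3) T(1)] irr(2) hom1[OF irr(2,3) T(3)]])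
          (simp_all only: sw1(2) T(2,4) not_False_eq_True)
    qed
  qed
qed

section \<open>Theta representations and commuting endomorphisms\<close>

lemma mutually_commuting_swap:
  "mutually_commuting A2 A1 s V \<tau>' \<longleftrightarrow> mutually_commuting A1 A2 s V \<tau>"
  unfolding mutually_commuting_def by auto

text \<open>On every quotient \<pi>1 \<otimes> \<pi>2 of \<open>V\<close>, the endomorphism
  \<open>X\<close> acts on the second tensor factor only and \<open>Y\<close> on the first only, by
  \<open>theta_fst_factor\<close> and its mirror image. These actions commute, so all such quotient
  maps kill \<open>X (Y v) - Y (X v)\<close>. Their common kernel is \<open>{0}\<close>, because
  \<open>exists_tensor_hom\<close> provides a quotient that is nonzero on any given nonzero
  subrepresentation.\<close>

lemma theta_rep_imp_mutually_commuting:
  assumes "theta_rep A1 A2 s V \<tau>"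
  shows "mutually_commuting A1 A2 s V \<tau>"
  unfolding mutually_commuting_def
proof (intro allI impI ballI, rule ccontr)
  interpret sw: group_pair_rep A2 A1 s V \<tau>' by (rule swapped)
  fix X Y v
  assume X: "intertwiner A1 s V \<rho>1 s V \<rho>1 X" and Y: "intertwiner A2 s V \<rho>2 s V \<rho>2 Y"
    and v: "v \<in> V" and neq: "X (Y v) \<noteq> Y (X v)"
  have th: "theta_fst A1 A2 s V \<tau>" "theta_fst A2 A1 s V \<tau>'"
    using assms by (simp_all add: theta_rep_iff_theta_fst)
  note XV = intertwiner_in[OF X] and YV = intertwiner_in[OF Y]
  let ?w = "X (Y v) - Y (X v)"
  have w: "?w \<in> V" using v XV YV by (simp add: diff_in)
  have T0: "T ?w = 0" if irr: "irrep A1 n \<pi>1" "irrep A2 m \<pi>2" and T: "tensor_hom n \<pi>1 m \<pi>2 T" for n \<pi>1 m \<pi>2 T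
  proof -
    obtain z where z: "\<And>v i l. v \<in> V \<Longrightarrow> T (X v) (i, l) = (\<Sum>q<m. z l q * T v (i, q))"
      using theta_fst_factor[OF th(1) irr T X] by blast
    have "intertwiner A2 s V sw.\<rho>1 s V sw.\<rho>1 Y" using Y by simp
    then obtain z' where "\<And>v l i. v \<in> V \<Longrightarrow> (\<lambda>x. T (Y v) (snd x, fst x)) (l, i) =
        (\<Sum>p<n. z' i p * (\<lambda>x. T v (snd x, fst x)) (l, p))"
      using sw.theta_fst_factor[OF th(2) irr(2,1) tensor_hom_swap[OF irr T]] by blast
    then have z': "\<And>v l i. v \<in> V \<Longrightarrow> T (Y v) (i, l) = (\<Sum>p<n. z' i p * T v (p, l))" by simp
    have "T (X (Y v)) (i, l) = T (Y (X v)) (i, l)" for i l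
    proof -
      have "T (X (Y v)) (i, l) = (\<Sum>q<m. \<Sum>p<n. z l q * (z' i p * T v (p, q)))"
        using v YV by (simp add: z z' sum_distrib_left)
      also have "\<dots> = (\<Sum>p<n. \<Sum>q<m. z' i p * (z l q * T v (p, q)))"
        by (subst sum.swap) (simp add: ac_simps)
      also have "\<dots> = T (Y (X v)) (i, l)"
        using v XV by (simp add: z z' sum_distrib_left)
      finally show ?thesis .
    qed
    then have "T (X (Y v)) = T (Y (X v))" by (auto simp: fun_eq_iff)
    then show ?thesis using v XV YV by (simp add: intertwiner_diff[OF T])
  qed
  define K where "K = {w \<in> V. \<forall>n \<pi>1 m \<pi>2 T. irrep A1 n \<pi>1 \<and> irrep A2 m \<pi>2 \<and> tensor_hom n \<pi>1 m \<pi>2 T \<longrightarrow> T w = 0}"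
  have wK: "?w \<in> K" using w T0 by (auto simp: K_def)
  have K: "monoid_rep (A1 \<times>\<times> A2) s K \<tau>"
  proof (rule sub_rep)
    have sub0: "T 0 = 0" if "tensor_hom n \<pi>1 m \<pi>2 T" for n \<pi>1 m \<pi>2 T
      using intertwiner_zero[OF that zero_in] .
    show "VS.subspace K"
    proof (rule VS.subspaceI)
      fix c x assume "x \<in> K"
      then have x: "x \<in> V" and T0: "T x = 0" if "irrep A1 n \<pi>1" "irrep A2 m \<pi>2" "tensor_hom n \<pi>1 m \<pi>2 T"
        for n \<pi>1 m \<pi>2 T using that by (auto simp: K_def)
      have "T (s c x) = 0" if "irrep A1 n \<pi>1" "irrep A2 m \<pi>2" "tensor_hom n \<pi>1 m \<pi>2 T" for n \<pi>1 m \<pi>2 T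
        using intertwiner_scale[OF that(3), of x c] \<open>x \<in> K\<close> T0[OF that]
        by (simp add: K_def coord.scale_zero_right del: coord.scale_eq_0_iff)
      then show "s c x \<in> K" using \<open>x \<in> K\<close> scale_in unfolding K_def by blast
    qed (auto simp: K_def zero_in add_in sub0 intertwiner_add)
    show "\<tau> a w \<in> K" if a: "a \<in> carrier (A1 \<times>\<times> A2)" and w: "w \<in> K" for a w
    proof -
      have "T (\<tau> a w) = 0" if irr: "irrep A1 n \<pi>1" "irrep A2 m \<pi>2" and T: "tensor_hom n \<pi>1 m \<pi>2 T" for n \<pi>1 m \<pi>2 T
      proof -
        interpret R: monoid_rep "A1 \<times>\<times> A2" coord_scale "coord_space ({..<n} \<times> {..<m})" "tensor_rep n \<pi>1 m \<pi>2"
          by (rule monoid_rep_tensor) (rule irr[THEN irreducible_rep_rep])+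
        have "w \<in> V" "T w = 0" using w irr T by (auto simp: K_def)
        then show ?thesis using intertwiner_commutes[OF T a] R.map_zero[OF a] by simp
      qed
      then show ?thesis using maps[OF a] w unfolding K_def by blast
    qed
  qed (auto simp: K_def)
  have KV: "K \<subseteq> V" by (auto simp: K_def)
  interpret V1: monoid_rep A1 s V \<rho>1 by (rule rep1)
  interpret K: monoid_rep "A1 \<times>\<times> A2" s K \<tau> by (rule K)
  have "monoid_rep A1 s K \<rho>1"
    by (rule V1.sub_rep) (use K.subspace KV K.maps in auto)
  moreover have "K \<noteq> {0}" using wK neq by auto
  ultimately obtain n \<pi>1 S u where S: "irrep A1 n \<pi>1"
    "intertwiner A1 s V \<rho>1 coord_scale (coord_space {..<n}) \<pi>1 S" "u \<in> K" "S u \<noteq> 0"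
    using exists_irrep_quotient[OF A1.group_axioms finite1 rep1 fin_dim _ KV] by blast
  obtain m \<pi>2 T x where "irrep A2 m \<pi>2" "tensor_hom n \<pi>1 m \<pi>2 T" "x \<in> K" "T x \<noteq> 0"
    using exists_tensor_hom[OF K KV S] by blast
  then show False using S(1) by (auto simp: K_def)
qed

text \<open>The projection onto an equivariant complement of \<open>ker T'\<close> commutes with the \<open>A1\<close>-endomorphism
  \<open>X\<close> that lifts \<open>T (\<cdot>, l)\<close> through the \<open>A1\<close>-map \<open>T' (\<cdot>, l')\<close>.\<close>

lemma mutually_commuting_kernel:
  assumes comm: "mutually_commuting A1 A2 s V \<tau>"
    and irr: "irrep A1 n \<pi>1" "irrep A2 m \<pi>2" "irrep A2 m' \<pi>2'"
    and T: "tensor_hom n \<pi>1 m \<pi>2 T" and T': "tensor_hom n \<pi>1 m' \<pi>2' T'" "v' \<in> V" "T' v' \<noteq> 0"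
    and w: "w \<in> V" "T' w = 0"
  shows "T w = 0"
proof -
  interpret V1: monoid_rep A1 s V \<rho>1 by (rule rep1)
  interpret P: monoid_rep A1 coord_scale "coord_space {..<n}" \<pi>1 by (rule irreducible_rep_rep) (rule irr)
  let ?K = "{v \<in> V. T' v = 0}"
  have KV: "?K \<subseteq> V" by auto
  have K: "monoid_rep (A1 \<times>\<times> A2) s ?K \<tau>"
    by (rule kernel_rep[OF T'(1) monoid_rep_tensor]) (rule irr[THEN irreducible_rep_rep])+
  obtain q where q: "intertwiner (A1 \<times>\<times> A2) s V \<tau> s V \<tau> q" "\<And>v. v \<in> V \<Longrightarrow> q v \<in> ?K" "\<And>v. v \<in> ?K \<Longrightarrow> q v = v"
    using Maschke[OF group_prod finite_prod monoid_rep_axioms K KV] by blast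
  define p where "p v = v - q v" for v
  have pV: "p v \<in> V" if "v \<in> V" for v using that intertwiner_in[OF q(1)] by (simp add: p_def diff_in)
  have "intertwiner A2 s V \<rho>2 s V \<rho>2 p"
    by (rule intertwinerI)
      (use pV in \<open>auto simp: p_def intertwiner_add[OF q(1)] intertwiner_scale[OF q(1)] intertwiner_commutes[OF q(1)]
        intertwiner_in[OF q(1)] VS.scale_right_diff_distrib map_diff\<close>)
  then have Xp: "X (p v) = p (X v)" if "intertwiner A1 s V \<rho>1 s V \<rho>1 X" "v \<in> V" for X v
    using comm that unfolding mutually_commuting_def by blast
  have T'p: "T' (p v) = T' v" if "v \<in> V" for v
    using that intertwiner_in[OF q(1)] q(2)[OF that] by (simp add: p_def intertwiner_diff[OF T'(1)])
  obtain i0 l' where l': "T' v' (i0, l') \<noteq> 0" using T'(3) by (auto simp: fun_eq_iff)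
  \<comment> \<open>A nonzero column of \<open>T'\<close>. It maps \<open>V\<close> onto a single
    copy of \<pi>1, through which columns of \<open>T\<close> can be lifted.\<close>
  define S' where "S' v = (\<lambda>i. T' v (i, l'))" for v
  have S': "intertwiner A1 s V \<rho>1 coord_scale (coord_space {..<n}) \<pi>1 S'"
    using slice_fst_in[OF intertwiner_in[OF T'(1)]]
    by (intro intertwinerI)
      (auto simp: S'_def fun_eq_iff intertwiner_add[OF T'(1)] intertwiner_scale[OF T'(1)]
        coord_scale_apply tensor_hom_fst[OF irr(1,3) T'(1)])
  have "S' v' \<noteq> 0" using l' by (auto simp: S'_def fun_eq_iff)
  then have onto: "S' ` V = coord_space {..<n}"
    by (rule intertwiner_onto_irreducible[OF rep1 irr(1) S' T'(2)])
  let ?L = "{v \<in> V. S' v = 0}"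
  have "monoid_rep A1 s ?L \<rho>1" by (rule V1.kernel_rep[OF S' P.monoid_rep_axioms])
  then obtain r where r: "intertwiner A1 s V \<rho>1 s V \<rho>1 r" "\<And>v. v \<in> V \<Longrightarrow> r v \<in> ?L" "\<And>v. v \<in> ?L \<Longrightarrow> r v = v"
    using Maschke[OF A1.group_axioms finite1 rep1] by blast
  have rV: "v \<in> V \<Longrightarrow> r v \<in> V" for v using r(2) by auto
  have wd: "v - r v = u - r u" if "v \<in> V" "u \<in> V" "S' v = S' u" for u v
  proof -
    have "v - u \<in> ?L" using that by (simp add: diff_in V1.intertwiner_diff[OF S'])
    then have "r v - r u = v - u" using r(3)[of "v - u"] that by (simp add: V1.intertwiner_diff[OF r(1)])
    then show ?thesis by (simp add: algebra_simps)
  qed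
  define g where "g x = (SOME v. v \<in> V \<and> S' v = x)" for x
  have g: "g x \<in> V" "S' (g x) = x" if "x \<in> coord_space {..<n}" for x
  proof -
    have "\<exists>v. v \<in> V \<and> S' v = x" using that onto by (metis imageE)
    then show "g x \<in> V" "S' (g x) = x" unfolding g_def by (metis (mono_tags, lifting) someI_ex)+
  qed
  \<comment> \<open>\<open>h\<close> is an \<open>A1\<close>-equivariant section of
    \<open>S'\<close>. Subtracting the equivariant projection \<open>r\<close> onto the kernel of
    \<open>S'\<close> makes the result depend on \<open>S' (g x)\<close> only, whatever the choice
    of \<open>g x\<close>.\<close>
  define h where "h x = g x - r (g x)" for x
  have hV: "h x \<in> V" if "x \<in> coord_space {..<n}" for x using g(1)[OF that] rV by (simp add: h_def diff_in)
  have S'h: "S' (h x) = x" if "x \<in> coord_space {..<n}" for x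
    using g[OF that] r(2)[of "g x"] rV by (simp add: h_def V1.intertwiner_diff[OF S'])
  have heq: "h x = v - r v" if "v \<in> V" "S' v = x" for x v
    unfolding h_def using that g[of x] intertwiner_in[OF S', of v] by (intro wd) auto
  have h: "intertwiner A1 coord_scale (coord_space {..<n}) \<pi>1 s V \<rho>1 h"
  proof (rule intertwinerI)
    fix x assume x: "x \<in> coord_space {..<n}"
    note gx = g[OF x] rV[OF g(1)[OF x]]
    show "h x \<in> V" by (rule hV[OF x])
    show "h (x + y) = h x + h y" if y: "y \<in> coord_space {..<n}" for y
    proof -
      note gy = g[OF y] rV[OF g(1)[OF y]]
      have "h (x + y) = (g x + g y) - r (g x + g y)"
        using gx gy by (intro heq) (simp_all add: add_in intertwiner_add[OF S'])
      then show ?thesis using gx gy by (simp add: h_def intertwiner_add[OF r(1)])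
    qed
    show "h (coord_scale c x) = s c (h x)" for c
    proof -
      have "h (coord_scale c x) = s c (g x) - r (s c (g x))"
        using gx by (intro heq) (simp_all add: scale_in intertwiner_scale[OF S'])
      then show ?thesis using gx by (simp add: h_def intertwiner_scale[OF r(1)] VS.scale_right_diff_distrib)
    qed
    show "h (\<pi>1 a x) = \<rho>1 a (h x)" if a: "a \<in> carrier A1" for a
    proof -
      have "h (\<pi>1 a x) = \<rho>1 a (g x) - r (\<rho>1 a (g x))"
        using gx a by (intro heq) (simp_all add: V1.maps intertwiner_commutes[OF S'])
      then show ?thesis using gx a by (simp add: h_def intertwiner_commutes[OF r(1)] V1.map_diff)
    qed
  qed
  have "T w (i, l) = 0" for i l
  proof -
    define S where "S v = (\<lambda>i. T v (i, l))" for v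
    have S: "intertwiner A1 s V \<rho>1 coord_scale (coord_space {..<n}) \<pi>1 S"
      using slice_fst_in[OF intertwiner_in[OF T]]
      by (intro intertwinerI)
        (auto simp: S_def fun_eq_iff intertwiner_add[OF T] intertwiner_scale[OF T]
          coord_scale_apply tensor_hom_fst[OF irr(1,2) T])
    define X where "X v = h (S v)" for v
    have X: "intertwiner A1 s V \<rho>1 s V \<rho>1 X"
      unfolding X_def by (rule intertwiner_compose[OF S h])
    have XV: "X w \<in> V" using intertwiner_in[OF X w(1)] .
    \<comment> \<open>Since \<open>w\<close> lies in the kernel of \<open>T'\<close>,
      \<open>p w = 0\<close>. As \<open>X\<close> commutes with \<open>p\<close>, also
      \<open>p (X w) = 0\<close>, so \<open>T'\<close> kills \<open>X w\<close>. Applying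
      \<open>S'\<close> gives \<open>S w = 0\<close>, because \<open>X\<close> lifts
      \<open>S\<close> through \<open>S'\<close>.\<close>
    have "q w = w" using q(3) w by blast
    then have "X (p w) = 0" using intertwiner_zero[OF X zero_in] by (simp add: p_def)
    then have "p (X w) = 0" using Xp[OF X w(1)] by simp
    then have "T' (X w) = 0" using T'p[OF XV] intertwiner_zero[OF T'(1) zero_in] by simp
    then have "S' (X w) = 0" by (simp add: S'_def fun_eq_iff)
    moreover have "S' (X w) = S w" using S'h intertwiner_in[OF S w(1)] by (simp add: X_def)
    ultimately show ?thesis by (simp add: S_def fun_eq_iff)
  qed
  then show ?thesis by (auto simp: fun_eq_iff)
qed

text \<open>\<open>T\<close> vanishes on the kernel of \<open>T'\<close>, so each of its columns is
  a combination of columns of \<open>T'\<close>; the coefficients are the matrix of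
  \<open>U\<close>. Equivariance of \<open>U\<close> is read off from row 0, because
  \<open>T'\<close> is onto and so takes every value \<open>unit_vec 0\<close> \<otimes>
  \<open>t\<close>.\<close>

lemma mutually_commuting_relates:
  assumes comm: "mutually_commuting A1 A2 s V \<tau>"
    and irr: "irrep A1 n \<pi>1" "irrep A2 m \<pi>2" "irrep A2 m' \<pi>2'"
    and T: "tensor_hom n \<pi>1 m \<pi>2 T" and T': "tensor_hom n \<pi>1 m' \<pi>2' T'" "v' \<in> V" "T' v' \<noteq> 0"
  obtains U where
    "intertwiner A2 coord_scale (coord_space {..<m'}) \<pi>2' coord_scale (coord_space {..<m}) \<pi>2 U"
    "\<And>v i l. v \<in> V \<Longrightarrow> T v (i, l) = U (\<lambda>q. T' v (i, q)) l"
proof -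
  let ?I = "{..<n} \<times> {..<m'}"
  interpret V1: monoid_rep A1 s V \<rho>1 by (rule rep1)
  note ker = mutually_commuting_kernel[OF comm irr T T']
  have "\<exists>z. \<forall>v\<in>V. \<forall>i. T v (i, l) = (\<Sum>q<m'. z q * T' v (i, q))" for l
  proof -
    let ?S = "\<lambda>v i. T v (i, l)"
    have S: "intertwiner A1 s V \<rho>1 coord_scale (coord_space {..<n}) \<pi>1 ?S"
      using slice_fst_in[OF intertwiner_in[OF T]]
      by (intro intertwinerI)
        (auto simp: fun_eq_iff intertwiner_add[OF T] intertwiner_scale[OF T]
          coord_scale_apply tensor_hom_fst[OF irr(1,2) T])
    have S0: "?S v = 0" if "v \<in> V" "T' v = 0" for v using ker[OF that] by (simp add: fun_eq_iff)
    obtain z where "\<And>v i. v \<in> V \<Longrightarrow> ?S v i = (\<Sum>q<m'. z q * T' v (i, q))"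
      using hom_factors_through_tensor_hom[OF irr(1,3) T' S S0] by blast
    then show ?thesis by blast
  qed
  then obtain z where z: "\<And>v i l. v \<in> V \<Longrightarrow> T v (i, l) = (\<Sum>q<m'. z l q * T' v (i, q))" by metis
  define U where "U t = (\<lambda>l. if l < m then \<Sum>q<m'. z l q * t q else 0)" for t
  have TU: "T v (i, l) = U (\<lambda>q. T' v (i, q)) l" if "v \<in> V" for v i l
    using z[OF that] intertwiner_in[OF T that] by (auto simp: U_def coord_space_def)
  have n: "0 < n" using irr(1) coord_space_nontrivial by (auto simp: irreducible_rep_def)
  have onto: "T' ` V = coord_space ?I" by (rule tensor_hom_onto[OF irr(1,3) T'])
  have "intertwiner A2 coord_scale (coord_space {..<m'}) \<pi>2' coord_scale (coord_space {..<m}) \<pi>2 U"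
  proof (rule intertwinerI)
    fix t assume t: "t \<in> coord_space {..<m'}"
    show "U t \<in> coord_space {..<m}" by (simp add: U_def coord_space_def)
    show "U (t + t') = U t + U t'" for t'
      by (auto simp: U_def fun_eq_iff algebra_simps sum.distrib)
    show "U (coord_scale c t) = coord_scale c (U t)" for c
      by (auto simp: U_def fun_eq_iff coord_scale_apply sum_distrib_left ac_simps)
    fix b assume b: "b \<in> carrier A2"
    have "tensor_vec (unit_vec 0) t \<in> coord_space ?I"
      using t n by (auto simp: tensor_vec_def coord_space_def unit_vec_def)
    then obtain v where v: "v \<in> V" "T' v = tensor_vec (unit_vec 0) t" using onto by (metis imageE)
    have v0: "(\<lambda>q. T' v (0, q)) = t" by (simp add: v(2) tensor_vec_def unit_vec_def)
    have bv: "\<rho>2 b v \<in> V" using maps b v by simp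
    have "U (\<pi>2' b t) l = T (\<rho>2 b v) (0, l)" for l
      using TU[OF bv] by (simp add: tensor_hom_snd[OF irr(1,3) T'(1) b v(1)] v0)
    also have "T (\<rho>2 b v) (0, l) = \<pi>2 b (U t) l" for l
      by (simp add: tensor_hom_snd[OF irr(1,2) T b v(1)] TU[OF v(1)] v0)
    finally show "U (\<pi>2' b t) = \<pi>2 b (U t)" by blast
  qed
  with TU that show ?thesis by blast
qed

text \<open>The map \<open>U\<close> between the second factors does both: being nonzero it is an
  isomorphism, and for equal second factors it is a scalar.\<close>

lemma mutually_commuting_imp_theta_fst:
  assumes comm: "mutually_commuting A1 A2 s V \<tau>"
  shows "theta_fst A1 A2 s V \<tau>"
  unfolding theta_fst_def
proof (intro conjI allI ballI impI)
  fix n \<pi>1 m \<pi>2 m' \<pi>2' T T'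
  assume T: "T \<in> theta_hom A1 A2 s V \<tau> n \<pi>1 m \<pi>2" and T': "T' \<in> theta_hom A1 A2 s V \<tau> n \<pi>1 m' \<pi>2'"
    and "irrep A1 n \<pi>1 \<and> irrep A2 m \<pi>2 \<and> irrep A2 m' \<pi>2' \<and> T \<noteq> 0 \<and> T' \<noteq> 0"
  then have irr: "irrep A1 n \<pi>1" "irrep A2 m \<pi>2" "irrep A2 m' \<pi>2'" and ne: "T \<noteq> 0" "T' \<noteq> 0" by auto
  obtain v where v: "v \<in> V" "T v \<noteq> 0"
    using ne(1) T unfolding theta_hom_def by (subst (asm) rep_hom_nonzero_iff) auto
  obtain v' where v': "v' \<in> V" "T' v' \<noteq> 0"
    using ne(2) T' unfolding theta_hom_def by (subst (asm) rep_hom_nonzero_iff) auto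
  have h: "tensor_hom n \<pi>1 m \<pi>2 T" "tensor_hom n \<pi>1 m' \<pi>2' T'" using T T' by (auto simp: theta_hom_iff)
  obtain U where
    U: "intertwiner A2 coord_scale (coord_space {..<m}) \<pi>2 coord_scale (coord_space {..<m'}) \<pi>2' U"
      "\<And>v i l. v \<in> V \<Longrightarrow> T' v (i, l) = U (\<lambda>q. T v (i, q)) l"
    using mutually_commuting_relates[OF comm irr(1,3,2) h(2,1) v] by blast
  obtain i l where "T' v' (i, l) \<noteq> 0" using v'(2) by (auto simp: fun_eq_iff)
  then have "U (\<lambda>q. T v' (i, q)) \<noteq> 0" using U(2)[OF v'(1)] by (auto simp: fun_eq_iff)
  moreover have "(\<lambda>q. T v' (i, q)) \<in> coord_space {..<m}"
    using slice_snd_in[OF intertwiner_in[OF h(1) v'(1)]] .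
  ultimately show "irrep_isomorphic A2 m \<pi>2 m' \<pi>2'"
    using rep_isomorphicI[OF irr(2,3) U(1)] by blast
next
  fix n \<pi>1 m \<pi>2 T T'
  assume T: "T \<in> theta_hom A1 A2 s V \<tau> n \<pi>1 m \<pi>2" and T': "T' \<in> theta_hom A1 A2 s V \<tau> n \<pi>1 m \<pi>2"
    and "irrep A1 n \<pi>1 \<and> irrep A2 m \<pi>2 \<and> T' \<noteq> 0"
  then have irr: "irrep A1 n \<pi>1" "irrep A2 m \<pi>2" and ne: "T' \<noteq> 0" by auto
  obtain v' where v': "v' \<in> V" "T' v' \<noteq> 0"
    using ne T' unfolding theta_hom_def by (subst (asm) rep_hom_nonzero_iff) auto
  have h: "tensor_hom n \<pi>1 m \<pi>2 T" "tensor_hom n \<pi>1 m \<pi>2 T'" using T T' by (auto simp: theta_hom_iff)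
  obtain U where
    U: "intertwiner A2 coord_scale (coord_space {..<m}) \<pi>2 coord_scale (coord_space {..<m}) \<pi>2 U"
      "\<And>v i l. v \<in> V \<Longrightarrow> T v (i, l) = U (\<lambda>q. T' v (i, q)) l"
    using mutually_commuting_relates[OF comm irr(1,2,2) h v'] by blast
  obtain c where c: "\<And>t. t \<in> coord_space {..<m} \<Longrightarrow> U t = coord_scale c t"
    using Schur_scalar[OF irr(2) U(1)] by blast
  have "T v (i, l) = c * T' v (i, l)" for v i l
  proof (cases "v \<in> V")
    case True
    then show ?thesis
      using U(2) c[OF slice_snd_in[OF intertwiner_in[OF h(2)]]] by (simp add: coord_scale_apply)
  next
    case False
    then show ?thesis using T T' by (simp add: theta_hom_iff)
  qed
  then have "T = fun_scale coord_scale c T'" by (auto simp: fun_eq_iff fun_scale_def)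
  then show "\<exists>c. T = fun_scale coord_scale c T'" ..
qed

theorem theta_rep_iff_mutually_commuting:
  "theta_rep A1 A2 s V \<tau> \<longleftrightarrow> mutually_commuting A1 A2 s V \<tau>"
proof
  assume "mutually_commuting A1 A2 s V \<tau>"
  then show "theta_rep A1 A2 s V \<tau>"
    unfolding theta_rep_iff_theta_fst
    using mutually_commuting_imp_theta_fst group_pair_rep.mutually_commuting_imp_theta_fst[OF swapped]
      mutually_commuting_swap by blast
qed (rule theta_rep_imp_mutually_commuting)

end

section \<open>Induction from a fibre product of groups\<close>

lemmas DirProd_simps = carrier_DirProd mult_DirProd mult_DirProd' one_DirProd inv_DirProd

text \<open>By Goursat's lemma, a subgroup \<open>K\<close> of a product that projects onto both
  factors is the fibre product of an isomorphism between \<open>H1\<close> modulo \<open>N1\<close>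
  and \<open>H2\<close> modulo \<open>N2\<close>, with \<open>N1\<close> and \<open>N2\<close> as
  defined below. So no such isomorphism has to be carried along.\<close>

locale fibre_group_rep = H1: group H1 + H2: group H2 +
    W: monoid_rep "(H1 \<times>\<times> H2)\<lparr>carrier := K\<rparr>" s W \<rho>
  for H1 :: "('a, 'm) monoid_scheme" and H2 :: "('b, 'k) monoid_scheme" and K :: "('a \<times> 'b) set"
    and s :: "complex \<Rightarrow> 'w::ab_group_add \<Rightarrow> 'w" and W :: "'w set" and \<rho> :: "'a \<times> 'b \<Rightarrow> 'w \<Rightarrow> 'w" +
  assumes subgroup_K: "subgroup K (H1 \<times>\<times> H2)"
    and onto_fst: "h1 \<in> carrier H1 \<Longrightarrow> \<exists>h2. (h1, h2) \<in> K"
    and onto_snd: "h2 \<in> carrier H2 \<Longrightarrow> \<exists>h1. (h1, h2) \<in> K"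
    and finite1: "finite (carrier H1)" and finite2: "finite (carrier H2)" and fin_dim: "finite_dim s W"
begin

abbreviation "G \<equiv> H1 \<times>\<times> H2"
abbreviation "J \<equiv> ind_space G K W \<rho>"
abbreviation "act \<equiv> ind_action G"

definition N1 :: "'a set" where "N1 = {h. (h, \<one>\<^bsub>H2\<^esub>) \<in> K}"
definition N2 :: "'b set" where "N2 = {h. (\<one>\<^bsub>H1\<^esub>, h) \<in> K}"

sublocale G: group G by (rule DirProd_group) (rule H1.group_axioms H2.group_axioms)+

lemma K_in: "\<kappa> \<in> K \<Longrightarrow> \<kappa> \<in> carrier G"
  and K_mult: "\<kappa> \<in> K \<Longrightarrow> \<kappa>' \<in> K \<Longrightarrow> \<kappa> \<otimes>\<^bsub>G\<^esub> \<kappa>' \<in> K"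
  and K_inv: "\<kappa> \<in> K \<Longrightarrow> inv\<^bsub>G\<^esub> \<kappa> \<in> K" and K_one: "\<one>\<^bsub>G\<^esub> \<in> K"
  using subgroup.mem_carrier[OF subgroup_K] subgroup.m_closed[OF subgroup_K]
    subgroup.m_inv_closed[OF subgroup_K] subgroup.one_closed[OF subgroup_K] by auto

lemma K_mult_left_iff: "\<kappa> \<in> K \<Longrightarrow> x \<in> carrier G \<Longrightarrow> \<kappa> \<otimes>\<^bsub>G\<^esub> x \<in> K \<longleftrightarrow> x \<in> K"
  using K_mult[of "inv\<^bsub>G\<^esub> \<kappa>" "\<kappa> \<otimes>\<^bsub>G\<^esub> x"] K_mult[of \<kappa> x] K_inv[of \<kappa>] K_in[of \<kappa>]
  by (auto simp: G.m_assoc[symmetric] simp del: DirProd_simps)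

lemma K_mult_right_iff: "\<kappa> \<in> K \<Longrightarrow> x \<in> carrier G \<Longrightarrow> x \<otimes>\<^bsub>G\<^esub> \<kappa> \<in> K \<longleftrightarrow> x \<in> K"
  using K_mult[of "x \<otimes>\<^bsub>G\<^esub> \<kappa>" "inv\<^bsub>G\<^esub> \<kappa>"] K_mult[of x \<kappa>] K_inv[of \<kappa>] K_in[of \<kappa>]
  by (auto simp: G.m_assoc simp del: DirProd_simps)

lemma K_sub: "K \<subseteq> carrier G" using K_in by blast

lemma finite_G: "finite (carrier G)"
  using finite1 finite2 by (simp add: DirProd_def)

lemma finite_K: "finite K"
  using finite_subset[OF K_sub finite_G] .

lemma W_maps: "\<kappa> \<in> K \<Longrightarrow> w \<in> W \<Longrightarrow> \<rho> \<kappa> w \<in> W"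
  and W_add: "\<kappa> \<in> K \<Longrightarrow> w \<in> W \<Longrightarrow> w' \<in> W \<Longrightarrow> \<rho> \<kappa> (w + w') = \<rho> \<kappa> w + \<rho> \<kappa> w'"
  and W_scale: "\<kappa> \<in> K \<Longrightarrow> w \<in> W \<Longrightarrow> \<rho> \<kappa> (s c w) = s c (\<rho> \<kappa> w)"
  and W_one: "w \<in> W \<Longrightarrow> \<rho> \<one>\<^bsub>G\<^esub> w = w"
  and W_mult: "\<kappa> \<in> K \<Longrightarrow> \<kappa>' \<in> K \<Longrightarrow> w \<in> W \<Longrightarrow> \<rho> (\<kappa> \<otimes>\<^bsub>G\<^esub> \<kappa>') w = \<rho> \<kappa> (\<rho> \<kappa>' w)"
  using W.maps W.map_add W.map_scale W.map_one W.map_mult by simp_all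

lemma W_inv: "\<kappa> \<in> K \<Longrightarrow> w \<in> W \<Longrightarrow> \<rho> (inv\<^bsub>G\<^esub> \<kappa>) (\<rho> \<kappa> w) = w"
  using W_mult[OF K_inv[of \<kappa>], of \<kappa> w] K_in[of \<kappa>] by (simp add: W_one del: DirProd_simps)

sublocale JR: monoid_rep G "fun_scale s" J act
  by (rule monoid_rep_ind[OF G.is_monoid K_sub W.monoid_rep_axioms])

lemma J_in: "\<phi> \<in> J \<Longrightarrow> x \<in> carrier G \<Longrightarrow> \<phi> x \<in> W"
  and J_out: "\<phi> \<in> J \<Longrightarrow> x \<notin> carrier G \<Longrightarrow> \<phi> x = 0"
  and J_equiv: "\<phi> \<in> J \<Longrightarrow> \<kappa> \<in> K \<Longrightarrow> x \<in> carrier G \<Longrightarrow> \<phi> (\<kappa> \<otimes>\<^bsub>G\<^esub> x) = \<rho> \<kappa> (\<phi> x)"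
  unfolding ind_space_def mem_Collect_eq by blast+

lemma act_apply: "x \<in> carrier G \<Longrightarrow> act m \<phi> x = \<phi> (x \<otimes>\<^bsub>G\<^esub> m)"
  by (simp add: ind_action_def)

lemma J_eqI: "\<phi> \<in> J \<Longrightarrow> \<psi> \<in> J \<Longrightarrow> (\<And>x. x \<in> carrier G \<Longrightarrow> \<phi> x = \<psi> x) \<Longrightarrow> \<phi> = \<psi>"
  using J_out by (metis ext)

text \<open>The copy of \<open>W\<close> inside \<open>J\<close>. It is stable under
  \<open>K\<close>, and its translates span \<open>J\<close>, see \<open>decompose\<close>.\<close>

definition emb :: "'w \<Rightarrow> 'a \<times> 'b \<Rightarrow> 'w" where
  "emb w = (\<lambda>x. if x \<in> K then \<rho> x w else 0)"

lemma emb_in: "w \<in> W \<Longrightarrow> emb w \<in> J"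
  unfolding ind_space_def mem_Collect_eq emb_def
  using W_maps K_in W.zero_in W_mult K_mult_left_iff W.map_zero by auto

lemma emb_one: "w \<in> W \<Longrightarrow> emb w \<one>\<^bsub>G\<^esub> = w"
  unfolding emb_def using K_one by (simp only: if_True W_one)

lemma emb_equiv: "\<kappa> \<in> K \<Longrightarrow> w \<in> W \<Longrightarrow> emb (\<rho> \<kappa> w) = act \<kappa> (emb w)"
proof (rule J_eqI)
  assume \<kappa>: "\<kappa> \<in> K" and w: "w \<in> W"
  show "emb (\<rho> \<kappa> w) \<in> J" by (intro emb_in W_maps \<kappa> w)
  show "act \<kappa> (emb w) \<in> J" by (intro JR.maps emb_in K_in \<kappa> w)
  show "emb (\<rho> \<kappa> w) x = act \<kappa> (emb w) x" if "x \<in> carrier G" for x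
    using \<kappa> w that by (simp add: act_apply emb_def K_mult_right_iff W_mult del: DirProd_simps)
qed

lemma emb_lin: "w \<in> W \<Longrightarrow> w' \<in> W \<Longrightarrow> emb (w + w') = emb w + emb w'"
  "w \<in> W \<Longrightarrow> emb (s c w) = fun_scale s c (emb w)"
  by (auto simp: emb_def fun_eq_iff W_add W_scale fun_scale_def)

text \<open>The lift is \<open>T \<phi> x = \<rho> \<kappa> (X (\<rho> (inv \<kappa>) (\<phi> x)))\<close> for any \<open>\<kappa> \<in> K\<close> with \<open>q \<kappa> = q x\<close>, where \<open>q\<close> is one
  of the two coordinate projections.\<close>

lemma lift_endomorphism:
  fixes q :: "'a \<times> 'b \<Rightarrow> 'c"
  assumes q_onto: "\<And>x. x \<in> carrier G \<Longrightarrow> \<exists>\<kappa>\<in>K. q \<kappa> = q x"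
    and q_mult: "\<And>\<kappa> x y. \<kappa> \<in> K \<Longrightarrow> x \<in> carrier G \<Longrightarrow> y \<in> carrier G \<Longrightarrow> q x = q y \<Longrightarrow>
      q (\<kappa> \<otimes>\<^bsub>G\<^esub> x) = q (\<kappa> \<otimes>\<^bsub>G\<^esub> y)"
    and X_in: "\<And>w. w \<in> W \<Longrightarrow> X w \<in> W"
    and X_add: "\<And>w w'. w \<in> W \<Longrightarrow> w' \<in> W \<Longrightarrow> X (w + w') = X w + X w'"
    and X_scale: "\<And>c w. w \<in> W \<Longrightarrow> X (s c w) = s c (X w)"
    and X_comm: "\<And>\<nu> w. \<nu> \<in> K \<Longrightarrow> q \<nu> = q \<one>\<^bsub>G\<^esub> \<Longrightarrow> w \<in> W \<Longrightarrow> X (\<rho> \<nu> w) = \<rho> \<nu> (X w)"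
  obtains T where "\<And>\<phi>. \<phi> \<in> J \<Longrightarrow> T \<phi> \<in> J" "\<And>\<phi>. \<phi> \<in> J \<Longrightarrow> T \<phi> \<one>\<^bsub>G\<^esub> = X (\<phi> \<one>\<^bsub>G\<^esub>)"
    "\<And>\<phi> \<psi>. \<phi> \<in> J \<Longrightarrow> \<psi> \<in> J \<Longrightarrow> T (\<phi> + \<psi>) = T \<phi> + T \<psi>"
    "\<And>c \<phi>. \<phi> \<in> J \<Longrightarrow> T (fun_scale s c \<phi>) = fun_scale s c (T \<phi>)"
    "\<And>m \<phi>. m \<in> carrier G \<Longrightarrow> (\<And>x. x \<in> carrier G \<Longrightarrow> q (x \<otimes>\<^bsub>G\<^esub> m) = q x) \<Longrightarrow> \<phi> \<in> J \<Longrightarrow>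
      T (act m \<phi>) = act m (T \<phi>)"
proof -
  have wd: "\<rho> \<kappa> (X (\<rho> (inv\<^bsub>G\<^esub> \<kappa>) w)) = \<rho> \<kappa>' (X (\<rho> (inv\<^bsub>G\<^esub> \<kappa>') w))"
    if k: "\<kappa> \<in> K" "\<kappa>' \<in> K" "q \<kappa> = q \<kappa>'" and w: "w \<in> W" for \<kappa> \<kappa>' w
  proof -
    \<comment> \<open>\<open>\<kappa>' = \<kappa> ?n\<close>, and \<open>q\<close> takes the same
      value on \<open>?n\<close> as on the identity, so \<open>X\<close> commutes with
      \<open>\<rho> ?n\<close>.\<close>
    let ?n = "inv\<^bsub>G\<^esub> \<kappa> \<otimes>\<^bsub>G\<^esub> \<kappa>'"
    note kG = K_in[OF k(1)] K_in[OF k(2)]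
    have n: "?n \<in> K" using k by (intro K_mult K_inv)
    have "q ?n = q (inv\<^bsub>G\<^esub> \<kappa> \<otimes>\<^bsub>G\<^esub> \<kappa>)" using k kG by (intro q_mult K_inv) auto
    also have "inv\<^bsub>G\<^esub> \<kappa> \<otimes>\<^bsub>G\<^esub> \<kappa> = \<one>\<^bsub>G\<^esub>" using kG by (rule_tac G.l_inv)
    finally have qn: "q ?n = q \<one>\<^bsub>G\<^esub>" .
    let ?u = "\<rho> (inv\<^bsub>G\<^esub> \<kappa>') w"
    have u: "?u \<in> W" using k w by (intro W_maps K_inv)
    have e1: "\<kappa> \<otimes>\<^bsub>G\<^esub> ?n = \<kappa>'" using kG by (simp add: G.m_assoc[symmetric] del: DirProd_simps)
    have e2: "?n \<otimes>\<^bsub>G\<^esub> inv\<^bsub>G\<^esub> \<kappa>' = inv\<^bsub>G\<^esub> \<kappa>" using kG by (simp add: G.m_assoc del: DirProd_simps)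
    have "\<rho> \<kappa> (X (\<rho> (inv\<^bsub>G\<^esub> \<kappa>) w)) = \<rho> \<kappa> (X (\<rho> ?n ?u))"
      using W_mult[OF n K_inv[OF k(2)] w] e2 by simp
    also have "\<dots> = \<rho> \<kappa> (\<rho> ?n (X ?u))" using X_comm[OF n qn u] by simp
    also have "\<dots> = \<rho> \<kappa>' (X ?u)" using W_mult[OF k(1) n X_in[OF u]] e1 by simp
    finally show ?thesis .
  qed
  define k where "k x = (SOME \<kappa>. \<kappa> \<in> K \<and> q \<kappa> = q x)" for x
  have k: "k x \<in> K" "q (k x) = q x" if "x \<in> carrier G" for x
    using someI_ex[of "\<lambda>\<kappa>. \<kappa> \<in> K \<and> q \<kappa> = q x"] q_onto[OF that] unfolding k_def by blast+
  define T where "T \<phi> = (\<lambda>x. if x \<in> carrier G then \<rho> (k x) (X (\<rho> (inv\<^bsub>G\<^esub> (k x)) (\<phi> x))) else 0)" for \<phi>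
  have T: "T \<phi> x = \<rho> \<kappa> (X (\<rho> (inv\<^bsub>G\<^esub> \<kappa>) (\<phi> x)))"
    if "\<phi> \<in> J" "x \<in> carrier G" "\<kappa> \<in> K" "q \<kappa> = q x" for \<phi> x \<kappa>
    using that k[OF that(2)] wd[OF k(1)[OF that(2)] that(3) _ J_in[OF that(1,2)]] by (simp add: T_def)
  have TJ: "T \<phi> \<in> J" if \<phi>: "\<phi> \<in> J" for \<phi>
    unfolding ind_space_def mem_Collect_eq
  proof (intro conjI ballI allI impI)
    fix x assume x: "x \<in> carrier G"
    show "T \<phi> x \<in> W"
      unfolding T[OF \<phi> x k[OF x]] using k[OF x] J_in[OF \<phi> x] by (intro W_maps X_in K_inv)
    fix \<kappa> assume \<kappa>: "\<kappa> \<in> K"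
    let ?k = "k x"
    note kx = k[OF x] and kG = K_in[OF k(1)[OF x]] K_in[OF \<kappa>]
    \<comment> \<open>The freedom in choosing the element of \<open>K\<close> gives equivariance: at
      \<open>\<kappa> x\<close> the product of \<open>\<kappa>\<close> and \<open>?k\<close> is a
      legitimate choice.\<close>
    have "q (\<kappa> \<otimes>\<^bsub>G\<^esub> ?k) = q (\<kappa> \<otimes>\<^bsub>G\<^esub> x)" using \<kappa> kG x kx by (intro q_mult)
    then have "T \<phi> (\<kappa> \<otimes>\<^bsub>G\<^esub> x) = \<rho> (\<kappa> \<otimes>\<^bsub>G\<^esub> ?k) (X (\<rho> (inv\<^bsub>G\<^esub> (\<kappa> \<otimes>\<^bsub>G\<^esub> ?k)) (\<phi> (\<kappa> \<otimes>\<^bsub>G\<^esub> x))))"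
      using \<kappa> kx x kG by (intro T[OF \<phi>] K_mult G.m_closed)
    also have "\<rho> (inv\<^bsub>G\<^esub> (\<kappa> \<otimes>\<^bsub>G\<^esub> ?k)) (\<phi> (\<kappa> \<otimes>\<^bsub>G\<^esub> x)) = \<rho> (inv\<^bsub>G\<^esub> ?k) (\<rho> (inv\<^bsub>G\<^esub> \<kappa>) (\<rho> \<kappa> (\<phi> x)))"
      unfolding J_equiv[OF \<phi> \<kappa> x] G.inv_mult_group[OF kG(2,1)]
      using kx \<kappa> J_in[OF \<phi> x] by (intro W_mult K_inv W_maps)
    also have "\<rho> (inv\<^bsub>G\<^esub> \<kappa>) (\<rho> \<kappa> (\<phi> x)) = \<phi> x" using W_inv[OF \<kappa> J_in[OF \<phi> x]] .
    also have "\<rho> (\<kappa> \<otimes>\<^bsub>G\<^esub> ?k) (X (\<rho> (inv\<^bsub>G\<^esub> ?k) (\<phi> x))) = \<rho> \<kappa> (\<rho> ?k (X (\<rho> (inv\<^bsub>G\<^esub> ?k) (\<phi> x))))"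
      using kx \<kappa> J_in[OF \<phi> x] by (intro W_mult X_in W_maps K_inv)
    also have "\<dots> = \<rho> \<kappa> (T \<phi> x)" by (simp only: T[OF \<phi> x kx])
    finally show "T \<phi> (\<kappa> \<otimes>\<^bsub>G\<^esub> x) = \<rho> \<kappa> (T \<phi> x)" .
  qed (simp add: T_def)
  show ?thesis
  proof (rule that[OF TJ])
    fix \<phi> assume \<phi>: "\<phi> \<in> J"
    have "T \<phi> \<one>\<^bsub>G\<^esub> = \<rho> \<one>\<^bsub>G\<^esub> (X (\<rho> (inv\<^bsub>G\<^esub> \<one>\<^bsub>G\<^esub>) (\<phi> \<one>\<^bsub>G\<^esub>)))"
      by (rule T[OF \<phi> G.one_closed K_one refl])
    then show "T \<phi> \<one>\<^bsub>G\<^esub> = X (\<phi> \<one>\<^bsub>G\<^esub>)"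
      unfolding G.inv_one W_one[OF J_in[OF \<phi> G.one_closed]] W_one[OF X_in[OF J_in[OF \<phi> G.one_closed]]] .
    show "T (\<phi> + \<psi>) = T \<phi> + T \<psi>" if \<psi>: "\<psi> \<in> J" for \<psi>
    proof
      fix x
      show "T (\<phi> + \<psi>) x = (T \<phi> + T \<psi>) x"
      proof (cases "x \<in> carrier G")
        case True
        note a = J_in[OF \<phi> True] J_in[OF \<psi> True] k(1)[OF True] K_inv[OF k(1)[OF True]]
        show ?thesis using True a by (simp add: T_def W_add X_add X_in W_maps del: DirProd_simps)
      qed (simp add: T_def)
    qed
    show "T (fun_scale s c \<phi>) = fun_scale s c (T \<phi>)" for c
    proof
      fix x
      show "T (fun_scale s c \<phi>) x = fun_scale s c (T \<phi>) x"
      proof (cases "x \<in> carrier G")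
        case True
        note a = J_in[OF \<phi> True] k(1)[OF True] K_inv[OF k(1)[OF True]]
        show ?thesis using True a by (simp add: T_def fun_scale_def W_scale X_scale X_in W_maps del: DirProd_simps)
      qed (simp add: T_def fun_scale_def)
    qed
    fix m assume m: "m \<in> carrier G" "\<And>x. x \<in> carrier G \<Longrightarrow> q (x \<otimes>\<^bsub>G\<^esub> m) = q x"
    show "T (act m \<phi>) = act m (T \<phi>)"
    proof (rule J_eqI)
      show "T (act m \<phi>) \<in> J" "act m (T \<phi>) \<in> J" using TJ JR.maps m(1) \<phi> by auto
      fix x assume x: "x \<in> carrier G"
      have xm: "x \<otimes>\<^bsub>G\<^esub> m \<in> carrier G" using x m by (intro G.m_closed)
      have "act m (T \<phi>) x = T \<phi> (x \<otimes>\<^bsub>G\<^esub> m)" by (rule act_apply[OF x])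
      also have "\<dots> = \<rho> (k x) (X (\<rho> (inv\<^bsub>G\<^esub> (k x)) (\<phi> (x \<otimes>\<^bsub>G\<^esub> m))))"
        using k[OF x] m(2)[OF x] by (intro T[OF \<phi> xm]) simp_all
      also have "\<phi> (x \<otimes>\<^bsub>G\<^esub> m) = act m \<phi> x" by (rule act_apply[OF x, symmetric])
      also have "\<rho> (k x) (X (\<rho> (inv\<^bsub>G\<^esub> (k x)) (act m \<phi> x))) = T (act m \<phi>) x"
        using k[OF x] JR.maps[OF m(1) \<phi>] x by (intro T[symmetric])
      finally show "T (act m \<phi>) x = act m (T \<phi>) x" by simp
    qed
  qed
qed

text \<open>The coordinates are crossed. \<open>X\<close> commutes with \<open>N1\<close>, that is,
  with the elements of \<open>K\<close> with trivial second coordinate, so it is lifted along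
  \<open>snd\<close>. Right translation by \<open>(a, 1)\<close> preserves \<open>snd\<close>, which
  makes the lift \<open>H1\<close>-equivariant. Evaluating the commuting lifts on
  \<open>emb w\<close> at the identity returns \<open>X (Y w)\<close> and
  \<open>Y (X w)\<close>.\<close>

lemma mutually_commuting_restrict:
  assumes J: "mutually_commuting H1 H2 (fun_scale s) J act"
  shows "mutually_commuting (H1\<lparr>carrier := N1\<rparr>) (H2\<lparr>carrier := N2\<rparr>) s W \<rho>"
  unfolding mutually_commuting_def
proof (intro allI impI ballI)
  fix X Y w
  assume "intertwiner (H1\<lparr>carrier := N1\<rparr>) s W (\<lambda>a. \<rho> (a, \<one>\<^bsub>H2\<lparr>carrier := N2\<rparr>\<^esub>)) s W (\<lambda>a. \<rho> (a, \<one>\<^bsub>H2\<lparr>carrier := N2\<rparr>\<^esub>)) X"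
    and "intertwiner (H2\<lparr>carrier := N2\<rparr>) s W (\<lambda>b. \<rho> (\<one>\<^bsub>H1\<lparr>carrier := N1\<rparr>\<^esub>, b)) s W (\<lambda>b. \<rho> (\<one>\<^bsub>H1\<lparr>carrier := N1\<rparr>\<^esub>, b)) Y"
    and w: "w \<in> W"
  then have X: "intertwiner (H1\<lparr>carrier := N1\<rparr>) s W (\<lambda>a. \<rho> (a, \<one>\<^bsub>H2\<^esub>)) s W (\<lambda>a. \<rho> (a, \<one>\<^bsub>H2\<^esub>)) X"
    and Y: "intertwiner (H2\<lparr>carrier := N2\<rparr>) s W (\<lambda>b. \<rho> (\<one>\<^bsub>H1\<^esub>, b)) s W (\<lambda>b. \<rho> (\<one>\<^bsub>H1\<^esub>, b)) Y" by simp_all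
  obtain T where T: "\<And>\<phi>. \<phi> \<in> J \<Longrightarrow> T \<phi> \<in> J" "\<And>\<phi>. \<phi> \<in> J \<Longrightarrow> T \<phi> \<one>\<^bsub>G\<^esub> = X (\<phi> \<one>\<^bsub>G\<^esub>)"
    "\<And>\<phi> \<psi>. \<phi> \<in> J \<Longrightarrow> \<psi> \<in> J \<Longrightarrow> T (\<phi> + \<psi>) = T \<phi> + T \<psi>"
    "\<And>c \<phi>. \<phi> \<in> J \<Longrightarrow> T (fun_scale s c \<phi>) = fun_scale s c (T \<phi>)"
    "\<And>m \<phi>. m \<in> carrier G \<Longrightarrow> (\<And>x. x \<in> carrier G \<Longrightarrow> snd (x \<otimes>\<^bsub>G\<^esub> m) = snd x) \<Longrightarrow> \<phi> \<in> J \<Longrightarrow>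
      T (act m \<phi>) = act m (T \<phi>)"
  proof (rule lift_endomorphism[where q = snd and X = X])
    show "\<exists>\<kappa>\<in>K. snd \<kappa> = snd x" if "x \<in> carrier G" for x
      using onto_snd[of "snd x"] that by force
    show "X (\<rho> \<nu> w) = \<rho> \<nu> (X w)" if "\<nu> \<in> K" "snd \<nu> = snd \<one>\<^bsub>G\<^esub>" "w \<in> W" for \<nu> w
      using that intertwiner_commutes[OF X, of "fst \<nu>" w] by (cases \<nu>) (auto simp: N1_def)
  qed (use intertwiner_in[OF X] intertwiner_add[OF X] intertwiner_scale[OF X] in auto)
  obtain U where U: "\<And>\<phi>. \<phi> \<in> J \<Longrightarrow> U \<phi> \<in> J" "\<And>\<phi>. \<phi> \<in> J \<Longrightarrow> U \<phi> \<one>\<^bsub>G\<^esub> = Y (\<phi> \<one>\<^bsub>G\<^esub>)"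
    "\<And>\<phi> \<psi>. \<phi> \<in> J \<Longrightarrow> \<psi> \<in> J \<Longrightarrow> U (\<phi> + \<psi>) = U \<phi> + U \<psi>"
    "\<And>c \<phi>. \<phi> \<in> J \<Longrightarrow> U (fun_scale s c \<phi>) = fun_scale s c (U \<phi>)"
    "\<And>m \<phi>. m \<in> carrier G \<Longrightarrow> (\<And>x. x \<in> carrier G \<Longrightarrow> fst (x \<otimes>\<^bsub>G\<^esub> m) = fst x) \<Longrightarrow> \<phi> \<in> J \<Longrightarrow>
      U (act m \<phi>) = act m (U \<phi>)"
  proof (rule lift_endomorphism[where q = fst and X = Y])
    show "\<exists>\<kappa>\<in>K. fst \<kappa> = fst x" if "x \<in> carrier G" for x
      using onto_fst[of "fst x"] that by force
    show "Y (\<rho> \<nu> w) = \<rho> \<nu> (Y w)" if "\<nu> \<in> K" "fst \<nu> = fst \<one>\<^bsub>G\<^esub>" "w \<in> W" for \<nu> w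
      using that intertwiner_commutes[OF Y, of "snd \<nu>" w] by (cases \<nu>) (auto simp: N2_def)
  qed (use intertwiner_in[OF Y] intertwiner_add[OF Y] intertwiner_scale[OF Y] in auto)
  have T_int: "intertwiner H1 (fun_scale s) J (\<lambda>a. act (a, \<one>\<^bsub>H2\<^esub>)) (fun_scale s) J (\<lambda>a. act (a, \<one>\<^bsub>H2\<^esub>)) T"
  proof (rule intertwinerI)
    show "T (act (a, \<one>\<^bsub>H2\<^esub>) \<phi>) = act (a, \<one>\<^bsub>H2\<^esub>) (T \<phi>)" if "a \<in> carrier H1" "\<phi> \<in> J" for a \<phi>
    proof (rule T(5)[OF _ _ that(2)])
      show "snd (x \<otimes>\<^bsub>G\<^esub> (a, \<one>\<^bsub>H2\<^esub>)) = snd x" if "x \<in> carrier G" for x using that by (cases x) auto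
    qed (use that in auto)
  qed (use T(1,3,4) in auto)
  have U_int: "intertwiner H2 (fun_scale s) J (\<lambda>b. act (\<one>\<^bsub>H1\<^esub>, b)) (fun_scale s) J (\<lambda>b. act (\<one>\<^bsub>H1\<^esub>, b)) U"
  proof (rule intertwinerI)
    show "U (act (\<one>\<^bsub>H1\<^esub>, b) \<phi>) = act (\<one>\<^bsub>H1\<^esub>, b) (U \<phi>)" if "b \<in> carrier H2" "\<phi> \<in> J" for b \<phi>
    proof (rule U(5)[OF _ _ that(2)])
      show "fst (x \<otimes>\<^bsub>G\<^esub> (\<one>\<^bsub>H1\<^esub>, b)) = fst x" if "x \<in> carrier G" for x using that by (cases x) auto
    qed (use that in auto)
  qed (use U(1,3,4) in auto)
  let ?e = "emb w"
  have e: "?e \<in> J" by (rule emb_in[OF w])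
  have "T (U ?e) = U (T ?e)"
    using J T_int U_int e unfolding mutually_commuting_def by blast
  then have "T (U ?e) \<one>\<^bsub>G\<^esub> = U (T ?e) \<one>\<^bsub>G\<^esub>" by simp
  then show "X (Y w) = Y (X w)" using T(1,2) U(1,2) e emb_one[OF w] by metis
qed

text \<open>By \<open>fst_in_K_iff\<close> the set is \<open>N1 \<times> N2\<close>, so
  \<open>C\<close> is the product of the orders of \<open>N1\<close> and \<open>N2\<close>. In
  \<open>decompose\<close> it is the number of translates that are supported at a given
  point.\<close>

definition C :: nat where "C = card {\<kappa> \<in> K. (fst \<kappa>, \<one>\<^bsub>H2\<^esub>) \<in> K}"

lemma C_nonzero: "of_nat C \<noteq> (0 :: complex)"
proof -
  have "\<one>\<^bsub>G\<^esub> \<in> {\<kappa> \<in> K. (fst \<kappa>, \<one>\<^bsub>H2\<^esub>) \<in> K}" using K_one by simp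
  then show ?thesis using finite_K by (auto simp: C_def card_eq_0_iff)
qed

lemma fst_in_K_iff: "\<kappa> \<in> K \<Longrightarrow> (fst \<kappa>, \<one>\<^bsub>H2\<^esub>) \<in> K \<longleftrightarrow> (\<one>\<^bsub>H1\<^esub>, snd \<kappa>) \<in> K"
proof -
  assume \<kappa>: "\<kappa> \<in> K"
  obtain y z where yz: "\<kappa> = (y, z)" "y \<in> carrier H1" "z \<in> carrier H2" using K_in[OF \<kappa>] by (cases \<kappa>) auto
  have "\<kappa> = (y, \<one>\<^bsub>H2\<^esub>) \<otimes>\<^bsub>G\<^esub> (\<one>\<^bsub>H1\<^esub>, z)" using yz by simp
  then show ?thesis
    using K_mult_left_iff[of "(y, \<one>\<^bsub>H2\<^esub>)" "(\<one>\<^bsub>H1\<^esub>, z)"] K_mult_right_iff[of "(\<one>\<^bsub>H1\<^esub>, z)" "(y, \<one>\<^bsub>H2\<^esub>)"] \<kappa> yz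
    by auto
qed

text \<open>The condition says that the first coordinate of \<open>x\<close> and that of
  \<open>\<kappa>\<close> agree modulo \<open>N1\<close>, up to a shift \<open>g\<close> depending
  on the second coordinate of \<open>x\<close>. Completing the shifted coordinate \<open>?a\<close>
  to an element \<open>(?a, d)\<close> of \<open>K\<close> gives the bijection that sends
  \<open>\<kappa>\<close> to \<open>(?a, d)\<close> times the inverse of \<open>\<kappa>\<close>.
  Hence the count does not depend on \<open>x\<close>.\<close>

lemma card_fst:
  assumes x: "x \<in> carrier G"
  shows "card {\<kappa> \<in> K. x \<otimes>\<^bsub>G\<^esub> (inv\<^bsub>H1\<^esub> (fst \<kappa>), \<one>\<^bsub>H2\<^esub>) \<in> K} = C"
proof -
  obtain x1 x2 where x12: "x = (x1, x2)" "x1 \<in> carrier H1" "x2 \<in> carrier H2" using x by (cases x) auto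
  obtain g where g: "(g, x2) \<in> K" using onto_snd x12 by blast
  have gG: "g \<in> carrier H1" using K_in[OF g] by simp
  let ?a = "inv\<^bsub>H1\<^esub> g \<otimes>\<^bsub>H1\<^esub> x1"
  obtain d where d: "(?a, d) \<in> K" using onto_fst gG x12 by blast
  have dG: "d \<in> carrier H2" using K_in[OF d] by simp
  have iff: "x \<otimes>\<^bsub>G\<^esub> (inv\<^bsub>H1\<^esub> (fst \<kappa>), \<one>\<^bsub>H2\<^esub>) \<in> K \<longleftrightarrow> (fst ((?a, d) \<otimes>\<^bsub>G\<^esub> inv\<^bsub>G\<^esub> \<kappa>), \<one>\<^bsub>H2\<^esub>) \<in> K"
    if \<kappa>: "\<kappa> \<in> K" for \<kappa>
  proof -
    obtain y z where yz: "\<kappa> = (y, z)" "y \<in> carrier H1" "z \<in> carrier H2" using K_in[OF \<kappa>] by (cases \<kappa>) auto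
    have "x \<otimes>\<^bsub>G\<^esub> (inv\<^bsub>H1\<^esub> (fst \<kappa>), \<one>\<^bsub>H2\<^esub>) = (g, x2) \<otimes>\<^bsub>G\<^esub> (fst ((?a, d) \<otimes>\<^bsub>G\<^esub> inv\<^bsub>G\<^esub> \<kappa>), \<one>\<^bsub>H2\<^esub>)"
      using yz x12 gG dG by (simp add: H1.m_assoc[symmetric] H1.group_axioms H2.group_axioms)
    also have "\<dots> \<in> K \<longleftrightarrow> (fst ((?a, d) \<otimes>\<^bsub>G\<^esub> inv\<^bsub>G\<^esub> \<kappa>), \<one>\<^bsub>H2\<^esub>) \<in> K"
      using yz x12 gG dG by (intro K_mult_left_iff[OF g]) (simp add: H1.group_axioms H2.group_axioms)
    finally show ?thesis .
  qed
  have inv2: "inv\<^bsub>G\<^esub> (\<mu> \<otimes>\<^bsub>G\<^esub> inv\<^bsub>G\<^esub> \<kappa>) \<otimes>\<^bsub>G\<^esub> \<mu> = \<kappa>" if "\<kappa> \<in> K" "\<mu> \<in> K" for \<kappa> \<mu>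
    using K_in[OF that(1)] K_in[OF that(2)] by (simp add: G.inv_mult_group G.m_assoc del: DirProd_simps)
  have inv3: "\<mu> \<otimes>\<^bsub>G\<^esub> inv\<^bsub>G\<^esub> (inv\<^bsub>G\<^esub> \<kappa> \<otimes>\<^bsub>G\<^esub> \<mu>) = \<kappa>" if "\<kappa> \<in> K" "\<mu> \<in> K" for \<kappa> \<mu>
    using K_in[OF that(1)] K_in[OF that(2)]
    by (simp add: G.inv_mult_group G.m_assoc[symmetric] del: DirProd_simps)
  let ?A = "{\<kappa> \<in> K. x \<otimes>\<^bsub>G\<^esub> (inv\<^bsub>H1\<^esub> (fst \<kappa>), \<one>\<^bsub>H2\<^esub>) \<in> K}" and ?B = "{\<kappa> \<in> K. (fst \<kappa>, \<one>\<^bsub>H2\<^esub>) \<in> K}"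
  have "bij_betw (\<lambda>\<kappa>. (?a, d) \<otimes>\<^bsub>G\<^esub> inv\<^bsub>G\<^esub> \<kappa>) ?A ?B"
  proof (rule bij_betw_byWitness[of _ "\<lambda>\<kappa>. inv\<^bsub>G\<^esub> \<kappa> \<otimes>\<^bsub>G\<^esub> (?a, d)"])
    show "(\<lambda>\<kappa>. (?a, d) \<otimes>\<^bsub>G\<^esub> inv\<^bsub>G\<^esub> \<kappa>) ` ?A \<subseteq> ?B"
      using iff K_mult[OF d K_inv] by blast
    have "inv\<^bsub>G\<^esub> \<kappa> \<otimes>\<^bsub>G\<^esub> (?a, d) \<in> ?A" if "\<kappa> \<in> ?B" for \<kappa>
    proof -
      have \<kappa>: "\<kappa> \<in> K" "(fst \<kappa>, \<one>\<^bsub>H2\<^esub>) \<in> K" using that by blast+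
      have "inv\<^bsub>G\<^esub> \<kappa> \<otimes>\<^bsub>G\<^esub> (?a, d) \<in> K" by (intro K_mult K_inv \<kappa> d)
      then show ?thesis using iff inv3[OF \<kappa>(1) d] \<kappa>(2) by simp
    qed
    then show "(\<lambda>\<kappa>. inv\<^bsub>G\<^esub> \<kappa> \<otimes>\<^bsub>G\<^esub> (?a, d)) ` ?B \<subseteq> ?A" by blast
  qed (use inv2 inv3 d in blast)+
  then show ?thesis unfolding C_def by (rule bij_betw_same_card)
qed

text \<open>The mirror image of \<open>card_fst\<close>. The set in \<open>C\<close> is described by
  first coordinates, and \<open>fst_in_K_iff\<close> translates it to second ones.\<close>

lemma card_snd:
  assumes x: "x \<in> carrier G"
  shows "card {\<kappa> \<in> K. x \<otimes>\<^bsub>G\<^esub> (\<one>\<^bsub>H1\<^esub>, inv\<^bsub>H2\<^esub> (snd \<kappa>)) \<in> K} = C"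
proof -
  obtain x1 x2 where x12: "x = (x1, x2)" "x1 \<in> carrier H1" "x2 \<in> carrier H2" using x by (cases x) auto
  obtain g where g: "(x1, g) \<in> K" using onto_fst x12 by blast
  have gG: "g \<in> carrier H2" using K_in[OF g] by simp
  let ?a = "inv\<^bsub>H2\<^esub> g \<otimes>\<^bsub>H2\<^esub> x2"
  obtain d where d: "(d, ?a) \<in> K" using onto_snd gG x12 by blast
  have dG: "d \<in> carrier H1" using K_in[OF d] by simp
  have iff: "x \<otimes>\<^bsub>G\<^esub> (\<one>\<^bsub>H1\<^esub>, inv\<^bsub>H2\<^esub> (snd \<kappa>)) \<in> K \<longleftrightarrow> (fst ((d, ?a) \<otimes>\<^bsub>G\<^esub> inv\<^bsub>G\<^esub> \<kappa>), \<one>\<^bsub>H2\<^esub>) \<in> K"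
    if \<kappa>: "\<kappa> \<in> K" for \<kappa>
  proof -
    obtain y z where yz: "\<kappa> = (y, z)" "y \<in> carrier H1" "z \<in> carrier H2" using K_in[OF \<kappa>] by (cases \<kappa>) auto
    have "x \<otimes>\<^bsub>G\<^esub> (\<one>\<^bsub>H1\<^esub>, inv\<^bsub>H2\<^esub> (snd \<kappa>)) = (x1, g) \<otimes>\<^bsub>G\<^esub> (\<one>\<^bsub>H1\<^esub>, snd ((d, ?a) \<otimes>\<^bsub>G\<^esub> inv\<^bsub>G\<^esub> \<kappa>))"
      using yz x12 gG dG by (simp add: H2.m_assoc[symmetric] H1.group_axioms H2.group_axioms)
    also have "\<dots> \<in> K \<longleftrightarrow> (\<one>\<^bsub>H1\<^esub>, snd ((d, ?a) \<otimes>\<^bsub>G\<^esub> inv\<^bsub>G\<^esub> \<kappa>)) \<in> K"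
      using yz x12 gG dG by (intro K_mult_left_iff[OF g]) (simp add: H1.group_axioms H2.group_axioms)
    also have "\<dots> \<longleftrightarrow> (fst ((d, ?a) \<otimes>\<^bsub>G\<^esub> inv\<^bsub>G\<^esub> \<kappa>), \<one>\<^bsub>H2\<^esub>) \<in> K"
      using fst_in_K_iff[OF K_mult[OF d K_inv[OF \<kappa>]]] by simp
    finally show ?thesis .
  qed
  have inv2: "inv\<^bsub>G\<^esub> (\<mu> \<otimes>\<^bsub>G\<^esub> inv\<^bsub>G\<^esub> \<kappa>) \<otimes>\<^bsub>G\<^esub> \<mu> = \<kappa>" if "\<kappa> \<in> K" "\<mu> \<in> K" for \<kappa> \<mu>
    using K_in[OF that(1)] K_in[OF that(2)] by (simp add: G.inv_mult_group G.m_assoc del: DirProd_simps)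
  have inv3: "\<mu> \<otimes>\<^bsub>G\<^esub> inv\<^bsub>G\<^esub> (inv\<^bsub>G\<^esub> \<kappa> \<otimes>\<^bsub>G\<^esub> \<mu>) = \<kappa>" if "\<kappa> \<in> K" "\<mu> \<in> K" for \<kappa> \<mu>
    using K_in[OF that(1)] K_in[OF that(2)]
    by (simp add: G.inv_mult_group G.m_assoc[symmetric] del: DirProd_simps)
  let ?A = "{\<kappa> \<in> K. x \<otimes>\<^bsub>G\<^esub> (\<one>\<^bsub>H1\<^esub>, inv\<^bsub>H2\<^esub> (snd \<kappa>)) \<in> K}" and ?B = "{\<kappa> \<in> K. (fst \<kappa>, \<one>\<^bsub>H2\<^esub>) \<in> K}"
  have "bij_betw (\<lambda>\<kappa>. (d, ?a) \<otimes>\<^bsub>G\<^esub> inv\<^bsub>G\<^esub> \<kappa>) ?A ?B"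
  proof (rule bij_betw_byWitness[of _ "\<lambda>\<kappa>. inv\<^bsub>G\<^esub> \<kappa> \<otimes>\<^bsub>G\<^esub> (d, ?a)"])
    show "(\<lambda>\<kappa>. (d, ?a) \<otimes>\<^bsub>G\<^esub> inv\<^bsub>G\<^esub> \<kappa>) ` ?A \<subseteq> ?B"
      using iff K_mult[OF d K_inv] by blast
    have "inv\<^bsub>G\<^esub> \<kappa> \<otimes>\<^bsub>G\<^esub> (d, ?a) \<in> ?A" if "\<kappa> \<in> ?B" for \<kappa>
    proof -
      have \<kappa>: "\<kappa> \<in> K" "(fst \<kappa>, \<one>\<^bsub>H2\<^esub>) \<in> K" using that by blast+
      have "inv\<^bsub>G\<^esub> \<kappa> \<otimes>\<^bsub>G\<^esub> (d, ?a) \<in> K" by (intro K_mult K_inv \<kappa> d)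
      then show ?thesis using iff inv3[OF \<kappa>(1) d] \<kappa>(2) by simp
    qed
    then show "(\<lambda>\<kappa>. inv\<^bsub>G\<^esub> \<kappa> \<otimes>\<^bsub>G\<^esub> (d, ?a)) ` ?B \<subseteq> ?A" by blast
  qed (use inv2 inv3 d in blast)+
  then show ?thesis unfolding C_def by (rule bij_betw_same_card)
qed

text \<open>By \<open>K\<close>-equivariance the summand of \<open>\<kappa>\<close> takes at
  \<open>x\<close> the value \<open>\<phi> x\<close> or 0, and \<open>C\<close> counts the first
  case. With \<open>p\<close> mapping \<open>\<kappa>\<close> to \<open>(fst \<kappa>, 1)\<close> or
  to \<open>(1, snd \<kappa>)\<close>, translations by only one of the two groups suffice to
  generate \<open>J\<close> from \<open>emb\<close>.\<close>

lemma decompose: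
  assumes \<phi>: "\<phi> \<in> J" and p: "\<And>\<kappa>. \<kappa> \<in> K \<Longrightarrow> p \<kappa> \<in> carrier G"
    and card: "\<And>x. x \<in> carrier G \<Longrightarrow> card {\<kappa> \<in> K. x \<otimes>\<^bsub>G\<^esub> inv\<^bsub>G\<^esub> (p \<kappa>) \<in> K} = C"
  shows "(\<Sum>\<kappa>\<in>K. act (inv\<^bsub>G\<^esub> (p \<kappa>)) (emb (\<phi> (p \<kappa>)))) = fun_scale s (of_nat C) \<phi>"
proof (rule J_eqI)
  show "(\<Sum>\<kappa>\<in>K. act (inv\<^bsub>G\<^esub> (p \<kappa>)) (emb (\<phi> (p \<kappa>)))) \<in> J"
    by (intro JR.sum_in JR.maps G.inv_closed emb_in J_in[OF \<phi>] p)
  show "fun_scale s (of_nat C) \<phi> \<in> J" by (rule JR.scale_in[OF \<phi>])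
  fix x assume x: "x \<in> carrier G"
  have "(\<Sum>\<kappa>\<in>K. act (inv\<^bsub>G\<^esub> (p \<kappa>)) (emb (\<phi> (p \<kappa>)))) x =
      (\<Sum>\<kappa>\<in>K. if x \<otimes>\<^bsub>G\<^esub> inv\<^bsub>G\<^esub> (p \<kappa>) \<in> K then \<phi> x else 0)"
    unfolding sum_apply
  proof (intro sum.cong refl)
    fix \<kappa> assume \<kappa>: "\<kappa> \<in> K"
    note pk = p[OF \<kappa>]
    have "x \<otimes>\<^bsub>G\<^esub> inv\<^bsub>G\<^esub> (p \<kappa>) \<otimes>\<^bsub>G\<^esub> p \<kappa> = x" using x pk by (simp add: G.m_assoc del: DirProd_simps)
    then show "act (inv\<^bsub>G\<^esub> (p \<kappa>)) (emb (\<phi> (p \<kappa>))) x = (if x \<otimes>\<^bsub>G\<^esub> inv\<^bsub>G\<^esub> (p \<kappa>) \<in> K then \<phi> x else 0)"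
      using J_equiv[OF \<phi> _ pk, of "x \<otimes>\<^bsub>G\<^esub> inv\<^bsub>G\<^esub> (p \<kappa>)"] x
      by (simp add: act_apply emb_def del: DirProd_simps)
  qed
  also have "\<dots> = (\<Sum>\<kappa>\<in>{\<kappa> \<in> K. x \<otimes>\<^bsub>G\<^esub> inv\<^bsub>G\<^esub> (p \<kappa>) \<in> K}. \<phi> x)"
    using finite_K by (subst sum.inter_filter) auto
  also have "\<dots> = s (of_nat C) (\<phi> x)"
    using card[OF x] by (simp add: W.VS.sum_constant_scale del: DirProd_simps)
  finally show "(\<Sum>\<kappa>\<in>K. act (inv\<^bsub>G\<^esub> (p \<kappa>)) (emb (\<phi> (p \<kappa>)))) x = fun_scale s (of_nat C) \<phi> x"
    by (simp add: fun_scale_def)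
qed

lemma fin_dim_J: "finite_dim (fun_scale s) J"
  by (rule finite_dim_fun_space[OF W.VS.vector_space_axioms finite_G fin_dim W.subspace])
    (simp_all add: J_in J_out del: DirProd_simps)

lemma mutually_commuting_induce:
  assumes N: "mutually_commuting (H1\<lparr>carrier := N1\<rparr>) (H2\<lparr>carrier := N2\<rparr>) s W \<rho>"
  shows "mutually_commuting H1 H2 (fun_scale s) J act"
  unfolding mutually_commuting_def
proof (intro allI impI ballI)
  define E1 where "E1 = {T. intertwiner H1 (fun_scale s) J (\<lambda>a. act (a, \<one>\<^bsub>H2\<^esub>)) (fun_scale s) J (\<lambda>a. act (a, \<one>\<^bsub>H2\<^esub>)) T}"
  define E2 where "E2 = {U. intertwiner H2 (fun_scale s) J (\<lambda>b. act (\<one>\<^bsub>H1\<^esub>, b)) (fun_scale s) J (\<lambda>b. act (\<one>\<^bsub>H1\<^esub>, b)) U}"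
  have act_mult: "act (x \<otimes>\<^bsub>G\<^esub> y) \<phi> = act x (act y \<phi>)" if "x \<in> carrier G" "y \<in> carrier G" "\<phi> \<in> J" for x y \<phi>
    using JR.map_mult that .
  have E1: "intertwiner H1 (fun_scale s) J (\<lambda>a. act (a, \<one>\<^bsub>H2\<^esub>)) (fun_scale s) J (\<lambda>a. act (a, \<one>\<^bsub>H2\<^esub>)) T"
    if "T \<in> E1" for T using that by (simp add: E1_def)
  have E2: "intertwiner H2 (fun_scale s) J (\<lambda>b. act (\<one>\<^bsub>H1\<^esub>, b)) (fun_scale s) J (\<lambda>b. act (\<one>\<^bsub>H1\<^esub>, b)) U"
    if "U \<in> E2" for U using that by (simp add: E2_def)
  have E1_sum: "T (sum g K) = (\<Sum>\<kappa>\<in>K. T (g \<kappa>))" if "T \<in> E1" "\<And>\<kappa>. \<kappa> \<in> K \<Longrightarrow> g \<kappa> \<in> J" for T g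
  proof -
    interpret J1: monoid_rep H1 "fun_scale s" J "\<lambda>a. act (a, \<one>\<^bsub>H2\<^esub>)"
      by (rule group_pair_rep.rep1) (intro group_pair_rep.intro group_pair_rep_axioms.intro
          H1.group_axioms H2.group_axioms JR.monoid_rep_axioms finite1 finite2 fin_dim_J)
    show ?thesis by (rule J1.intertwiner_sum[OF E1[OF that(1)] that(2)])
  qed
  have E2_sum: "U (sum g K) = (\<Sum>\<kappa>\<in>K. U (g \<kappa>))" if "U \<in> E2" "\<And>\<kappa>. \<kappa> \<in> K \<Longrightarrow> g \<kappa> \<in> J" for U g
  proof -
    interpret J2: monoid_rep H2 "fun_scale s" J "\<lambda>b. act (\<one>\<^bsub>H1\<^esub>, b)"
      by (rule group_pair_rep.rep2) (intro group_pair_rep.intro group_pair_rep_axioms.intro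
          H1.group_axioms H2.group_axioms JR.monoid_rep_axioms finite1 finite2 fin_dim_J)
    show ?thesis by (rule J2.intertwiner_sum[OF E2[OF that(1)] that(2)])
  qed
  have dec1: "fun_scale s (of_nat C) \<phi> = (\<Sum>\<kappa>\<in>K. act (inv\<^bsub>H1\<^esub> (fst \<kappa>), \<one>\<^bsub>H2\<^esub>) (emb (\<phi> (fst \<kappa>, \<one>\<^bsub>H2\<^esub>))))"
    if "\<phi> \<in> J" for \<phi>
  proof -
    have e: "inv\<^bsub>G\<^esub> (fst \<kappa>, \<one>\<^bsub>H2\<^esub>) = (inv\<^bsub>H1\<^esub> (fst \<kappa>), \<one>\<^bsub>H2\<^esub>)" "(fst \<kappa>, \<one>\<^bsub>H2\<^esub>) \<in> carrier G" if "\<kappa> \<in> K" for \<kappa>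
      using K_in[OF that] by (cases \<kappa>, simp add: H1.group_axioms H2.group_axioms)+
    have "(\<Sum>\<kappa>\<in>K. act (inv\<^bsub>G\<^esub> (fst \<kappa>, \<one>\<^bsub>H2\<^esub>)) (emb (\<phi> (fst \<kappa>, \<one>\<^bsub>H2\<^esub>)))) = fun_scale s (of_nat C) \<phi>"
    proof (rule decompose[OF that, of "\<lambda>\<kappa>. (fst \<kappa>, \<one>\<^bsub>H2\<^esub>)"])
      fix x assume x: "x \<in> carrier G"
      have "{\<kappa> \<in> K. x \<otimes>\<^bsub>G\<^esub> inv\<^bsub>G\<^esub> (fst \<kappa>, \<one>\<^bsub>H2\<^esub>) \<in> K} = {\<kappa> \<in> K. x \<otimes>\<^bsub>G\<^esub> (inv\<^bsub>H1\<^esub> (fst \<kappa>), \<one>\<^bsub>H2\<^esub>) \<in> K}"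
        using e by (intro Collect_cong conj_cong) simp_all
      then show "card {\<kappa> \<in> K. x \<otimes>\<^bsub>G\<^esub> inv\<^bsub>G\<^esub> (fst \<kappa>, \<one>\<^bsub>H2\<^esub>) \<in> K} = C" using card_fst[OF x] by simp
    qed (rule e)
    then show ?thesis by (simp add: e del: DirProd_simps cong: sum.cong)
  qed
  have dec2: "fun_scale s (of_nat C) \<phi> = (\<Sum>\<kappa>\<in>K. act (\<one>\<^bsub>H1\<^esub>, inv\<^bsub>H2\<^esub> (snd \<kappa>)) (emb (\<phi> (\<one>\<^bsub>H1\<^esub>, snd \<kappa>))))"
    if "\<phi> \<in> J" for \<phi>
  proof -
    have e: "inv\<^bsub>G\<^esub> (\<one>\<^bsub>H1\<^esub>, snd \<kappa>) = (\<one>\<^bsub>H1\<^esub>, inv\<^bsub>H2\<^esub> (snd \<kappa>))" "(\<one>\<^bsub>H1\<^esub>, snd \<kappa>) \<in> carrier G" if "\<kappa> \<in> K" for \<kappa>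
      using K_in[OF that] by (cases \<kappa>, simp add: H1.group_axioms H2.group_axioms)+
    have "(\<Sum>\<kappa>\<in>K. act (inv\<^bsub>G\<^esub> (\<one>\<^bsub>H1\<^esub>, snd \<kappa>)) (emb (\<phi> (\<one>\<^bsub>H1\<^esub>, snd \<kappa>)))) = fun_scale s (of_nat C) \<phi>"
    proof (rule decompose[OF that, of "\<lambda>\<kappa>. (\<one>\<^bsub>H1\<^esub>, snd \<kappa>)"])
      fix x assume x: "x \<in> carrier G"
      have "{\<kappa> \<in> K. x \<otimes>\<^bsub>G\<^esub> inv\<^bsub>G\<^esub> (\<one>\<^bsub>H1\<^esub>, snd \<kappa>) \<in> K} = {\<kappa> \<in> K. x \<otimes>\<^bsub>G\<^esub> (\<one>\<^bsub>H1\<^esub>, inv\<^bsub>H2\<^esub> (snd \<kappa>)) \<in> K}"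
        using e by (intro Collect_cong conj_cong) simp_all
      then show "card {\<kappa> \<in> K. x \<otimes>\<^bsub>G\<^esub> inv\<^bsub>G\<^esub> (\<one>\<^bsub>H1\<^esub>, snd \<kappa>) \<in> K} = C" using card_snd[OF x] by simp
    qed (rule e)
    then show ?thesis by (simp add: e del: DirProd_simps cong: sum.cong)
  qed
  have base: "T (U (emb w)) \<one>\<^bsub>G\<^esub> = U (T (emb w)) \<one>\<^bsub>G\<^esub>" if T: "T \<in> E1" and U: "U \<in> E2" and w: "w \<in> W" for T U w
  proof -
    define Tz where "Tz z w = T (emb w) (\<one>\<^bsub>H1\<^esub>, z)" for z w
    define Uy where "Uy y w = U (emb w) (y, \<one>\<^bsub>H2\<^esub>)" for y w
    note TJ = intertwiner_in[OF E1[OF T]] and UJ = intertwiner_in[OF E2[OF U]]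
    have TzW: "Tz z w \<in> W" if "z \<in> carrier H2" "w \<in> W" for z w
      unfolding Tz_def using that by (intro J_in[OF TJ[OF emb_in]]) simp_all
    have UyW: "Uy y w \<in> W" if "y \<in> carrier H1" "w \<in> W" for y w
      unfolding Uy_def using that by (intro J_in[OF UJ[OF emb_in]]) simp_all
    have Tz: "intertwiner (H1\<lparr>carrier := N1\<rparr>) s W (\<lambda>a. \<rho> (a, \<one>\<^bsub>H2\<lparr>carrier := N2\<rparr>\<^esub>)) s W (\<lambda>a. \<rho> (a, \<one>\<^bsub>H2\<lparr>carrier := N2\<rparr>\<^esub>)) (Tz z)"
      if z: "z \<in> carrier H2" for z
    proof (rule intertwinerI)
      fix n v assume "n \<in> carrier (H1\<lparr>carrier := N1\<rparr>)" and v: "v \<in> W"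
      then have n: "(n, \<one>\<^bsub>H2\<^esub>) \<in> K" by (simp add: N1_def)
      then have nH: "n \<in> carrier H1" using K_in[OF n] by simp
      \<comment> \<open>Since \<open>(1, z)(n, 1) = (n, 1)(1, z)\<close>, the right translation by
        \<open>(n, 1)\<close> is at this point a left multiplication by an element of
        \<open>K\<close>.\<close>
      have "Tz z (\<rho> (n, \<one>\<^bsub>H2\<^esub>) v) = act (n, \<one>\<^bsub>H2\<^esub>) (T (emb v)) (\<one>\<^bsub>H1\<^esub>, z)"
        unfolding Tz_def emb_equiv[OF n v] intertwiner_commutes[OF E1[OF T] nH emb_in[OF v]] ..
      also have "\<dots> = T (emb v) ((n, \<one>\<^bsub>H2\<^esub>) \<otimes>\<^bsub>G\<^esub> (\<one>\<^bsub>H1\<^esub>, z))"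
        using nH z by (simp add: ind_action_def)
      also have "\<dots> = \<rho> (n, \<one>\<^bsub>H2\<^esub>) (Tz z v)"
        unfolding Tz_def using z by (intro J_equiv[OF TJ[OF emb_in[OF v]] n]) simp
      finally show "Tz z (\<rho> (n, \<one>\<^bsub>H2\<lparr>carrier := N2\<rparr>\<^esub>) v) = \<rho> (n, \<one>\<^bsub>H2\<lparr>carrier := N2\<rparr>\<^esub>) (Tz z v)" by simp
    next
      show "Tz z (s c v) = s c (Tz z v)" if "v \<in> W" for c v
        unfolding Tz_def emb_lin(2)[OF that] intertwiner_scale[OF E1[OF T] emb_in[OF that]]
        by (simp add: fun_scale_def)
    qed (use z TzW in \<open>auto simp: Tz_def emb_lin(1) emb_in intertwiner_add[OF E1[OF T]]\<close>)
    have Uy: "intertwiner (H2\<lparr>carrier := N2\<rparr>) s W (\<lambda>b. \<rho> (\<one>\<^bsub>H1\<lparr>carrier := N1\<rparr>\<^esub>, b)) s W (\<lambda>b. \<rho> (\<one>\<^bsub>H1\<lparr>carrier := N1\<rparr>\<^esub>, b)) (Uy y)"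
      if y: "y \<in> carrier H1" for y
    proof (rule intertwinerI)
      fix n v assume "n \<in> carrier (H2\<lparr>carrier := N2\<rparr>)" and v: "v \<in> W"
      then have n: "(\<one>\<^bsub>H1\<^esub>, n) \<in> K" by (simp add: N2_def)
      then have nH: "n \<in> carrier H2" using K_in[OF n] by simp
      have "Uy y (\<rho> (\<one>\<^bsub>H1\<^esub>, n) v) = act (\<one>\<^bsub>H1\<^esub>, n) (U (emb v)) (y, \<one>\<^bsub>H2\<^esub>)"
        unfolding Uy_def emb_equiv[OF n v] intertwiner_commutes[OF E2[OF U] nH emb_in[OF v]] ..
      also have "\<dots> = U (emb v) ((\<one>\<^bsub>H1\<^esub>, n) \<otimes>\<^bsub>G\<^esub> (y, \<one>\<^bsub>H2\<^esub>))"
        using nH y by (simp add: ind_action_def)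
      also have "\<dots> = \<rho> (\<one>\<^bsub>H1\<^esub>, n) (Uy y v)"
        unfolding Uy_def using y by (intro J_equiv[OF UJ[OF emb_in[OF v]] n]) simp
      finally show "Uy y (\<rho> (\<one>\<^bsub>H1\<lparr>carrier := N1\<rparr>\<^esub>, n) v) = \<rho> (\<one>\<^bsub>H1\<lparr>carrier := N1\<rparr>\<^esub>, n) (Uy y v)" by simp
    next
      show "Uy y (s c v) = s c (Uy y v)" if "v \<in> W" for c v
        unfolding Uy_def emb_lin(2)[OF that] intertwiner_scale[OF E2[OF U] emb_in[OF that]]
        by (simp add: fun_scale_def)
    qed (use y UyW in \<open>auto simp: Uy_def emb_lin(1) emb_in intertwiner_add[OF E2[OF U]]\<close>)
    have comm: "Tz z (Uy y v) = Uy y (Tz z v)" if "z \<in> carrier H2" "y \<in> carrier H1" "v \<in> W" for z y v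
      using N Tz[OF that(1)] Uy[OF that(2)] that(3) unfolding mutually_commuting_def by blast
    have KH: "fst \<kappa> \<in> carrier H1" "snd \<kappa> \<in> carrier H2" if "\<kappa> \<in> K" for \<kappa>
      using K_in[OF that] by (cases \<kappa>, simp)+
    have one: "s (of_nat C) (\<phi> \<one>\<^bsub>G\<^esub>) = fun_scale s (of_nat C) \<phi> \<one>\<^bsub>G\<^esub>" for \<phi> by (simp add: fun_scale_def)
    have "s (of_nat C) (T (U (emb w)) \<one>\<^bsub>G\<^esub>) = T (fun_scale s (of_nat C) (U (emb w))) \<one>\<^bsub>G\<^esub>"
      unfolding one by (simp only: intertwiner_scale[OF E1[OF T] UJ[OF emb_in[OF w]]])
    also have "\<dots> = (\<Sum>\<kappa>\<in>K. T (act (inv\<^bsub>H1\<^esub> (fst \<kappa>), \<one>\<^bsub>H2\<^esub>) (emb (Uy (fst \<kappa>) w))) \<one>\<^bsub>G\<^esub>)"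
      unfolding dec1[OF UJ[OF emb_in[OF w]]] Uy_def[symmetric] using UyW[OF KH(1) w] KH
      by (subst E1_sum[OF T]) (auto simp: sum_apply simp del: one_DirProd intro!: JR.maps emb_in)
    also have "\<dots> = (\<Sum>\<kappa>\<in>K. \<rho> (inv\<^bsub>G\<^esub> \<kappa>) (Tz (snd \<kappa>) (Uy (fst \<kappa>) w)))"
    proof (intro sum.cong refl)
      fix \<kappa> assume \<kappa>: "\<kappa> \<in> K"
      note u = UyW[OF KH(1)[OF \<kappa>] w]
      \<comment> \<open>Multiplication by the inverse of \<open>\<kappa>\<close> trades an argument
        in \<open>H1\<close> for one in \<open>H2\<close>. This is where \<open>\<rho>\<close>
        enters and \<open>T\<^sub>z\<close> takes the place of a value of \<open>T\<close> on the
        first factor.\<close>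
      have e: "(inv\<^bsub>H1\<^esub> (fst \<kappa>), \<one>\<^bsub>H2\<^esub>) = inv\<^bsub>G\<^esub> \<kappa> \<otimes>\<^bsub>G\<^esub> (\<one>\<^bsub>H1\<^esub>, snd \<kappa>)"
        using KH[OF \<kappa>] by (cases \<kappa>) (simp add: H1.group_axioms H2.group_axioms)
      have "T (act (inv\<^bsub>H1\<^esub> (fst \<kappa>), \<one>\<^bsub>H2\<^esub>) (emb (Uy (fst \<kappa>) w))) \<one>\<^bsub>G\<^esub> =
          T (emb (Uy (fst \<kappa>) w)) (inv\<^bsub>H1\<^esub> (fst \<kappa>), \<one>\<^bsub>H2\<^esub>)"
        unfolding intertwiner_commutes[OF E1[OF T] H1.inv_closed[OF KH(1)[OF \<kappa>]] emb_in[OF u]]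
        using KH[OF \<kappa>] by (simp add: ind_action_def)
      also have "\<dots> = \<rho> (inv\<^bsub>G\<^esub> \<kappa>) (Tz (snd \<kappa>) (Uy (fst \<kappa>) w))"
        unfolding Tz_def e using KH[OF \<kappa>] by (intro J_equiv[OF TJ[OF emb_in[OF u]] K_inv[OF \<kappa>]]) simp
      finally show "T (act (inv\<^bsub>H1\<^esub> (fst \<kappa>), \<one>\<^bsub>H2\<^esub>) (emb (Uy (fst \<kappa>) w))) \<one>\<^bsub>G\<^esub> =
        \<rho> (inv\<^bsub>G\<^esub> \<kappa>) (Tz (snd \<kappa>) (Uy (fst \<kappa>) w))" .
    qed
    also have "\<dots> = (\<Sum>\<kappa>\<in>K. \<rho> (inv\<^bsub>G\<^esub> \<kappa>) (Uy (fst \<kappa>) (Tz (snd \<kappa>) w)))"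
      using comm[OF KH(2,1) w] by (intro sum.cong refl) simp
    also have "\<dots> = (\<Sum>\<kappa>\<in>K. U (act (\<one>\<^bsub>H1\<^esub>, inv\<^bsub>H2\<^esub> (snd \<kappa>)) (emb (Tz (snd \<kappa>) w))) \<one>\<^bsub>G\<^esub>)"
    proof (intro sum.cong refl)
      fix \<kappa> assume \<kappa>: "\<kappa> \<in> K"
      note u = TzW[OF KH(2)[OF \<kappa>] w]
      have e: "(\<one>\<^bsub>H1\<^esub>, inv\<^bsub>H2\<^esub> (snd \<kappa>)) = inv\<^bsub>G\<^esub> \<kappa> \<otimes>\<^bsub>G\<^esub> (fst \<kappa>, \<one>\<^bsub>H2\<^esub>)"
        using KH[OF \<kappa>] by (cases \<kappa>) (simp add: H1.group_axioms H2.group_axioms)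
      have "U (act (\<one>\<^bsub>H1\<^esub>, inv\<^bsub>H2\<^esub> (snd \<kappa>)) (emb (Tz (snd \<kappa>) w))) \<one>\<^bsub>G\<^esub> =
          U (emb (Tz (snd \<kappa>) w)) (\<one>\<^bsub>H1\<^esub>, inv\<^bsub>H2\<^esub> (snd \<kappa>))"
        unfolding intertwiner_commutes[OF E2[OF U] H2.inv_closed[OF KH(2)[OF \<kappa>]] emb_in[OF u]]
        using KH[OF \<kappa>] by (simp add: ind_action_def)
      also have "\<dots> = \<rho> (inv\<^bsub>G\<^esub> \<kappa>) (Uy (fst \<kappa>) (Tz (snd \<kappa>) w))"
        unfolding Uy_def e using KH[OF \<kappa>] by (intro J_equiv[OF UJ[OF emb_in[OF u]] K_inv[OF \<kappa>]]) simp
      finally show "\<rho> (inv\<^bsub>G\<^esub> \<kappa>) (Uy (fst \<kappa>) (Tz (snd \<kappa>) w)) =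
        U (act (\<one>\<^bsub>H1\<^esub>, inv\<^bsub>H2\<^esub> (snd \<kappa>)) (emb (Tz (snd \<kappa>) w))) \<one>\<^bsub>G\<^esub>" by (rule sym)
    qed
    also have "\<dots> = U (fun_scale s (of_nat C) (T (emb w))) \<one>\<^bsub>G\<^esub>"
      unfolding dec2[OF TJ[OF emb_in[OF w]]] Tz_def[symmetric] using TzW[OF KH(2) w] KH
      by (subst E2_sum[OF U]) (auto simp: sum_apply simp del: one_DirProd intro!: JR.maps emb_in)
    also have "\<dots> = s (of_nat C) (U (T (emb w)) \<one>\<^bsub>G\<^esub>)"
      unfolding one by (simp only: intertwiner_scale[OF E2[OF U] TJ[OF emb_in[OF w]]])
    finally show ?thesis using C_nonzero by (simp del: one_DirProd)
  qed
  text \<open>Translations by the second factor preserve \<open>E1\<close>, which moves \<open>base\<close> to all points and all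
    translates of \<open>emb w\<close>.\<close>
  have shift: "(\<lambda>\<phi>. act (\<one>\<^bsub>H1\<^esub>, b) (T (act (\<one>\<^bsub>H1\<^esub>, c) \<phi>))) \<in> E1"
    if T: "T \<in> E1" and bc: "b \<in> carrier H2" "c \<in> carrier H2" for T b c
  proof -
    have tr: "intertwiner H1 (fun_scale s) J (\<lambda>a. act (a, \<one>\<^bsub>H2\<^esub>)) (fun_scale s) J (\<lambda>a. act (a, \<one>\<^bsub>H2\<^esub>)) (act (\<one>\<^bsub>H1\<^esub>, b))"
      if b: "b \<in> carrier H2" for b
    proof (rule intertwinerI)
      fix a \<phi> assume a: "a \<in> carrier H1" and \<phi>: "\<phi> \<in> J"
      show "act (\<one>\<^bsub>H1\<^esub>, b) (act (a, \<one>\<^bsub>H2\<^esub>) \<phi>) = act (a, \<one>\<^bsub>H2\<^esub>) (act (\<one>\<^bsub>H1\<^esub>, b) \<phi>)"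
        using a b \<phi> act_mult[of "(\<one>\<^bsub>H1\<^esub>, b)" "(a, \<one>\<^bsub>H2\<^esub>)" \<phi>] act_mult[of "(a, \<one>\<^bsub>H2\<^esub>)" "(\<one>\<^bsub>H1\<^esub>, b)" \<phi>] by simp
    qed (use b JR.maps JR.map_add JR.map_scale in auto)
    show ?thesis
      unfolding E1_def mem_Collect_eq
      by (rule intertwiner_compose[OF intertwiner_compose[OF tr[OF bc(2)] E1[OF T]] tr[OF bc(1)]])
  qed
  fix T U \<phi>
  assume "intertwiner H1 (fun_scale s) J (\<lambda>a. act (a, \<one>\<^bsub>H2\<^esub>)) (fun_scale s) J (\<lambda>a. act (a, \<one>\<^bsub>H2\<^esub>)) T"
    and "intertwiner H2 (fun_scale s) J (\<lambda>b. act (\<one>\<^bsub>H1\<^esub>, b)) (fun_scale s) J (\<lambda>b. act (\<one>\<^bsub>H1\<^esub>, b)) U"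
    and \<phi>: "\<phi> \<in> J"
  then have T: "T \<in> E1" and U: "U \<in> E2" by (auto simp: E1_def E2_def)
  note TJ = intertwiner_in[OF E1[OF T]] and UJ = intertwiner_in[OF E2[OF U]]
  have eq: "T (U (act (\<one>\<^bsub>H1\<^esub>, c) (emb w))) = U (T (act (\<one>\<^bsub>H1\<^esub>, c) (emb w)))"
    if c: "c \<in> carrier H2" and w: "w \<in> W" for c w
  proof -
    let ?e = "act (\<one>\<^bsub>H1\<^esub>, c) (emb w)"
    have eJ: "?e \<in> J" using c w by (intro JR.maps emb_in) simp_all
    have 1: "T (U ?e) (\<one>\<^bsub>H1\<^esub>, b) = U (T ?e) (\<one>\<^bsub>H1\<^esub>, b)" if b: "b \<in> carrier H2" for b
    proof -
      have at: "act (\<one>\<^bsub>H1\<^esub>, b) \<psi> \<one>\<^bsub>G\<^esub> = \<psi> (\<one>\<^bsub>H1\<^esub>, b)" for \<psi> using b by (simp add: ind_action_def)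
      \<comment> \<open>\<open>U\<close> commutes with translations by \<open>H1\<close>'s partner
        \<open>H2\<close>, so both translations can be absorbed into \<open>T\<close>;
        \<open>base\<close> is applied to the resulting element of \<open>E1\<close>.\<close>
      have "T (U ?e) (\<one>\<^bsub>H1\<^esub>, b) = act (\<one>\<^bsub>H1\<^esub>, b) (T (act (\<one>\<^bsub>H1\<^esub>, c) (U (emb w)))) \<one>\<^bsub>G\<^esub>"
        unfolding at intertwiner_commutes[OF E2[OF U] c emb_in[OF w]] ..
      also have "\<dots> = U (act (\<one>\<^bsub>H1\<^esub>, b) (T ?e)) \<one>\<^bsub>G\<^esub>"
        by (rule base[OF shift[OF T b c] U w])
      also have "\<dots> = U (T ?e) (\<one>\<^bsub>H1\<^esub>, b)"
        unfolding intertwiner_commutes[OF E2[OF U] b TJ[OF eJ]] at ..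
      finally show ?thesis .
    qed
    show ?thesis
    proof (rule J_eqI)
      show "T (U ?e) \<in> J" "U (T ?e) \<in> J" using TJ UJ eJ by blast+
      fix x assume "x \<in> carrier G"
      then obtain x1 x2 where x: "x = (x1, x2)" "x1 \<in> carrier H1" "x2 \<in> carrier H2" by (cases x) auto
      obtain d where d: "(x1, d) \<in> K" using onto_fst x by blast
      have dH: "d \<in> carrier H2" using K_in[OF d] by simp
      let ?b = "inv\<^bsub>H2\<^esub> d \<otimes>\<^bsub>H2\<^esub> x2"
      have b: "?b \<in> carrier H2" "(\<one>\<^bsub>H1\<^esub>, ?b) \<in> carrier G" using dH x by simp_all
      \<comment> \<open>As \<open>K\<close> projects onto \<open>H1\<close>, every point is an
        element of \<open>K\<close> times a point \<open>(1, b)\<close>; the values at the latter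
        determine a function of \<open>J\<close>.\<close>
      have xe: "x = (x1, d) \<otimes>\<^bsub>G\<^esub> (\<one>\<^bsub>H1\<^esub>, ?b)" using x dH by (simp add: H2.m_assoc[symmetric])
      show "T (U ?e) x = U (T ?e) x"
        unfolding xe J_equiv[OF TJ[OF UJ[OF eJ]] d b(2)] J_equiv[OF UJ[OF TJ[OF eJ]] d b(2)] 1[OF b(1)] ..
    qed
  qed
  \<comment> \<open>Up to the nonzero factor \<open>C\<close>, \<open>\<phi>\<close> is the sum of
    these translates, for which \<open>eq\<close> is available.\<close>
  define g where "g \<kappa> = act (\<one>\<^bsub>H1\<^esub>, inv\<^bsub>H2\<^esub> (snd \<kappa>)) (emb (\<phi> (\<one>\<^bsub>H1\<^esub>, snd \<kappa>)))" for \<kappa> :: "'a \<times> 'b"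
  have gJ: "g \<kappa> \<in> J" and gTU: "T (U (g \<kappa>)) = U (T (g \<kappa>))" if "\<kappa> \<in> K" for \<kappa>
  proof -
    have z: "snd \<kappa> \<in> carrier H2" using K_in[OF that] by (cases \<kappa>) simp
    then have p: "\<phi> (\<one>\<^bsub>H1\<^esub>, snd \<kappa>) \<in> W" by (intro J_in[OF \<phi>]) simp
    show "g \<kappa> \<in> J" unfolding g_def using z p by (intro JR.maps emb_in) simp_all
    show "T (U (g \<kappa>)) = U (T (g \<kappa>))" unfolding g_def using z p by (intro eq) simp_all
  qed
  have d: "fun_scale s (of_nat C) \<phi> = sum g K" unfolding g_def by (rule dec2[OF \<phi>])
  have "T (U (sum g K)) = U (T (sum g K))"
    using gJ TJ UJ gTU by (simp add: E1_sum[OF T] E2_sum[OF U] cong: sum.cong)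
  then have "fun_scale s (of_nat C) (T (U \<phi>)) = fun_scale s (of_nat C) (U (T \<phi>))"
    unfolding d[symmetric]
    by (simp add: intertwiner_scale[OF E1[OF T]] intertwiner_scale[OF E2[OF U]] \<phi> TJ UJ)
  then show "T (U \<phi>) = U (T \<phi>)" using C_nonzero by simp
qed

theorem mutually_commuting_ind_iff:
  "mutually_commuting (H1\<lparr>carrier := N1\<rparr>) (H2\<lparr>carrier := N2\<rparr>) s W \<rho> \<longleftrightarrow>
    mutually_commuting H1 H2 (fun_scale s) J act"
  using mutually_commuting_restrict mutually_commuting_induce by blast

end

section \<open>Finite Clifford monoids\<close>

text \<open>Clifford monoids: unions of groups whose idempotents are central. Regularity is stated
  in the one-sided form that semisimplicity yields; powers of \<open>m\<close> turn it into
  invertibility relative to an idempotent.\<close>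

locale finite_clifford = monoid M for M (structure) +
  assumes finite_carrier: "finite (carrier M)"
    and regular: "m \<in> carrier M \<Longrightarrow> \<exists>x\<in>carrier M. m = m \<otimes> m \<otimes> x"
    and central: "e \<in> idempotents M \<Longrightarrow> m \<in> carrier M \<Longrightarrow> e \<otimes> m = m \<otimes> e"

text \<open>From \<open>e M = M e\<close> one gets \<open>e m = x e\<close> and
  \<open>m e = e y\<close>. Multiplying by \<open>e\<close> shows that both are equal to
  \<open>e m e\<close>.\<close>

lemma centric_idempotent_central:
  assumes "monoid M" "centric (carrier M) M" "e \<in> idempotents M" "m \<in> carrier M"
  shows "e \<otimes>\<^bsub>M\<^esub> m = m \<otimes>\<^bsub>M\<^esub> e"
proof -
  interpret monoid M by fact
  have e: "e \<in> carrier M" "e \<otimes>\<^bsub>M\<^esub> e = e" using assms(3) by (auto simp: idempotents_def)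
  have c: "e <#\<^bsub>M\<^esub> carrier M = carrier M #>\<^bsub>M\<^esub> e" using assms(2) e by (auto simp: centric_def)
  have "e \<otimes>\<^bsub>M\<^esub> m \<in> e <#\<^bsub>M\<^esub> carrier M" using assms(4) by (auto simp: l_coset_def)
  then obtain x where x: "x \<in> carrier M" "e \<otimes>\<^bsub>M\<^esub> m = x \<otimes>\<^bsub>M\<^esub> e" unfolding c by (auto simp: r_coset_def)
  have "m \<otimes>\<^bsub>M\<^esub> e \<in> carrier M #>\<^bsub>M\<^esub> e" using assms(4) by (auto simp: r_coset_def)
  then obtain y where y: "y \<in> carrier M" "m \<otimes>\<^bsub>M\<^esub> e = e \<otimes>\<^bsub>M\<^esub> y" unfolding c[symmetric] by (auto simp: l_coset_def)
  have "e \<otimes>\<^bsub>M\<^esub> m = e \<otimes>\<^bsub>M\<^esub> m \<otimes>\<^bsub>M\<^esub> e" using x e by (simp add: m_assoc)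
  also have "\<dots> = e \<otimes>\<^bsub>M\<^esub> (e \<otimes>\<^bsub>M\<^esub> y)" using y e assms(4) by (simp add: m_assoc)
  also have "\<dots> = m \<otimes>\<^bsub>M\<^esub> e" using y e by (simp add: m_assoc[symmetric])
  finally show ?thesis .
qed

text \<open>The functions supported on \<open>m M = M m\<close> form a left ideal \<open>I\<close>, and the \<open>I\<close>-component \<open>x\<close> of the
  unit is a right identity of \<open>I\<close>. So \<open>m\<close> lies in the support of \<open>m x\<close>, which is contained in
  \<open>m m M\<close>.\<close>

lemma semisimple_centric_regular:
  assumes M: "monoid M" and fin: "finite (carrier M)" and ss: "semisimple_ring (monoid_algebra M)"
    and centric: "centric (carrier M) M" and m: "m \<in> carrier M"
  shows "\<exists>x\<in>carrier M. m = m \<otimes>\<^bsub>M\<^esub> m \<otimes>\<^bsub>M\<^esub> x"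
proof -
  interpret monoid M by fact
  let ?R = "monoid_algebra M" and ?C = "carrier M"
  interpret R: ring ?R by (rule ring_monoid_algebra) fact+
  have C: "carrier ?R = {x. \<forall>a. a \<notin> ?C \<longrightarrow> x a = 0}"
    and add: "x \<oplus>\<^bsub>?R\<^esub> y = (\<lambda>a. x a + y a)" and zero: "\<zero>\<^bsub>?R\<^esub> = (\<lambda>a. 0)" for x y
    by (simp_all add: monoid_algebra_def)
  note mult = monoid_algebra_mult[OF fin]
  define S where "S = (\<lambda>x. m \<otimes>\<^bsub>M\<^esub> x) ` ?C"
  have SC: "S \<subseteq> ?C" using m by (auto simp: S_def)
  have S_left: "a \<otimes>\<^bsub>M\<^esub> b \<in> S" if "a \<in> ?C" "b \<in> S" for a b
  proof -
    obtain x where x: "x \<in> ?C" "b = m \<otimes>\<^bsub>M\<^esub> x" using \<open>b \<in> S\<close> by (auto simp: S_def)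
    have "a \<otimes>\<^bsub>M\<^esub> m \<in> ?C #>\<^bsub>M\<^esub> m" using that by (auto simp: r_coset_def)
    also have "\<dots> = m <#\<^bsub>M\<^esub> ?C" using centric m by (simp add: centric_def)
    finally obtain y where y: "y \<in> ?C" "a \<otimes>\<^bsub>M\<^esub> m = m \<otimes>\<^bsub>M\<^esub> y" by (auto simp: l_coset_def)
    have "a \<otimes>\<^bsub>M\<^esub> b = m \<otimes>\<^bsub>M\<^esub> (y \<otimes>\<^bsub>M\<^esub> x)" using that x y m by (simp add: m_assoc[symmetric])
    then show ?thesis using x y by (auto simp: S_def)
  qed
  define I where "I = {x :: 'a \<Rightarrow> complex. \<forall>a. a \<notin> S \<longrightarrow> x a = 0}"
  have neg: "\<ominus>\<^bsub>?R\<^esub> x = (\<lambda>a. - x a)" if "x \<in> carrier ?R" for x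
    using that by (intro R.minus_equality) (auto simp: C add zero)
  have IR: "I \<subseteq> carrier ?R" using SC by (auto simp: I_def C)
  have "left_ideal I ?R" unfolding left_ideal_def
  proof (intro conjI ballI)
    show "additive_subgroup I ?R"
    proof (intro additive_subgroup.intro R.a_group[THEN group.subgroupI])
      show "I \<subseteq> carrier (add_monoid ?R)" using IR by simp
      show "I \<noteq> {}" by (auto simp: I_def)
      show "inv\<^bsub>add_monoid ?R\<^esub> x \<in> I" if "x \<in> I" for x
      proof -
        have "inv\<^bsub>add_monoid ?R\<^esub> x = (\<lambda>a. - x a)"
          using neg[of x] that IR unfolding a_inv_def by blast
        then show ?thesis using that by (simp add: I_def)
      qed
      show "x \<otimes>\<^bsub>add_monoid ?R\<^esub> y \<in> I" if "x \<in> I" "y \<in> I" for x y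
        using that by (simp add: add I_def)
    qed
    fix r x assume "r \<in> carrier ?R" "x \<in> I"
    show "r \<otimes>\<^bsub>?R\<^esub> x \<in> I"
      unfolding I_def mem_Collect_eq mult
    proof (intro allI impI sum.neutral ballI)
      fix c a b assume "c \<notin> S" "a \<in> ?C" "b \<in> ?C"
      then show "(if a \<otimes>\<^bsub>M\<^esub> b = c then r a * x b else 0) = 0"
        using S_left[of a b] \<open>x \<in> I\<close> by (auto simp: I_def)
    qed
  qed
  then obtain J where J: "left_ideal J ?R" "I \<inter> J = {\<zero>\<^bsub>?R\<^esub>}" "I <+>\<^bsub>?R\<^esub> J = carrier ?R"
    using ss unfolding semisimple_ring_def by blast
  have "\<one>\<^bsub>?R\<^esub> \<in> I <+>\<^bsub>?R\<^esub> J" unfolding J(3) by (rule R.one_closed)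
  then obtain x j where xj: "x \<in> I" "j \<in> J" "\<one>\<^bsub>?R\<^esub> = x \<oplus>\<^bsub>?R\<^esub> j"
    by (auto simp: set_add_defs)
  have JR: "J \<subseteq> carrier ?R" using J(1) by (auto simp: left_ideal_def dest: additive_subgroup.a_subset)
  define d where "d = (\<lambda>a. if a = m then 1 else 0 :: complex)"
  have "m \<in> S" unfolding S_def using m by (intro image_eqI[of _ _ "\<one>\<^bsub>M\<^esub>"]) auto
  then have dI: "d \<in> I" by (auto simp: d_def I_def)
  have carr: "d \<in> carrier ?R" "x \<in> carrier ?R" "j \<in> carrier ?R" using dI xj IR JR by auto
  have dx: "d \<otimes>\<^bsub>?R\<^esub> x \<in> I" using \<open>left_ideal I ?R\<close> carr xj by (auto simp: left_ideal_def)
  have dj: "d \<otimes>\<^bsub>?R\<^esub> j \<in> J" using J(1) carr xj by (auto simp: left_ideal_def)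
  have dec: "d = d \<otimes>\<^bsub>?R\<^esub> x \<oplus>\<^bsub>?R\<^esub> d \<otimes>\<^bsub>?R\<^esub> j"
    using carr xj(3) R.r_distr[of x j d] R.r_one[of d] by simp
  \<comment> \<open>\<open>d j\<close> lies in \<open>J\<close>, and being the difference of
    \<open>d\<close> and \<open>d x\<close> also in \<open>I\<close>. So it is zero and
    \<open>d = d x\<close>.\<close>
  have "d \<otimes>\<^bsub>?R\<^esub> j \<in> I"
  proof -
    have "(d \<otimes>\<^bsub>?R\<^esub> j) a = d a - (d \<otimes>\<^bsub>?R\<^esub> x) a" for a using fun_cong[OF dec, of a] by (simp add: add)
    then show ?thesis using dI dx by (simp add: I_def)
  qed
  then have "d \<otimes>\<^bsub>?R\<^esub> j = \<zero>\<^bsub>?R\<^esub>" using dj J(2) by blast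
  then have "d = d \<otimes>\<^bsub>?R\<^esub> x" using dec by (simp add: add zero)
  then have "(d \<otimes>\<^bsub>?R\<^esub> x) m \<noteq> 0" by (metis d_def one_neq_zero)
  then obtain a where a: "a \<in> ?C" "(\<Sum>b\<in>?C. if a \<otimes>\<^bsub>M\<^esub> b = m then d a * x b else 0) \<noteq> 0"
    unfolding mult by (rule sum.not_neutral_contains_not_neutral)
  from a(2) obtain b where b: "b \<in> ?C" "(if a \<otimes>\<^bsub>M\<^esub> b = m then d a * x b else 0) \<noteq> 0"
    by (rule sum.not_neutral_contains_not_neutral)
  have ab: "a \<in> ?C" "b \<in> ?C" "a \<otimes>\<^bsub>M\<^esub> b = m" "d a * x b \<noteq> 0" using a b by (auto split: if_splits)
  then have "a = m" "b \<in> S" using xj(1) by (auto simp: d_def I_def split: if_splits)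
  then obtain y where "y \<in> ?C" "b = m \<otimes>\<^bsub>M\<^esub> y" by (auto simp: S_def)
  then have "m = m \<otimes>\<^bsub>M\<^esub> m \<otimes>\<^bsub>M\<^esub> y" using ab(3) \<open>a = m\<close> m by (simp add: m_assoc)
  then show ?thesis using \<open>y \<in> ?C\<close> by blast
qed

lemma finite_clifford_of_semisimple:
  assumes "monoid M" "finite (carrier M)" "semisimple_ring (monoid_algebra M)" "centric (carrier M) M"
  shows "finite_clifford M"
  using assms semisimple_centric_regular[OF assms] centric_idempotent_central[OF assms(1,4)]
  by (intro finite_clifford.intro finite_clifford_axioms.intro) auto

lemma finite_clifford_prod:
  assumes "finite_clifford M1" "finite_clifford M2"
  shows "finite_clifford (M1 \<times>\<times> M2)"
proof -
  interpret M1: finite_clifford M1 by fact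
  interpret M2: finite_clifford M2 by fact
  show ?thesis
  proof (intro finite_clifford.intro finite_clifford_axioms.intro)
    show "monoid (M1 \<times>\<times> M2)" by (intro DirProd_monoid M1.monoid_axioms M2.monoid_axioms)
    show "finite (carrier (M1 \<times>\<times> M2))" using M1.finite_carrier M2.finite_carrier by simp
    show "\<exists>x\<in>carrier (M1 \<times>\<times> M2). m = m \<otimes>\<^bsub>M1 \<times>\<times> M2\<^esub> m \<otimes>\<^bsub>M1 \<times>\<times> M2\<^esub> x"
      if mM: "m \<in> carrier (M1 \<times>\<times> M2)" for m
    proof -
      obtain a b where ab: "m = (a, b)" "a \<in> carrier M1" "b \<in> carrier M2" using mM by (cases m) auto
      obtain x y where "x \<in> carrier M1" "a = a \<otimes>\<^bsub>M1\<^esub> a \<otimes>\<^bsub>M1\<^esub> x"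
        "y \<in> carrier M2" "b = b \<otimes>\<^bsub>M2\<^esub> b \<otimes>\<^bsub>M2\<^esub> y"
        using M1.regular[OF ab(2)] M2.regular[OF ab(3)] by blast
      then show ?thesis by (intro bexI[of _ "(x, y)"]) (simp_all add: ab)
    qed
    show "e \<otimes>\<^bsub>M1 \<times>\<times> M2\<^esub> m = m \<otimes>\<^bsub>M1 \<times>\<times> M2\<^esub> e"
      if "e \<in> idempotents (M1 \<times>\<times> M2)" "m \<in> carrier (M1 \<times>\<times> M2)" for e m
      using that M1.central[of "fst e" "fst m"] M2.central[of "snd e" "snd m"]
      by (cases e; cases m) (auto simp: idempotents_def)
  qed
qed

text \<open>The group of units of \<open>e M e\<close>, for a central idempotent \<open>e\<close>.\<close>

definition max_subgroup :: "('a, 'm) monoid_scheme \<Rightarrow> 'a \<Rightarrow> 'a set" where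
  "max_subgroup M e = {m \<in> carrier M. m \<otimes>\<^bsub>M\<^esub> e = m \<and> (\<exists>y\<in>carrier M. m \<otimes>\<^bsub>M\<^esub> y = e)}"

definition max_group :: "('a, 'm) monoid_scheme \<Rightarrow> 'a \<Rightarrow> ('a, 'm) monoid_scheme" where
  "max_group M e = M\<lparr>carrier := max_subgroup M e, one := e\<rparr>"

lemma max_group_simps [simp]:
  "carrier (max_group M e) = max_subgroup M e" "\<one>\<^bsub>max_group M e\<^esub> = e"
  "x \<otimes>\<^bsub>max_group M e\<^esub> y = x \<otimes>\<^bsub>M\<^esub> y"
  by (simp_all add: max_group_def)

lemma max_subgroup_prod:
  "max_subgroup (M1 \<times>\<times> M2) (e1, e2) = max_subgroup M1 e1 \<times> max_subgroup M2 e2"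
  by (auto simp: max_subgroup_def)

section \<open>Idempotent powers and units\<close>

context finite_clifford begin

text \<open>The powers of \<open>m\<close> are eventually periodic, and a multiple of the period
  beyond the preperiod is an idempotent exponent. The exponent is written \<open>Suc k\<close>
  because it has to be positive.\<close>

lemma idempotent_power:
  assumes m: "m \<in> carrier M"
  obtains k where "m [^] Suc k \<in> idempotents M"
proof -
  have "\<not> inj (\<lambda>i::nat. m [^] i)"
  proof
    assume "inj (\<lambda>i::nat. m [^] i)"
    then have "infinite (range (\<lambda>i::nat. m [^] i))" by (simp add: finite_image_iff)
    moreover have "range (\<lambda>i::nat. m [^] i) \<subseteq> carrier M" using m by auto
    ultimately show False using finite_carrier finite_subset by blast
  qed
  then obtain i j :: nat where "m [^] i = m [^] j" "i \<noteq> j" by (auto simp: inj_on_def)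
  then obtain i j :: nat where ij: "m [^] i = m [^] j" "i < j" by (metis nat_neq_iff)
  define p where "p = j - i"
  have p: "0 < p" "j = i + p" using ij by (auto simp: p_def)
  have step: "m [^] (a + p) = m [^] a" if "i \<le> a" for a
  proof -
    have "j + (a - i) = a + p" using that p by simp
    then have "m [^] (a + p) = m [^] j \<otimes> m [^] (a - i)" using m by (simp only: nat_pow_mult)
    also have "\<dots> = m [^] i \<otimes> m [^] (a - i)" by (simp only: ij(1))
    also have "\<dots> = m [^] a" using m that by (simp add: nat_pow_mult)
    finally show ?thesis .
  qed
  have steps: "m [^] (a + q * p) = m [^] a" if "i \<le> a" for a q
  proof (induction q)
    case (Suc q)
    have "m [^] (a + Suc q * p) = m [^] ((a + q * p) + p)" by (simp add: algebra_simps)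
    also have "\<dots> = m [^] (a + q * p)" using that by (intro step) simp
    finally show ?case using Suc by simp
  qed simp
  \<comment> \<open>A multiple of the period \<open>p\<close> that is at least the preperiod
    \<open>i\<close>. The factor \<open>Suc i\<close> keeps it positive when
    \<open>i = 0\<close>.\<close>
  define k where "k = Suc i * p"
  have "Suc i * 1 \<le> k" unfolding k_def using p(1) by (intro mult_le_mono2) simp
  then have k: "i \<le> k" "0 < k" by simp_all
  have "m [^] k \<otimes> m [^] k = m [^] k" using steps[OF k(1), of "Suc i"] m by (simp add: nat_pow_mult k_def)
  then have "m [^] Suc (k - 1) \<in> idempotents M" using m k(2) by (simp add: idempotents_def del: nat_pow_Suc)
  with that show ?thesis by blast
qed

text \<open>Iterating \<open>m = m m x\<close> gives a factorisation of \<open>m\<close> with the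
  idempotent power as its left factor, and an idempotent absorbs itself.\<close>

lemma power_idempotent_absorbs:
  assumes m: "m \<in> carrier M" and k: "m [^] Suc k \<in> idempotents M"
  shows "m [^] Suc k \<otimes> m = m" "m \<otimes> m [^] Suc k = m"
proof -
  obtain x where x: "x \<in> carrier M" "m = m \<otimes> m \<otimes> x" using regular[OF m] by blast
  have e: "m = m [^] Suc i \<otimes> x [^] i" for i
  proof (induction i)
    case (Suc i)
    have "m [^] Suc (Suc i) \<otimes> x [^] Suc i = m [^] i \<otimes> (m \<otimes> m \<otimes> x) \<otimes> x [^] i"
      unfolding nat_pow_Suc2[OF x(1)] using m x(1) by (simp add: m_assoc)
    also have "\<dots> = m [^] Suc i \<otimes> x [^] i" by (simp add: x(2)[symmetric])
    finally show ?case using Suc by simp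
  qed (use m in simp)
  let ?g = "m [^] Suc k"
  have gg: "?g \<otimes> ?g = ?g" and gC: "?g \<in> carrier M" using k by (auto simp: idempotents_def)
  have me: "m = ?g \<otimes> x [^] k" by (rule e)
  have "?g \<otimes> m = ?g \<otimes> (?g \<otimes> x [^] k)" using me by simp
  also have "\<dots> = ?g \<otimes> x [^] k" using gC x(1) gg by (simp add: m_assoc[symmetric] del: nat_pow_Suc)
  also have "\<dots> = m" using me by simp
  finally show gm: "?g \<otimes> m = m" .
  then show "m \<otimes> ?g = m" using central[OF k m] by simp
qed

lemma idempotent_in_carrier: "e \<in> idempotents M \<Longrightarrow> e \<in> carrier M"
  and idempotent_square: "e \<in> idempotents M \<Longrightarrow> e \<otimes> e = e"
  by (auto simp: idempotents_def)

lemma max_subgroup_in: "m \<in> max_subgroup M e \<Longrightarrow> m \<in> carrier M"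
  and max_subgroup_right: "m \<in> max_subgroup M e \<Longrightarrow> m \<otimes> e = m"
  by (auto simp: max_subgroup_def)

text \<open>If \<open>m y = e\<close>, then \<open>g e = g m y = m y = e\<close>. This recognises
  the idempotent power of a unit of \<open>e M e\<close> as \<open>e\<close> itself.\<close>

lemma max_subgroup_idempotent:
  assumes e: "e \<in> idempotents M" and m: "m \<in> max_subgroup M e"
    and g: "g \<in> idempotents M" "g \<otimes> e = g" "m \<otimes> g = m"
  shows "g = e"
proof -
  obtain y where y: "y \<in> carrier M" "m \<otimes> y = e" using m by (auto simp: max_subgroup_def)
  note c = max_subgroup_in[OF m] idempotent_in_carrier[OF g(1)]
  have "g \<otimes> e = g \<otimes> m \<otimes> y" using y c by (simp add: m_assoc)
  also have "g \<otimes> m = m" using central[OF g(1) c(1)] g(3) by simp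
  finally show ?thesis using g(2) y(2) by simp
qed

lemma max_subgroup_power:
  assumes e: "e \<in> idempotents M" and m: "m \<in> max_subgroup M e"
  obtains k where "m [^] Suc k = e"
proof -
  note mC = max_subgroup_in[OF m]
  obtain k where k: "m [^] Suc k \<in> idempotents M" using idempotent_power[OF mC] .
  have "m [^] Suc k \<otimes> e = m [^] Suc k"
    using mC max_subgroup_right[OF m] idempotent_in_carrier[OF e] by (simp add: m_assoc)
  then have "m [^] Suc k = e"
    using power_idempotent_absorbs[OF mC k] k by (intro max_subgroup_idempotent[OF e m])
  with that show ?thesis .
qed

lemma one_in_max_subgroup: "e \<in> idempotents M \<Longrightarrow> e \<in> max_subgroup M e"
  by (auto simp: max_subgroup_def idempotents_def)

lemma max_subgroup_mult:
  assumes e: "e \<in> idempotents M" and "m \<in> max_subgroup M e" "n \<in> max_subgroup M e"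
  shows "m \<otimes> n \<in> max_subgroup M e"
proof -
  obtain y z where yz: "y \<in> carrier M" "m \<otimes> y = e" "z \<in> carrier M" "n \<otimes> z = e"
    using assms(2,3) by (auto simp: max_subgroup_def)
  note c = max_subgroup_in[OF assms(2)] max_subgroup_in[OF assms(3)] idempotent_in_carrier[OF e]
  have "m \<otimes> n \<otimes> (z \<otimes> y) = m \<otimes> (n \<otimes> z) \<otimes> y" using c yz(1,3) by (simp add: m_assoc)
  also have "\<dots> = e" using yz max_subgroup_right[OF assms(2)] by simp
  finally have "\<exists>w\<in>carrier M. m \<otimes> n \<otimes> w = e" using yz by blast
  moreover have "m \<otimes> n \<otimes> e = m \<otimes> n" using c max_subgroup_right[OF assms(3)] by (simp add: m_assoc)
  ultimately show ?thesis using c by (simp add: max_subgroup_def)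
qed

text \<open>The inverse is a power of \<open>m\<close>, so it stays in any submonoid containing
  \<open>m\<close> and \<open>e\<close>. The factor \<open>e\<close> matters for
  \<open>k = 0\<close>, where the power is the identity of \<open>M\<close>.\<close>

lemma max_subgroup_inverse_power:
  assumes e: "e \<in> idempotents M" and m: "m \<in> max_subgroup M e" and k: "m [^] Suc k = e"
  shows "m [^] k \<otimes> e \<in> max_subgroup M e" "m [^] k \<otimes> e \<otimes> m = e"
proof -
  note c = max_subgroup_in[OF m] idempotent_in_carrier[OF e]
  have "m [^] k \<otimes> e \<otimes> m = m [^] k \<otimes> (m \<otimes> e)" using c central[OF e c(1)] by (simp add: m_assoc)
  also have "\<dots> = e" using k by (simp add: max_subgroup_right[OF m])
  finally show 1: "m [^] k \<otimes> e \<otimes> m = e" .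
  have "m [^] k \<otimes> e \<otimes> e = m [^] k \<otimes> e" using c idempotent_square[OF e] by (simp add: m_assoc)
  then show "m [^] k \<otimes> e \<in> max_subgroup M e" using 1 c by (auto simp: max_subgroup_def)
qed

lemma group_max_group:
  assumes e: "e \<in> idempotents M"
  shows "group (max_group M e)"
proof (rule groupI)
  fix x assume x: "x \<in> carrier (max_group M e)"
  show "\<one>\<^bsub>max_group M e\<^esub> \<otimes>\<^bsub>max_group M e\<^esub> x = x"
    using x central[OF e max_subgroup_in[of x e]] max_subgroup_right[of x e] by simp
  obtain k where "x [^] Suc k = e" using max_subgroup_power[OF e] x by auto
  then show "\<exists>y\<in>carrier (max_group M e). y \<otimes>\<^bsub>max_group M e\<^esub> x = \<one>\<^bsub>max_group M e\<^esub>"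
    using max_subgroup_inverse_power[OF e, of x k] x by auto
qed (auto simp: max_subgroup_mult[OF e] one_in_max_subgroup[OF e] max_subgroup_in m_assoc)

lemma max_subgroup_factor_left:
  assumes "a \<in> carrier M" "b \<in> carrier M" "a \<otimes> e = a" "a \<otimes> b \<in> max_subgroup M e"
  shows "a \<in> max_subgroup M e"
proof -
  obtain y where "y \<in> carrier M" "a \<otimes> b \<otimes> y = e" using assms(4) by (auto simp: max_subgroup_def)
  then have "b \<otimes> y \<in> carrier M" "a \<otimes> (b \<otimes> y) = e" using assms by (simp_all add: m_assoc)
  then show ?thesis using assms by (auto simp: max_subgroup_def)
qed

lemma max_subgroup_factor_right:
  assumes e: "e \<in> idempotents M" and a: "a \<in> max_subgroup M e" and b: "b \<in> carrier M" "b \<otimes> e = b"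
    and ab: "a \<otimes> b \<in> max_subgroup M e"
  shows "b \<in> max_subgroup M e"
proof -
  obtain k where k: "a [^] Suc k = e" using max_subgroup_power[OF e a] .
  let ?c = "a [^] k \<otimes> e"
  note c = max_subgroup_inverse_power[OF e a k]
  have "?c \<otimes> (a \<otimes> b) = ?c \<otimes> a \<otimes> b"
    using max_subgroup_in[OF c(1)] max_subgroup_in[OF a] b by (simp only: m_assoc)
  also have "\<dots> = b" unfolding c(2) using central[OF e b(1)] b(2) by simp
  finally show ?thesis using max_subgroup_mult[OF e c(1) ab] by simp
qed

text \<open>A nonunit of \<open>e M\<close> is absorbed by an idempotent strictly below
  \<open>e\<close>, namely its idempotent power. So the vanishing of an operator on nonunits reduces
  to its vanishing on idempotents.\<close>

lemma below_idempotent: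
  assumes e: "e \<in> idempotents M" and m: "m \<in> carrier M" "m \<otimes> e = m" "m \<notin> max_subgroup M e"
  obtains k where "m [^] Suc k \<in> idempotents M" "m [^] Suc k \<otimes> e = m [^] Suc k" "m [^] Suc k \<noteq> e"
    "m \<otimes> m [^] Suc k = m"
proof -
  obtain k where k: "m [^] Suc k \<in> idempotents M" using idempotent_power[OF m(1)] .
  have 1: "m [^] Suc k \<otimes> e = m [^] Suc k"
    using m idempotent_in_carrier[OF e] by (simp add: m_assoc)
  have 2: "m [^] Suc k \<noteq> e"
  proof
    assume "m [^] Suc k = e"
    then have "m \<otimes> m [^] k = e" using nat_pow_Suc2[OF m(1)] by simp
    then show False using m by (auto simp: max_subgroup_def)
  qed
  show ?thesis by (rule that[OF k 1 2 power_idempotent_absorbs(2)[OF m(1) k]])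
qed

text \<open>This rewrites the ideal in the definition of an apex as invertibility of
  \<open>m e\<close>. If \<open>m e\<close> is not a unit, some idempotent \<open>g\<close> strictly
  below \<open>e\<close> absorbs it; then \<open>e = x m y\<close> would be absorbed as well,
  forcing \<open>e = g\<close>.\<close>

lemma mem_two_sided_ideal_iff:
  assumes e: "e \<in> idempotents M" and m: "m \<in> carrier M"
  shows "e \<in> {x \<otimes> m \<otimes> y | x y. x \<in> carrier M \<and> y \<in> carrier M} \<longleftrightarrow> m \<otimes> e \<in> max_subgroup M e"
proof
  note eC = idempotent_in_carrier[OF e] and ee = idempotent_square[OF e]
  have me: "m \<otimes> e \<otimes> e = m \<otimes> e" using m eC ee by (simp add: m_assoc)
  assume "e \<in> {x \<otimes> m \<otimes> y | x y. x \<in> carrier M \<and> y \<in> carrier M}"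
  then obtain x y where xy: "x \<in> carrier M" "y \<in> carrier M" "e = x \<otimes> m \<otimes> y" by blast
  show "m \<otimes> e \<in> max_subgroup M e"
  proof (rule ccontr)
    assume n: "m \<otimes> e \<notin> max_subgroup M e"
    obtain k where k: "(m \<otimes> e) [^] Suc k \<in> idempotents M" "(m \<otimes> e) [^] Suc k \<otimes> e = (m \<otimes> e) [^] Suc k"
      "(m \<otimes> e) [^] Suc k \<noteq> e" "m \<otimes> e \<otimes> (m \<otimes> e) [^] Suc k = m \<otimes> e"
      using below_idempotent[OF e _ me n] m eC by blast
    define g where "g = (m \<otimes> e) [^] Suc k"
    note g = k[folded g_def] and gC = idempotent_in_carrier[OF k(1), folded g_def]
    have "e = e \<otimes> e" using ee by simp
    also have "\<dots> = x \<otimes> m \<otimes> y \<otimes> e" using xy(3) by simp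
    also have "\<dots> = x \<otimes> (m \<otimes> e) \<otimes> y" using xy m eC central[OF e xy(2)] by (simp add: m_assoc)
    also have "\<dots> = x \<otimes> (m \<otimes> e \<otimes> g) \<otimes> y" by (simp only: g(4))
    also have "\<dots> = x \<otimes> (m \<otimes> (e \<otimes> (y \<otimes> g)))" using xy m eC gC central[OF g(1) xy(2)] by (simp add: m_assoc)
    also have "\<dots> = x \<otimes> m \<otimes> y \<otimes> (e \<otimes> g)"
      using xy m eC gC central[OF e xy(2)] by (simp add: m_assoc[symmetric])
    also have "\<dots> = e \<otimes> (e \<otimes> g)" using xy(3) by simp
    also have "\<dots> = g" using eC gC ee central[OF e gC] g(2) by (simp add: m_assoc[symmetric])
    finally show False using g(3) by simp
  qed
next
  note eC = idempotent_in_carrier[OF e]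
  assume "m \<otimes> e \<in> max_subgroup M e"
  then obtain y where y: "y \<in> carrier M" "m \<otimes> e \<otimes> y = e" by (auto simp: max_subgroup_def)
  then have "e = \<one> \<otimes> m \<otimes> (e \<otimes> y)" using m eC by (simp add: m_assoc)
  then show "e \<in> {x \<otimes> m \<otimes> y | x y. x \<in> carrier M \<and> y \<in> carrier M}" using y eC by blast
qed

end

section \<open>The fibre product\<close>

lemma quot_class_eq_iff:
  assumes "x \<in> carrier M" "y \<in> carrier M"
  shows "quot_class M N x = quot_class M N y \<longleftrightarrow> N #>\<^bsub>M\<^esub> x = N #>\<^bsub>M\<^esub> y"
  using assms by (auto simp: quot_class_def)

lemma quot_class_eqD:
  assumes "monoid M" "submonoid N M" "x \<in> carrier M" "y \<in> carrier M" "quot_class M N x = quot_class M N y"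
  obtains n where "n \<in> N" "x = n \<otimes>\<^bsub>M\<^esub> y"
proof -
  interpret monoid M by fact
  have "\<one>\<^bsub>M\<^esub> \<otimes>\<^bsub>M\<^esub> x \<in> N #>\<^bsub>M\<^esub> x" using submonoid.one_closed[OF assms(2)] by (auto simp: r_coset_def)
  then have "x \<in> N #>\<^bsub>M\<^esub> y" using assms quot_class_eq_iff[OF assms(3,4), of N] by simp
  then show ?thesis using that by (auto simp: r_coset_def)
qed

lemma quot_class_translate:
  assumes "monoid M" "submonoid N M" "group (M\<lparr>carrier := N\<rparr>)" "n \<in> N" "y \<in> carrier M"
  shows "quot_class M N (n \<otimes>\<^bsub>M\<^esub> y) = quot_class M N y"
proof -
  interpret monoid M by fact
  interpret N: group "M\<lparr>carrier := N\<rparr>" by fact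
  have NM: "N \<subseteq> carrier M" by (rule submonoid.subset[OF assms(2)])
  obtain n' where n': "n' \<in> N" "n' \<otimes>\<^bsub>M\<^esub> n = \<one>\<^bsub>M\<^esub>" using N.l_inv_ex[of n] assms(4) by auto
  have nM: "n \<in> carrier M" "n' \<in> carrier M" using NM assms(4) n' by auto
  have "N #>\<^bsub>M\<^esub> (n \<otimes>\<^bsub>M\<^esub> y) = N #>\<^bsub>M\<^esub> y"
  proof (intro equalityI subsetI)
    fix z assume "z \<in> N #>\<^bsub>M\<^esub> (n \<otimes>\<^bsub>M\<^esub> y)"
    then obtain h where "h \<in> N" "z = h \<otimes>\<^bsub>M\<^esub> (n \<otimes>\<^bsub>M\<^esub> y)" by (auto simp: r_coset_def)
    then have "h \<otimes>\<^bsub>M\<^esub> n \<in> N" "z = h \<otimes>\<^bsub>M\<^esub> n \<otimes>\<^bsub>M\<^esub> y"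
      using NM assms(4,5) submonoid.m_closed[OF assms(2)] by (auto simp: m_assoc subset_iff)
    then show "z \<in> N #>\<^bsub>M\<^esub> y" by (auto simp: r_coset_def)
  next
    fix z assume "z \<in> N #>\<^bsub>M\<^esub> y"
    then obtain h where h: "h \<in> N" "z = h \<otimes>\<^bsub>M\<^esub> y" by (auto simp: r_coset_def)
    then have hM: "h \<in> carrier M" using NM by blast
    have "h \<otimes>\<^bsub>M\<^esub> n' \<in> N" using h n' submonoid.m_closed[OF assms(2)] by blast
    moreover have "z = h \<otimes>\<^bsub>M\<^esub> n' \<otimes>\<^bsub>M\<^esub> (n \<otimes>\<^bsub>M\<^esub> y)"
    proof -
      have "h \<otimes>\<^bsub>M\<^esub> n' \<otimes>\<^bsub>M\<^esub> (n \<otimes>\<^bsub>M\<^esub> y) = h \<otimes>\<^bsub>M\<^esub> (n' \<otimes>\<^bsub>M\<^esub> n) \<otimes>\<^bsub>M\<^esub> y"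
        using hM nM assms(5) by (simp add: m_assoc)
      then show ?thesis using h n'(2) hM by simp
    qed
    ultimately show "z \<in> N #>\<^bsub>M\<^esub> (n \<otimes>\<^bsub>M\<^esub> y)" by (auto simp: r_coset_def)
  qed
  then show ?thesis using assms nM by (simp add: quot_class_eq_iff)
qed

locale centric_fibre =
  fixes M1 :: "('a, 'm) monoid_scheme" and M2 :: "('b, 'k) monoid_scheme"
    and N1 :: "'a set" and N2 :: "'b set" and \<iota> :: "'a set \<Rightarrow> 'b set"
  assumes clifford1: "finite_clifford M1" and clifford2: "finite_clifford M2"
    and sub1: "submonoid N1 M1" and sub2: "submonoid N2 M2"
    and centric1: "centric N1 M1" and centric2: "centric N2 M2"
    and group1: "group (M1\<lparr>carrier := N1\<rparr>)" and group2: "group (M2\<lparr>carrier := N2\<rparr>)"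
    and iso: "\<iota> \<in> iso (quot_monoid M1 N1) (quot_monoid M2 N2)"
begin

sublocale M1: finite_clifford M1 by (rule clifford1)
sublocale M2: finite_clifford M2 by (rule clifford2)

abbreviation "\<Gamma> \<equiv> fibre_prod M1 N1 M2 N2 \<iota>"
abbreviation "X \<equiv> M1 \<times>\<times> M2"

sublocale X: finite_clifford X by (rule finite_clifford_prod[OF clifford1 clifford2])

lemma mem_\<Gamma>: "(a, b) \<in> \<Gamma> \<longleftrightarrow> a \<in> carrier M1 \<and> b \<in> carrier M2 \<and> \<iota> (quot_class M1 N1 a) = quot_class M2 N2 b"
  by (auto simp: fibre_prod_def)

lemma \<Gamma>_in: "\<gamma> \<in> \<Gamma> \<Longrightarrow> \<gamma> \<in> carrier X"
  by (cases \<gamma>) (auto simp: mem_\<Gamma>)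

lemma \<iota>_mult:
  assumes "a \<in> carrier M1" "b \<in> carrier M1"
  shows "\<iota> (quot_class M1 N1 (a \<otimes>\<^bsub>M1\<^esub> b)) =
    \<iota> (quot_class M1 N1 a) \<otimes>\<^bsub>quot_monoid M2 N2\<^esub> \<iota> (quot_class M1 N1 b)"
proof -
  have "\<iota> \<in> hom (quot_monoid M1 N1) (quot_monoid M2 N2)" using iso by (auto simp: iso_def)
  then show ?thesis
    using assms hom_mult[of \<iota> "quot_monoid M1 N1" "quot_monoid M2 N2" "quot_class M1 N1 a" "quot_class M1 N1 b"]
    by (simp add: quot_monoid_mult[OF M1.monoid_axioms centric1 assms, symmetric]) (simp add: quot_monoid_def)
qed

lemma \<iota>_bij: "bij_betw \<iota> (quot_class M1 N1 ` carrier M1) (quot_class M2 N2 ` carrier M2)"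
  using iso by (simp add: iso_def quot_monoid_def)

lemma exists_snd: "a \<in> carrier M1 \<Longrightarrow> \<exists>b. (a, b) \<in> \<Gamma>"
  using bij_betw_apply[OF \<iota>_bij imageI[of a "carrier M1" "quot_class M1 N1"]] by (auto simp: mem_\<Gamma>)

lemma exists_fst: "b \<in> carrier M2 \<Longrightarrow> \<exists>a. (a, b) \<in> \<Gamma>"
proof -
  assume b: "b \<in> carrier M2"
  then have "quot_class M2 N2 b \<in> \<iota> ` quot_class M1 N1 ` carrier M1" using \<iota>_bij by (auto simp: bij_betw_def)
  then show ?thesis using b by (auto simp: mem_\<Gamma>)
qed

lemma \<Gamma>_mult: "\<gamma> \<in> \<Gamma> \<Longrightarrow> \<gamma>' \<in> \<Gamma> \<Longrightarrow> \<gamma> \<otimes>\<^bsub>X\<^esub> \<gamma>' \<in> \<Gamma>"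
  by (cases \<gamma>; cases \<gamma>') (simp add: mem_\<Gamma> \<iota>_mult quot_monoid_mult[OF M2.monoid_axioms centric2])

text \<open>Membership in \<open>iso\<close> gives a multiplicative bijection but no equation for
  the identity. Surjectivity supplies partners \<open>x\<close> and \<open>y\<close> of the two
  identities, and the product \<open>(x, y)\<close> of these pairs equates the classes of
  \<open>y\<close> and the identity of \<open>M2\<close>.\<close>

lemma \<Gamma>_one: "\<one>\<^bsub>X\<^esub> \<in> \<Gamma>"
proof -
  obtain x where x: "(x, \<one>\<^bsub>M2\<^esub>) \<in> \<Gamma>" using exists_fst M2.one_closed by blast
  obtain y where y: "(\<one>\<^bsub>M1\<^esub>, y) \<in> \<Gamma>" using exists_snd M1.one_closed by blast
  have "(\<one>\<^bsub>M1\<^esub>, y) \<otimes>\<^bsub>X\<^esub> (x, \<one>\<^bsub>M2\<^esub>) \<in> \<Gamma>" by (rule \<Gamma>_mult[OF y x])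
  then have "(x, y) \<in> \<Gamma>" using x y by (simp add: mem_\<Gamma>)
  then show ?thesis using x y by (simp add: mem_\<Gamma>)
qed

lemma \<Gamma>_power: "\<gamma> \<in> \<Gamma> \<Longrightarrow> \<gamma> [^]\<^bsub>X\<^esub> (k::nat) \<in> \<Gamma>"
  using \<Gamma>_one by (induction k) (auto simp: \<Gamma>_mult simp del: one_DirProd)

lemma \<Gamma>_translate: "(a, b) \<in> \<Gamma> \<Longrightarrow> n1 \<in> N1 \<Longrightarrow> n2 \<in> N2 \<Longrightarrow> (n1 \<otimes>\<^bsub>M1\<^esub> a, n2 \<otimes>\<^bsub>M2\<^esub> b) \<in> \<Gamma>"
  using submonoid.subset[OF sub1] submonoid.subset[OF sub2]
  by (auto simp: mem_\<Gamma> quot_class_translate[OF M1.monoid_axioms sub1 group1]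
      quot_class_translate[OF M2.monoid_axioms sub2 group2])

lemma N_in_\<Gamma>: "n1 \<in> N1 \<Longrightarrow> n2 \<in> N2 \<Longrightarrow> (n1, n2) \<in> \<Gamma>"
  using \<Gamma>_translate[of "\<one>\<^bsub>M1\<^esub>" "\<one>\<^bsub>M2\<^esub>" n1 n2] \<Gamma>_one subsetD[OF submonoid.subset[OF sub1], of n1]
    subsetD[OF submonoid.subset[OF sub2], of n2] by simp

lemma \<Gamma>_snd_unique:
  assumes "(a, b) \<in> \<Gamma>" "(a, b') \<in> \<Gamma>"
  obtains n where "n \<in> N2" "b = n \<otimes>\<^bsub>M2\<^esub> b'"
  using assms quot_class_eqD[OF M2.monoid_axioms sub2, of b b'] by (auto simp: mem_\<Gamma>)

lemma \<Gamma>_fst_unique: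
  assumes "(a, b) \<in> \<Gamma>" "(a', b) \<in> \<Gamma>"
  obtains n where "n \<in> N1" "a = n \<otimes>\<^bsub>M1\<^esub> a'"
proof -
  have "\<iota> (quot_class M1 N1 a) = \<iota> (quot_class M1 N1 a')" using assms by (simp add: mem_\<Gamma>)
  then have "quot_class M1 N1 a = quot_class M1 N1 a'"
    using \<iota>_bij assms by (auto simp: bij_betw_def inj_on_def mem_\<Gamma>)
  then show ?thesis using quot_class_eqD[OF M1.monoid_axioms sub1, of a a'] assms that by (auto simp: mem_\<Gamma>)
qed

end

text \<open>Since \<open>n\<close> is invertible, \<open>e\<close> and \<open>g\<close> absorb each
  other, and commuting idempotents that do so are equal. Hence different idempotents have different
  classes modulo \<open>N\<close>.\<close>

lemma translated_idempotent_eq: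
  assumes "finite_clifford M" "submonoid N M" "group (M\<lparr>carrier := N\<rparr>)"
    and e: "e \<in> idempotents M" "g \<in> idempotents M" and n: "n \<in> N" "g = n \<otimes>\<^bsub>M\<^esub> e"
  shows "g = e"
proof -
  interpret finite_clifford M by fact
  interpret N: group "M\<lparr>carrier := N\<rparr>" by fact
  obtain n' where n': "n' \<in> N" "n' \<otimes>\<^bsub>M\<^esub> n = \<one>\<^bsub>M\<^esub>" using N.l_inv_ex[of n] n by auto
  have c: "n \<in> carrier M" "n' \<in> carrier M" "e \<in> carrier M" "g \<in> carrier M"
    using n n' submonoid.subset[OF assms(2)] e idempotent_in_carrier by auto
  have ge: "g \<otimes>\<^bsub>M\<^esub> e = g" using c idempotent_square[OF e(1)] unfolding n(2) by (simp add: m_assoc)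
  have "n' \<otimes>\<^bsub>M\<^esub> g = n' \<otimes>\<^bsub>M\<^esub> n \<otimes>\<^bsub>M\<^esub> e" using c n(2) by (simp add: m_assoc)
  then have e': "e = n' \<otimes>\<^bsub>M\<^esub> g" using c n' by simp
  then have "e \<otimes>\<^bsub>M\<^esub> g = e" using c idempotent_square[OF e(2)] by (metis m_assoc)
  then show ?thesis using central[OF e(1) c(4)] ge by simp
qed

section \<open>Representations of the fibre product with a single apex\<close>

locale centric_fibre_rep = centric_fibre M1 M2 N1 N2 \<iota> +
    R: monoid_rep "(M1 \<times>\<times> M2)\<lparr>carrier := fibre_prod M1 N1 M2 N2 \<iota>\<rparr>" s W \<rho>
  for M1 :: "('a, 'm) monoid_scheme" and M2 :: "('b, 'k) monoid_scheme"
    and N1 :: "'a set" and N2 :: "'b set" and \<iota> :: "'a set \<Rightarrow> 'b set"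
    and s :: "complex \<Rightarrow> 'w::ab_group_add \<Rightarrow> 'w" and W :: "'w set" and \<rho> :: "'a \<times> 'b \<Rightarrow> 'w \<Rightarrow> 'w" +
  fixes f1 :: 'a and f2 :: 'b
  assumes fin_dim: "finite_dim s W"
    and f_matched: "(f1, f2) \<in> matched_idempotents M1 N1 M2 N2 \<iota>"
    and apex: "\<And>U. U \<subseteq> W \<Longrightarrow> irreducible_rep ((M1 \<times>\<times> M2)\<lparr>carrier := fibre_prod M1 N1 M2 N2 \<iota>\<rparr>) s U \<rho> \<Longrightarrow>
           is_apex ((M1 \<times>\<times> M2)\<lparr>carrier := fibre_prod M1 N1 M2 N2 \<iota>\<rparr>) U \<rho> (f1, f2)"
begin

abbreviation "f \<equiv> (f1, f2)"
abbreviation "\<Gamma>X \<equiv> X\<lparr>carrier := \<Gamma>\<rparr>"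
abbreviation "H1 \<equiv> max_group M1 f1"
abbreviation "H2 \<equiv> max_group M2 f2"
abbreviation "HH \<equiv> max_subgroup X f"
abbreviation "K \<equiv> \<Gamma> \<inter> HH"
abbreviation "G \<equiv> H1 \<times>\<times> H2"

lemma f1: "f1 \<in> idempotents M1" and f2: "f2 \<in> idempotents M2" and f_\<Gamma>: "f \<in> \<Gamma>"
  using f_matched M1.idempotent_in_carrier M2.idempotent_in_carrier
  by (auto simp: matched_idempotents_def mem_\<Gamma>)

lemma f: "f \<in> idempotents X"
  using f1 f2 by (auto simp: idempotents_def)

lemma HH_eq: "HH = max_subgroup M1 f1 \<times> max_subgroup M2 f2"
  by (rule max_subgroup_prod)

lemma carrier_G: "carrier G = HH"
  by (simp add: HH_eq)

lemma mult_G: "x \<otimes>\<^bsub>G\<^esub> y = x \<otimes>\<^bsub>X\<^esub> y"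
  by (cases x; cases y) simp

sublocale H1: group H1 by (rule M1.group_max_group[OF f1])
sublocale H2: group H2 by (rule M2.group_max_group[OF f2])

lemma \<Gamma>_maps: "\<gamma> \<in> \<Gamma> \<Longrightarrow> w \<in> W \<Longrightarrow> \<rho> \<gamma> w \<in> W"
  and \<Gamma>_map_mult: "\<gamma> \<in> \<Gamma> \<Longrightarrow> \<gamma>' \<in> \<Gamma> \<Longrightarrow> w \<in> W \<Longrightarrow> \<rho> (\<gamma> \<otimes>\<^bsub>X\<^esub> \<gamma>') w = \<rho> \<gamma> (\<rho> \<gamma>' w)"
  using R.maps R.map_mult by (simp_all del: mult_DirProd)

text \<open>As \<open>f\<close> is central, the image of \<open>1 - \<rho> f\<close> is a
  subrepresentation, and \<open>f\<close> kills it. An irreducible constituent of it would have apex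
  \<open>f\<close> and still be killed by \<open>f\<close>, although
  \<open>f = f f f\<close>.\<close>

lemma \<rho>_f:
  assumes w: "w \<in> W"
  shows "\<rho> f w = w"
proof (rule ccontr)
  assume neq: "\<rho> f w \<noteq> w"
  let ?T = "\<lambda>w. w - \<rho> f w"
  have comm: "\<rho> f (\<rho> \<gamma> w) = \<rho> \<gamma> (\<rho> f w)" if "\<gamma> \<in> \<Gamma>" "w \<in> W" for \<gamma> w
    using \<Gamma>_map_mult[OF f_\<Gamma> that] \<Gamma>_map_mult[OF that(1) f_\<Gamma> that(2)] X.central[OF f \<Gamma>_in[OF that(1)]] by simp
  have T: "intertwiner \<Gamma>X s W \<rho> s W \<rho> ?T"
    by (rule intertwinerI)
      (simp_all add: R.diff_in R.maps f_\<Gamma> R.map_add R.map_scale R.VS.scale_right_diff_distrib R.map_diff comm)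
  interpret I: monoid_rep \<Gamma>X s "?T ` W" \<rho> by (rule R.image_rep[OF T R.monoid_rep_axioms])
  have sub: "?T ` W \<subseteq> W" using intertwiner_in[OF T] by blast
  have "?T w \<in> ?T ` W" "?T w \<noteq> 0" using w neq by auto
  then have "?T ` W \<noteq> {0}" by blast
  then obtain U where U: "U \<subseteq> ?T ` W" "irreducible_rep \<Gamma>X s U \<rho>"
    using I.exists_irreducible_subrep[OF finite_dim_subset[OF fin_dim sub]] by blast
  have ap: "is_apex \<Gamma>X U \<rho> f" using apex U sub by blast
  have ff: "f \<otimes>\<^bsub>X\<^esub> f = f" using X.idempotent_square[OF f] .
  have kill: "\<rho> f u = 0" if u: "u \<in> U" for u
  proof -
    obtain v where v: "v \<in> W" "u = v - \<rho> f v" using u U(1) by blast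
    have "\<rho> f (\<rho> f v) = \<rho> f v" using \<Gamma>_map_mult[OF f_\<Gamma> f_\<Gamma> v(1)] ff by simp
    then show ?thesis using v by (simp add: R.map_diff f_\<Gamma> R.maps)
  qed
  have "f \<in> {x \<otimes>\<^bsub>\<Gamma>X\<^esub> f \<otimes>\<^bsub>\<Gamma>X\<^esub> y | x y. x \<in> carrier \<Gamma>X \<and> y \<in> carrier \<Gamma>X}"
    using f_\<Gamma> ff by (intro CollectI exI[of _ f]) simp
  moreover have "f \<in> {m \<in> carrier \<Gamma>X. \<forall>u\<in>U. \<rho> m u = 0}" using kill f_\<Gamma> by simp
  ultimately show False using ap unfolding is_apex_def by blast
qed

text \<open>On the image of \<open>\<rho> e\<close>, a subrepresentation because \<open>e\<close> is
  central, \<open>e\<close> acts as the identity. But \<open>f\<close> is not in the ideal generated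
  by \<open>e\<close>, whose elements are all absorbed by \<open>e\<close>, so \<open>e\<close> has
  to kill every irreducible constituent.\<close>

lemma \<rho>_idempotent_zero:
  assumes e: "e \<in> idempotents X" "e \<in> \<Gamma>" "e \<otimes>\<^bsub>X\<^esub> f \<noteq> f" and w: "w \<in> W"
  shows "\<rho> e w = 0"
proof (rule ccontr)
  assume neq: "\<rho> e w \<noteq> 0"
  have comm: "\<rho> e (\<rho> \<gamma> w) = \<rho> \<gamma> (\<rho> e w)" if "\<gamma> \<in> \<Gamma>" "w \<in> W" for \<gamma> w
    using \<Gamma>_map_mult[OF e(2) that] \<Gamma>_map_mult[OF that(1) e(2) that(2)] X.central[OF e(1) \<Gamma>_in[OF that(1)]] by simp
  have T: "intertwiner \<Gamma>X s W \<rho> s W \<rho> (\<rho> e)"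
    by (rule intertwinerI) (simp_all add: R.maps e(2) R.map_add R.map_scale comm)
  interpret I: monoid_rep \<Gamma>X s "\<rho> e ` W" \<rho> by (rule R.image_rep[OF T R.monoid_rep_axioms])
  have sub: "\<rho> e ` W \<subseteq> W" using intertwiner_in[OF T] by blast
  have "\<rho> e ` W \<noteq> {0}" using w neq by blast
  then obtain U where U: "U \<subseteq> \<rho> e ` W" "irreducible_rep \<Gamma>X s U \<rho>"
    using I.exists_irreducible_subrep[OF finite_dim_subset[OF fin_dim sub]] by blast
  have ap: "is_apex \<Gamma>X U \<rho> f" using apex U sub by blast
  have id: "\<rho> e u = u" if u: "u \<in> U" for u
  proof -
    obtain v where v: "v \<in> W" "u = \<rho> e v" using u U(1) by blast
    then show ?thesis using \<Gamma>_map_mult[OF e(2,2) v(1)] X.idempotent_square[OF e(1)] by simp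
  qed
  have "f \<notin> {x \<otimes>\<^bsub>X\<^esub> e \<otimes>\<^bsub>X\<^esub> y | x y. x \<in> \<Gamma> \<and> y \<in> \<Gamma>}"
  proof
    assume "f \<in> {x \<otimes>\<^bsub>X\<^esub> e \<otimes>\<^bsub>X\<^esub> y | x y. x \<in> \<Gamma> \<and> y \<in> \<Gamma>}"
    then obtain x y where xy: "x \<in> carrier X" "y \<in> carrier X" "f = x \<otimes>\<^bsub>X\<^esub> e \<otimes>\<^bsub>X\<^esub> y" using \<Gamma>_in by blast
    have eC: "e \<in> carrier X" by (rule X.idempotent_in_carrier[OF e(1)])
    have "e \<otimes>\<^bsub>X\<^esub> f = e \<otimes>\<^bsub>X\<^esub> (x \<otimes>\<^bsub>X\<^esub> e \<otimes>\<^bsub>X\<^esub> y)" using xy(3) by simp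
    also have "\<dots> = e \<otimes>\<^bsub>X\<^esub> x \<otimes>\<^bsub>X\<^esub> e \<otimes>\<^bsub>X\<^esub> y" using xy eC by (simp only: X.m_assoc X.m_closed)
    also have "e \<otimes>\<^bsub>X\<^esub> x = x \<otimes>\<^bsub>X\<^esub> e" by (rule X.central[OF e(1) xy(1)])
    also have "x \<otimes>\<^bsub>X\<^esub> e \<otimes>\<^bsub>X\<^esub> e = x \<otimes>\<^bsub>X\<^esub> e" using xy eC X.idempotent_square[OF e(1)] by (simp only: X.m_assoc)
    finally show False using e(3) xy(3) by simp
  qed
  then have "e \<in> {m \<in> carrier \<Gamma>X. f \<notin> {x \<otimes>\<^bsub>\<Gamma>X\<^esub> m \<otimes>\<^bsub>\<Gamma>X\<^esub> y | x y. x \<in> carrier \<Gamma>X \<and> y \<in> carrier \<Gamma>X}}"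
    using e(2) by simp
  then have "\<forall>u\<in>U. \<rho> e u = 0" using ap unfolding is_apex_def by blast
  then have "U = {0}" using id monoid_rep.zero_in[OF irreducible_rep_rep[OF U(2)]] by force
  then show False using U(2) by (simp add: irreducible_rep_def)
qed

lemma right_f: "x \<in> carrier X \<Longrightarrow> x \<otimes>\<^bsub>X\<^esub> f \<otimes>\<^bsub>X\<^esub> f = x \<otimes>\<^bsub>X\<^esub> f"
  using X.m_assoc[OF _ X.idempotent_in_carrier[OF f] X.idempotent_in_carrier[OF f]] X.idempotent_square[OF f]
  by simp

lemma f_carrier: "f \<in> carrier X" by (rule X.idempotent_in_carrier[OF f])

text \<open>\<open>\<gamma>\<close> acts as \<open>\<gamma> f\<close>, which is absorbed by its
  idempotent power. The latter is a power of an element of \<open>\<Gamma>\<close>, hence in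
  \<open>\<Gamma>\<close>, and strictly below \<open>f\<close>.\<close>

lemma \<rho>_nonunit_zero:
  assumes \<gamma>: "\<gamma> \<in> \<Gamma>" "\<gamma> \<otimes>\<^bsub>X\<^esub> f \<notin> HH" and w: "w \<in> W"
  shows "\<rho> \<gamma> w = 0"
proof -
  let ?x = "\<gamma> \<otimes>\<^bsub>X\<^esub> f"
  have x: "?x \<in> \<Gamma>" by (rule \<Gamma>_mult[OF \<gamma>(1) f_\<Gamma>])
  obtain k where k: "?x [^]\<^bsub>X\<^esub> Suc k \<in> idempotents X" "?x [^]\<^bsub>X\<^esub> Suc k \<otimes>\<^bsub>X\<^esub> f = ?x [^]\<^bsub>X\<^esub> Suc k"
    "?x [^]\<^bsub>X\<^esub> Suc k \<noteq> f" "?x \<otimes>\<^bsub>X\<^esub> ?x [^]\<^bsub>X\<^esub> Suc k = ?x"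
    using X.below_idempotent[OF f \<Gamma>_in[OF x] right_f[OF \<Gamma>_in[OF \<gamma>(1)]] \<gamma>(2)] by blast
  let ?g = "?x [^]\<^bsub>X\<^esub> Suc k"
  have g: "?g \<in> \<Gamma>" by (rule \<Gamma>_power[OF x])
  have "\<rho> \<gamma> w = \<rho> ?x w" using \<Gamma>_map_mult[OF \<gamma>(1) f_\<Gamma> w] \<rho>_f[OF w] by simp
  also have "\<dots> = \<rho> ?x (\<rho> ?g w)" using \<Gamma>_map_mult[OF x g w] k(4) by simp
  also have "\<rho> ?g w = 0" using k by (intro \<rho>_idempotent_zero g w) auto
  also have "\<rho> ?x 0 = 0" using x by (intro R.map_zero) simp
  finally show ?thesis .
qed

lemma matched_idempotent_snd: "(f1, g) \<in> \<Gamma> \<Longrightarrow> g \<in> idempotents M2 \<Longrightarrow> g = f2"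
  using \<Gamma>_snd_unique[OF _ f_\<Gamma>] translated_idempotent_eq[OF clifford2 sub2 group2 f2] by metis

lemma matched_idempotent_fst: "(g, f2) \<in> \<Gamma> \<Longrightarrow> g \<in> idempotents M1 \<Longrightarrow> g = f1"
  using \<Gamma>_fst_unique[OF _ f_\<Gamma>] translated_idempotent_eq[OF clifford1 sub1 group1 f1] by metis

text \<open>In \<open>\<Gamma>\<close>, a unit in one coordinate is a unit in both. The idempotent
  power \<open>(g1, g2)\<close> lies in \<open>\<Gamma>\<close>; the unit coordinate makes one of
  its entries \<open>f1\<close> or \<open>f2\<close>, and matched idempotents determine each
  other.\<close>

lemma K_intro:
  assumes x: "(a, b) \<in> \<Gamma>" "a \<otimes>\<^bsub>M1\<^esub> f1 = a" "b \<otimes>\<^bsub>M2\<^esub> f2 = b"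
    and ab: "a \<in> max_subgroup M1 f1 \<or> b \<in> max_subgroup M2 f2"
  shows "(a, b) \<in> K"
proof (rule ccontr)
  let ?x = "(a, b)"
  assume "?x \<notin> K"
  then have n: "?x \<notin> HH" using x by blast
  have xf: "?x \<otimes>\<^bsub>X\<^esub> f = ?x" using x by simp
  obtain k where k: "?x [^]\<^bsub>X\<^esub> Suc k \<in> idempotents X" "?x [^]\<^bsub>X\<^esub> Suc k \<otimes>\<^bsub>X\<^esub> f = ?x [^]\<^bsub>X\<^esub> Suc k"
    "?x [^]\<^bsub>X\<^esub> Suc k \<noteq> f" "?x \<otimes>\<^bsub>X\<^esub> ?x [^]\<^bsub>X\<^esub> Suc k = ?x"
    using X.below_idempotent[OF f \<Gamma>_in[OF x(1)] xf n] by blast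
  obtain g1 g2 where g: "?x [^]\<^bsub>X\<^esub> Suc k = (g1, g2)" by (cases "?x [^]\<^bsub>X\<^esub> Suc k")
  note k = k[unfolded g]
  have gi: "g1 \<in> idempotents M1" "g2 \<in> idempotents M2" using k(1) by (auto simp: idempotents_def)
  have g\<Gamma>: "(g1, g2) \<in> \<Gamma>" using \<Gamma>_power[OF x(1), of "Suc k"] unfolding g .
  have "g1 = f1 \<or> g2 = f2"
    using ab k gi M1.max_subgroup_idempotent[OF f1, of a g1] M2.max_subgroup_idempotent[OF f2, of b g2] by auto
  then have "(g1, g2) = f"
    using matched_idempotent_fst[of g1] matched_idempotent_snd[of g2] gi g\<Gamma> by auto
  then show False using k(3) by simp
qed

text \<open>\<open>\<Gamma>\<close> is only closed under products. Inverses stay in it because in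
  the finite group \<open>HH\<close> they are powers times \<open>f\<close>.\<close>

lemma subgroup_K: "subgroup K G"
proof -
  interpret G: group G by (rule DirProd_group) (rule H1.group_axioms H2.group_axioms)+
  show ?thesis
  proof (rule G.subgroupI)
    show "K \<subseteq> carrier G" unfolding carrier_G by blast
    have "f \<in> K" using f_\<Gamma> X.one_in_max_subgroup[OF f] by blast
    then show "K \<noteq> {}" by blast
    show "a \<otimes>\<^bsub>G\<^esub> b \<in> K" if "a \<in> K" "b \<in> K" for a b
      using that \<Gamma>_mult X.max_subgroup_mult[OF f] by (auto simp only: mult_G Int_iff)
    fix a assume a: "a \<in> K"
    obtain k where k: "a [^]\<^bsub>X\<^esub> Suc k = f" using X.max_subgroup_power[OF f] a by blast
    let ?b = "a [^]\<^bsub>X\<^esub> k \<otimes>\<^bsub>X\<^esub> f"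
    have b: "?b \<in> HH" "?b \<otimes>\<^bsub>X\<^esub> a = f" using X.max_subgroup_inverse_power[OF f _ k] a by auto
    have "?b \<in> K" using b(1) \<Gamma>_mult[OF \<Gamma>_power f_\<Gamma>] a by blast
    moreover have "inv\<^bsub>G\<^esub> a = ?b"
    proof (rule G.inv_equality)
      show "?b \<otimes>\<^bsub>G\<^esub> a = \<one>\<^bsub>G\<^esub>" using b(2) by (simp add: mult_G del: mult_DirProd)
      show "a \<in> carrier G" using a by (simp only: carrier_G Int_iff)
      show "?b \<in> carrier G" using b(1) by (simp only: carrier_G)
    qed
    ultimately show "inv\<^bsub>G\<^esub> a \<in> K" by simp
  qed
qed

sublocale F: fibre_group_rep H1 H2 K s W \<rho>
proof (intro fibre_group_rep.intro fibre_group_rep_axioms.intro)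
  show "monoid_rep (G\<lparr>carrier := K\<rparr>) s W \<rho>"
  proof (intro monoid_rep.intro monoid_rep_axioms.intro)
    show "monoid (G\<lparr>carrier := K\<rparr>)"
      using subgroup.subgroup_is_group[OF subgroup_K] DirProd_group[OF H1.group_axioms H2.group_axioms]
      by (simp add: group.is_monoid)
    show "\<rho> (a \<otimes>\<^bsub>G\<lparr>carrier := K\<rparr>\<^esub> b) v = \<rho> a (\<rho> b v)"
      if "a \<in> carrier (G\<lparr>carrier := K\<rparr>)" "b \<in> carrier (G\<lparr>carrier := K\<rparr>)" "v \<in> W" for a b v
      using that \<Gamma>_map_mult[of a b v] by (simp add: mult_G del: mult_DirProd)
  qed (use R.subspace \<Gamma>_maps \<rho>_f R.map_add R.map_scale R.VS.vector_space_axioms in auto)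
  show "\<exists>h2. (h1, h2) \<in> K" if "h1 \<in> carrier H1" for h1
  proof -
    have h1: "h1 \<in> max_subgroup M1 f1" using that by simp
    obtain b where b: "(h1, b) \<in> \<Gamma>" using exists_snd M1.max_subgroup_in[OF h1] by blast
    \<comment> \<open>Multiplication by \<open>f\<close> keeps \<open>h1\<close> and moves its
      partner \<open>b\<close> into \<open>M2 f2\<close>; \<open>K_intro\<close> then makes the
      partner a unit.\<close>
    have "(h1, b) \<otimes>\<^bsub>X\<^esub> f \<in> \<Gamma>" by (rule \<Gamma>_mult[OF b f_\<Gamma>])
    then have "(h1, b \<otimes>\<^bsub>M2\<^esub> f2) \<in> \<Gamma>" using M1.max_subgroup_right[OF h1] by simp
    moreover have "b \<otimes>\<^bsub>M2\<^esub> f2 \<otimes>\<^bsub>M2\<^esub> f2 = b \<otimes>\<^bsub>M2\<^esub> f2"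
      using b M2.idempotent_in_carrier[OF f2] M2.idempotent_square[OF f2] by (simp add: mem_\<Gamma> M2.m_assoc)
    ultimately show ?thesis using K_intro M1.max_subgroup_right[OF h1] h1 by blast
  qed
  show "\<exists>h1. (h1, h2) \<in> K" if "h2 \<in> carrier H2" for h2
  proof -
    have h2: "h2 \<in> max_subgroup M2 f2" using that by simp
    obtain a where a: "(a, h2) \<in> \<Gamma>" using exists_fst M2.max_subgroup_in[OF h2] by blast
    have "(a, h2) \<otimes>\<^bsub>X\<^esub> f \<in> \<Gamma>" by (rule \<Gamma>_mult[OF a f_\<Gamma>])
    then have "(a \<otimes>\<^bsub>M1\<^esub> f1, h2) \<in> \<Gamma>" using M2.max_subgroup_right[OF h2] by simp
    moreover have "a \<otimes>\<^bsub>M1\<^esub> f1 \<otimes>\<^bsub>M1\<^esub> f1 = a \<otimes>\<^bsub>M1\<^esub> f1"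
      using a M1.idempotent_in_carrier[OF f1] M1.idempotent_square[OF f1] by (simp add: mem_\<Gamma> M1.m_assoc)
    ultimately show ?thesis using K_intro M2.max_subgroup_right[OF h2] h2 by blast
  qed
  show "finite (carrier H1)" "finite (carrier H2)"
    using M1.finite_carrier M2.finite_carrier by (auto simp: max_subgroup_def)
qed (rule H1.group_axioms H2.group_axioms subgroup_K fin_dim)+

lemma N1_translate: "n \<in> N1 \<Longrightarrow> n \<otimes>\<^bsub>M1\<^esub> f1 \<in> F.N1 \<and> (\<forall>w\<in>W. \<rho> (n \<otimes>\<^bsub>M1\<^esub> f1, f2) w = \<rho> (n, \<one>\<^bsub>M2\<^esub>) w)"
proof (intro conjI ballI)
  assume n: "n \<in> N1"
  have nM: "n \<in> carrier M1" using n submonoid.subset[OF sub1] by blast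
  have n\<Gamma>: "(n, \<one>\<^bsub>M2\<^esub>) \<in> \<Gamma>" using N_in_\<Gamma>[OF n submonoid.one_closed[OF sub2]] .
  have e: "(n, \<one>\<^bsub>M2\<^esub>) \<otimes>\<^bsub>X\<^esub> f = (n \<otimes>\<^bsub>M1\<^esub> f1, f2)"
    using M2.idempotent_in_carrier[OF f2] by simp
  have "n \<otimes>\<^bsub>M1\<^esub> f1 \<otimes>\<^bsub>M1\<^esub> f1 = n \<otimes>\<^bsub>M1\<^esub> f1"
    using nM M1.idempotent_in_carrier[OF f1] M1.idempotent_square[OF f1] by (simp add: M1.m_assoc)
  then have "(n \<otimes>\<^bsub>M1\<^esub> f1, f2) \<in> K"
    using \<Gamma>_mult[OF n\<Gamma> f_\<Gamma>] M2.one_in_max_subgroup[OF f2] M2.idempotent_square[OF f2] unfolding e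
    by (intro K_intro) auto
  then show "n \<otimes>\<^bsub>M1\<^esub> f1 \<in> F.N1" by (simp add: F.N1_def)
  show "\<rho> (n \<otimes>\<^bsub>M1\<^esub> f1, f2) w = \<rho> (n, \<one>\<^bsub>M2\<^esub>) w" if "w \<in> W" for w
    using \<Gamma>_map_mult[OF n\<Gamma> f_\<Gamma> that] \<rho>_f[OF that] unfolding e by simp
qed

lemma N2_translate: "n \<in> N2 \<Longrightarrow> n \<otimes>\<^bsub>M2\<^esub> f2 \<in> F.N2 \<and> (\<forall>w\<in>W. \<rho> (f1, n \<otimes>\<^bsub>M2\<^esub> f2) w = \<rho> (\<one>\<^bsub>M1\<^esub>, n) w)"
proof (intro conjI ballI)
  assume n: "n \<in> N2"
  have nM: "n \<in> carrier M2" using n submonoid.subset[OF sub2] by blast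
  have n\<Gamma>: "(\<one>\<^bsub>M1\<^esub>, n) \<in> \<Gamma>" using N_in_\<Gamma>[OF submonoid.one_closed[OF sub1] n] .
  have e: "(\<one>\<^bsub>M1\<^esub>, n) \<otimes>\<^bsub>X\<^esub> f = (f1, n \<otimes>\<^bsub>M2\<^esub> f2)"
    using M1.idempotent_in_carrier[OF f1] by simp
  have "n \<otimes>\<^bsub>M2\<^esub> f2 \<otimes>\<^bsub>M2\<^esub> f2 = n \<otimes>\<^bsub>M2\<^esub> f2"
    using nM M2.idempotent_in_carrier[OF f2] M2.idempotent_square[OF f2] by (simp add: M2.m_assoc)
  then have "(f1, n \<otimes>\<^bsub>M2\<^esub> f2) \<in> K"
    using \<Gamma>_mult[OF n\<Gamma> f_\<Gamma>] M1.one_in_max_subgroup[OF f1] M1.idempotent_square[OF f1] unfolding e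
    by (intro K_intro) auto
  then show "n \<otimes>\<^bsub>M2\<^esub> f2 \<in> F.N2" by (simp add: F.N2_def)
  show "\<rho> (f1, n \<otimes>\<^bsub>M2\<^esub> f2) w = \<rho> (\<one>\<^bsub>M1\<^esub>, n) w" if "w \<in> W" for w
    using \<Gamma>_map_mult[OF n\<Gamma> f_\<Gamma> that] \<rho>_f[OF that] unfolding e by simp
qed

text \<open>The map \<open>n \<mapsto> n f1\<close> sends \<open>N1\<close> onto
  \<open>F.N1\<close>, because an element with partner \<open>f2\<close> differs from
  \<open>f1\<close> by an element of \<open>N1\<close>. It respects the actions on \<open>W\<close>,
  so both groups have the same intertwiners.\<close>

lemma intertwiner_N1_iff:
  "intertwiner (M1\<lparr>carrier := N1\<rparr>) s W (\<lambda>a. \<rho> (a, \<one>\<^bsub>M2\<^esub>)) s W (\<lambda>a. \<rho> (a, \<one>\<^bsub>M2\<^esub>)) T \<longleftrightarrow>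
   intertwiner (H1\<lparr>carrier := F.N1\<rparr>) s W (\<lambda>a. \<rho> (a, f2)) s W (\<lambda>a. \<rho> (a, f2)) T"
proof -
  have "\<exists>n\<in>N1. a = n \<otimes>\<^bsub>M1\<^esub> f1" if "a \<in> F.N1" for a
    using that \<Gamma>_fst_unique[OF _ f_\<Gamma>, of a] by (auto simp: F.N1_def)
  then have "(\<forall>a\<in>F.N1. \<forall>w\<in>W. T (\<rho> (a, f2) w) = \<rho> (a, f2) (T w)) \<longleftrightarrow>
      (\<forall>a\<in>N1. \<forall>w\<in>W. T (\<rho> (a, \<one>\<^bsub>M2\<^esub>) w) = \<rho> (a, \<one>\<^bsub>M2\<^esub>) (T w))" if "\<forall>w\<in>W. T w \<in> W"
    using N1_translate that by metis
  then show ?thesis unfolding intertwiner_def by auto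
qed

lemma intertwiner_N2_iff:
  "intertwiner (M2\<lparr>carrier := N2\<rparr>) s W (\<lambda>b. \<rho> (\<one>\<^bsub>M1\<^esub>, b)) s W (\<lambda>b. \<rho> (\<one>\<^bsub>M1\<^esub>, b)) T \<longleftrightarrow>
   intertwiner (H2\<lparr>carrier := F.N2\<rparr>) s W (\<lambda>b. \<rho> (f1, b)) s W (\<lambda>b. \<rho> (f1, b)) T"
proof -
  have "\<exists>n\<in>N2. b = n \<otimes>\<^bsub>M2\<^esub> f2" if "b \<in> F.N2" for b
    using that \<Gamma>_snd_unique[OF _ f_\<Gamma>, of b] by (auto simp: F.N2_def)
  then have "(\<forall>b\<in>F.N2. \<forall>w\<in>W. T (\<rho> (f1, b) w) = \<rho> (f1, b) (T w)) \<longleftrightarrow>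
      (\<forall>b\<in>N2. \<forall>w\<in>W. T (\<rho> (\<one>\<^bsub>M1\<^esub>, b) w) = \<rho> (\<one>\<^bsub>M1\<^esub>, b) (T w))" if "\<forall>w\<in>W. T w \<in> W"
    using N2_translate that by metis
  then show ?thesis unfolding intertwiner_def by auto
qed

lemma theta_rep_N_iff_theta_rep_H:
  "theta_rep (M1\<lparr>carrier := N1\<rparr>) (M2\<lparr>carrier := N2\<rparr>) s W \<rho> \<longleftrightarrow>
    theta_rep H1 H2 (fun_scale s) (ind_space G K W \<rho>) (ind_action G)"
proof -
  interpret N: group_pair_rep "M1\<lparr>carrier := N1\<rparr>" "M2\<lparr>carrier := N2\<rparr>" s W \<rho>
  proof (intro group_pair_rep.intro group_pair_rep_axioms.intro monoid_rep.intro monoid_rep_axioms.intro)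
    show "monoid (M1\<lparr>carrier := N1\<rparr> \<times>\<times> M2\<lparr>carrier := N2\<rparr>)"
      by (intro DirProd_monoid group.is_monoid group1 group2)
    fix a b w assume "a \<in> carrier (M1\<lparr>carrier := N1\<rparr> \<times>\<times> M2\<lparr>carrier := N2\<rparr>)"
      "b \<in> carrier (M1\<lparr>carrier := N1\<rparr> \<times>\<times> M2\<lparr>carrier := N2\<rparr>)" "w \<in> W"
    then show "\<rho> (a \<otimes>\<^bsub>M1\<lparr>carrier := N1\<rparr> \<times>\<times> M2\<lparr>carrier := N2\<rparr>\<^esub> b) w = \<rho> a (\<rho> b w)"
      using \<Gamma>_map_mult[of a b w] N_in_\<Gamma> by (cases a; cases b) simp
  next
    show "\<rho> \<one>\<^bsub>M1\<lparr>carrier := N1\<rparr> \<times>\<times> M2\<lparr>carrier := N2\<rparr>\<^esub> w = w" if "w \<in> W" for w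
      using R.map_one[OF that] by simp
    show "finite (carrier (M1\<lparr>carrier := N1\<rparr>))" "finite (carrier (M2\<lparr>carrier := N2\<rparr>))"
      using M1.finite_carrier M2.finite_carrier submonoid.subset[OF sub1] submonoid.subset[OF sub2]
      by (auto intro: finite_subset)
  qed (use group1 group2 fin_dim R.VS.vector_space_axioms R.subspace R.map_add R.map_scale \<Gamma>_maps N_in_\<Gamma> in auto)
  interpret J: group_pair_rep H1 H2 "fun_scale s" "ind_space G K W \<rho>" "ind_action G"
    by (intro group_pair_rep.intro group_pair_rep_axioms.intro H1.group_axioms H2.group_axioms
        F.JR.monoid_rep_axioms F.finite1 F.finite2 F.fin_dim_J)
  have "mutually_commuting (M1\<lparr>carrier := N1\<rparr>) (M2\<lparr>carrier := N2\<rparr>) s W \<rho> \<longleftrightarrow>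
      mutually_commuting (H1\<lparr>carrier := F.N1\<rparr>) (H2\<lparr>carrier := F.N2\<rparr>) s W \<rho>"
    unfolding mutually_commuting_def using intertwiner_N1_iff intertwiner_N2_iff by simp
  then show ?thesis
    unfolding N.theta_rep_iff_mutually_commuting J.theta_rep_iff_mutually_commuting
    by (simp add: F.mutually_commuting_ind_iff)
qed

end

section \<open>Representations with a given apex\<close>

lemma monoid_rep_cong:
  assumes "monoid_rep A s V \<rho>" "\<And>a v. a \<in> carrier A \<Longrightarrow> v \<in> V \<Longrightarrow> \<rho>' a v = \<rho> a v"
  shows "monoid_rep A s V \<rho>'"
proof -
  interpret monoid_rep A s V \<rho> by fact
  show ?thesis
    by unfold_locales
      (use subspace maps map_add map_scale map_one map_mult assms(2) add_in scale_in in auto)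
qed

lemma irreducible_rep_cong:
  assumes "irreducible_rep A s V \<rho>" "\<And>a v. a \<in> carrier A \<Longrightarrow> v \<in> V \<Longrightarrow> \<rho>' a v = \<rho> a v"
  shows "irreducible_rep A s V \<rho>'"
proof -
  have "monoid_rep A s U \<rho>" if "U \<subseteq> V" "monoid_rep A s U \<rho>'" for U
    by (rule monoid_rep_cong[OF that(2)]) (use that(1) assms(2) in auto)
  then show ?thesis
    using assms(1) monoid_rep_cong[OF irreducible_rep_rep[OF assms(1)] assms(2)]
    unfolding irreducible_rep_def by blast
qed

lemma rep_hom_cong:
  assumes "\<And>a v. a \<in> carrier A \<Longrightarrow> v \<in> V \<Longrightarrow> \<rho>' a v = \<rho> a v" "\<And>a v. a \<in> carrier A \<Longrightarrow> v \<in> V' \<Longrightarrow> \<sigma>' a v = \<sigma> a v"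
  shows "rep_hom A s V \<rho>' s' V' \<sigma>' = rep_hom A s V \<rho> s' V' \<sigma>"
  using assms unfolding rep_hom_def by auto

text \<open>These are the representations obtained from one of \<open>max_group M e\<close> by
  pulling back along \<open>m \<mapsto> m e\<close> and extending by zero on nonunits, as
  \<open>ext_rep\<close> does.\<close>

definition apex_type ::
  "('a, 'm) monoid_scheme \<Rightarrow> 'a \<Rightarrow> 'v::zero set \<Rightarrow> ('a \<Rightarrow> 'v \<Rightarrow> 'v) \<Rightarrow> bool" where
  "apex_type M e V \<pi> \<longleftrightarrow> (\<forall>v\<in>V. \<pi> e v = v) \<and>
     (\<forall>m\<in>carrier M. m \<otimes>\<^bsub>M\<^esub> e \<notin> max_subgroup M e \<longrightarrow> (\<forall>v\<in>V. \<pi> m v = 0))"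

definition ext_rep :: "('a, 'm) monoid_scheme \<Rightarrow> 'a \<Rightarrow> ('a \<Rightarrow> 'v \<Rightarrow> 'v) \<Rightarrow> 'a \<Rightarrow> 'v::zero \<Rightarrow> 'v" where
  "ext_rep M e \<sigma> m = (if m \<otimes>\<^bsub>M\<^esub> e \<in> max_subgroup M e then \<sigma> (m \<otimes>\<^bsub>M\<^esub> e) else (\<lambda>v. 0))"

context finite_clifford begin

lemma mult_idempotent:
  assumes e: "e \<in> idempotents M" and "x \<in> carrier M" "y \<in> carrier M"
  shows "(x \<otimes> y) \<otimes> e = (x \<otimes> e) \<otimes> (y \<otimes> e)"
proof -
  note eC = idempotent_in_carrier[OF e]
  have "(x \<otimes> e) \<otimes> (y \<otimes> e) = x \<otimes> (e \<otimes> y) \<otimes> e" using assms eC by (simp add: m_assoc)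
  also have "\<dots> = x \<otimes> y \<otimes> (e \<otimes> e)" using assms eC central[OF e assms(3)] by (simp add: m_assoc)
  finally show ?thesis using idempotent_square[OF e] by simp
qed

lemma right_idempotent: "e \<in> idempotents M \<Longrightarrow> x \<in> carrier M \<Longrightarrow> x \<otimes> e \<otimes> e = x \<otimes> e"
  using idempotent_in_carrier idempotent_square by (simp add: m_assoc)

text \<open>\<open>m \<mapsto> m e\<close> is multiplicative, and a product in \<open>M e\<close> is
  a unit only if both factors are. This is what makes the extension by zero multiplicative.\<close>

lemma mult_in_max_subgroup_iff:
  assumes e: "e \<in> idempotents M" and xy: "x \<in> carrier M" "y \<in> carrier M"
  shows "x \<otimes> y \<otimes> e \<in> max_subgroup M e \<longleftrightarrow> x \<otimes> e \<in> max_subgroup M e \<and> y \<otimes> e \<in> max_subgroup M e"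
proof -
  note c = xy idempotent_in_carrier[OF e]
  have xe: "x \<otimes> e \<in> carrier M" and ye: "y \<otimes> e \<in> carrier M" using c by auto
  show ?thesis
    unfolding mult_idempotent[OF assms]
  proof
    assume xy': "(x \<otimes> e) \<otimes> (y \<otimes> e) \<in> max_subgroup M e"
    have "x \<otimes> e \<in> max_subgroup M e"
      by (rule max_subgroup_factor_left[OF xe ye right_idempotent[OF e xy(1)] xy'])
    then show "x \<otimes> e \<in> max_subgroup M e \<and> y \<otimes> e \<in> max_subgroup M e"
      using max_subgroup_factor_right[OF e _ ye right_idempotent[OF e xy(2)] xy'] by simp
  qed (simp add: max_subgroup_mult[OF e])
qed

lemma idempotent_in_max_subgroup_eq:
  assumes e: "e \<in> idempotents M" and g: "g \<in> idempotents M" "g \<in> max_subgroup M e"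
  shows "g = e"
  by (rule max_subgroup_idempotent[OF e g(2,1) max_subgroup_right[OF g(2)] idempotent_square[OF g(1)]])

lemma is_apex_iff:
  assumes "e \<in> idempotents M"
  shows "is_apex M V \<rho> e \<longleftrightarrow>
    (\<forall>m\<in>carrier M. (\<forall>v\<in>V. \<rho> m v = 0) \<longleftrightarrow> m \<otimes> e \<notin> max_subgroup M e)"
  unfolding is_apex_def using assms mem_two_sided_ideal_iff[OF assms] by blast

text \<open>\<open>\<rho> e\<close> commutes with the action and is nonzero, so it is onto by
  irreducibility; a surjective idempotent operator is the identity.\<close>

lemma is_apex_imp_apex_type:
  assumes irr: "irreducible_rep M s V \<rho>" and apex: "is_apex M V \<rho> e"
  shows "apex_type M e V \<rho>"
proof -
  interpret R: monoid_rep M s V \<rho> by (rule irreducible_rep_rep) fact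
  have e: "e \<in> idempotents M" using apex by (simp add: is_apex_def)
  note eC = idempotent_in_carrier[OF e]
  note kill = apex[unfolded is_apex_iff[OF e], rule_format]
  have "e \<otimes> e \<in> max_subgroup M e" using one_in_max_subgroup[OF e] idempotent_square[OF e] by simp
  then obtain v where v: "v \<in> V" "\<rho> e v \<noteq> 0" using kill[OF eC] by blast
  have comm: "\<rho> e (\<rho> a w) = \<rho> a (\<rho> e w)" if "a \<in> carrier M" "w \<in> V" for a w
    using R.map_mult[OF eC that] R.map_mult[OF that(1) eC that(2)] central[OF e that(1)] by simp
  have T: "intertwiner M s V \<rho> s V \<rho> (\<rho> e)"
    by (rule intertwinerI) (rule R.maps[OF eC] R.map_add[OF eC] R.map_scale[OF eC] comm; assumption)+
  have onto: "\<rho> e ` V = V"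
    by (rule intertwiner_onto_irreducible[OF R.monoid_rep_axioms irr T v])
  have "\<rho> e w = w" if w: "w \<in> V" for w
  proof -
    obtain u where u: "u \<in> V" "w = \<rho> e u" using onto w by blast
    show ?thesis using R.map_mult[OF eC eC u(1)] unfolding idempotent_square[OF e] u(2) by (rule sym)
  qed
  then show ?thesis using kill by (auto simp: apex_type_def)
qed

lemma apex_type_right:
  assumes e: "e \<in> idempotents M" and "monoid_rep M s V \<pi>" "apex_type M e V \<pi>" "m \<in> carrier M" "v \<in> V"
  shows "\<pi> (m \<otimes> e) v = \<pi> m v"
  using assms monoid_rep.map_mult[OF assms(2,4) idempotent_in_carrier[OF e] assms(5)]
  by (simp add: apex_type_def)

lemma monoid_rep_max_group:
  assumes e: "e \<in> idempotents M" and R: "monoid_rep M s V \<pi>" and id: "\<And>v. v \<in> V \<Longrightarrow> \<pi> e v = v"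
  shows "monoid_rep (max_group M e) s V \<pi>"
proof -
  interpret R: monoid_rep M s V \<pi> by fact
  interpret H: group "max_group M e" by (rule group_max_group[OF e])
  show ?thesis
    by unfold_locales
      (use R.subspace R.maps R.map_add R.map_scale R.map_mult id max_subgroup_in in auto)
qed

text \<open>Every operator of \<open>M\<close> is 0 or an operator of the group, so the invariant
  subspaces are the same.\<close>

lemma irreducible_rep_max_group:
  assumes e: "e \<in> idempotents M" and irr: "irreducible_rep M s V \<pi>" and type: "apex_type M e V \<pi>"
  shows "irreducible_rep (max_group M e) s V \<pi>"
proof -
  interpret R: monoid_rep M s V \<pi> by (rule irreducible_rep_rep) fact
  have "monoid_rep M s U \<pi>" if U: "U \<subseteq> V" "monoid_rep (max_group M e) s U \<pi>" for U
  proof (rule R.sub_rep)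
    interpret U: monoid_rep "max_group M e" s U \<pi> by fact
    show "R.VS.subspace U" by (rule U.subspace)
    fix m u assume m: "m \<in> carrier M" and u: "u \<in> U"
    show "\<pi> m u \<in> U"
    proof (cases "m \<otimes> e \<in> max_subgroup M e")
      case True
      have "\<pi> m u = \<pi> (m \<otimes> e) u"
        using apex_type_right[OF e R.monoid_rep_axioms type m] u U(1) by auto
      then show ?thesis using U.maps[of "m \<otimes> e" u] True u by simp
    next
      case False
      then have "\<pi> m u = 0" using type m u U(1) by (auto simp: apex_type_def)
      then show ?thesis using U.zero_in by simp
    qed
  qed fact
  then show ?thesis
    using irr monoid_rep_max_group[OF e R.monoid_rep_axioms] type
    unfolding irreducible_rep_def apex_type_def by blast
qed

lemma irreducible_rep_of_max_group:
  assumes e: "e \<in> idempotents M" and irr: "irreducible_rep (max_group M e) s V \<pi>"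
    and R: "monoid_rep M s V \<pi>"
  shows "irreducible_rep M s V \<pi>"
proof -
  have id: "\<pi> e v = v" if "v \<in> V" for v
    using monoid_rep.map_one[OF irreducible_rep_rep[OF irr] that] by simp
  have "monoid_rep (max_group M e) s U \<pi>" if U: "U \<subseteq> V" "monoid_rep M s U \<pi>" for U
    by (rule monoid_rep_max_group[OF e U(2)]) (use id U(1) in auto)
  then show ?thesis using irr R unfolding irreducible_rep_def by blast
qed

lemma ext_rep_eq: "m \<in> max_subgroup M e \<Longrightarrow> ext_rep M e \<sigma> m = \<sigma> m"
  by (simp add: ext_rep_def max_subgroup_right)

lemma ext_rep_apex_type:
  assumes e: "e \<in> idempotents M" and \<sigma>: "irreducible_rep (max_group M e) s V \<sigma>"
  shows "irreducible_rep M s V (ext_rep M e \<sigma>)" "apex_type M e V (ext_rep M e \<sigma>)"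
proof -
  interpret S: monoid_rep "max_group M e" s V \<sigma> by (rule irreducible_rep_rep) fact
  have "monoid_rep M s V (ext_rep M e \<sigma>)"
  proof (intro monoid_rep.intro monoid_rep_axioms.intro)
    show "ext_rep M e \<sigma> (a \<otimes> b) v = ext_rep M e \<sigma> a (ext_rep M e \<sigma> b v)"
      if "a \<in> carrier M" "b \<in> carrier M" "v \<in> V" for a b v
    proof (cases "a \<otimes> e \<in> max_subgroup M e \<and> b \<otimes> e \<in> max_subgroup M e")
      case True
      then show ?thesis
        using that mult_in_max_subgroup_iff[OF e that(1,2)] S.map_mult[of "a \<otimes> e" "b \<otimes> e" v]
        by (simp add: ext_rep_def mult_idempotent[OF e])
    next
      case False
      then show ?thesis
        using that mult_in_max_subgroup_iff[OF e that(1,2)] S.map_zero[of "a \<otimes> e"] S.zero_in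
        by (auto simp: ext_rep_def)
    qed
    show "ext_rep M e \<sigma> \<one> v = v" if "v \<in> V" for v
      using S.map_one[OF that] one_in_max_subgroup[OF e] idempotent_in_carrier[OF e] by (simp add: ext_rep_def)
  qed (use monoid_axioms S.VS.vector_space_axioms S.subspace S.maps S.map_add S.map_scale S.zero_in
      in \<open>auto simp: ext_rep_def\<close>)
  moreover have "irreducible_rep (max_group M e) s V (ext_rep M e \<sigma>)"
    by (rule irreducible_rep_cong[OF \<sigma>]) (simp add: ext_rep_eq)
  ultimately show "irreducible_rep M s V (ext_rep M e \<sigma>)"
    by (intro irreducible_rep_of_max_group[OF e])
  show "apex_type M e V (ext_rep M e \<sigma>)"
    using S.map_one ext_rep_eq[OF one_in_max_subgroup[OF e], of \<sigma>] by (auto simp: apex_type_def ext_rep_def)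
qed

lemma apex_type_intertwiner_iff:
  assumes e: "e \<in> idempotents M" and "monoid_rep M s V \<pi>" "monoid_rep M s' V' \<pi>'"
    and type: "apex_type M e V \<pi>" "apex_type M e V' \<pi>'"
  shows "intertwiner (max_group M e) s V \<pi> s' V' \<pi>' T \<longleftrightarrow> intertwiner M s V \<pi> s' V' \<pi>' T"
proof
  interpret R: monoid_rep M s V \<pi> by fact
  interpret R': monoid_rep M s' V' \<pi>' by fact
  assume T: "intertwiner (max_group M e) s V \<pi> s' V' \<pi>' T"
  show "intertwiner M s V \<pi> s' V' \<pi>' T"
  proof (rule intertwinerI)
    fix m v assume m: "m \<in> carrier M" and v: "v \<in> V"
    note Tv = intertwiner_in[OF T v]
    show "T (\<pi> m v) = \<pi>' m (T v)"
    proof (cases "m \<otimes> e \<in> max_subgroup M e")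
      case True
      have "T (\<pi> m v) = T (\<pi> (m \<otimes> e) v)" using apex_type_right[OF e assms(2) type(1) m v] by simp
      also have "\<dots> = \<pi>' (m \<otimes> e) (T v)" using True by (intro intertwiner_commutes[OF T _ v]) simp
      also have "\<dots> = \<pi>' m (T v)" by (rule apex_type_right[OF e assms(3) type(2) m Tv])
      finally show ?thesis .
    next
      case False
      then show ?thesis
        using type m v Tv intertwiner_zero[OF T R.zero_in] by (simp add: apex_type_def)
    qed
  qed (use intertwiner_in[OF T] intertwiner_add[OF T] intertwiner_scale[OF T] in auto)
qed (erule intertwiner_restrict_monoid, auto simp: max_subgroup_in)

end

section \<open>The part of the induced representation with apex \<open>f\<close>\<close>

context centric_fibre_rep begin

abbreviation "I \<equiv> ind_space X \<Gamma> W \<rho>"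
abbreviation "J \<equiv> ind_space G K W \<rho>"
abbreviation "actX \<equiv> ind_action X"
abbreviation "actG \<equiv> ind_action G"

lemma G_eq: "G = max_group X f"
  by (simp add: max_group_def DirProd_def max_subgroup_prod[unfolded DirProd_def])

sublocale IR: monoid_rep X "fun_scale s" I actX
  by (rule monoid_rep_ind[OF X.monoid_axioms _ R.monoid_rep_axioms]) (use \<Gamma>_in in blast)

lemma I_in: "\<phi> \<in> I \<Longrightarrow> x \<in> carrier X \<Longrightarrow> \<phi> x \<in> W"
  and I_out: "\<phi> \<in> I \<Longrightarrow> x \<notin> carrier X \<Longrightarrow> \<phi> x = 0"
  and I_equiv: "\<phi> \<in> I \<Longrightarrow> \<gamma> \<in> \<Gamma> \<Longrightarrow> x \<in> carrier X \<Longrightarrow> \<phi> (\<gamma> \<otimes>\<^bsub>X\<^esub> x) = \<rho> \<gamma> (\<phi> x)"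
  unfolding ind_space_def mem_Collect_eq by blast+

lemma I_eqI: "\<phi> \<in> I \<Longrightarrow> \<psi> \<in> I \<Longrightarrow> (\<And>x. x \<in> carrier X \<Longrightarrow> \<phi> x = \<psi> x) \<Longrightarrow> \<phi> = \<psi>"
  using I_out by (metis ext)

lemma J_in: "\<psi> \<in> J \<Longrightarrow> h \<in> HH \<Longrightarrow> \<psi> h \<in> W"
  and J_out: "\<psi> \<in> J \<Longrightarrow> h \<notin> HH \<Longrightarrow> \<psi> h = 0"
  and J_equiv: "\<psi> \<in> J \<Longrightarrow> \<kappa> \<in> K \<Longrightarrow> h \<in> HH \<Longrightarrow> \<psi> (\<kappa> \<otimes>\<^bsub>X\<^esub> h) = \<rho> \<kappa> (\<psi> h)"
  using F.J_in[unfolded carrier_G] F.J_out[unfolded carrier_G] F.J_equiv[unfolded carrier_G mult_G] by blast+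

lemma actX_apply: "x \<in> carrier X \<Longrightarrow> actX m \<phi> x = \<phi> (x \<otimes>\<^bsub>X\<^esub> m)"
  by (simp add: ind_action_def)

lemma actG_apply: "h \<in> HH \<Longrightarrow> actG m \<psi> h = \<psi> (h \<otimes>\<^bsub>X\<^esub> m)"
  unfolding ind_action_def carrier_G mult_G by simp

lemma HH_in: "h \<in> HH \<Longrightarrow> h \<in> carrier X"
  by (rule X.max_subgroup_in)

lemma HH_f: "h \<in> HH \<Longrightarrow> h \<otimes>\<^bsub>X\<^esub> f = h"
  by (rule X.max_subgroup_right)

lemma J_ops: "\<psi> \<in> J \<Longrightarrow> h \<in> HH \<Longrightarrow> actG h \<psi> \<in> J"
  using F.JR.maps unfolding carrier_G by blast

lemma fin_dim_I: "finite_dim (fun_scale s) I"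
  by (rule finite_dim_fun_space[OF R.VS.vector_space_axioms X.finite_carrier fin_dim R.subspace])
    (simp_all add: I_in I_out del: DirProd_simps)

text \<open>\<open>extend\<close> and \<open>restrict\<close> identify \<open>J\<close> with the
  functions of \<open>I\<close> that are annihilated by all idempotents strictly below
  \<open>f\<close>.\<close>

definition extend :: "('a \<times> 'b \<Rightarrow> 'w) \<Rightarrow> 'a \<times> 'b \<Rightarrow> 'w" where
  "extend \<psi> x = (if x \<in> carrier X \<and> x \<otimes>\<^bsub>X\<^esub> f \<in> HH then \<psi> (x \<otimes>\<^bsub>X\<^esub> f) else 0)"

definition restrict :: "('a \<times> 'b \<Rightarrow> 'w) \<Rightarrow> 'a \<times> 'b \<Rightarrow> 'w" where
  "restrict \<phi> x = (if x \<in> HH then \<phi> x else 0)"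

text \<open>Equivariance under \<open>\<gamma>\<close> outside the units is the crucial case: if
  \<open>\<gamma> f\<close> is not a unit, the left side vanishes by definition and the right side
  by \<open>\<rho>_nonunit_zero\<close>.\<close>

lemma extend_in:
  assumes \<psi>: "\<psi> \<in> J"
  shows "extend \<psi> \<in> I"
  unfolding ind_space_def mem_Collect_eq
proof (intro conjI ballI allI impI)
  fix \<gamma> x assume \<gamma>: "\<gamma> \<in> \<Gamma>" and x: "x \<in> carrier X"
  note \<gamma>X = \<Gamma>_in[OF \<gamma>]
  have \<gamma>x: "\<gamma> \<otimes>\<^bsub>X\<^esub> x \<in> carrier X" by (rule X.m_closed[OF \<gamma>X x])
  note iff = X.mult_in_max_subgroup_iff[OF f \<gamma>X x]
  show "extend \<psi> (\<gamma> \<otimes>\<^bsub>X\<^esub> x) = \<rho> \<gamma> (extend \<psi> x)"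
  proof (cases "\<gamma> \<otimes>\<^bsub>X\<^esub> f \<in> HH \<and> x \<otimes>\<^bsub>X\<^esub> f \<in> HH")
    case True
    have \<gamma>f: "\<gamma> \<otimes>\<^bsub>X\<^esub> f \<in> K" using True \<Gamma>_mult[OF \<gamma> f_\<Gamma>] by blast
    have w: "\<psi> (x \<otimes>\<^bsub>X\<^esub> f) \<in> W" using J_in[OF \<psi>] True by blast
    have "extend \<psi> (\<gamma> \<otimes>\<^bsub>X\<^esub> x) = \<psi> (\<gamma> \<otimes>\<^bsub>X\<^esub> f \<otimes>\<^bsub>X\<^esub> (x \<otimes>\<^bsub>X\<^esub> f))"
      using True iff \<gamma>x by (simp only: extend_def simp_thms if_True X.mult_idempotent[OF f \<gamma>X x])
    also have "\<dots> = \<rho> (\<gamma> \<otimes>\<^bsub>X\<^esub> f) (\<psi> (x \<otimes>\<^bsub>X\<^esub> f))" using True by (intro J_equiv[OF \<psi> \<gamma>f]) blast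
    also have "\<dots> = \<rho> \<gamma> (\<psi> (x \<otimes>\<^bsub>X\<^esub> f))" using \<Gamma>_map_mult[OF \<gamma> f_\<Gamma> w] \<rho>_f[OF w] by simp
    finally show ?thesis using True x by (simp only: extend_def simp_thms if_True)
  next
    case False
    have "\<rho> \<gamma> (extend \<psi> x) = 0"
    proof (cases "x \<otimes>\<^bsub>X\<^esub> f \<in> HH")
      case True
      then have "extend \<psi> x \<in> W" using J_in[OF \<psi>] x by (simp only: extend_def simp_thms if_True)
      then show ?thesis using False True \<rho>_nonunit_zero[OF \<gamma>] by blast
    next
      case nx: False
      then have "extend \<psi> x = 0" by (simp only: extend_def simp_thms if_False)
      then show ?thesis using R.map_zero \<gamma> by simp
    qed
    then show ?thesis using False iff by (simp only: extend_def simp_thms if_False)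
  qed
qed (auto simp: extend_def R.zero_in intro: J_in[OF \<psi>] simp del: DirProd_simps)

lemma restrict_in:
  assumes \<phi>: "\<phi> \<in> I"
  shows "restrict \<phi> \<in> J"
  unfolding ind_space_def mem_Collect_eq carrier_G mult_G
proof (intro conjI ballI allI impI)
  fix \<kappa> x assume \<kappa>: "\<kappa> \<in> K" and x: "x \<in> HH"
  have "\<kappa> \<otimes>\<^bsub>X\<^esub> x \<in> HH" using \<kappa> x X.max_subgroup_mult[OF f] by blast
  then show "restrict \<phi> (\<kappa> \<otimes>\<^bsub>X\<^esub> x) = \<rho> \<kappa> (restrict \<phi> x)"
    using I_equiv[OF \<phi> _ HH_in[OF x]] \<kappa> x by (simp add: restrict_def del: DirProd_simps)
qed (simp_all add: restrict_def I_in[OF \<phi>] HH_in del: DirProd_simps)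

lemma J_eqI: "\<psi> \<in> J \<Longrightarrow> \<psi>' \<in> J \<Longrightarrow> (\<And>h. h \<in> HH \<Longrightarrow> \<psi> h = \<psi>' h) \<Longrightarrow> \<psi> = \<psi>'"
  using J_out by (metis ext)

lemma restrict_extend: "\<psi> \<in> J \<Longrightarrow> restrict (extend \<psi>) = \<psi>"
  by (rule J_eqI) (simp_all add: restrict_in extend_in restrict_def extend_def HH_in HH_f del: DirProd_simps)

lemma extend_lin: "extend (\<psi> + \<psi>') = extend \<psi> + extend \<psi>'"
    "extend (fun_scale s c \<psi>) = fun_scale s c (extend \<psi>)"
  by (auto simp: extend_def fun_eq_iff fun_scale_def simp del: DirProd_simps)

lemma restrict_lin: "restrict (\<phi> + \<phi>') = restrict \<phi> + restrict \<phi>'"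
    "restrict (fun_scale s c \<phi>) = fun_scale s c (restrict \<phi>)"
  by (auto simp: restrict_def fun_eq_iff fun_scale_def simp del: DirProd_simps)

lemma actX_extend:
  assumes m: "m \<in> carrier X" and \<psi>: "\<psi> \<in> J"
  shows "actX m (extend \<psi>) = (if m \<otimes>\<^bsub>X\<^esub> f \<in> HH then extend (actG (m \<otimes>\<^bsub>X\<^esub> f) \<psi>) else 0)"
proof (rule I_eqI)
  show "actX m (extend \<psi>) \<in> I" by (rule IR.maps[OF m extend_in[OF \<psi>]])
  show "(if m \<otimes>\<^bsub>X\<^esub> f \<in> HH then extend (actG (m \<otimes>\<^bsub>X\<^esub> f) \<psi>) else 0) \<in> I"
    using extend_in[OF J_ops[OF \<psi>]] IR.zero_in by simp
  fix x assume x: "x \<in> carrier X"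
  have xm: "x \<otimes>\<^bsub>X\<^esub> m \<in> carrier X" by (rule X.m_closed[OF x m])
  show "actX m (extend \<psi>) x = (if m \<otimes>\<^bsub>X\<^esub> f \<in> HH then extend (actG (m \<otimes>\<^bsub>X\<^esub> f) \<psi>) else 0) x"
    using x xm X.mult_in_max_subgroup_iff[OF f x m] unfolding X.mult_idempotent[OF f x m]
    by (simp add: actX_apply extend_def X.mult_idempotent[OF f x m] actG_apply del: DirProd_simps)
qed

definition lower :: "('a \<times> 'b) set" where
  "lower = {g \<in> idempotents X. g \<otimes>\<^bsub>X\<^esub> f = g \<and> g \<noteq> f}"

lemma lower_not_in_HH:
  assumes "g \<in> lower"
  shows "g \<otimes>\<^bsub>X\<^esub> f \<notin> HH"
proof -
  have g: "g \<in> idempotents X" "g \<otimes>\<^bsub>X\<^esub> f = g" "g \<noteq> f" using assms unfolding lower_def by blast+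
  then show ?thesis using X.idempotent_in_max_subgroup_eq[OF f g(1)] by metis
qed

text \<open>\<open>\<phi> (x f) = \<phi> x\<close>, because \<open>f\<close> is central and acts as
  the identity on \<open>W\<close>. If \<open>x f\<close> is not a unit it equals
  \<open>x f g\<close> with \<open>g\<close> strictly below \<open>f\<close>, so
  \<open>\<phi> (x f)\<close> is a value of \<open>actX g \<phi> = 0\<close>.\<close>

lemma extend_restrict:
  assumes \<phi>: "\<phi> \<in> I" and kill: "\<And>g. g \<in> lower \<Longrightarrow> actX g \<phi> = 0"
  shows "extend (restrict \<phi>) = \<phi>"
proof (rule I_eqI)
  fix x assume x: "x \<in> carrier X"
  let ?y = "x \<otimes>\<^bsub>X\<^esub> f"
  have y: "?y \<in> carrier X" by (rule X.m_closed[OF x f_carrier])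
  have "\<phi> ?y = \<phi> (f \<otimes>\<^bsub>X\<^esub> x)" using X.central[OF f x] by simp
  also have "\<dots> = \<phi> x" using I_equiv[OF \<phi> f_\<Gamma> x] \<rho>_f[OF I_in[OF \<phi> x]] by simp
  finally have eq: "\<phi> ?y = \<phi> x" .
  show "extend (restrict \<phi>) x = \<phi> x"
  proof (cases "?y \<in> HH")
    case True
    then show ?thesis using x eq by (simp add: extend_def restrict_def del: DirProd_simps)
  next
    case False
    obtain k where k: "?y [^]\<^bsub>X\<^esub> Suc k \<in> idempotents X" "?y [^]\<^bsub>X\<^esub> Suc k \<otimes>\<^bsub>X\<^esub> f = ?y [^]\<^bsub>X\<^esub> Suc k"
      "?y [^]\<^bsub>X\<^esub> Suc k \<noteq> f" "?y \<otimes>\<^bsub>X\<^esub> ?y [^]\<^bsub>X\<^esub> Suc k = ?y"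
      using X.below_idempotent[OF f y right_f[OF x] False] by blast
    then have "?y [^]\<^bsub>X\<^esub> Suc k \<in> lower" unfolding lower_def by blast
    then have "actX (?y [^]\<^bsub>X\<^esub> Suc k) \<phi> ?y = 0" using kill by simp
    then have "\<phi> ?y = 0" unfolding actX_apply[OF y] k(4) .
    then show ?thesis using False eq by (simp add: extend_def del: DirProd_simps)
  qed
qed (auto intro: extend_in restrict_in \<phi>)

text \<open>The product of the operators \<open>1 - g\<close>. Taken over all idempotents strictly below \<open>f\<close>, it projects
  \<open>I\<close> onto the copy of \<open>J\<close> that consists of the functions vanishing at \<open>x\<close> unless \<open>x f\<close> is a unit of
  \<open>f X f\<close>.\<close>

primrec cut :: "('a \<times> 'b) list \<Rightarrow> ('a \<times> 'b \<Rightarrow> 'w) \<Rightarrow> 'a \<times> 'b \<Rightarrow> 'w" where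
  "cut [] \<phi> = \<phi>"
| "cut (g # gs) \<phi> = cut gs \<phi> - actX g (cut gs \<phi>)"

lemma actX_mult: "x \<in> carrier X \<Longrightarrow> y \<in> carrier X \<Longrightarrow> \<phi> \<in> I \<Longrightarrow> actX (x \<otimes>\<^bsub>X\<^esub> y) \<phi> = actX x (actX y \<phi>)"
  by (rule IR.map_mult)

lemma actX_central:
  assumes "g \<in> idempotents X" "m \<in> carrier X" "\<phi> \<in> I"
  shows "actX g (actX m \<phi>) = actX m (actX g \<phi>)"
  using actX_mult[OF _ _ assms(3), of g m] actX_mult[OF _ _ assms(3), of m g] X.central[OF assms(1,2)]
    X.idempotent_in_carrier[OF assms(1)] assms(2) by (simp del: DirProd_simps)

lemma cut_intertwiner:
  "set gs \<subseteq> idempotents X \<Longrightarrow> intertwiner X (fun_scale s) I actX (fun_scale s) I actX (cut gs)"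
proof (induction gs)
  case Nil
  then show ?case by (simp add: intertwiner_def)
next
  case (Cons g gs)
  then have g: "g \<in> idempotents X" and IH: "intertwiner X (fun_scale s) I actX (fun_scale s) I actX (cut gs)" by auto
  note gX = X.idempotent_in_carrier[OF g] and C = intertwiner_in[OF IH]
  show ?case
  proof (rule intertwinerI)
    fix \<phi> assume \<phi>: "\<phi> \<in> I"
    note c = C[OF \<phi>] IR.maps[OF gX C[OF \<phi>]]
    show "cut (g # gs) \<phi> \<in> I" using c by (simp add: IR.diff_in)
    show "cut (g # gs) (\<phi> + \<psi>) = cut (g # gs) \<phi> + cut (g # gs) \<psi>" if "\<psi> \<in> I" for \<psi>
      using C[OF that] c by (simp add: intertwiner_add[OF IH \<phi> that] IR.map_add[OF gX] algebra_simps)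
    show "cut (g # gs) (fun_scale s c \<phi>) = fun_scale s c (cut (g # gs) \<phi>)" for c
      using C[OF \<phi>] by (simp add: intertwiner_scale[OF IH \<phi>] IR.map_scale[OF gX] F.JR.VS.scale_right_diff_distrib)
    fix m assume m: "m \<in> carrier X"
    show "cut (g # gs) (actX m \<phi>) = actX m (cut (g # gs) \<phi>)"
      using c by (simp add: intertwiner_commutes[OF IH m \<phi>] actX_central[OF g m C[OF \<phi>]] IR.map_diff[OF m] del: DirProd_simps)
  qed
qed

lemma cut_kill:
  "set gs \<subseteq> idempotents X \<Longrightarrow> \<phi> \<in> I \<Longrightarrow> g \<in> set gs \<Longrightarrow> actX g (cut gs \<phi>) = 0"
proof (induction gs)
  case (Cons h gs)
  then have h: "h \<in> idempotents X" and g: "g \<in> idempotents X" and gs: "set gs \<subseteq> idempotents X" by auto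
  note C = intertwiner_in[OF cut_intertwiner[OF gs] Cons.prems(2)]
  note hX = X.idempotent_in_carrier[OF h] and gX = X.idempotent_in_carrier[OF g]
  have e: "actX g (cut (h # gs) \<phi>) = actX g (cut gs \<phi>) - actX g (actX h (cut gs \<phi>))"
    using C IR.maps[OF hX C] by (simp add: IR.map_diff[OF gX])
  show ?case
  proof (cases "g = h")
    case True
    then show ?thesis unfolding e using actX_mult[OF hX hX C] X.idempotent_square[OF h] by simp
  next
    case False
    then have "actX g (cut gs \<phi>) = 0" using Cons gs by auto
    then show ?thesis unfolding e actX_central[OF g hX C] by (simp only: IR.map_zero[OF hX] diff_0_right)
  qed
qed simp

lemma cut_id: "(\<And>g. g \<in> set gs \<Longrightarrow> actX g \<phi> = 0) \<Longrightarrow> cut gs \<phi> = \<phi>"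
  by (induction gs) auto

text \<open>Each \<open>g\<close> of the list acts as 0 on the target, so every factor
  \<open>1 - g\<close> becomes the identity after \<open>S\<close>.\<close>

lemma cut_hom:
  assumes S: "intertwiner X (fun_scale s) I actX s' V' \<pi> S" and \<phi>: "\<phi> \<in> I"
  shows "set gs \<subseteq> idempotents X \<Longrightarrow> (\<And>g v. g \<in> set gs \<Longrightarrow> v \<in> V' \<Longrightarrow> \<pi> g v = 0) \<Longrightarrow> S (cut gs \<phi>) = S \<phi>"
proof (induction gs)
  case (Cons g gs)
  then have g: "g \<in> idempotents X" and gs: "set gs \<subseteq> idempotents X" by auto
  note C = intertwiner_in[OF cut_intertwiner[OF gs] \<phi>] and gX = X.idempotent_in_carrier[OF g]
  have e: "S (cut (g # gs) \<phi>) = S (cut gs \<phi>) - \<pi> g (S (cut gs \<phi>))"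
    using C IR.maps[OF gX C] by (simp add: IR.intertwiner_diff[OF S] intertwiner_commutes[OF S gX C])
  have "\<pi> g (S (cut gs \<phi>)) = 0" using Cons.prems(2) intertwiner_in[OF S C] by simp
  moreover have "S (cut gs \<phi>) = S \<phi>" using Cons.IH gs Cons.prems(2) by simp
  ultimately show ?case unfolding e by simp
qed simp

text \<open>The order of the list is immaterial, since the operators \<open>1 - g\<close>
  commute.\<close>

definition lower_list :: "('a \<times> 'b) list" where
  "lower_list = (SOME gs. set gs = lower)"

lemma set_lower_list: "set lower_list = lower"
proof -
  have "lower \<subseteq> carrier X" using X.idempotent_in_carrier unfolding lower_def by blast
  then have "finite lower" using X.finite_carrier finite_subset by blast
  then show ?thesis unfolding lower_list_def by (rule someI_ex[OF finite_list])
qed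

lemma lower_idempotents: "set lower_list \<subseteq> idempotents X"
  unfolding set_lower_list lower_def by blast

abbreviation "proj \<equiv> cut lower_list"

lemma proj_in: "\<phi> \<in> I \<Longrightarrow> proj \<phi> \<in> I"
  by (rule intertwiner_in[OF cut_intertwiner[OF lower_idempotents]])

lemma proj_extend: "\<psi> \<in> J \<Longrightarrow> proj (extend \<psi>) = extend \<psi>"
proof (rule cut_id)
  fix g assume \<psi>: "\<psi> \<in> J" and "g \<in> set lower_list"
  then have g: "g \<in> lower" by (simp add: set_lower_list)
  then have "g \<in> carrier X" using X.idempotent_in_carrier unfolding lower_def by blast
  then show "actX g (extend \<psi>) = 0" using actX_extend[OF _ \<psi>] lower_not_in_HH[OF g] by simp
qed

lemma extend_restrict_proj: "\<phi> \<in> I \<Longrightarrow> extend (restrict (proj \<phi>)) = proj \<phi>"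
  using cut_kill[OF lower_idempotents] by (intro extend_restrict proj_in) (auto simp: set_lower_list)

section \<open>Intertwiners out of the induced representation\<close>

context
  fixes s' :: "complex \<Rightarrow> 'u::ab_group_add \<Rightarrow> 'u" and V' \<pi>
  assumes \<pi>: "monoid_rep X s' V' \<pi>" and type: "apex_type X f V' \<pi>"
begin

lemma hom_extend:
  assumes S: "intertwiner X (fun_scale s) I actX s' V' \<pi> S"
  shows "intertwiner G (fun_scale s) J actG s' V' \<pi> (\<lambda>\<psi>. S (extend \<psi>))"
proof (rule intertwinerI)
  fix h \<psi> assume "h \<in> carrier G" and \<psi>: "\<psi> \<in> J"
  then have h: "h \<in> HH" by (simp only: carrier_G)
  have "extend (actG h \<psi>) = actX h (extend \<psi>)"
    using actX_extend[OF HH_in[OF h] \<psi>] h by (simp add: HH_f del: DirProd_simps)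
  then show "S (extend (actG h \<psi>)) = \<pi> h (S (extend \<psi>))"
    by (simp add: intertwiner_commutes[OF S HH_in[OF h] extend_in[OF \<psi>]])
qed (simp_all add: extend_in extend_lin intertwiner_in[OF S] intertwiner_add[OF S] intertwiner_scale[OF S])

lemma hom_determined:
  assumes S: "intertwiner X (fun_scale s) I actX s' V' \<pi> S" and \<phi>: "\<phi> \<in> I"
  shows "S \<phi> = S (extend (restrict (proj \<phi>)))"
proof -
  have "S (proj \<phi>) = S \<phi>"
  proof (rule cut_hom[OF S \<phi> lower_idempotents])
    fix g v assume "g \<in> set lower_list" "v \<in> V'"
    then have g: "g \<in> lower" by (simp add: set_lower_list)
    then have "g \<in> carrier X" using X.idempotent_in_carrier unfolding lower_def by blast
    then show "\<pi> g v = 0" using type lower_not_in_HH[OF g] \<open>v \<in> V'\<close> unfolding apex_type_def by blast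
  qed
  then show ?thesis by (simp add: extend_restrict_proj[OF \<phi>])
qed

lemma hom_restrict:
  assumes T: "intertwiner G (fun_scale s) J actG s' V' \<pi> T"
  shows "intertwiner X (fun_scale s) I actX s' V' \<pi> (\<lambda>\<phi>. T (restrict (proj \<phi>)))"
proof (rule intertwinerI)
  note P = cut_intertwiner[OF lower_idempotents]
  fix \<phi> assume \<phi>: "\<phi> \<in> I"
  let ?\<psi> = "restrict (proj \<phi>)"
  have \<psi>: "?\<psi> \<in> J" by (rule restrict_in[OF proj_in[OF \<phi>]])
  show "T ?\<psi> \<in> V'" by (rule intertwiner_in[OF T \<psi>])
  show "T (restrict (proj (\<phi> + \<phi>'))) = T ?\<psi> + T (restrict (proj \<phi>'))" if "\<phi>' \<in> I" for \<phi>'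
    using restrict_in[OF proj_in[OF that]] \<psi>
    by (simp add: intertwiner_add[OF P \<phi> that] restrict_lin intertwiner_add[OF T])
  show "T (restrict (proj (fun_scale s c \<phi>))) = s' c (T ?\<psi>)" for c
    using \<psi> by (simp add: intertwiner_scale[OF P \<phi>] restrict_lin intertwiner_scale[OF T])
  fix m assume m: "m \<in> carrier X"
  have "proj (actX m \<phi>) = actX m (extend ?\<psi>)"
    by (simp add: intertwiner_commutes[OF P m \<phi>] extend_restrict_proj[OF \<phi>])
  then have e: "restrict (proj (actX m \<phi>)) =
      restrict (if m \<otimes>\<^bsub>X\<^esub> f \<in> HH then extend (actG (m \<otimes>\<^bsub>X\<^esub> f) ?\<psi>) else 0)"
    by (simp only: actX_extend[OF m \<psi>])
  show "T (restrict (proj (actX m \<phi>))) = \<pi> m (T ?\<psi>)"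
  proof (cases "m \<otimes>\<^bsub>X\<^esub> f \<in> HH")
    case True
    then have "T (restrict (proj (actX m \<phi>))) = T (actG (m \<otimes>\<^bsub>X\<^esub> f) ?\<psi>)"
      unfolding e by (simp only: if_True restrict_extend[OF J_ops[OF \<psi>]])
    also have "\<dots> = \<pi> (m \<otimes>\<^bsub>X\<^esub> f) (T ?\<psi>)"
      using True by (intro intertwiner_commutes[OF T _ \<psi>]) (simp only: carrier_G)
    also have "\<dots> = \<pi> m (T ?\<psi>)"
      by (rule X.apex_type_right[OF f \<pi> type m intertwiner_in[OF T \<psi>]])
    finally show ?thesis .
  next
    case False
    have "restrict 0 = 0" by (simp add: restrict_def fun_eq_iff del: DirProd_simps)
    then have "T (restrict (proj (actX m \<phi>))) = 0"
      unfolding e using False intertwiner_zero[OF T F.JR.zero_in] by simp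
    moreover have "\<pi> m (T ?\<psi>) = 0"
      using type False m intertwiner_in[OF T \<psi>] unfolding apex_type_def by blast
    ultimately show ?thesis by simp
  qed
qed

text \<open>Homomorphisms into a representation with apex \<open>f\<close> are determined on the
  copy of \<open>J\<close> in \<open>I\<close>. Conversely, a homomorphism on \<open>J\<close> is
  extended to \<open>I\<close> through the projection onto this copy.\<close>

lemma bij_betw_hom:
  "bij_betw (\<lambda>S. zero_ext J (\<lambda>\<psi>. S (extend \<psi>)))
    (rep_hom X (fun_scale s) I actX s' V' \<pi>) (rep_hom G (fun_scale s) J actG s' V' \<pi>)"
proof (rule bij_betw_byWitness[of _ "\<lambda>T. zero_ext I (\<lambda>\<phi>. T (restrict (proj \<phi>)))"])
  show "\<forall>S\<in>rep_hom X (fun_scale s) I actX s' V' \<pi>.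
      zero_ext I (\<lambda>\<phi>. zero_ext J (\<lambda>\<psi>. S (extend \<psi>)) (restrict (proj \<phi>))) = S"
  proof
    fix S assume "S \<in> rep_hom X (fun_scale s) I actX s' V' \<pi>"
    then have S: "intertwiner X (fun_scale s) I actX s' V' \<pi> S" "\<And>\<phi>. \<phi> \<notin> I \<Longrightarrow> S \<phi> = 0"
      by (simp_all add: rep_hom_iff)
    show "zero_ext I (\<lambda>\<phi>. zero_ext J (\<lambda>\<psi>. S (extend \<psi>)) (restrict (proj \<phi>))) = S"
    proof
      fix \<phi>
      show "zero_ext I (\<lambda>\<phi>. zero_ext J (\<lambda>\<psi>. S (extend \<psi>)) (restrict (proj \<phi>))) \<phi> = S \<phi>"
        using hom_determined[OF S(1), of \<phi>] S(2)[of \<phi>] restrict_in[OF proj_in, of \<phi>]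
        by (simp add: zero_ext_def)
    qed
  qed
  show "\<forall>T\<in>rep_hom G (fun_scale s) J actG s' V' \<pi>.
      zero_ext J (\<lambda>\<psi>. zero_ext I (\<lambda>\<phi>. T (restrict (proj \<phi>))) (extend \<psi>)) = T"
  proof
    fix T assume "T \<in> rep_hom G (fun_scale s) J actG s' V' \<pi>"
    then have T: "\<And>\<psi>. \<psi> \<notin> J \<Longrightarrow> T \<psi> = 0" by (simp add: rep_hom_iff)
    show "zero_ext J (\<lambda>\<psi>. zero_ext I (\<lambda>\<phi>. T (restrict (proj \<phi>))) (extend \<psi>)) = T"
    proof
      fix \<psi>
      show "zero_ext J (\<lambda>\<psi>. zero_ext I (\<lambda>\<phi>. T (restrict (proj \<phi>))) (extend \<psi>)) \<psi> = T \<psi>"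
        using T[of \<psi>] extend_in[of \<psi>] by (simp add: zero_ext_def proj_extend restrict_extend)
    qed
  qed
  show "(\<lambda>S. zero_ext J (\<lambda>\<psi>. S (extend \<psi>))) ` rep_hom X (fun_scale s) I actX s' V' \<pi> \<subseteq> rep_hom G (fun_scale s) J actG s' V' \<pi>"
  proof (rule image_subsetI)
    fix S assume "S \<in> rep_hom X (fun_scale s) I actX s' V' \<pi>"
    then show "zero_ext J (\<lambda>\<psi>. S (extend \<psi>)) \<in> rep_hom G (fun_scale s) J actG s' V' \<pi>"
      by (intro F.JR.zero_ext_rep_hom hom_extend) (simp add: rep_hom_iff)
  qed
  show "(\<lambda>T. zero_ext I (\<lambda>\<phi>. T (restrict (proj \<phi>)))) ` rep_hom G (fun_scale s) J actG s' V' \<pi> \<subseteq> rep_hom X (fun_scale s) I actX s' V' \<pi>"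
  proof (rule image_subsetI)
    fix T assume "T \<in> rep_hom G (fun_scale s) J actG s' V' \<pi>"
    then show "zero_ext I (\<lambda>\<phi>. T (restrict (proj \<phi>))) \<in> rep_hom X (fun_scale s) I actX s' V' \<pi>"
      by (intro IR.zero_ext_rep_hom hom_restrict) (simp add: rep_hom_iff)
  qed
qed

end

section \<open>Comparison of the tested irreducibles\<close>

abbreviation "tensor_space n m \<equiv> coord_space ({..<n::nat} \<times> {..<m::nat})"
abbreviation "HX n \<pi>1 m \<pi>2 \<equiv> theta_hom M1 M2 (fun_scale s) I actX n \<pi>1 m \<pi>2"
abbreviation "HG n \<pi>1 m \<pi>2 \<equiv> theta_hom H1 H2 (fun_scale s) J actG n \<pi>1 m \<pi>2"
abbreviation "hom_dim \<equiv> vector_space.dim (fun_scale coord_scale)"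

definition apex_irrep1 :: "nat \<Rightarrow> ('a \<Rightarrow> (nat \<Rightarrow> complex) \<Rightarrow> nat \<Rightarrow> complex) \<Rightarrow> bool" where
  "apex_irrep1 n \<pi> \<longleftrightarrow> irrep M1 n \<pi> \<and> apex_type M1 f1 (coord_space {..<n}) \<pi>"

definition apex_irrep2 :: "nat \<Rightarrow> ('b \<Rightarrow> (nat \<Rightarrow> complex) \<Rightarrow> nat \<Rightarrow> complex) \<Rightarrow> bool" where
  "apex_irrep2 m \<pi> \<longleftrightarrow> irrep M2 m \<pi> \<and> apex_type M2 f2 (coord_space {..<m}) \<pi>"

lemma apex_irrep_H: "apex_irrep1 n \<pi>1 \<Longrightarrow> irrep H1 n \<pi>1" "apex_irrep2 m \<pi>2 \<Longrightarrow> irrep H2 m \<pi>2"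
  using M1.irreducible_rep_max_group[OF f1] M2.irreducible_rep_max_group[OF f2]
  by (auto simp: apex_irrep1_def apex_irrep2_def)

text \<open>Irreducibility comes from the finite groups \<open>H1\<close> and \<open>H2\<close>, to
  which \<open>irreducible_tensor\<close> applies. For the apex: if \<open>x f\<close> is a unit
  then \<open>f\<close> is a multiple of \<open>x\<close>, so \<open>x\<close> cannot act as 0;
  otherwise a coordinate of \<open>x f\<close> is not a unit and kills its tensor factor.\<close>

lemma tensor_apex:
  assumes "apex_irrep1 n \<pi>1" "apex_irrep2 m \<pi>2"
  shows "irreducible_rep X coord_scale (tensor_space n m) (tensor_rep n \<pi>1 m \<pi>2)"
    and "is_apex X (tensor_space n m) (tensor_rep n \<pi>1 m \<pi>2) f"
    and "apex_type X f (tensor_space n m) (tensor_rep n \<pi>1 m \<pi>2)"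
proof -
  let ?V = "tensor_space n m" and ?\<tau> = "tensor_rep n \<pi>1 m \<pi>2"
  have irr: "irrep M1 n \<pi>1" "irrep M2 m \<pi>2" using assms by (auto simp: apex_irrep1_def apex_irrep2_def)
  have rep: "monoid_rep X coord_scale ?V ?\<tau>"
    by (rule monoid_rep_tensor) (rule irr[THEN irreducible_rep_rep])+
  interpret T: monoid_rep X coord_scale ?V ?\<tau> by (rule rep)
  have irrG: "irreducible_rep G coord_scale ?V ?\<tau>"
    by (rule irreducible_tensor[OF H1.group_axioms H2.group_axioms F.finite1 F.finite2])
      (rule apex_irrep_H assms)+
  show irrX: "irreducible_rep X coord_scale ?V ?\<tau>"
    by (rule X.irreducible_rep_of_max_group[OF f irrG[unfolded G_eq] rep])
  have id: "?\<tau> f v = v" if "v \<in> ?V" for v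
    using monoid_rep.map_one[OF irreducible_rep_rep[OF irrG] that] by simp
  have "(\<forall>v\<in>?V. ?\<tau> x v = 0) \<longleftrightarrow> x \<otimes>\<^bsub>X\<^esub> f \<notin> HH" if x: "x \<in> carrier X" for x
  proof
    assume kill: "\<forall>v\<in>?V. ?\<tau> x v = 0"
    show "x \<otimes>\<^bsub>X\<^esub> f \<notin> HH"
    proof
      assume "x \<otimes>\<^bsub>X\<^esub> f \<in> HH"
      then obtain y where y: "y \<in> carrier X" "x \<otimes>\<^bsub>X\<^esub> f \<otimes>\<^bsub>X\<^esub> y = f" by (auto simp: max_subgroup_def)
      have fy: "f \<otimes>\<^bsub>X\<^esub> y \<in> carrier X" by (rule X.m_closed[OF f_carrier y(1)])
      have xfy: "x \<otimes>\<^bsub>X\<^esub> (f \<otimes>\<^bsub>X\<^esub> y) = f" using X.m_assoc[OF x f_carrier y(1)] y(2) by simp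
      have "v = 0" if v: "v \<in> ?V" for v
        using T.map_mult[OF x fy v] kill T.maps[OF fy v] id[OF v] unfolding xfy by simp
      then have "?V = {0}" using T.zero_in by blast
      then show False using irrX by (simp add: irreducible_rep_def)
    qed
  next
    assume n: "x \<otimes>\<^bsub>X\<^esub> f \<notin> HH"
    obtain x1 x2 where x12: "x = (x1, x2)" "x1 \<in> carrier M1" "x2 \<in> carrier M2" using x by (cases x) auto
    have "x1 \<otimes>\<^bsub>M1\<^esub> f1 \<notin> max_subgroup M1 f1 \<or> x2 \<otimes>\<^bsub>M2\<^esub> f2 \<notin> max_subgroup M2 f2"
      using n by (simp add: x12 HH_eq)
    then have z: "(\<forall>v\<in>coord_space {..<n}. \<pi>1 x1 v = 0) \<or> (\<forall>v\<in>coord_space {..<m}. \<pi>2 x2 v = 0)"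
      using assms x12 by (auto simp: apex_irrep1_def apex_irrep2_def apex_type_def)
    have "?\<tau> x v (i, j) = 0" for v i j
      unfolding x12(1) tensor_rep_apply using z by (intro sum.neutral ballI) auto
    then show "\<forall>v\<in>?V. ?\<tau> x v = 0" by (auto simp: fun_eq_iff)
  qed
  then show ap: "is_apex X ?V ?\<tau> f" unfolding X.is_apex_iff[OF f] by blast
  show "apex_type X f ?V ?\<tau>" by (rule X.is_apex_imp_apex_type[OF irrX ap])
qed

lemma tensor_in_Irr_E:
  assumes "apex_irrep1 n \<pi>1" "apex_irrep2 m \<pi>2"
  shows "(tensor_space n m, tensor_rep n \<pi>1 m \<pi>2) \<in> Irr_E M1 N1 M2 N2 \<iota>"
  using tensor_apex[OF assms] f_matched by (auto simp: Irr_E_def)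

lemma matched_in: "e \<in> matched_idempotents M1 N1 M2 N2 \<iota> \<Longrightarrow> e \<in> idempotents X \<and> e \<in> \<Gamma>"
  by (cases e) (auto simp: matched_idempotents_def idempotents_def mem_\<Gamma>)

text \<open>Both \<open>e\<close> and \<open>f\<close> lie in \<open>\<Gamma>\<close>, so they act
  on \<open>I\<close> through \<open>\<rho>\<close>. If \<open>e f \<noteq> f\<close>, then
  \<open>e\<close> kills \<open>I\<close> but is the identity on \<open>V'\<close>. If
  \<open>e f = f\<close>, then \<open>f\<close> is the identity on \<open>I\<close> but lies
  strictly below \<open>e\<close> and kills \<open>V'\<close>.\<close>

lemma hom_other_apex_zero:
  assumes irr: "irreducible_rep X s' V' \<pi>" and apex: "is_apex X V' \<pi> e"
    and e: "e \<in> matched_idempotents M1 N1 M2 N2 \<iota>" "e \<noteq> f"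
    and S: "intertwiner X (fun_scale s) I actX s' V' \<pi> S" and \<phi>: "\<phi> \<in> I"
  shows "S \<phi> = 0"
proof -
  interpret P: monoid_rep X s' V' \<pi> by (rule irreducible_rep_rep) fact
  have ei: "e \<in> idempotents X" and e\<Gamma>: "e \<in> \<Gamma>" using matched_in[OF e(1)] by auto
  note eX = X.idempotent_in_carrier[OF ei]
  \<comment> \<open>Centrality turns right translation by \<open>g\<close> into left multiplication,
    to which \<open>\<Gamma>\<close>-equivariance applies.\<close>
  have act: "actX g \<phi> x = \<rho> g (\<phi> x)" if "g \<in> idempotents X" "g \<in> \<Gamma>" "x \<in> carrier X" for g x
    using X.central[OF that(1,3)] I_equiv[OF \<phi> that(2,3)] by (simp add: actX_apply[OF that(3)])
  have id: "\<pi> e v = v" if "v \<in> V'" for v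
    using X.is_apex_imp_apex_type[OF irr apex] that by (simp add: apex_type_def)
  note SV = intertwiner_in[OF S \<phi>]
  show ?thesis
  proof (cases "e \<otimes>\<^bsub>X\<^esub> f = f")
    case False
    have "actX e \<phi> = 0"
    proof (rule I_eqI[OF IR.maps[OF eX \<phi>] IR.zero_in])
      show "actX e \<phi> x = 0 x" if "x \<in> carrier X" for x
        using act[OF ei e\<Gamma> that] \<rho>_idempotent_zero[OF ei e\<Gamma> False I_in[OF \<phi> that]] by simp
    qed
    then have "\<pi> e (S \<phi>) = 0"
      using intertwiner_commutes[OF S eX \<phi>] intertwiner_zero[OF S IR.zero_in] by simp
    then show ?thesis using id[OF SV] by simp
  next
    case True
    have "actX f \<phi> = \<phi>"
    proof (rule I_eqI[OF IR.maps[OF f_carrier \<phi>] \<phi>])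
      show "actX f \<phi> x = \<phi> x" if "x \<in> carrier X" for x
        using act[OF f f_\<Gamma> that] \<rho>_f[OF I_in[OF \<phi> that]] by simp
    qed
    then have "S \<phi> = \<pi> f (S \<phi>)" using intertwiner_commutes[OF S f_carrier \<phi>] by simp
    moreover have "f \<otimes>\<^bsub>X\<^esub> e \<notin> max_subgroup X e"
    proof
      assume "f \<otimes>\<^bsub>X\<^esub> e \<in> max_subgroup X e"
      then have "f \<in> max_subgroup X e" using True X.central[OF f eX] by simp
      then show False using X.idempotent_in_max_subgroup_eq[OF ei f] e(2) by simp
    qed
    ultimately show ?thesis
      using apex[unfolded X.is_apex_iff[OF ei]] f_carrier SV by metis
  qed
qed

text \<open>\<pi>1 is recovered from the action of \<open>(a, 1)\<close> on the tensors
  \<open>v\<close> \<otimes> \<open>unit_vec 0\<close>, and \<pi>2 symmetrically, so both inherit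
  the behaviour of the tensor product on units and nonunits.\<close>

lemma tensor_factor_apex:
  assumes irr: "irrep M1 n \<pi>1" "irrep M2 m \<pi>2"
    and type: "apex_type X f (tensor_space n m) (tensor_rep n \<pi>1 m \<pi>2)"
  shows "apex_irrep1 n \<pi>1" "apex_irrep2 m \<pi>2"
proof -
  note reps = irr[THEN irreducible_rep_rep]
  interpret T: monoid_rep X coord_scale "tensor_space n m" "tensor_rep n \<pi>1 m \<pi>2"
    by (rule monoid_rep_tensor) (rule reps)+
  have nm: "0 < n" "0 < m" using irr coord_space_nontrivial by (auto simp: irreducible_rep_def)
  let ?\<tau> = "tensor_rep n \<pi>1 m \<pi>2"
  have f12: "f1 \<in> carrier M1" "f2 \<in> carrier M2"
    using M1.idempotent_in_carrier[OF f1] M2.idempotent_in_carrier[OF f2] by auto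
  have right: "?\<tau> (x \<otimes>\<^bsub>X\<^esub> f) t = ?\<tau> x t" if "x \<in> carrier X" "t \<in> tensor_space n m" for x t
    by (rule X.apex_type_right[OF f T.monoid_rep_axioms type that])
  have id: "?\<tau> f t = t" if "t \<in> tensor_space n m" for t using type that by (simp add: apex_type_def)
  have kill: "?\<tau> x t = 0" if "x \<in> carrier X" "x \<otimes>\<^bsub>X\<^esub> f \<notin> HH" "t \<in> tensor_space n m" for x t
    using type that unfolding apex_type_def by blast
  let ?t1 = "\<lambda>v. tensor_vec v (unit_vec (0::nat))" and ?t2 = "\<lambda>v. tensor_vec (unit_vec (0::nat)) v"
  have t1: "?t1 v \<in> tensor_space n m" "\<pi>1 a v i = ?\<tau> (a, \<one>\<^bsub>M2\<^esub>) (?t1 v) (i, 0)"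
    if "v \<in> coord_space {..<n}" "a \<in> carrier M1" for v a i
  proof -
    show t: "?t1 v \<in> tensor_space n m" using that nm by (auto simp: coord_space_def tensor_vec_def unit_vec_def)
    show "\<pi>1 a v i = ?\<tau> (a, \<one>\<^bsub>M2\<^esub>) (?t1 v) (i, 0)"
      by (simp add: tensor_rep_fst[OF reps that(2) t]) (simp add: tensor_vec_def unit_vec_def)
  qed
  have t2: "?t2 v \<in> tensor_space n m" "\<pi>2 b v j = ?\<tau> (\<one>\<^bsub>M1\<^esub>, b) (?t2 v) (0, j)"
    if "v \<in> coord_space {..<m}" "b \<in> carrier M2" for v b j
  proof -
    show t: "?t2 v \<in> tensor_space n m" using that nm by (auto simp: coord_space_def tensor_vec_def unit_vec_def)
    show "\<pi>2 b v j = ?\<tau> (\<one>\<^bsub>M1\<^esub>, b) (?t2 v) (0, j)"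
      by (simp add: tensor_rep_snd[OF reps that(2) t]) (simp add: tensor_vec_def unit_vec_def)
  qed
  have "\<pi>1 f1 v = v" if v: "v \<in> coord_space {..<n}" for v
  proof
    fix i
    \<comment> \<open>\<open>(f1, 1) f = f\<close>, so \<open>(f1, 1)\<close> acts as
      \<open>f\<close>, that is, as the identity.\<close>
    have "?\<tau> (f1, \<one>\<^bsub>M2\<^esub>) (?t1 v) = ?t1 v"
      using right[of "(f1, \<one>\<^bsub>M2\<^esub>)" "?t1 v"] id t1(1)[OF v f12(1)] f12 M1.idempotent_square[OF f1] by simp
    then show "\<pi>1 f1 v i = v i" using t1(2)[OF v f12(1), of i] by (simp add: tensor_vec_def unit_vec_def)
  qed
  moreover have "\<pi>1 a v = 0" if "a \<in> carrier M1" "a \<otimes>\<^bsub>M1\<^esub> f1 \<notin> max_subgroup M1 f1" "v \<in> coord_space {..<n}" for a v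
    using kill[of "(a, \<one>\<^bsub>M2\<^esub>)" "?t1 v"] t1[OF that(3,1)] that by (auto simp: fun_eq_iff HH_eq)
  ultimately show "apex_irrep1 n \<pi>1" using irr by (auto simp: apex_irrep1_def apex_type_def)
  have "\<pi>2 f2 v = v" if v: "v \<in> coord_space {..<m}" for v
  proof
    fix j
    have "?\<tau> (\<one>\<^bsub>M1\<^esub>, f2) (?t2 v) = ?t2 v"
      using right[of "(\<one>\<^bsub>M1\<^esub>, f2)" "?t2 v"] id t2(1)[OF v f12(2)] f12 M2.idempotent_square[OF f2] by simp
    then show "\<pi>2 f2 v j = v j" using t2(2)[OF v f12(2), of j] by (simp add: tensor_vec_def unit_vec_def)
  qed
  moreover have "\<pi>2 b v = 0" if "b \<in> carrier M2" "b \<otimes>\<^bsub>M2\<^esub> f2 \<notin> max_subgroup M2 f2" "v \<in> coord_space {..<m}" for b v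
    using kill[of "(\<one>\<^bsub>M1\<^esub>, b)" "?t2 v"] t2[OF that(3,1)] that by (auto simp: fun_eq_iff HH_eq)
  ultimately show "apex_irrep2 m \<pi>2" using irr by (auto simp: apex_irrep2_def apex_type_def)
qed

lemma Irr_E_cases:
  assumes irr: "irrep M1 n \<pi>1" "irrep M2 m \<pi>2"
    and mem: "(tensor_space n m, tensor_rep n \<pi>1 m \<pi>2) \<in> Irr_E M1 N1 M2 N2 \<iota>"
  shows "HX n \<pi>1 m \<pi>2 \<subseteq> {0} \<or> apex_irrep1 n \<pi>1 \<and> apex_irrep2 m \<pi>2"
proof -
  obtain e where e: "e \<in> matched_idempotents M1 N1 M2 N2 \<iota>"
    "is_apex X (tensor_space n m) (tensor_rep n \<pi>1 m \<pi>2) e"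
    and irrX: "irreducible_rep X coord_scale (tensor_space n m) (tensor_rep n \<pi>1 m \<pi>2)"
    using mem by (auto simp: Irr_E_def)
  show ?thesis
  proof (cases "e = f")
    case True
    then show ?thesis using tensor_factor_apex[OF irr X.is_apex_imp_apex_type[OF irrX]] e(2) by blast
  next
    case False
    have "S = 0" if "S \<in> HX n \<pi>1 m \<pi>2" for S
    proof
      fix \<phi>
      show "S \<phi> = 0 \<phi>"
        using that hom_other_apex_zero[OF irrX e(2,1) False, of S \<phi>]
        by (cases "\<phi> \<in> I") (auto simp: theta_hom_def rep_hom_iff)
    qed
    then show ?thesis by blast
  qed
qed

text \<open>\<open>\<Phi>\<close> is a bijection that preserves 0 and scalar multiples, and so
  preserves the dimension bound in the form of \<open>dim_le_1_iff_proportional\<close>.\<close>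

lemma theta_hom_transfer:
  assumes "apex_irrep1 n \<pi>1" "apex_irrep2 m \<pi>2"
  shows "hom_dim (HX n \<pi>1 m \<pi>2) \<le> 1 \<longleftrightarrow> hom_dim (HG n \<pi>1 m \<pi>2) \<le> 1"
    and "HX n \<pi>1 m \<pi>2 \<noteq> {0} \<longleftrightarrow> HG n \<pi>1 m \<pi>2 \<noteq> {0}"
proof -
  define \<Phi> :: "(('a \<times> 'b \<Rightarrow> 'w) \<Rightarrow> nat \<times> nat \<Rightarrow> complex) \<Rightarrow> ('a \<times> 'b \<Rightarrow> 'w) \<Rightarrow> nat \<times> nat \<Rightarrow> complex"
    where "\<Phi> S = zero_ext J (\<lambda>\<psi>. S (extend \<psi>))" for S
  have bij: "bij_betw \<Phi> (HX n \<pi>1 m \<pi>2) (HG n \<pi>1 m \<pi>2)"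
    using bij_betw_hom[OF irreducible_rep_rep[OF tensor_apex(1)[OF assms]] tensor_apex(3)[OF assms]]
    unfolding theta_hom_def \<Phi>_def .
  have \<Phi>0: "\<Phi> 0 = 0" and \<Phi>s: "\<Phi> (fun_scale coord_scale c S) = fun_scale coord_scale c (\<Phi> S)" for c S
    by (auto simp: \<Phi>_def zero_ext_def fun_eq_iff fun_scale_def)
  have inj: "inj_on \<Phi> (HX n \<pi>1 m \<pi>2)" and img: "\<Phi> ` HX n \<pi>1 m \<pi>2 = HG n \<pi>1 m \<pi>2"
    using bij by (auto simp: bij_betw_def)
  have fin: "finite ({..<n} \<times> {..<m})" by simp
  note vs = vector_space_fun_scale[OF vector_space_coord]
  have dX: "hom_dim (HX n \<pi>1 m \<pi>2) \<le> 1 \<longleftrightarrow> (\<forall>S\<in>HX n \<pi>1 m \<pi>2. \<forall>T\<in>HX n \<pi>1 m \<pi>2. T \<noteq> 0 \<longrightarrow> (\<exists>c. S = fun_scale coord_scale c T))"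
    unfolding theta_hom_def
    by (rule dim_le_1_iff_proportional[OF vs finite_dim_rep_hom[OF IR.monoid_rep_axioms fin_dim_I fin]])
  have dG: "hom_dim (HG n \<pi>1 m \<pi>2) \<le> 1 \<longleftrightarrow> (\<forall>S\<in>HG n \<pi>1 m \<pi>2. \<forall>T\<in>HG n \<pi>1 m \<pi>2. T \<noteq> 0 \<longrightarrow> (\<exists>c. S = fun_scale coord_scale c T))"
    unfolding theta_hom_def
    by (rule dim_le_1_iff_proportional[OF vs finite_dim_rep_hom[OF F.JR.monoid_rep_axioms F.fin_dim_J fin]])
  interpret FX: vector_space "fun_scale coord_scale :: complex \<Rightarrow> (('a \<times> 'b \<Rightarrow> 'w) \<Rightarrow> nat \<times> nat \<Rightarrow> complex) \<Rightarrow> ('a \<times> 'b \<Rightarrow> 'w) \<Rightarrow> nat \<times> nat \<Rightarrow> complex"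
    by (rule vs)
  interpret T: monoid_rep X coord_scale "tensor_space n m" "tensor_rep n \<pi>1 m \<pi>2"
    by (rule irreducible_rep_rep[OF tensor_apex(1)[OF assms]])
  have zX: "0 \<in> HX n \<pi>1 m \<pi>2"
    unfolding theta_hom_def by (rule zero_in_rep_hom[OF T.monoid_rep_axioms])
  have scX: "fun_scale coord_scale c T \<in> HX n \<pi>1 m \<pi>2" if "T \<in> HX n \<pi>1 m \<pi>2" for c T
  proof -
    have "intertwiner X coord_scale (tensor_space n m) (tensor_rep n \<pi>1 m \<pi>2)
        coord_scale (tensor_space n m) (tensor_rep n \<pi>1 m \<pi>2) (coord_scale c)"
      by (rule intertwinerI) (simp_all add: T.scale_in coord.scale_right_distrib T.map_scale mult.commute del: DirProd_simps)
    note scal = this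
    have T: "intertwiner X (fun_scale s) I actX coord_scale (tensor_space n m) (tensor_rep n \<pi>1 m \<pi>2) T"
      "\<And>\<phi>. \<phi> \<notin> I \<Longrightarrow> T \<phi> = 0"
      using that unfolding theta_hom_def rep_hom_iff by blast+
    have "intertwiner X (fun_scale s) I actX coord_scale (tensor_space n m) (tensor_rep n \<pi>1 m \<pi>2)
        (fun_scale coord_scale c T)"
      unfolding fun_scale_def[of coord_scale] by (rule intertwiner_compose[OF T(1) scal])
    moreover have "fun_scale coord_scale c T \<phi> = 0" if "\<phi> \<notin> I" for \<phi>
      by (simp only: fun_scale_def[of coord_scale] T(2)[OF that] coord.scale_zero_right)
    ultimately show ?thesis unfolding theta_hom_def rep_hom_iff by blast
  qed
  have nz: "\<Phi> T = 0 \<longleftrightarrow> T = 0" if "T \<in> HX n \<pi>1 m \<pi>2" for T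
    using inj_onD[OF inj _ that zX] \<Phi>0 by metis
  show "HX n \<pi>1 m \<pi>2 \<noteq> {0} \<longleftrightarrow> HG n \<pi>1 m \<pi>2 \<noteq> {0}"
  proof -
    have "HX n \<pi>1 m \<pi>2 = {0} \<longleftrightarrow> (\<forall>T\<in>HX n \<pi>1 m \<pi>2. T = 0)" using zX by blast
    also have "\<dots> \<longleftrightarrow> (\<forall>T\<in>HX n \<pi>1 m \<pi>2. \<Phi> T = 0)" using nz by (intro ball_cong) auto
    also have "\<dots> \<longleftrightarrow> \<Phi> ` HX n \<pi>1 m \<pi>2 = {0}" using imageI[OF zX, of \<Phi>] by auto
    finally show ?thesis unfolding img by simp
  qed
  have "(\<exists>c. \<Phi> S = fun_scale coord_scale c (\<Phi> T)) \<longleftrightarrow> (\<exists>c. S = fun_scale coord_scale c T)"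
    if "S \<in> HX n \<pi>1 m \<pi>2" "T \<in> HX n \<pi>1 m \<pi>2" for S T
    unfolding \<Phi>s[symmetric] using inj_on_eq_iff[OF inj that(1) scX[OF that(2)]] by simp
  then show "hom_dim (HX n \<pi>1 m \<pi>2) \<le> 1 \<longleftrightarrow> hom_dim (HG n \<pi>1 m \<pi>2) \<le> 1"
    unfolding dX dG unfolding img[symmetric] using nz by simp
qed

lemma isomorphic_transfer1:
  assumes "apex_irrep1 n \<pi>" "apex_irrep1 n' \<pi>'"
  shows "irrep_isomorphic H1 n \<pi> n' \<pi>' \<longleftrightarrow> irrep_isomorphic M1 n \<pi> n' \<pi>'"
  unfolding rep_isomorphic_def rep_hom_iff Bex_def
  using M1.apex_type_intertwiner_iff[OF f1, of coord_scale "coord_space {..<n}" \<pi> coord_scale "coord_space {..<n'}" \<pi>'] assms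
  by (simp add: apex_irrep1_def irreducible_rep_rep)

lemma isomorphic_transfer2:
  assumes "apex_irrep2 n \<pi>" "apex_irrep2 n' \<pi>'"
  shows "irrep_isomorphic H2 n \<pi> n' \<pi>' \<longleftrightarrow> irrep_isomorphic M2 n \<pi> n' \<pi>'"
  unfolding rep_isomorphic_def rep_hom_iff Bex_def
  using M2.apex_type_intertwiner_iff[OF f2, of coord_scale "coord_space {..<n}" \<pi> coord_scale "coord_space {..<n'}" \<pi>'] assms
  by (simp add: apex_irrep2_def irreducible_rep_rep)

abbreviation "ext1 \<equiv> ext_rep M1 f1"
abbreviation "ext2 \<equiv> ext_rep M2 f2"

lemma ext_apex: "irrep H1 n \<sigma>1 \<Longrightarrow> apex_irrep1 n (ext1 \<sigma>1)" "irrep H2 m \<sigma>2 \<Longrightarrow> apex_irrep2 m (ext2 \<sigma>2)"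
  using M1.ext_rep_apex_type[OF f1] M2.ext_rep_apex_type[OF f2] by (auto simp: apex_irrep1_def apex_irrep2_def)

lemma HG_ext: "HG n (ext1 \<sigma>1) m (ext2 \<sigma>2) = HG n \<sigma>1 m \<sigma>2"
  unfolding theta_hom_def
proof (rule rep_hom_cong)
  fix x v assume "x \<in> carrier G"
  then obtain x1 x2 where x: "x = (x1, x2)" "x1 \<in> max_subgroup M1 f1" "x2 \<in> max_subgroup M2 f2" by (cases x) auto
  show "tensor_rep n (ext1 \<sigma>1) m (ext2 \<sigma>2) x v = tensor_rep n \<sigma>1 m \<sigma>2 x v"
    using x by (simp add: tensor_rep_def M1.ext_rep_eq M2.ext_rep_eq)
qed simp

lemma isomorphic_ext1: "irrep_isomorphic H1 n (ext1 \<sigma>) n' (ext1 \<sigma>') \<longleftrightarrow> irrep_isomorphic H1 n \<sigma> n' \<sigma>'"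
  unfolding rep_isomorphic_def
  by (subst rep_hom_cong[of H1 "coord_space {..<n}" "ext1 \<sigma>" \<sigma> "coord_space {..<n'}" "ext1 \<sigma>'" \<sigma>'])
    (simp_all add: M1.ext_rep_eq)

lemma isomorphic_ext2: "irrep_isomorphic H2 n (ext2 \<sigma>) n' (ext2 \<sigma>') \<longleftrightarrow> irrep_isomorphic H2 n \<sigma> n' \<sigma>'"
  unfolding rep_isomorphic_def
  by (subst rep_hom_cong[of H2 "coord_space {..<n}" "ext2 \<sigma>" \<sigma> "coord_space {..<n'}" "ext2 \<sigma>'" \<sigma>'])
    (simp_all add: M2.ext_rep_eq)

text \<open>In one direction, irreducibles of \<open>H1\<close> and \<open>H2\<close> are extended
  by zero to members of \<open>Irr\<^sup>E\<close>. In the other, a member of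
  \<open>Irr\<^sup>E\<close> with a nonzero homomorphism from \<open>I\<close> has apex
  \<open>f\<close> and restricts to irreducibles of \<open>H1\<close> and \<open>H2\<close>.\<close>

lemma theta_rep_wrt_iff_theta_rep_H:
  "theta_rep_wrt M1 M2 (Irr_E M1 N1 M2 N2 \<iota>) (fun_scale s) I actX \<longleftrightarrow> theta_rep H1 H2 (fun_scale s) J actG"
proof -
  let ?E = "Irr_E M1 N1 M2 N2 \<iota>"
  define inS where "inS n \<pi>1 m \<pi>2 \<longleftrightarrow> irrep M1 n \<pi>1 \<and> irrep M2 m \<pi>2 \<and> (tensor_space n m, tensor_rep n \<pi>1 m \<pi>2) \<in> ?E"
    for n \<pi>1 m \<pi>2
  have LX: "theta_rep_wrt M1 M2 ?E (fun_scale s) I actX \<longleftrightarrow>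
     (\<forall>n \<pi>1 m \<pi>2. inS n \<pi>1 m \<pi>2 \<longrightarrow> hom_dim (HX n \<pi>1 m \<pi>2) \<le> 1) \<and>
     (\<forall>n \<pi>1 m \<pi>2 m' \<pi>2'. inS n \<pi>1 m \<pi>2 \<longrightarrow> HX n \<pi>1 m \<pi>2 \<noteq> {0} \<longrightarrow> inS n \<pi>1 m' \<pi>2' \<longrightarrow> HX n \<pi>1 m' \<pi>2' \<noteq> {0} \<longrightarrow>
        irrep_isomorphic M2 m \<pi>2 m' \<pi>2') \<and>
     (\<forall>n \<pi>1 n' \<pi>1' m \<pi>2. inS n \<pi>1 m \<pi>2 \<longrightarrow> HX n \<pi>1 m \<pi>2 \<noteq> {0} \<longrightarrow> inS n' \<pi>1' m \<pi>2 \<longrightarrow> HX n' \<pi>1' m \<pi>2 \<noteq> {0} \<longrightarrow>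
        irrep_isomorphic M1 n \<pi>1 n' \<pi>1')"
    unfolding theta_rep_wrt_def Let_def inS_def[symmetric]
    using IR.monoid_rep_axioms fin_dim_I by (simp only: simp_thms imp_conjL)
  have LG: "theta_rep H1 H2 (fun_scale s) J actG \<longleftrightarrow>
     (\<forall>n \<sigma>1 m \<sigma>2. irrep H1 n \<sigma>1 \<longrightarrow> irrep H2 m \<sigma>2 \<longrightarrow> hom_dim (HG n \<sigma>1 m \<sigma>2) \<le> 1) \<and>
     (\<forall>n \<sigma>1 m \<sigma>2 m' \<sigma>2'. irrep H1 n \<sigma>1 \<longrightarrow> irrep H2 m \<sigma>2 \<longrightarrow> HG n \<sigma>1 m \<sigma>2 \<noteq> {0} \<longrightarrow>
        irrep H1 n \<sigma>1 \<longrightarrow> irrep H2 m' \<sigma>2' \<longrightarrow> HG n \<sigma>1 m' \<sigma>2' \<noteq> {0} \<longrightarrow> irrep_isomorphic H2 m \<sigma>2 m' \<sigma>2') \<and>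
     (\<forall>n \<sigma>1 n' \<sigma>1' m \<sigma>2. irrep H1 n \<sigma>1 \<longrightarrow> irrep H2 m \<sigma>2 \<longrightarrow> HG n \<sigma>1 m \<sigma>2 \<noteq> {0} \<longrightarrow>
        irrep H1 n' \<sigma>1' \<longrightarrow> irrep H2 m \<sigma>2 \<longrightarrow> HG n' \<sigma>1' m \<sigma>2 \<noteq> {0} \<longrightarrow> irrep_isomorphic H1 n \<sigma>1 n' \<sigma>1')"
    unfolding theta_rep_def theta_rep_wrt_def Let_def
    using F.JR.monoid_rep_axioms F.fin_dim_J by (simp only: simp_thms imp_conjL UNIV_I)
  have good: "apex_irrep1 n \<pi>1 \<and> apex_irrep2 m \<pi>2" if "inS n \<pi>1 m \<pi>2" "HX n \<pi>1 m \<pi>2 \<noteq> {0}" for n \<pi>1 m \<pi>2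
  proof -
    have "0 \<in> HX n \<pi>1 m \<pi>2"
      unfolding theta_hom_def using that(1)
      by (intro zero_in_rep_hom monoid_rep_tensor) (auto simp: inS_def irreducible_rep_rep)
    then show ?thesis using Irr_E_cases[of n \<pi>1 m \<pi>2] that unfolding inS_def by blast
  qed
  have inS_ext: "inS n (ext1 \<sigma>1) m (ext2 \<sigma>2)" if "irrep H1 n \<sigma>1" "irrep H2 m \<sigma>2" for n \<sigma>1 m \<sigma>2
    using ext_apex that tensor_in_Irr_E[of n "ext1 \<sigma>1" m "ext2 \<sigma>2"]
    unfolding inS_def by (simp add: apex_irrep1_def apex_irrep2_def)
  have ext_dim: "hom_dim (HX n (ext1 \<sigma>1) m (ext2 \<sigma>2)) \<le> 1 \<longleftrightarrow> hom_dim (HG n \<sigma>1 m \<sigma>2) \<le> 1"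
    and ext_nz: "HX n (ext1 \<sigma>1) m (ext2 \<sigma>2) \<noteq> {0} \<longleftrightarrow> HG n \<sigma>1 m \<sigma>2 \<noteq> {0}"
    if "irrep H1 n \<sigma>1" "irrep H2 m \<sigma>2" for n \<sigma>1 m \<sigma>2
    using theta_hom_transfer[OF ext_apex(1)[OF that(1)] ext_apex(2)[OF that(2)]] by (simp_all only: HG_ext)
  show ?thesis
  proof
    assume "theta_rep_wrt M1 M2 ?E (fun_scale s) I actX"
    note L = this[unfolded LX]
    note dim = conjunct1[OF L, rule_format] and fst = conjunct1[OF conjunct2[OF L], rule_format]
      and snd = conjunct2[OF conjunct2[OF L], rule_format]
    show "theta_rep H1 H2 (fun_scale s) J actG"
      unfolding LG
    proof (intro conjI allI impI)
      fix n \<sigma>1 m \<sigma>2 assume irr: "irrep H1 n \<sigma>1" "irrep H2 m \<sigma>2"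
      show "hom_dim (HG n \<sigma>1 m \<sigma>2) \<le> 1" using dim[OF inS_ext[OF irr]] unfolding ext_dim[OF irr] .
    next
      fix n \<sigma>1 m \<sigma>2 m' \<sigma>2'
      assume irr: "irrep H1 n \<sigma>1" "irrep H2 m \<sigma>2" "irrep H2 m' \<sigma>2'"
        and nz: "HG n \<sigma>1 m \<sigma>2 \<noteq> {0}" "HG n \<sigma>1 m' \<sigma>2' \<noteq> {0}"
      have "irrep_isomorphic M2 m (ext2 \<sigma>2) m' (ext2 \<sigma>2')"
        by (rule fst[of n "ext1 \<sigma>1"]) (intro inS_ext irr ext_nz[THEN iffD2] nz)+
      then show "irrep_isomorphic H2 m \<sigma>2 m' \<sigma>2'"
        using isomorphic_transfer2[OF ext_apex(2)[OF irr(2)] ext_apex(2)[OF irr(3)]] isomorphic_ext2 by simp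
    next
      fix n \<sigma>1 n' \<sigma>1' m \<sigma>2
      assume irr: "irrep H1 n \<sigma>1" "irrep H1 n' \<sigma>1'" "irrep H2 m \<sigma>2"
        and nz: "HG n \<sigma>1 m \<sigma>2 \<noteq> {0}" "HG n' \<sigma>1' m \<sigma>2 \<noteq> {0}"
      have "irrep_isomorphic M1 n (ext1 \<sigma>1) n' (ext1 \<sigma>1')"
        by (rule snd[of n "ext1 \<sigma>1" m "ext2 \<sigma>2"]) (intro inS_ext irr ext_nz[THEN iffD2] nz)+
      then show "irrep_isomorphic H1 n \<sigma>1 n' \<sigma>1'"
        using isomorphic_transfer1[OF ext_apex(1)[OF irr(1)] ext_apex(1)[OF irr(2)]] isomorphic_ext1 by simp
    qed
  next
    assume "theta_rep H1 H2 (fun_scale s) J actG"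
    note L = this[unfolded LG]
    note dim = conjunct1[OF L, rule_format] and fst = conjunct1[OF conjunct2[OF L], rule_format]
      and snd = conjunct2[OF conjunct2[OF L], rule_format]
    show "theta_rep_wrt M1 M2 ?E (fun_scale s) I actX"
      unfolding LX
    proof (intro conjI allI impI)
      fix n \<pi>1 m \<pi>2 assume S: "inS n \<pi>1 m \<pi>2"
      \<comment> \<open>Members of \<open>Irr\<^sup>E\<close> with an apex other than
        \<open>f\<close> fall under the first case, where the Hom space is trivial.\<close>
      show "hom_dim (HX n \<pi>1 m \<pi>2) \<le> 1"
      proof (cases "HX n \<pi>1 m \<pi>2 = {0}")
        case True
        interpret FX: vector_space "fun_scale coord_scale :: complex \<Rightarrow> (('a \<times> 'b \<Rightarrow> 'w) \<Rightarrow> nat \<times> nat \<Rightarrow> complex) \<Rightarrow> ('a \<times> 'b \<Rightarrow> 'w) \<Rightarrow> nat \<times> nat \<Rightarrow> complex"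
          by (rule vector_space_fun_scale[OF vector_space_coord])
        have "finite_dim (fun_scale coord_scale) {0 :: ('a \<times> 'b \<Rightarrow> 'w) \<Rightarrow> nat \<times> nat \<Rightarrow> complex}"
          unfolding finite_dim_def by (intro exI[of _ "{}"]) (simp add: FX.span_zero)
        then show ?thesis
          unfolding True by (simp only: dim_le_1_iff_proportional[OF FX.vector_space_axioms] singleton_iff) simp
      next
        case False
        then have g: "apex_irrep1 n \<pi>1" "apex_irrep2 m \<pi>2" using good[OF S] by auto
        show ?thesis unfolding theta_hom_transfer(1)[OF g] by (rule dim) (rule apex_irrep_H g)+
      qed
    next
      fix n \<pi>1 m \<pi>2 m' \<pi>2'
      assume S: "inS n \<pi>1 m \<pi>2" "inS n \<pi>1 m' \<pi>2'" and nz: "HX n \<pi>1 m \<pi>2 \<noteq> {0}" "HX n \<pi>1 m' \<pi>2' \<noteq> {0}"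
      have g: "apex_irrep1 n \<pi>1" "apex_irrep2 m \<pi>2" "apex_irrep2 m' \<pi>2'"
        using good[OF S(1) nz(1)] good[OF S(2) nz(2)] by auto
      have nzG: "HG n \<pi>1 m \<pi>2 \<noteq> {0}" "HG n \<pi>1 m' \<pi>2' \<noteq> {0}"
        using theta_hom_transfer(2)[OF g(1,2)] theta_hom_transfer(2)[OF g(1,3)] nz by simp_all
      show "irrep_isomorphic M2 m \<pi>2 m' \<pi>2'"
        unfolding isomorphic_transfer2[OF g(2,3), symmetric]
        using apex_irrep_H(1)[OF g(1)] apex_irrep_H(2)[OF g(2)] apex_irrep_H(2)[OF g(3)] nzG by (intro fst[of n \<pi>1])
    next
      fix n \<pi>1 n' \<pi>1' m \<pi>2
      assume S: "inS n \<pi>1 m \<pi>2" "inS n' \<pi>1' m \<pi>2" and nz: "HX n \<pi>1 m \<pi>2 \<noteq> {0}" "HX n' \<pi>1' m \<pi>2 \<noteq> {0}"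
      have g: "apex_irrep1 n \<pi>1" "apex_irrep1 n' \<pi>1'" "apex_irrep2 m \<pi>2"
        using good[OF S(1) nz(1)] good[OF S(2) nz(2)] by auto
      have nzG: "HG n \<pi>1 m \<pi>2 \<noteq> {0}" "HG n' \<pi>1' m \<pi>2 \<noteq> {0}"
        using theta_hom_transfer(2)[OF g(1,3)] theta_hom_transfer(2)[OF g(2,3)] nz by simp_all
      show "irrep_isomorphic M1 n \<pi>1 n' \<pi>1'"
        unfolding isomorphic_transfer1[OF g(1,2), symmetric]
        using apex_irrep_H(1)[OF g(1)] apex_irrep_H(1)[OF g(2)] apex_irrep_H(2)[OF g(3)] nzG by (intro snd[of n \<pi>1 m \<pi>2])
    qed
  qed
qed

end

theorem proposition8p7:
  fixes M1 :: "('a, 'm) monoid_scheme" and M2 :: "('b, 'k) monoid_scheme"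
    and N1 :: "'a set" and N2 :: "'b set" and \<iota> :: "'a set \<Rightarrow> 'b set"
    and s :: "complex \<Rightarrow> 'w::ab_group_add \<Rightarrow> 'w" and W :: "'w set"
    and \<rho> :: "'a \<times> 'b \<Rightarrow> 'w \<Rightarrow> 'w" and f :: "'a \<times> 'b"
  defines "\<Gamma> \<equiv> fibre_prod M1 N1 M2 N2 \<iota>"
  assumes "monoid M1" and "finite (carrier M1)" and "monoid M2" and "finite (carrier M2)"
    and "submonoid N1 M1" and "submonoid N2 M2"
    and "semisimple_ring (monoid_algebra M1)" and "semisimple_ring (monoid_algebra M2)"
    and "centric N1 M1" and "centric (carrier M1) M1"
    and "centric N2 M2" and "centric (carrier M2) M2"
    and "group (M1\<lparr>carrier := N1\<rparr>)" and "group (M2\<lparr>carrier := N2\<rparr>)"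
    and "\<iota> \<in> iso (quot_monoid M1 N1) (quot_monoid M2 N2)"
    and "monoid_rep ((M1 \<times>\<times> M2)\<lparr>carrier := \<Gamma>\<rparr>) s W \<rho>" and "finite_dim s W"
    and "f \<in> matched_idempotents M1 N1 M2 N2 \<iota>"
    and "\<And>U. U \<subseteq> W \<Longrightarrow> irreducible_rep ((M1 \<times>\<times> M2)\<lparr>carrier := \<Gamma>\<rparr>) s U \<rho> \<Longrightarrow>
           is_apex ((M1 \<times>\<times> M2)\<lparr>carrier := \<Gamma>\<rparr>) U \<rho> f"
  shows "theta_rep (M1\<lparr>carrier := N1\<rparr>) (M2\<lparr>carrier := N2\<rparr>) s W \<rho> \<longleftrightarrow>
         theta_rep_wrt M1 M2 (Irr_E M1 N1 M2 N2 \<iota>)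
           (fun_scale s) (ind_space (M1 \<times>\<times> M2) \<Gamma> W \<rho>) (ind_action (M1 \<times>\<times> M2))"
proof -
  obtain f1 f2 where f12: "f = (f1, f2)" by (cases f)
  interpret D: centric_fibre_rep M1 M2 N1 N2 \<iota> s W \<rho> f1 f2
  proof (intro centric_fibre_rep.intro centric_fibre.intro centric_fibre_rep_axioms.intro)
    show "finite_clifford M1" "finite_clifford M2" using assms by (auto intro: finite_clifford_of_semisimple)
  qed (use assms in \<open>simp_all add: f12 \<Gamma>_def\<close>)
  show ?thesis
    unfolding D.theta_rep_N_iff_theta_rep_H \<Gamma>_def D.theta_rep_wrt_iff_theta_rep_H ..
qed

end
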